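(* Let $\Phi \in C_{0}^{\infty}(\mathbb{R}^n \times \mathbb{R}^n)$ satisfy the condition (B), i.e. there exists a point $\boldsymbol{\xi}^{0}\in\mathbb{R}^{2n}$ such that $\Phi(\boldsymbol{\xi}^{0})\neq 0$ and $\boldsymbol{\xi}^{0}\notin \bigcup_{\boldsymbol{\mu}\in\mathbb{Z}^{2n}\setminus\{0\}} \mathrm{supp}\,\Phi(\cdot-\boldsymbol{\mu})$. Let $p_1, p_2, p, q_1, q_2, q \in (0, \infty]$ satisfy $1/q_1+1/q_2 \ge 1/q$. Then there exists a constant $c\in (0, \infty)$ depending only on $n, p_1,p_2,p, q_1, q_2, q$, and $\Phi$, such that $$c^{-1} \|T^{\mathrm{period}}_{a}\|_{L^{p_1}\times L^{p_2}\to L^{p}} \le \|T_{a,\Phi}\|_{(L^{p_1},\ell^{q_1})\times (L^{p_2},\ell^{q_2})\to (L^{p},\ell^{q})} \le c\, \|T^{\mathrm{period}}_{a}\|_{L^{p_1}\times L^{p_2}\to L^{p}}$$ for all $a \in \ell^{\infty}(\mathbb{Z}^n\times \mathbb{Z}^n)$ (the norms take values in $[0,\infty]$).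
   Context: Convention $1/\infty=0$. Fourier transform on $\mathbb{R}^n$: $\widehat{f}(\xi)=\int_{\mathbb{R}^n} e^{-2\pi i x\cdot\xi}f(x)\,dx$. $\mathcal{S}=\mathcal{S}(\mathbb{R}^n)$ is the Schwartz space; $C_0^\infty$ denotes compactly supported smooth functions; $\mathbb{T}^n=\mathbb{R}^n/\mathbb{Z}^n$. Bilinear Fourier multiplier operator: for $\sigma\in L^\infty(\mathbb{R}^n\times\mathbb{R}^n)$ and $f_1,f_2\in\mathcal{S}(\mathbb{R}^n)$, $$T_\sigma(f_1,f_2)(x)=\iint_{\mathbb{R}^n\times\mathbb{R}^n} e^{2\pi i x\cdot(\xi_1+\xi_2)}\sigma(\xi_1,\xi_2)\widehat{f_1}(\xi_1)\widehat{f_2}(\xi_2)\,d\xi_1d\xi_2,\quad x\in\mathbb{R}^n.$$ For function spaces $X_1,X_2,Y$ on $\mathbb{R}^n$ with quasi-norms, $\|T_\sigma\|_{X_1\times X_2\to Y}$ is the smallest $C\in[0,\infty)$ such that $\|T_\sigma(f_1,f_2)\|_Y\le C\|f_1\|_{X_1}\|f_2\|_{X_2}$ for all $f_1\in\mathcal{S}\cap X_1$, $f_2\in\mathcal{S}\cap X_2$, and is $\infty$ if no such finite $C$ exists. For $a\in\ell^\infty(\mathbb{Z}^n\times\mathbb{Z}^n)$ and $\Phi\in C_0^\infty(\mathbb{R}^n\times\mathbb{R}^n)$, set $\sigma_{a,\Phi}(\xi_1,\xi_2)=\sum_{\mu_1,\mu_2\in\mathbb{Z}^n}a(\mu_1,\mu_2)\Phi(\xi_1-\mu_1,\xi_2-\mu_2)$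 and $T_{a,\Phi}=T_{\sigma_{a,\Phi}}$. Amalgam spaces: let $Q=(-1/2,1/2]^n$. For $p,q\in(0,\infty]$, $(L^p,\ell^q)$ is the set of all measurable functions $f$ on $\mathbb{R}^n$ with $$\|f\|_{(L^p,\ell^q)}=\Big\{\sum_{k\in\mathbb{Z}^n}\Big(\int_{k+Q}|f(x)|^p\,dx\Big)^{q/p}\Big\}^{1/q}<\infty,$$ with the usual modifications if $p=\infty$ or $q=\infty$. Periodic operator: for $F\in L^1(\mathbb{T}^n)$ and $\mu\in\mathbb{Z}^n$, $\widehat{F}(\mu)=\int_{\mathbb{T}^n}F(x)e^{-2\pi i\mu\cdot x}\,dx$. For $F_1,F_2\in C^\infty(\mathbb{T}^n)$, $$T^{\mathrm{period}}_a(F_1,F_2)(x)=\sum_{\mu_1,\mu_2\in\mathbb{Z}^n}e^{2\pi i x\cdot(\mu_1+\mu_2)}a(\mu_1,\mu_2)\widehat{F_1}(\mu_1)\widehat{F_2}(\mu_2),\quad x\in\mathbb{T}^n,$$ and $$\|T^{\mathrm{period}}_a\|_{L^{p_1}\times L^{p_2}\to L^p}=\sup\left\{\frac{\|T^{\mathrm{period}}_a(F_1,F_2)\|_{L^p(\mathbb{T}^n)}}{\|F_1\|_{L^{p_1}(\mathbb{T}^n)}\|F_2\|_{L^{p_2}(\mathbb{T}^n)}}\;\Big|\;F_1,F_2\in C^\infty(\mathbb{T}^n)\setminus\{0\}\right\}.$$ *)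

theory Defs
  imports "HOL-Analysis.Analysis" "HOL-Probability.Essential_Supremum"
begin

section \<open>Smooth, test and Schwartz functions\<close>

text \<open>\<open>iter_deriv [b\<^sub>1, \<dots>, b\<^sub>m] f\<close> is the iterated directional derivative
  \<open>\<partial>\<^bsub>b\<^sub>1\<^esub> \<dots> \<partial>\<^bsub>b\<^sub>m\<^esub> f\<close>; lists of basis vectors play the role of multi-indices.\<close>

primrec iter_deriv ::
  "'a::euclidean_space list \<Rightarrow> ('a \<Rightarrow> 'b::real_normed_vector) \<Rightarrow> 'a \<Rightarrow> 'b" where
  "iter_deriv [] f = f"
| "iter_deriv (b # bs) f = (\<lambda>x. frechet_derivative (iter_deriv bs f) (at x) b)"

definition smooth :: "('a::euclidean_space \<Rightarrow> 'b::real_normed_vector) \<Rightarrow> bool" where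
  "smooth f \<longleftrightarrow> (\<forall>bs. set bs \<subseteq> Basis \<longrightarrow> (\<forall>x. iter_deriv bs f differentiable (at x)))"

definition supp :: "('a::topological_space \<Rightarrow> 'b::zero) \<Rightarrow> 'a set" where
  "supp f = closure {x. f x \<noteq> 0}"

definition test_function :: "('a::euclidean_space \<Rightarrow> complex) \<Rightarrow> bool" where
  "test_function f \<longleftrightarrow> smooth f \<and> compact (supp f)"

definition schwartz :: "('a::euclidean_space \<Rightarrow> complex) \<Rightarrow> bool" where
  "schwartz f \<longleftrightarrow> smooth f \<and>
     (\<forall>bs N. set bs \<subseteq> Basis \<longrightarrow> bounded (range (\<lambda>x. norm x ^ N * norm (iter_deriv bs f x))))"


section \<open>Lebesgue quasi-norms with exponent in \<open>(0, \<infinity>]\<close>\<close>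

definition epowr :: "ennreal \<Rightarrow> real \<Rightarrow> ennreal" where
  "epowr x r = (if x = \<infinity> then \<infinity> else ennreal (enn2real x powr r))"

text \<open>Only used for \<open>p > 0\<close>.\<close>

definition Lp_norm :: "ennreal \<Rightarrow> 'a measure \<Rightarrow> ('a \<Rightarrow> ennreal) \<Rightarrow> ennreal" where
  "Lp_norm p M g =
     (if p = \<infinity> then esssup M g
      else epowr (\<integral>\<^sup>+ x. epowr (g x) (enn2real p) \<partial>M) (1 / enn2real p))"


section \<open>The lattice, the unit cube and amalgam spaces\<close>

text \<open>The lattice points are the elements of \<open>int ^ 'n\<close>, embedded into \<open>real ^ 'n\<close>.\<close>

definition lat :: "int ^ 'n \<Rightarrow> real ^ 'n" where
  "lat \<mu> = (\<chi> i. real_of_int (\<mu> $ i))"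

definition unit_cube :: "(real ^ 'n) set" where
  "unit_cube = {x. \<forall>i. - 1/2 < x $ i \<and> x $ i \<le> 1/2}"

text \<open>The outer norm is the \<open>\<ell>\<^sup>q\<close> norm over the lattice, i.e. the \<open>L\<^sup>q\<close> norm for counting measure.
  The value is \<open>\<infinity>\<close> on non-measurable functions, so the amalgam space is exactly the set of
  functions on which this functional is finite.\<close>

definition amalgam_norm :: "ennreal \<Rightarrow> ennreal \<Rightarrow> (real ^ 'n \<Rightarrow> complex) \<Rightarrow> ennreal" where
  "amalgam_norm p q f =
     (if f \<in> borel_measurable lebesgue
      then Lp_norm q (count_space UNIV)
             (\<lambda>k :: int ^ 'n. Lp_norm p (lebesgue_on ((+) (lat k) ` unit_cube))
                                 (\<lambda>x. ennreal (norm (f x))))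
      else \<infinity>)"


section \<open>Bilinear Fourier multiplier operators\<close>

definition fourier :: "(real ^ 'n \<Rightarrow> complex) \<Rightarrow> real ^ 'n \<Rightarrow> complex" where
  "fourier f \<xi> = (LINT x|lebesgue. cis (- 2 * pi * (x \<bullet> \<xi>)) * f x)"

definition bilin_mult ::
  "((real ^ 'n) \<times> (real ^ 'n) \<Rightarrow> complex) \<Rightarrow> (real ^ 'n \<Rightarrow> complex) \<Rightarrow> (real ^ 'n \<Rightarrow> complex) \<Rightarrow>
     real ^ 'n \<Rightarrow> complex" where
  "bilin_mult \<sigma> f1 f2 x =
     (LINT (\<xi>1, \<xi>2)|lebesgue.
        cis (2 * pi * (x \<bullet> (\<xi>1 + \<xi>2))) * \<sigma> (\<xi>1, \<xi>2) * fourier f1 \<xi>1 * fourier f2 \<xi>2)"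

text \<open>A quasi-normed function space \<open>X\<close> is given by its quasi-norm \<open>N\<close>, extended by \<open>\<infinity>\<close>
  outside \<open>X\<close>. The infimum is \<open>\<infinity>\<close> if there is no admissible finite constant, and is
  itself admissible otherwise.\<close>

definition bilin_mult_norm ::
  "((real ^ 'n) \<times> (real ^ 'n) \<Rightarrow> complex) \<Rightarrow> ((real ^ 'n \<Rightarrow> complex) \<Rightarrow> ennreal) \<Rightarrow>
     ((real ^ 'n \<Rightarrow> complex) \<Rightarrow> ennreal) \<Rightarrow> ((real ^ 'n \<Rightarrow> complex) \<Rightarrow> ennreal) \<Rightarrow> ennreal" where
  "bilin_mult_norm \<sigma> N1 N2 N =
     Inf {C. C < \<infinity> \<and>
       (\<forall>f1 f2. schwartz f1 \<and> N1 f1 < \<infinity> \<and> schwartz f2 \<and> N2 f2 < \<infinity> \<longrightarrow>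
          N (bilin_mult \<sigma> f1 f2) \<le> C * N1 f1 * N2 f2)}"

definition lattice_symbol ::
  "((int ^ 'n) \<times> (int ^ 'n) \<Rightarrow> complex) \<Rightarrow> ((real ^ 'n) \<times> (real ^ 'n) \<Rightarrow> complex) \<Rightarrow>
     (real ^ 'n) \<times> (real ^ 'n) \<Rightarrow> complex" where
  "lattice_symbol a \<Phi> = (\<lambda>(\<xi>1, \<xi>2).
     \<Sum>\<^sub>\<infinity>(\<mu>1, \<mu>2)\<in>UNIV. a (\<mu>1, \<mu>2) * \<Phi> (\<xi>1 - lat \<mu>1, \<xi>2 - lat \<mu>2))"

definition condition_B :: "((real ^ 'n) \<times> (real ^ 'n) \<Rightarrow> complex) \<Rightarrow> bool" where
  "condition_B \<Phi> \<longleftrightarrow>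
     (\<exists>\<xi>0. \<Phi> \<xi>0 \<noteq> 0 \<and>
        \<xi>0 \<notin> (\<Union>\<mu>\<in>UNIV - {0 :: (int ^ 'n) \<times> (int ^ 'n)}.
                  supp (\<lambda>\<xi>. \<Phi> (\<xi> - map_prod lat lat \<mu>))))"


section \<open>Periodic bilinear operators\<close>

text \<open>Functions on the torus are functions on \<open>real ^ 'n\<close> that are periodic with respect to the
  lattice; integration over the torus is integration over the fundamental domain \<open>unit_cube\<close>.\<close>

definition smooth_torus :: "(real ^ 'n \<Rightarrow> complex) \<Rightarrow> bool" where
  "smooth_torus F \<longleftrightarrow> smooth F \<and> (\<forall>\<mu> x. F (x + lat \<mu>) = F x)"

definition torus_norm :: "ennreal \<Rightarrow> (real ^ 'n \<Rightarrow> complex) \<Rightarrow> ennreal" where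
  "torus_norm p F = Lp_norm p (lebesgue_on unit_cube) (\<lambda>x. ennreal (norm (F x)))"

definition fourier_coeff :: "(real ^ 'n \<Rightarrow> complex) \<Rightarrow> int ^ 'n \<Rightarrow> complex" where
  "fourier_coeff F \<mu> = (LINT x|lebesgue_on unit_cube. F x * cis (- 2 * pi * (lat \<mu> \<bullet> x)))"

definition bilin_period ::
  "((int ^ 'n) \<times> (int ^ 'n) \<Rightarrow> complex) \<Rightarrow> (real ^ 'n \<Rightarrow> complex) \<Rightarrow> (real ^ 'n \<Rightarrow> complex) \<Rightarrow>
     real ^ 'n \<Rightarrow> complex" where
  "bilin_period a F1 F2 x =
     (\<Sum>\<^sub>\<infinity>(\<mu>1, \<mu>2)\<in>UNIV.
        cis (2 * pi * (x \<bullet> (lat \<mu>1 + lat \<mu>2))) * a (\<mu>1, \<mu>2)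
          * fourier_coeff F1 \<mu>1 * fourier_coeff F2 \<mu>2)"

definition bilin_period_norm ::
  "((int ^ 'n) \<times> (int ^ 'n) \<Rightarrow> complex) \<Rightarrow> ennreal \<Rightarrow> ennreal \<Rightarrow> ennreal \<Rightarrow> ennreal" where
  "bilin_period_norm a p1 p2 p =
     Sup {torus_norm p (bilin_period a F1 F2) / (torus_norm p1 F1 * torus_norm p2 F2) | F1 F2.
            smooth_torus F1 \<and> F1 \<noteq> (\<lambda>_. 0) \<and> smooth_torus F2 \<and> F2 \<noteq> (\<lambda>_. 0)}"

end

theory Submission
  imports Defs "HOL-Probability.Sinc_Integral"
begin

text \<open>
  For the upper bound write \<open>x = k + z\<close> with \<open>k\<close> in the lattice and \<open>z\<close> in the unit cube. Poisson summation
  expands \<open>\<Phi>(\<eta>\<^sub>1, \<eta>\<^sub>2)\<close> times the character \<open>ech (z \<bullet> (\<eta>\<^sub>1 + \<eta>\<^sub>2))\<close> into characters of period \<open>R\<close>, cut off by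
  \<open>\<theta>(\<eta>\<^sub>1) \<theta>(\<eta>\<^sub>2)\<close> with \<open>\<theta> = 1\<close> near the support of \<open>\<Phi>\<close>; the coefficients decay rapidly, uniformly in \<open>z\<close>.
  Each term is a product in \<open>\<eta>\<^sub>1\<close> and \<open>\<eta>\<^sub>2\<close>, so \<open>T(f\<^sub>1, f\<^sub>2)(k + z)\<close> becomes a rapidly convergent sum of values at
  \<open>z\<close> of the periodic operator, applied to periodizations of \<open>f\<^sub>1\<close> and \<open>f\<^sub>2\<close> multiplied by a Schwartz function
  concentrated near \<open>k\<close>. Summing the \<open>p\<close>-th powers over \<open>k\<close> uses Hoelder's inequality for sequences, and hence
  the condition on \<open>q\<^sub>1, q\<^sub>2, q\<close>.

  For the lower bound take \<open>f\<^sub>j = F\<^sub>j e\<^sub>j g\<close>, where \<open>e\<^sub>j\<close> is the character of frequency \<open>\<xi>\<^sup>0\<^sub>j\<close> and the Fourier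
  transform of \<open>g\<close> is a bump function of small support. Then the spectrum of \<open>f\<^sub>j\<close> sits near \<open>\<xi>\<^sup>0\<^sub>j\<close> plus the
  lattice, where condition (B) isolates a single coefficient of \<open>a\<close>, and \<open>T(f\<^sub>1, f\<^sub>2)\<close> is the periodic operator
  applied to \<open>F\<^sub>1, F\<^sub>2\<close> times a function that is bounded below on the unit cube.
\<close>

section \<open>Characters and polynomial weights\<close>

text \<open>The computation behind the upper bound: for \<open>x = k + z\<close> and
  \<open>\<xi> = \<mu> + \<eta>\<close> with \<open>k\<close>, \<open>\<mu>\<close> in the lattice,
  \<open>k \<bullet> \<mu>\<close> is an integer, so the character of
  \<open>x \<bullet> \<xi>\<close> is the product of those of \<open>z \<bullet> \<mu>\<close>,
  \<open>z \<bullet> \<eta>\<close> and \<open>k \<bullet> \<eta>\<close>. The first is the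
  character of the periodic operator at the point \<open>z\<close>, the second is absorbed into the
  symbol, the third moves the window to \<open>k\<close>. The obstacle is exponents below 1, for
  which neither Minkowski's inequality nor duality is available. Therefore every infinite sum
  carries a weight of freely chosen polynomial decay, and a large power of it is spent: on summing,
  on summing powers, and on the growth of the terms. The Fourier analysis rests on one uniqueness
  statement, \<open>coeffs_zero\<close>; Fourier series, Poisson summation and inversion follow from
  it in this order. Sums are treated as integrals over counting measure and integrals are taken over
  \<open>lborel\<close>, so that Fubini's theorem covers the exchanges; the forms in the definitions
  are reached through bridging lemmas.\<close>

definition ech :: "real \<Rightarrow> complex" where
  "ech t = cis (2 * pi * t)"

lemma ech_add: "ech (s + t) = ech s * ech t"
  by (simp add: ech_def cis_mult distrib_left)

lemma ech_diff: "ech (s - t) = ech s * ech (- t)"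
  using ech_add[of s "- t"] by simp

lemma norm_ech [simp]: "norm (ech t) = 1"
  by (simp add: ech_def)

lemma ech_0 [simp]: "ech 0 = 1"
  by (simp add: ech_def)

lemma ech_Ints: "t \<in> \<int> \<Longrightarrow> ech t = 1"
  by (simp add: ech_def)

lemma ech_cancel [simp]: "ech t * ech (- t) = 1" "ech (- t) * ech t = 1"
  using ech_add[of t "- t"] ech_add[of "- t" t] by simp_all

lemma ech_cis: "cis (2 * pi * t) = ech t" "cis (- 2 * pi * t) = ech (- t)"
  by (simp_all add: ech_def)

lemma borel_measurable_ech [measurable]: "ech \<in> borel_measurable borel"
  unfolding ech_def cis_conv_exp
  by measurable

lemma continuous_on_ech [continuous_intros]:
  "continuous_on S f \<Longrightarrow> continuous_on S (\<lambda>x. ech (f x))"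
  unfolding ech_def cis_conv_exp by (intro continuous_intros)

text \<open>Powers of this weight serve as majorants and are never differentiated, so it need not be
  smooth at the origin. Its reciprocal is submultiplicative without a constant, see
  \<open>dec_shift\<close>.\<close>

definition dec :: "'a::real_normed_vector \<Rightarrow> real" where
  "dec x = 1 / (1 + norm x)"

lemma dec_pos [simp]: "0 < dec x"
  by (simp add: dec_def add_pos_nonneg)

lemma dec_nonneg [simp]: "0 \<le> dec x"
  using dec_pos[of x] by linarith

lemma dec_le_1 [simp]: "dec x \<le> 1"
  by (simp add: dec_def add_pos_nonneg)

lemma dec_minus [simp]: "dec (- x) = dec x"
  by (simp add: dec_def)

text \<open>Peetre's inequality. It transfers decay from one point to another at the price of a
  polynomial in their difference; the uniformity of later estimates over the unit cube comes from
  it.\<close>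

lemma dec_shift: "dec x \<le> (1 + norm y) * dec (x + y)"
proof -
  have "norm (x + y) \<le> norm x + norm y" by (rule norm_triangle_ineq)
  also have "\<dots> \<le> norm x + norm y + norm x * norm y" by simp
  finally have "1 + norm (x + y) \<le> (1 + norm x) * (1 + norm y)" by (simp add: algebra_simps)
  then show ?thesis
    by (simp add: dec_def field_simps add_pos_nonneg)
qed

lemma dec_shift_power: "dec x ^ N \<le> (1 + norm y) ^ N * dec (x + y) ^ N"
  using power_mono[OF dec_shift[of x y], of N] by (simp add: power_mult_distrib)

lemma dec_shift_power': "dec (x + y) ^ N \<le> (1 + norm y) ^ N * dec x ^ N"
  using dec_shift_power[of "x + y" N "- y"] by simp

lemma dec_power_antimono: "M \<le> N \<Longrightarrow> dec x ^ N \<le> dec x ^ M"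
  by (rule power_decreasing) auto

lemma dec_inverse: "(1 + norm x) * dec x = 1"
  by (simp add: dec_def add_pos_nonneg field_simps) (metis add_pos_nonneg norm_ge_zero zero_less_one less_irrefl)

lemma dec_inverse_power: "(1 + norm x) ^ N * dec x ^ N = 1"
  by (simp add: dec_inverse flip: power_mult_distrib)

lemma continuous_on_dec [continuous_intros]:
  "continuous_on S f \<Longrightarrow> continuous_on S (\<lambda>x. dec (f x))"
  unfolding dec_def by (intro continuous_intros) (auto simp: add_nonneg_eq_0_iff)

lemma borel_measurable_dec [measurable]:
  "(dec :: 'a::{real_normed_vector, second_countable_topology} \<Rightarrow> real) \<in> borel_measurable borel"
  by (intro borel_measurable_continuous_onI continuous_intros)

section \<open>Functions whose derivatives are controlled by a weight\<close>

abbreviation pd :: "'a::euclidean_space \<Rightarrow> ('a \<Rightarrow> 'b::real_normed_vector) \<Rightarrow> 'a \<Rightarrow> 'b" where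
  "pd b f \<equiv> (\<lambda>x. frechet_derivative f (at x) b)"

text \<open>The constant may have any sign, so nothing has to be said about it when it is produced;
  estimates that need monotonicity pass to its absolute value.\<close>

definition dominated :: "('a \<Rightarrow> real) \<Rightarrow> ('a \<Rightarrow> 'b::real_normed_vector) \<Rightarrow> bool" where
  "dominated \<rho> f \<longleftrightarrow> (\<exists>C. \<forall>x. norm (f x) \<le> C * \<rho> x)"

text \<open>The recursion peels off the innermost derivative, whereas \<open>iter_deriv\<close> adds
  the outermost one. With the order as recursion parameter and \<open>f\<close> arbitrary, the
  product and chain rules, which replace one function by a sum of several, go through by induction;
  an induction along lists of directions would need the full Leibniz formula.\<close>

primrec smooth_bd ::
  "nat \<Rightarrow> ('a \<Rightarrow> real) \<Rightarrow> ('a::euclidean_space \<Rightarrow> 'b::real_normed_vector) \<Rightarrow> bool" where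
  "smooth_bd 0 \<rho> f \<longleftrightarrow> (\<forall>x. f differentiable (at x)) \<and> dominated \<rho> f"
| "smooth_bd (Suc n) \<rho> f \<longleftrightarrow> (\<forall>x. f differentiable (at x)) \<and> dominated \<rho> f
     \<and> (\<forall>b\<in>Basis. smooth_bd n \<rho> (pd b f))"

lemma iter_deriv_append: "iter_deriv (bs @ cs) f = iter_deriv bs (iter_deriv cs f)"
  by (induction bs) auto

lemma iter_deriv_snoc: "iter_deriv (bs @ [b]) f = iter_deriv bs (pd b f)"
  by (simp add: iter_deriv_append)

lemma smooth_bd_iter_deriv:
  assumes "smooth_bd n \<rho> f" "set bs \<subseteq> Basis" "length bs \<le> n"
  shows "(\<forall>x. iter_deriv bs f differentiable (at x)) \<and> dominated \<rho> (iter_deriv bs f)"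
  using assms
proof (induction n arbitrary: f bs)
  case (Suc n)
  show ?case
  proof (cases bs rule: rev_cases)
    case (snoc cs c)
    then show ?thesis using Suc.prems Suc.IH[of "pd c f" cs] by (simp add: iter_deriv_snoc)
  qed (use Suc.prems in simp)
qed simp

lemma smooth_bd_iff:
  "(\<forall>n. smooth_bd n \<rho> f) \<longleftrightarrow>
     smooth f \<and> (\<forall>bs. set bs \<subseteq> Basis \<longrightarrow> dominated \<rho> (iter_deriv bs f))"
proof safe
  assume *: "\<forall>n. smooth_bd n \<rho> f"
  show "smooth f" unfolding smooth_def
    using smooth_bd_iter_deriv[OF *[rule_format]] by blast
  fix bs :: "'a list" assume "set bs \<subseteq> Basis"
  then show "dominated \<rho> (iter_deriv bs f)"
    using smooth_bd_iter_deriv[OF *[rule_format]] by blast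
next
  fix n
  show "smooth f \<Longrightarrow> \<forall>bs. set bs \<subseteq> Basis \<longrightarrow> dominated \<rho> (iter_deriv bs f) \<Longrightarrow> smooth_bd n \<rho> f"
  proof (induction n arbitrary: f)
    case 0
    have "dominated \<rho> (iter_deriv [] f)" "\<forall>x. iter_deriv [] f differentiable (at x)"
      using 0 unfolding smooth_def by (metis empty_subsetI list.set(1))+
    then show ?case by simp
  next
    case (Suc n)
    have 1: "dominated \<rho> (iter_deriv [] f)" "\<forall>x. iter_deriv [] f differentiable (at x)"
      using Suc.prems unfolding smooth_def by (metis empty_subsetI list.set(1))+
    have "smooth_bd n \<rho> (pd b f)" if b: "b \<in> Basis" for b
    proof (rule Suc.IH)
      show "smooth (pd b f)" unfolding smooth_def
      proof safe
        fix bs x assume "set bs \<subseteq> (Basis :: 'a set)"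
        then have "set (bs @ [b]) \<subseteq> Basis" using b by simp
        then show "iter_deriv bs (pd b f) differentiable at x"
          using Suc.prems(1) unfolding smooth_def by (metis iter_deriv_snoc)
      qed
      show "\<forall>bs. set bs \<subseteq> Basis \<longrightarrow> dominated \<rho> (iter_deriv bs (pd b f))"
      proof safe
        fix bs assume "set bs \<subseteq> (Basis :: 'a set)"
        then have "set (bs @ [b]) \<subseteq> Basis" using b by simp
        then show "dominated \<rho> (iter_deriv bs (pd b f))"
          using Suc.prems(2) by (metis iter_deriv_snoc)
      qed
    qed
    then show ?case using 1 by simp
  qed
qed

lemma smooth_bd_diff: "smooth_bd n \<rho> f \<Longrightarrow> f differentiable (at x)"
  by (cases n) auto

lemma smooth_bd_dom: "smooth_bd n \<rho> f \<Longrightarrow> dominated \<rho> f"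
  by (cases n) auto

lemma smooth_bd_Suc_D: "smooth_bd (Suc n) \<rho> f \<Longrightarrow> smooth_bd n \<rho> f"
  by (induction n arbitrary: f) auto

lemma dominated_mono:
  assumes "dominated \<rho> f" "\<And>x. \<rho> x \<le> K * \<sigma> x" "\<And>x. 0 \<le> \<rho> x"
  shows "dominated \<sigma> f"
proof -
  obtain C where C: "\<And>x. norm (f x) \<le> C * \<rho> x" using assms(1) by (auto simp: dominated_def)
  have "norm (f x) \<le> (\<bar>C\<bar> * K) * \<sigma> x" for x
  proof -
    have "norm (f x) \<le> C * \<rho> x" by (rule C)
    also have "\<dots> \<le> \<bar>C\<bar> * \<rho> x" by (rule mult_right_mono) (use assms(3) in auto)
    also have "\<dots> \<le> \<bar>C\<bar> * (K * \<sigma> x)" by (rule mult_left_mono) (use assms(2) in auto)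
    finally show ?thesis by (simp add: mult.assoc)
  qed
  then show ?thesis unfolding dominated_def by blast
qed

lemma dominated_add: "dominated \<rho> f \<Longrightarrow> dominated \<rho> g \<Longrightarrow> dominated \<rho> (\<lambda>x. f x + g x)"
  unfolding dominated_def
proof (elim exE)
  fix C D assume *: "\<forall>x. norm (f x) \<le> C * \<rho> x" "\<forall>x. norm (g x) \<le> D * \<rho> x"
  show "\<exists>C. \<forall>x. norm (f x + g x) \<le> C * \<rho> x"
    by (rule exI[of _ "C + D"]) (use * in \<open>auto simp: distrib_right intro!: norm_triangle_mono\<close>)
qed

lemma dominated_mult:
  fixes f g :: "'a \<Rightarrow> 'b::real_normed_algebra"
  assumes "dominated \<rho> f" "dominated \<sigma> g"
  shows "dominated (\<lambda>x. \<rho> x * \<sigma> x) (\<lambda>x. f x * g x)"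
proof -
  obtain C D where *: "\<And>x. norm (f x) \<le> C * \<rho> x" "\<And>x. norm (g x) \<le> D * \<sigma> x"
    using assms by (auto simp: dominated_def)
  have "norm (f x * g x) \<le> (C * D) * (\<rho> x * \<sigma> x)" for x
  proof -
    have "norm (f x * g x) \<le> norm (f x) * norm (g x)" by (rule norm_mult_ineq)
    also have "\<dots> \<le> (C * \<rho> x) * (D * \<sigma> x)"
      by (intro mult_mono *) (use *[of x] in \<open>auto intro: order.trans[OF norm_ge_zero]\<close>)
    finally show ?thesis by (simp add: mult_ac)
  qed
  then show ?thesis unfolding dominated_def by blast
qed

lemma dominated_linear:
  assumes "bounded_linear L" "dominated \<rho> f"
  shows "dominated \<rho> (\<lambda>x. L (f x))"
proof -
  obtain C where C: "\<And>x. norm (f x) \<le> C * \<rho> x" using assms(2) by (auto simp: dominated_def)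
  obtain K where K: "0 < K" "\<And>x. norm (L x) \<le> norm x * K"
    using bounded_linear.pos_bounded[OF assms(1)] by blast
  have "norm (L (f x)) \<le> (C * K) * \<rho> x" for x
  proof -
    have "norm (L (f x)) \<le> norm (f x) * K" by (rule K)
    also have "\<dots> \<le> (C * \<rho> x) * K" by (rule mult_right_mono) (use C K in auto)
    finally show ?thesis by (simp add: mult_ac)
  qed
  then show ?thesis unfolding dominated_def by blast
qed

lemma smooth_bd_mono:
  assumes "smooth_bd n \<rho> f" "\<And>x. \<rho> x \<le> K * \<sigma> x" "\<And>x. 0 \<le> \<rho> x"
  shows "smooth_bd n \<sigma> f"
  using assms(1)
  by (induction n arbitrary: f) (auto intro: dominated_mono assms(2,3))

lemma pd_add:
  assumes "f differentiable (at x)" "g differentiable (at x)"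
  shows "pd b (\<lambda>x. f x + g x) x = pd b f x + pd b g x"
  using frechet_derivative_at[OF has_derivative_add[OF assms[unfolded frechet_derivative_works]]]
  by metis

lemma smooth_bd_add:
  "smooth_bd n \<rho> f \<Longrightarrow> smooth_bd n \<rho> g \<Longrightarrow> smooth_bd n \<rho> (\<lambda>x. f x + g x)"
  by (induction n arbitrary: f g) (simp_all add: pd_add dominated_add)

lemma pd_mult:
  fixes f g :: "'a::euclidean_space \<Rightarrow> 'b::real_normed_algebra"
  assumes "f differentiable (at x)" "g differentiable (at x)"
  shows "pd b (\<lambda>x. f x * g x) x = f x * pd b g x + pd b f x * g x"
  using frechet_derivative_at[OF has_derivative_mult[OF assms[unfolded frechet_derivative_works]]]
  by metis

text \<open>Both terms of the product rule are again products; the undifferentiated factor is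
  brought down to order \<open>n\<close> by \<open>smooth_bd_Suc_D\<close>, and the induction
  hypothesis applies to each term.\<close>

lemma smooth_bd_mult:
  fixes f g :: "'a::euclidean_space \<Rightarrow> 'b::real_normed_algebra"
  shows "smooth_bd n \<rho> f \<Longrightarrow> smooth_bd n \<sigma> g \<Longrightarrow> smooth_bd n (\<lambda>x. \<rho> x * \<sigma> x) (\<lambda>x. f x * g x)"
proof (induction n arbitrary: f g)
  case (Suc n)
  have "smooth_bd n (\<lambda>x. \<rho> x * \<sigma> x) (pd b (\<lambda>x. f x * g x))" if b: "b \<in> Basis" for b
  proof -
    have "pd b (\<lambda>x. f x * g x) = (\<lambda>x. f x * pd b g x + pd b f x * g x)"
      by (rule ext, rule pd_mult) (use Suc.prems in auto)
    moreover have "smooth_bd n (\<lambda>x. \<rho> x * \<sigma> x) (\<lambda>x. f x * pd b g x + pd b f x * g x)"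
      by (intro smooth_bd_add Suc.IH) (use Suc.prems b smooth_bd_Suc_D in auto)
    ultimately show ?thesis by simp
  qed
  then show ?case using Suc.prems by (auto intro: dominated_mult)
qed (simp add: dominated_mult)

lemma pd_linear:
  assumes "bounded_linear L" "f differentiable (at x)"
  shows "pd b (\<lambda>x. L (f x)) x = L (pd b f x)"
  using frechet_derivative_at[OF bounded_linear.has_derivative[OF assms(1) assms(2)[unfolded frechet_derivative_works]]]
  by metis

lemma differentiable_linear:
  assumes "bounded_linear L" "f differentiable (at x)"
  shows "(\<lambda>x. L (f x)) differentiable (at x)"
  using bounded_linear.has_derivative[OF assms(1)] assms(2) unfolding differentiable_def by blast

lemma smooth_bd_linear:
  assumes "bounded_linear L"
  shows "smooth_bd n \<rho> f \<Longrightarrow> smooth_bd n \<rho> (\<lambda>x. L (f x))"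
  by (induction n arbitrary: f)
     (simp_all add: pd_linear[OF assms] dominated_linear[OF assms] differentiable_linear[OF assms])

lemma smooth_bd_zero: "smooth_bd n \<rho> (\<lambda>_. 0)"
  by (induction n) (auto simp: dominated_def intro: exI[of _ 0])

lemma smooth_bd_sum:
  "(\<And>i. i \<in> I \<Longrightarrow> smooth_bd n \<rho> (f i)) \<Longrightarrow> smooth_bd n \<rho> (\<lambda>x. \<Sum>i\<in>I. f i x)"
  by (induction I rule: infinite_finite_induct) (auto intro: smooth_bd_add smooth_bd_zero)

lemma smooth_bd_const: "smooth_bd n (\<lambda>_. 1) (\<lambda>_. c)"
proof (cases n)
  case (Suc m)
  then show ?thesis by (auto simp: dominated_def smooth_bd_zero)
qed (auto simp: dominated_def)

lemma pd_expand:
  assumes "f differentiable (at x)"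
  shows "frechet_derivative f (at x) v = (\<Sum>b\<in>Basis. (v \<bullet> b) *\<^sub>R pd b f x)"
proof -
  have lin: "linear (frechet_derivative f (at x))"
    using assms frechet_derivative_works has_derivative_linear by blast
  have "frechet_derivative f (at x) v = frechet_derivative f (at x) (\<Sum>b\<in>Basis. (v \<bullet> b) *\<^sub>R b)"
    by (simp add: euclidean_representation)
  also have "\<dots> = (\<Sum>b\<in>Basis. (v \<bullet> b) *\<^sub>R pd b f x)"
    by (simp add: linear_sum[OF lin] linear_cmul[OF lin])
  finally show ?thesis .
qed

lemma has_derivative_affine:
  assumes "bounded_linear A" "f differentiable (at (A x + c))"
  shows "((\<lambda>x. f (A x + c)) has_derivative (\<lambda>v. frechet_derivative f (at (A x + c)) (A v))) (at x)"
proof -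
  have "((\<lambda>x. A x + c) has_derivative A) (at x)"
    by (rule has_derivative_add_const[OF bounded_linear_imp_has_derivative[OF assms(1)]])
  from has_derivative_compose[OF this, of f] assms(2)[unfolded frechet_derivative_works]
  show ?thesis by auto
qed

text \<open>By the chain rule a derivative of the composition is a combination, with the constant
  coefficients \<open>A b \<bullet> b'\<close>, of derivatives of \<open>f\<close> at
  \<open>A x + c\<close>, so the induction closes under finite sums. The effect of \<open>A\<close>
  and \<open>c\<close> on the decay is isolated in the hypothesis that links the two
  weights.\<close>

lemma smooth_bd_affine:
  fixes A :: "'a::euclidean_space \<Rightarrow> 'b::euclidean_space"
  assumes A: "bounded_linear A" and \<rho>: "\<And>x. \<rho> (A x + c) \<le> K * \<sigma> x" "\<And>x. 0 \<le> \<rho> x"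
  shows "smooth_bd n \<rho> f \<Longrightarrow> smooth_bd n \<sigma> (\<lambda>x. f (A x + c))"
proof -
  have base: "smooth_bd 0 \<sigma> (\<lambda>x. f (A x + c))" if "smooth_bd n \<rho> f"
    for n and f :: "'b \<Rightarrow> 'c::real_normed_vector"
  proof -
    have "dominated (\<lambda>x. \<rho> (A x + c)) (\<lambda>x. f (A x + c))"
      using smooth_bd_dom[OF that] by (auto simp: dominated_def)
    then have "dominated \<sigma> (\<lambda>x. f (A x + c))"
      by (rule dominated_mono) (use \<rho> in auto)
    then show ?thesis
      using has_derivative_affine[OF A smooth_bd_diff[OF that]] by (auto simp: differentiable_def)
  qed
  show "smooth_bd n \<rho> f \<Longrightarrow> smooth_bd n \<sigma> (\<lambda>x. f (A x + c))"
  proof (induction n arbitrary: f)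
  case 0
  show ?case by (rule base) (rule 0)
next
  case (Suc n)
  have "smooth_bd n \<sigma> (pd b (\<lambda>x. f (A x + c)))" if b: "b \<in> Basis" for b
  proof -
    have "pd b (\<lambda>x. f (A x + c)) = (\<lambda>x. \<Sum>b'\<in>Basis. (A b \<bullet> b') *\<^sub>R pd b' f (A x + c))"
    proof
      fix x
      have d: "f differentiable (at (A x + c))" using Suc.prems by simp
      from frechet_derivative_at[OF has_derivative_affine[OF A d]]
      have "pd b (\<lambda>x. f (A x + c)) x = frechet_derivative f (at (A x + c)) (A b)" by metis
      also have "\<dots> = (\<Sum>b'\<in>Basis. (A b \<bullet> b') *\<^sub>R pd b' f (A x + c))" by (rule pd_expand[OF d])
      finally show "pd b (\<lambda>x. f (A x + c)) x = (\<Sum>b'\<in>Basis. (A b \<bullet> b') *\<^sub>R pd b' f (A x + c))" .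
    qed
    moreover have "smooth_bd n \<sigma> (\<lambda>x. \<Sum>b'\<in>Basis. (A b \<bullet> b') *\<^sub>R pd b' f (A x + c))"
      by (intro smooth_bd_sum smooth_bd_linear[OF bounded_linear_scaleR_right])
         (use Suc.prems Suc.IH in auto)
    ultimately show ?thesis by simp
  qed
  moreover have "smooth_bd 0 \<sigma> (\<lambda>x. f (A x + c))"
    by (rule base) (rule Suc.prems)
  ultimately show ?case by auto
  qed
qed

lemma has_derivative_ech:
  "((\<lambda>x. ech (x \<bullet> v)) has_derivative (\<lambda>h. (2 * pi * \<i> * (h \<bullet> v)) * ech (x \<bullet> v))) (at x)"
proof -
  define L where "L = (\<lambda>x. \<i> * complex_of_real (2 * pi * (x \<bullet> v)))"
  have "bounded_linear L"
    unfolding L_def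
    by (intro bounded_linear_const_mult bounded_linear_of_real bounded_linear_compose[OF bounded_linear_of_real]
        bounded_linear_mult_right bounded_linear_inner_left bounded_linear_compose[OF bounded_linear_mult_right])
  then have 1: "(L has_derivative L) (at x)" by (rule bounded_linear_imp_has_derivative)
  have 2: "(exp has_derivative (*) (exp (L x))) (at (L x))"
    using DERIV_exp[of "L x"] by (simp add: has_field_derivative_def)
  have "((\<lambda>x. exp (L x)) has_derivative (\<lambda>h. exp (L x) * L h)) (at x)"
    by (rule has_derivative_compose[OF 1 2])
  moreover have "(\<lambda>x. exp (L x)) = (\<lambda>x. ech (x \<bullet> v))"
    by (simp add: L_def ech_def cis_conv_exp)
  moreover have "(\<lambda>h. exp (L x) * L h) = (\<lambda>h. (2 * pi * \<i> * (h \<bullet> v)) * ech (x \<bullet> v))"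
    by (simp add: L_def ech_def cis_conv_exp mult_ac)
  ultimately show ?thesis by simp
qed

lemma differentiable_ech: "(\<lambda>x. ech (x \<bullet> v)) differentiable (at x)"
  using has_derivative_ech[of v x] by (rule differentiableI)

lemma smooth_bd_ech: "smooth_bd n (\<lambda>_. 1) (\<lambda>x. ech (x \<bullet> v))"
proof (induction n)
  case 0
  then show ?case using differentiable_ech
    by (auto simp: dominated_def intro!: exI[of _ 1])
next
  case (Suc n)
  have "pd b (\<lambda>x. ech (x \<bullet> v)) = (\<lambda>x. (2 * pi * \<i> * (b \<bullet> v)) * ech (x \<bullet> v))" for b
    using frechet_derivative_at[OF has_derivative_ech[of v]] by (intro ext) metis
  moreover have "smooth_bd n (\<lambda>_. 1) (\<lambda>x. (2 * pi * \<i> * (b \<bullet> v)) * ech (x \<bullet> v))" for b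
    by (rule smooth_bd_linear[OF bounded_linear_mult_right Suc])
  moreover have "(\<lambda>x. ech (x \<bullet> v)) differentiable (at x)" for x
    by (rule differentiable_ech)
  moreover have "dominated (\<lambda>_. 1) (\<lambda>x. ech (x \<bullet> v))"
    by (auto simp: dominated_def intro!: exI[of _ 1])
  ultimately show ?case by simp
qed

section \<open>Differentiation under the integral sign\<close>

lemma onorm_frechet_le:
  fixes L :: "'a::euclidean_space \<Rightarrow> 'b::real_normed_vector"
  assumes "linear L" "\<And>b. b \<in> Basis \<Longrightarrow> norm (L b) \<le> B"
  shows "onorm L \<le> real DIM('a) * B"
proof (rule onorm_le)
  fix v :: 'a
  have "norm (L v) = norm (\<Sum>b\<in>Basis. (v \<bullet> b) *\<^sub>R L b)"
    using linear_sum[OF assms(1), of "\<lambda>b. (v \<bullet> b) *\<^sub>R b" Basis]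
    by (simp add: linear_cmul[OF assms(1)] euclidean_representation)
  also have "\<dots> \<le> (\<Sum>b\<in>Basis. norm ((v \<bullet> b) *\<^sub>R L b))" by (rule norm_sum)
  also have "\<dots> \<le> (\<Sum>b\<in>(Basis::'a set). norm v * B)"
  proof (rule sum_mono)
    fix b :: 'a assume b: "b \<in> Basis"
    have "norm ((v \<bullet> b) *\<^sub>R L b) = \<bar>v \<bullet> b\<bar> * norm (L b)" by simp
    also have "\<dots> \<le> norm v * B"
      by (rule mult_mono) (use b Basis_le_norm assms(2) in auto)
    finally show "norm ((v \<bullet> b) *\<^sub>R L b) \<le> norm v * B" .
  qed
  finally show "norm (L v) \<le> real DIM('a) * B * norm v" by (simp add: mult_ac)
qed

text \<open>The remainder is quadratic, so that it survives integration over a parameter with an integrable bound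
  for the second derivatives only.\<close>

lemma taylor_quadratic:
  fixes f :: "'a::euclidean_space \<Rightarrow> 'b::real_normed_vector"
  assumes f: "\<And>z. f differentiable (at z)"
    and f': "\<And>z b. b \<in> Basis \<Longrightarrow> pd b f differentiable (at z)"
    and B: "\<And>z b b'. norm z \<le> r \<Longrightarrow> b \<in> Basis \<Longrightarrow> b' \<in> Basis \<Longrightarrow> norm (pd b' (pd b f) z) \<le> B"
    and xy: "norm x \<le> r" "norm y \<le> r"
  shows "norm (f y - f x - frechet_derivative f (at x) (y - x)) \<le> (norm (y - x))\<^sup>2 * (real (DIM('a))^2 * B)"
proof -
  have lin: "linear (frechet_derivative g (at z))" if "g differentiable (at z)"
    for g :: "'a \<Rightarrow> 'b" and z using that frechet_derivative_works has_derivative_linear by blast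
  have B0: "0 \<le> B"
    using B[OF xy(1) SOME_Basis SOME_Basis] by (rule order_trans[OF norm_ge_zero])
  have seg: "closed_segment x y \<subseteq> cball 0 r"
    using xy closed_segment_subset[OF _ _ convex_cball, of x 0 r y] by (simp add: dist_norm)
  \<comment> \<open>The mean value inequality is applied twice, here to the partial derivatives and
    then to \<open>f\<close> minus its linearisation. Each application yields one factor of the
    distance and costs one factor \<open>DIM('a)\<close>.\<close>
  have 1: "norm (pd b f z - pd b f x) \<le> real DIM('a) * B * norm (y - x)"
    if z: "z \<in> closed_segment x y" and b: "b \<in> Basis" for z b
  proof -
    have "norm (pd b f z - pd b f x) \<le> real DIM('a) * B * norm (z - x)"
    proof (rule differentiable_bound[of "cball 0 r"])
      fix w :: 'a assume "w \<in> cball 0 r"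
      then show "onorm (frechet_derivative (pd b f) (at w)) \<le> real DIM('a) * B"
        by (intro onorm_frechet_le lin f' b B) auto
      show "(pd b f has_derivative frechet_derivative (pd b f) (at w)) (at w within cball 0 r)"
        using f'[OF b, unfolded frechet_derivative_works] has_derivative_at_withinI by blast
    qed (use seg z xy in auto)
    also have "\<dots> \<le> real DIM('a) * B * norm (y - x)"
      using z B0 by (intro mult_left_mono segment_bound1[of z x y]) (auto simp: dist_norm)
    finally show ?thesis .
  qed
  have "norm (f y - f x - frechet_derivative f (at x) (y - x)) \<le> norm (y - x) * (real DIM('a) * (real DIM('a) * B * norm (y - x)))"
  proof (rule differentiable_bound_linearization)
    show "x + t *\<^sub>R (y - x) \<in> closed_segment x y" if "t \<in> {0..1}" for t
      using that by (auto simp: closed_segment_def algebra_simps intro!: exI[of _ t])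
    fix w assume w: "w \<in> closed_segment x y"
    show "(f has_derivative frechet_derivative f (at w)) (at w within closed_segment x y)"
      using f[unfolded frechet_derivative_works] has_derivative_at_withinI by blast
    show "onorm (frechet_derivative f (at w) - frechet_derivative f (at x)) \<le> real DIM('a) * (real DIM('a) * B * norm (y - x))"
    proof (rule onorm_frechet_le)
      show "linear (frechet_derivative f (at w) - frechet_derivative f (at x))"
        unfolding fun_diff_def by (intro linear_compose_sub lin f)
    qed (use 1[OF w] in auto)
  qed auto
  then show ?thesis by (simp add: power2_eq_square mult_ac)
qed

lemma integral_norm_bound_mono:
  fixes f :: "'a \<Rightarrow> 'b::{banach, second_countable_topology}"
  assumes "integrable M f" "integrable M g" "\<And>x. x \<in> space M \<Longrightarrow> norm (f x) \<le> g x"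
  shows "norm (LINT x|M. f x) \<le> (LINT x|M. g x)"
  by (rule order_trans[OF integral_norm_bound Bochner_Integration.integral_mono]) (use assms in auto)

text \<open>The majorants may depend on the radius \<open>r\<close>, since differentiability at
  \<open>x\<close> concerns bounded parameters only. Translates \<open>f (x + t)\<close> need this:
  their integrable bound in \<open>t\<close> deteriorates as \<open>x\<close> grows.\<close>

lemma has_derivative_integral_param:
  fixes f :: "'a::euclidean_space \<Rightarrow> 't \<Rightarrow> 'b::{banach, second_countable_topology}"
  assumes f: "\<And>t z. t \<in> space M \<Longrightarrow> (\<lambda>x. f x t) differentiable (at z)"
    and f': "\<And>t z b. t \<in> space M \<Longrightarrow> b \<in> Basis \<Longrightarrow> pd b (\<lambda>x. f x t) differentiable (at z)"
    and meas0: "\<And>x. (\<lambda>t. f x t) \<in> borel_measurable M"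
    and meas1: "\<And>x b. b \<in> Basis \<Longrightarrow> (\<lambda>t. pd b (\<lambda>x. f x t) x) \<in> borel_measurable M"
    and dom0: "\<And>r. \<exists>B. integrable M B \<and> (\<forall>x t. norm x \<le> r \<longrightarrow> t \<in> space M \<longrightarrow> norm (f x t) \<le> B t)"
    and dom1: "\<And>r b. b \<in> Basis \<Longrightarrow> \<exists>B. integrable M B \<and>
        (\<forall>x t. norm x \<le> r \<longrightarrow> t \<in> space M \<longrightarrow> norm (pd b (\<lambda>x. f x t) x) \<le> B t)"
    and dom2: "\<And>r b b'. b \<in> Basis \<Longrightarrow> b' \<in> Basis \<Longrightarrow> \<exists>B. integrable M B \<and>
        (\<forall>x t. norm x \<le> r \<longrightarrow> t \<in> space M \<longrightarrow> norm (pd b' (pd b (\<lambda>x. f x t)) x) \<le> B t)"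
  shows "((\<lambda>x. LINT t|M. f x t) has_derivative (\<lambda>v. \<Sum>b\<in>Basis. (v \<bullet> b) *\<^sub>R (LINT t|M. pd b (\<lambda>x. f x t) x))) (at x)"
proof -
  define r where "r = norm x + 1"
  have int0: "integrable M (\<lambda>t. f x t)" for x
  proof -
    obtain B where "integrable M B" "\<forall>z t. norm z \<le> norm x \<longrightarrow> t \<in> space M \<longrightarrow> norm (f z t) \<le> B t"
      using dom0 by blast
    then show ?thesis
      by (intro Bochner_Integration.integrable_bound[where f=B, OF _ meas0] AE_I2)
         (auto intro: order_trans[OF _ abs_ge_self])
  qed
  have int1: "integrable M (\<lambda>t. pd b (\<lambda>x. f x t) x)" if b: "b \<in> Basis" for x b
  proof -
    obtain B where "integrable M B" "\<forall>z t. norm z \<le> norm x \<longrightarrow> t \<in> space M \<longrightarrow> norm (pd b (\<lambda>x. f x t) z) \<le> B t"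
      using dom1[OF b] by blast
    then show ?thesis
      by (intro Bochner_Integration.integrable_bound[where f=B, OF _ meas1[OF b]] AE_I2)
         (auto intro: order_trans[OF _ abs_ge_self])
  qed
  have "\<forall>b b'. \<exists>B. b \<in> Basis \<longrightarrow> b' \<in> Basis \<longrightarrow> integrable M B \<and>
      (\<forall>x t. norm x \<le> r \<longrightarrow> t \<in> space M \<longrightarrow> norm (pd b' (pd b (\<lambda>x. f x t)) x) \<le> B t)"
    using dom2 by blast
  note bchoice_dom2 = this[unfolded choice_iff]
  obtain B where B: "\<And>b b'. b \<in> Basis \<Longrightarrow> b' \<in> Basis \<Longrightarrow> integrable M (B b b')"
    "\<And>b b' z t. b \<in> Basis \<Longrightarrow> b' \<in> Basis \<Longrightarrow> norm z \<le> r \<Longrightarrow> t \<in> space M \<Longrightarrow>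
        norm (pd b' (pd b (\<lambda>x. f x t)) z) \<le> B b b' t"
    using bchoice_dom2 by blast
  \<comment> \<open>One integrable majorant for all pairs of directions; the absolute values make
    every summand a lower bound of the sum.\<close>
  define A where "A t = (\<Sum>b\<in>Basis. \<Sum>b'\<in>Basis. \<bar>B b b' t\<bar>)" for t
  have intA: "integrable M A" unfolding A_def by (intro Bochner_Integration.integrable_sum integrable_abs B)
  have A: "norm (pd b' (pd b (\<lambda>x. f x t)) z) \<le> A t"
    if "b \<in> Basis" "b' \<in> Basis" "norm z \<le> r" "t \<in> space M" for b b' z t
  proof -
    have "norm (pd b' (pd b (\<lambda>x. f x t)) z) \<le> \<bar>B b b' t\<bar>" using B(2)[OF that] by linarith
    also have "\<dots> \<le> (\<Sum>b'\<in>Basis. \<bar>B b b' t\<bar>)" by (rule member_le_sum) (use that in auto)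
    also have "\<dots> \<le> A t" unfolding A_def by (rule member_le_sum) (use that in \<open>auto intro: sum_nonneg\<close>)
    finally show ?thesis .
  qed
  define K where "K = (real DIM('a))\<^sup>2 * (LINT t|M. A t)"
  define L where "L v = (\<Sum>b\<in>Basis. (v \<bullet> b) *\<^sub>R (LINT t|M. pd b (\<lambda>x. f x t) x))" for v
  have L: "L v = (LINT t|M. frechet_derivative (\<lambda>x. f x t) (at x) v)"
    "integrable M (\<lambda>t. frechet_derivative (\<lambda>x. f x t) (at x) v)" for v
  proof -
    have 1: "integrable M (\<lambda>t. \<Sum>b\<in>Basis. (v \<bullet> b) *\<^sub>R pd b (\<lambda>x. f x t) x)"
      by (intro Bochner_Integration.integrable_sum integrable_scaleR_right int1)
    have "L v = (LINT t|M. (\<Sum>b\<in>Basis. (v \<bullet> b) *\<^sub>R pd b (\<lambda>x. f x t) x))"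
      unfolding L_def by (subst Bochner_Integration.integral_sum) (auto intro!: integrable_scaleR_right int1)
    also have "\<dots> = (LINT t|M. frechet_derivative (\<lambda>x. f x t) (at x) v)"
      by (rule Bochner_Integration.integral_cong[OF refl], rule pd_expand[symmetric]) (rule f)
    finally show "L v = (LINT t|M. frechet_derivative (\<lambda>x. f x t) (at x) v)" .
    show "integrable M (\<lambda>t. frechet_derivative (\<lambda>x. f x t) (at x) v)"
      using 1 by (subst Bochner_Integration.integrable_cong[OF refl, OF pd_expand[OF f]])
  qed
  have "((\<lambda>x. LINT t|M. f x t) has_derivative L) (at x)"
  proof (rule has_derivativeI_sandwich[where e=1])
    show "bounded_linear L" unfolding L_def
      by (intro bounded_linear_sum bounded_linear_scaleR_left[THEN bounded_linear_compose] bounded_linear_inner_left)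
    show "((\<lambda>y. norm (y - x) * K) \<longlongrightarrow> 0) (at x within UNIV)"
      by (auto intro!: tendsto_eq_intros)
    fix y assume y: "y \<noteq> x" "dist y x < 1"
    have yr: "norm y \<le> r" using y norm_triangle_sub[of y x] by (simp add: r_def dist_norm)
    have "norm ((LINT t|M. f y t) - (LINT t|M. f x t) - L (y - x))
        = norm (LINT t|M. f y t - f x t - frechet_derivative (\<lambda>x. f x t) (at x) (y - x))"
      by (simp add: L int0)
    also have "\<dots> \<le> (LINT t|M. (norm (y - x))\<^sup>2 * (real DIM('a)^2 * A t))"
    proof (rule integral_norm_bound_mono)
      fix t assume t: "t \<in> space M"
      show "norm (f y t - f x t - frechet_derivative (\<lambda>x. f x t) (at x) (y - x)) \<le> (norm (y - x))\<^sup>2 * (real DIM('a)^2 * A t)"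
        by (rule taylor_quadratic[where r=r]) (use f f' A yr t in \<open>auto simp: r_def\<close>)
    qed (use int0 L intA in auto)
    also have "\<dots> = norm (y - x) * (norm (y - x) * K)"
      by (simp add: K_def power2_eq_square mult_ac)
    finally show "norm ((LINT t|M. f y t) - (LINT t|M. f x t) - L (y - x)) / norm (y - x) \<le> norm (y - x) * K"
      using y by (simp add: field_simps)
  qed simp
  then show ?thesis unfolding L_def[abs_def] .
qed

text \<open>Iterates \<open>has_derivative_integral_param\<close> along a list of directions. Each
  step consumes majorants for two further derivatives, hence the hypotheses about all lists at
  once.\<close>

lemma smooth_integral_param:
  fixes f :: "'a::euclidean_space \<Rightarrow> 't \<Rightarrow> 'b::{banach, second_countable_topology}"
  assumes f: "\<And>t. t \<in> space M \<Longrightarrow> smooth (\<lambda>x. f x t)"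
    and meas: "\<And>x bs. set bs \<subseteq> Basis \<Longrightarrow> (\<lambda>t. iter_deriv bs (\<lambda>x. f x t) x) \<in> borel_measurable M"
    and dom: "\<And>r bs. set bs \<subseteq> Basis \<Longrightarrow> \<exists>B. integrable M B \<and>
        (\<forall>x t. norm x \<le> r \<longrightarrow> t \<in> space M \<longrightarrow> norm (iter_deriv bs (\<lambda>x. f x t) x) \<le> B t)"
  shows "smooth (\<lambda>x. LINT t|M. f x t)"
    and "set bs \<subseteq> Basis \<Longrightarrow>
      iter_deriv bs (\<lambda>x. LINT t|M. f x t) = (\<lambda>x. LINT t|M. iter_deriv bs (\<lambda>x. f x t) x)"
proof -
  have step: "((\<lambda>x. LINT t|M. iter_deriv bs (\<lambda>x. f x t) x) has_derivative
      (\<lambda>v. \<Sum>b\<in>Basis. (v \<bullet> b) *\<^sub>R (LINT t|M. iter_deriv (b # bs) (\<lambda>x. f x t) x))) (at x)"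
    if bs: "set bs \<subseteq> Basis" for bs x
  proof -
    have "((\<lambda>x. LINT t|M. iter_deriv bs (\<lambda>x. f x t) x) has_derivative
      (\<lambda>v. \<Sum>b\<in>Basis. (v \<bullet> b) *\<^sub>R (LINT t|M. pd b (\<lambda>x. iter_deriv bs (\<lambda>x. f x t) x) x))) (at x)"
    proof (rule has_derivative_integral_param)
      fix t z assume t: "t \<in> space M"
      show "iter_deriv bs (\<lambda>x. f x t) differentiable at z"
        using f[OF t] bs by (auto simp: smooth_def)
      fix b :: 'a assume b: "b \<in> Basis"
      then have "set (b # bs) \<subseteq> Basis" using bs by simp
      then have "iter_deriv (b # bs) (\<lambda>x. f x t) differentiable at z"
        using f[OF t] unfolding smooth_def by blast
      then show "pd b (iter_deriv bs (\<lambda>x. f x t)) differentiable at z" by simp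
    next
      fix b x assume "b \<in> (Basis :: 'a set)"
      then show "(\<lambda>t. pd b (iter_deriv bs (\<lambda>x. f x t)) x) \<in> borel_measurable M"
        using meas[of "b # bs" x] bs by simp
    next
      fix b r assume "b \<in> (Basis :: 'a set)"
      then show "\<exists>B. integrable M B \<and> (\<forall>x t. norm x \<le> r \<longrightarrow> t \<in> space M \<longrightarrow> norm (pd b (iter_deriv bs (\<lambda>x. f x t)) x) \<le> B t)"
        using dom[of "b # bs" r] bs by simp
    next
      fix b b' r assume "b \<in> (Basis :: 'a set)" "b' \<in> (Basis :: 'a set)"
      then show "\<exists>B. integrable M B \<and> (\<forall>x t. norm x \<le> r \<longrightarrow> t \<in> space M \<longrightarrow> norm (pd b' (pd b (iter_deriv bs (\<lambda>x. f x t))) x) \<le> B t)"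
        using dom[of "b' # b # bs" r] bs by simp
    qed (use meas dom bs in auto)
    then show ?thesis by simp
  qed
  show eq: "iter_deriv bs (\<lambda>x. LINT t|M. f x t) = (\<lambda>x. LINT t|M. iter_deriv bs (\<lambda>x. f x t) x)"
    if "set bs \<subseteq> Basis" for bs using that
  proof (induction bs)
    case (Cons b bs)
    then have IH: "iter_deriv bs (\<lambda>x. LINT t|M. f x t) = (\<lambda>x. LINT t|M. iter_deriv bs (\<lambda>x. f x t) x)"
      and b: "b \<in> Basis" and bs: "set bs \<subseteq> Basis" by auto
    show ?case
    proof
      fix x
      have "iter_deriv (b # bs) (\<lambda>x. LINT t|M. f x t) x = pd b (\<lambda>x. LINT t|M. iter_deriv bs (\<lambda>x. f x t) x) x"
        by (simp add: IH)
      also have "\<dots> = (\<Sum>b'\<in>Basis. (b \<bullet> b') *\<^sub>R (LINT t|M. iter_deriv (b' # bs) (\<lambda>x. f x t) x))"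
        by (rule fun_cong[OF frechet_derivative_at[OF step[OF bs, of x]], symmetric])
      also have "\<dots> = (\<Sum>b'\<in>Basis. if b' = b then (LINT t|M. iter_deriv (b # bs) (\<lambda>x. f x t) x) else 0)"
        by (rule sum.cong) (use b in \<open>auto simp: inner_Basis\<close>)
      also have "\<dots> = (LINT t|M. iter_deriv (b # bs) (\<lambda>x. f x t) x)" using b by simp
      finally show "iter_deriv (b # bs) (\<lambda>x. LINT t|M. f x t) x = (LINT t|M. iter_deriv (b # bs) (\<lambda>x. f x t) x)" .
    qed
  qed simp
  show "smooth (\<lambda>x. LINT t|M. f x t)"
    unfolding smooth_def
  proof safe
    fix bs x assume bs: "set bs \<subseteq> (Basis :: 'a set)"
    show "iter_deriv bs (\<lambda>x. LINT t|M. f x t) differentiable at x"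
      unfolding eq[OF bs] by (rule differentiableI[OF step[OF bs]])
  qed
qed

section \<open>Integrability of the weights\<close>

lemma nn_integral_inverse_square: "(\<integral>\<^sup>+x. ennreal (1 / (1 + x\<^sup>2)) \<partial>lborel) < \<infinity>"
proof -
  have "integrable lborel (\<lambda>x::real. inverse (1 + x\<^sup>2))"
    using integrable_inverse_1_plus_square by (simp add: set_integrable_def)
  then show ?thesis
    unfolding integrable_iff_bounded by (simp add: divide_inverse)
qed

text \<open>Every coordinate t of x satisfies 1 + t^2 <= (1 + |x|)^2, so two powers of
  \<open>dec\<close> per dimension reduce integrability to the one-variable integral of 1/(1 + t^2).
  This is the origin of the threshold \<open>2 * DIM('a)\<close> that recurs below.\<close>

lemma dec_power_le_prod:
  fixes x :: "'a::euclidean_space"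
  assumes "2 * DIM('a) \<le> N"
  shows "dec x ^ N \<le> (\<Prod>b\<in>Basis. 1 / (1 + (x \<bullet> b)\<^sup>2))"
proof -
  have "dec x ^ N \<le> dec x ^ (2 * DIM('a))" by (rule dec_power_antimono[OF assms])
  also have "\<dots> = (\<Prod>b\<in>(Basis::'a set). (dec x)\<^sup>2)" by (simp add: power_mult)
  also have "\<dots> \<le> (\<Prod>b\<in>Basis. 1 / (1 + (x \<bullet> b)\<^sup>2))"
  proof (rule prod_mono, safe)
    fix b :: 'a assume b: "b \<in> Basis"
    have "\<bar>x \<bullet> b\<bar> \<le> norm x" using b by (rule Basis_le_norm)
    then have "(x \<bullet> b)\<^sup>2 \<le> (norm x)\<^sup>2" by (metis abs_ge_zero power2_abs power_mono)
    then have "1 + (x \<bullet> b)\<^sup>2 \<le> (1 + norm x)\<^sup>2"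
      using norm_ge_zero[of x] unfolding power2_sum one_power2 by linarith
    then show "(dec x)\<^sup>2 \<le> 1 / (1 + (x \<bullet> b)\<^sup>2)"
      by (simp add: dec_def power_divide divide_simps add_pos_nonneg)
  qed simp
  finally show ?thesis .
qed

lemma integrable_dec_power:
  assumes "2 * DIM('a) \<le> N"
  shows "integrable lborel (\<lambda>x::'a::euclidean_space. dec x ^ N)"
proof (rule integrableI_bounded)
  have "(\<integral>\<^sup>+x. ennreal (norm (dec (x::'a) ^ N)) \<partial>lborel) \<le> (\<integral>\<^sup>+x. (\<Prod>b\<in>Basis. ennreal (1 / (1 + ((x::'a) \<bullet> b)\<^sup>2))) \<partial>lborel)"
    using dec_power_le_prod[OF assms] by (intro nn_integral_mono) (simp add: prod_ennreal ennreal_leI)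
  also have "\<dots> = (\<Prod>b\<in>(Basis::'a set). (\<integral>\<^sup>+x. ennreal (1 / (1 + x\<^sup>2)) \<partial>lborel))"
    by (rule nn_integral_lborel_prod) auto
  also have "\<dots> < \<infinity>" using nn_integral_inverse_square by (simp add: power_less_top_ennreal)
  finally show "(\<integral>\<^sup>+x. ennreal (norm (dec (x::'a) ^ N)) \<partial>lborel) < \<infinity>" .
qed measurable

lemma integrable_dominated:
  fixes f :: "'a::euclidean_space \<Rightarrow> 'b::{banach, second_countable_topology}"
  assumes "f \<in> borel_measurable borel" "dominated (\<lambda>x. dec x ^ N) f" "2 * DIM('a) \<le> N"
  shows "integrable lborel f"
proof -
  obtain C where C: "\<And>x. norm (f x) \<le> C * dec x ^ N" using assms(2) by (auto simp: dominated_def)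
  show ?thesis
  proof (rule Bochner_Integration.integrable_bound)
    show "integrable lborel (\<lambda>x::'a. C * dec x ^ N)" using integrable_dec_power[OF assms(3)] by simp
    show "f \<in> borel_measurable lborel" using assms(1) by simp
    show "AE x in lborel. norm (f x) \<le> norm (C * dec x ^ N)"
      using C by (intro AE_I2) (auto intro: order_trans[OF _ abs_ge_self])
  qed
qed

section \<open>Schwartz functions\<close>

lemma one_plus_power_le:
  fixes t :: real assumes "0 \<le> t"
  shows "(1 + t) ^ N \<le> 2 ^ N * (1 + t ^ N)"
proof (cases "t \<le> 1")
  case True
  then have "(1 + t) ^ N \<le> 2 ^ N" using assms by (intro power_mono) auto
  also have "\<dots> \<le> 2 ^ N * (1 + t ^ N)" using assms by simp
  finally show ?thesis .
next
  case False
  then have "(1 + t) ^ N \<le> (2 * t) ^ N" by (intro power_mono) auto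
  also have "\<dots> \<le> 2 ^ N * (1 + t ^ N)" by (simp add: power_mult_distrib)
  finally show ?thesis .
qed

text \<open>The seminorms with exponents 0 and \<open>N\<close> together control (1 + |x|)^N times a
  derivative. In the form on the right, closure properties of Schwartz functions reduce to those of
  \<open>smooth_bd\<close>.\<close>

lemma schwartz_iff: "schwartz f \<longleftrightarrow> (\<forall>N n. smooth_bd n (\<lambda>x. dec x ^ N) f)"
proof
  assume f: "schwartz f"
  have "dominated (\<lambda>x. dec x ^ N) (iter_deriv bs f)" if bs: "set bs \<subseteq> Basis" for N bs
  proof -
    have "bounded (range (\<lambda>x. norm x ^ M * norm (iter_deriv bs f x)))" for M
      using f bs unfolding schwartz_def by blast
    then have "\<exists>C. \<forall>x. norm x ^ M * norm (iter_deriv bs f x) \<le> C" for M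
      unfolding bounded_iff by (auto intro!: exI order_trans[OF abs_ge_self])
    then obtain C where C: "\<And>M x. norm x ^ M * norm (iter_deriv bs f x) \<le> C M" by metis
    have "norm (iter_deriv bs f x) \<le> (2 ^ N * (C 0 + C N)) * dec x ^ N" for x
    proof -
      have "norm (iter_deriv bs f x) = dec x ^ N * ((1 + norm x) ^ N * norm (iter_deriv bs f x))"
        using dec_inverse_power[of x N] by (simp add: mult.assoc[symmetric] mult.commute[of "dec x ^ N"])
      also have "\<dots> \<le> dec x ^ N * ((2 ^ N * (1 + norm x ^ N)) * norm (iter_deriv bs f x))"
        by (intro mult_left_mono mult_right_mono one_plus_power_le) auto
      also have "\<dots> = dec x ^ N * (2 ^ N * (norm x ^ 0 * norm (iter_deriv bs f x) + norm x ^ N * norm (iter_deriv bs f x)))"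
        by (simp add: algebra_simps)
      also have "\<dots> \<le> dec x ^ N * (2 ^ N * (C 0 + C N))"
        by (intro mult_left_mono add_mono C) auto
      finally show ?thesis by (simp add: mult_ac)
    qed
    then show ?thesis unfolding dominated_def by blast
  qed
  then have "\<forall>n. smooth_bd n (\<lambda>x. dec x ^ N) f" for N
    using f unfolding smooth_bd_iff schwartz_def by simp
  then show "\<forall>N n. smooth_bd n (\<lambda>x. dec x ^ N) f" by simp
next
  assume *: "\<forall>N n. smooth_bd n (\<lambda>x. dec x ^ N) f"
  have "bounded (range (\<lambda>x. norm x ^ N * norm (iter_deriv bs f x)))" if "set bs \<subseteq> Basis" for N bs
  proof -
    have "\<forall>n. smooth_bd n (\<lambda>x. dec x ^ N) f" using * by simp
    then have "dominated (\<lambda>x. dec x ^ N) (iter_deriv bs f)" using that unfolding smooth_bd_iff by simp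
    then obtain C where C: "\<And>x. norm (iter_deriv bs f x) \<le> C * dec x ^ N" by (auto simp: dominated_def)
    have "norm (norm x ^ N * norm (iter_deriv bs f x)) \<le> C" for x
    proof -
      have "norm x ^ N * norm (iter_deriv bs f x) \<le> (1 + norm x) ^ N * (C * dec x ^ N)"
        by (intro mult_mono power_mono C) auto
      also have "\<dots> = C" using dec_inverse_power[of x N] by (simp add: mult_ac)
      finally show ?thesis by simp
    qed
    then show ?thesis unfolding bounded_iff by auto
  qed
  moreover have "smooth f"
  proof -
    have "\<forall>n. smooth_bd n (\<lambda>x. dec x ^ 0) f" using * by blast
    then show ?thesis unfolding smooth_bd_iff by simp
  qed
  ultimately show "schwartz f" unfolding schwartz_def by simp
qed

lemma schwartzI:
  assumes "smooth f" "\<And>bs N. set bs \<subseteq> Basis \<Longrightarrow> dominated (\<lambda>x. dec x ^ N) (iter_deriv bs f)"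
  shows "schwartz f"
proof -
  have "\<forall>n. smooth_bd n (\<lambda>x. dec x ^ N) f" for N
    using assms unfolding smooth_bd_iff by simp
  then show ?thesis by (simp add: schwartz_iff)
qed

lemma schwartzD: "schwartz f \<Longrightarrow> smooth_bd n (\<lambda>x. dec x ^ N) f"
  by (rule schwartz_iff[THEN iffD1, rule_format])

lemma schwartz_smooth: "schwartz f \<Longrightarrow> smooth f"
  by (simp add: schwartz_def)

lemma schwartz_smooth_bd: "schwartz f \<Longrightarrow> smooth_bd n (\<lambda>_. 1) f"
  using schwartzD[of f n 0] by simp

lemma schwartz_dominated: "schwartz f \<Longrightarrow> dominated (\<lambda>x. dec x ^ N) f"
  by (rule smooth_bd_dom[of 0]) (rule schwartzD)

lemma schwartz_pd: "schwartz f \<Longrightarrow> b \<in> Basis \<Longrightarrow> schwartz (pd b f)"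
proof -
  assume f: "schwartz f" and b: "b \<in> Basis"
  have "smooth_bd (Suc n) (\<lambda>x. dec x ^ N) f" for n N
    by (rule schwartzD[OF f])
  then have "smooth_bd n (\<lambda>x. dec x ^ N) (pd b f)" for n N
    using b unfolding smooth_bd.simps by blast
  then show "schwartz (pd b f)" by (intro schwartz_iff[THEN iffD2] allI)
qed

lemma schwartz_iter_deriv: "schwartz f \<Longrightarrow> set bs \<subseteq> Basis \<Longrightarrow> schwartz (iter_deriv bs f)"
proof (induction bs)
  case (Cons b bs)
  then show ?case unfolding iter_deriv.simps by (intro schwartz_pd) simp_all
qed simp

lemma smooth_differentiable: "smooth f \<Longrightarrow> f differentiable (at x)"
  unfolding smooth_def by (drule spec[of _ "[]"]) simp

lemma smooth_continuous_on: "smooth f \<Longrightarrow> continuous_on S f"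
  by (rule differentiable_imp_continuous_on, rule differentiable_at_imp_differentiable_on, rule smooth_differentiable)

lemma smooth_iter_deriv: "smooth f \<Longrightarrow> set bs \<subseteq> Basis \<Longrightarrow> smooth (iter_deriv bs f)"
  unfolding smooth_def
proof safe
  fix cs x assume f: "\<forall>bs. set bs \<subseteq> Basis \<longrightarrow> (\<forall>x. iter_deriv bs f differentiable at x)"
    and "set bs \<subseteq> Basis" "set cs \<subseteq> (Basis :: 'a set)"
  then have "set (cs @ bs) \<subseteq> Basis" by simp
  with f have "iter_deriv (cs @ bs) f differentiable at x" by blast
  then show "iter_deriv cs (iter_deriv bs f) differentiable at x" by (simp only: iter_deriv_append)
qed

lemma smooth_borel: "smooth f \<Longrightarrow> f \<in> borel_measurable borel"
  by (rule borel_measurable_continuous_onI) (rule smooth_continuous_on)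

lemma schwartz_borel: "schwartz f \<Longrightarrow> f \<in> borel_measurable borel"
  by (rule smooth_borel) (rule schwartz_smooth)

lemma schwartz_integrable: "schwartz f \<Longrightarrow> integrable lborel f"
  by (rule integrable_dominated[OF schwartz_borel schwartz_dominated order.refl])

text \<open>\<open>K\<close> surplus powers of decay of \<open>f\<close> absorb the polynomial
  growth of \<open>g\<close>.\<close>

lemma schwartz_mult:
  assumes "schwartz f" "\<And>n. smooth_bd n (\<lambda>x. (1 + norm x) ^ K) g"
  shows "schwartz (\<lambda>x. g x * f x)"
  unfolding schwartz_iff
proof safe
  fix N n
  have "smooth_bd n (\<lambda>x. (1 + norm x) ^ K * dec x ^ (K + N)) (\<lambda>x. g x * f x)"
    by (intro smooth_bd_mult assms(2)) (rule schwartzD[OF assms(1)])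
  moreover have "(1 + norm x) ^ K * dec x ^ (K + N) = dec x ^ N" for x :: 'a
    using dec_inverse_power[of x K] by (simp add: power_add)
  ultimately show "smooth_bd n (\<lambda>x. dec x ^ N) (\<lambda>x. g x * f x)" by simp
qed

lemma schwartz_mult_bd:
  assumes "schwartz f" "\<And>n. smooth_bd n (\<lambda>_. 1) g"
  shows "schwartz (\<lambda>x. g x * f x)"
  by (rule schwartz_mult[OF assms(1), where K=0]) (simp only: power_0 assms(2))

text \<open>The hypothesis on \<open>K\<close> is injectivity of \<open>A\<close> in quantitative
  form: decay in \<open>A x + c\<close> has to become decay in \<open>x\<close>. The bound
  \<open>1 \<le> K\<close> lets the same constant absorb the summand 1 of the weight.\<close>

lemma schwartz_affine:
  fixes A :: "'a::euclidean_space \<Rightarrow> 'b::euclidean_space"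
  assumes A: "bounded_linear A" and K: "\<And>x. norm x \<le> K * norm (A x)" "1 \<le> K"
    and f: "schwartz f"
  shows "schwartz (\<lambda>x. f (A x + c))"
  unfolding schwartz_iff
proof safe
  fix N n
  show "smooth_bd n (\<lambda>x. dec x ^ N) (\<lambda>x. f (A x + c))"
  proof (rule smooth_bd_affine[OF A, where \<rho> = "\<lambda>x. dec x ^ N" and K = "((1 + norm c) * K) ^ N"])
    fix x
    have "1 + norm x \<le> K * (1 + norm (A x))" using K(1)[of x] K(2) by (simp add: algebra_simps)
    then have "dec (A x) \<le> K * dec x"
      by (simp add: dec_def divide_simps add_pos_nonneg mult_ac)
    moreover have "dec (A x + c) \<le> (1 + norm c) * dec (A x)" using dec_shift[of "A x + c" "- c"] by simp
    ultimately have "dec (A x + c) \<le> (1 + norm c) * (K * dec x)"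
      by (elim order_trans, intro mult_left_mono) auto
    then have "dec (A x + c) ^ N \<le> ((1 + norm c) * (K * dec x)) ^ N" by (rule power_mono) simp
    then show "dec (A x + c) ^ N \<le> ((1 + norm c) * K) ^ N * dec x ^ N" by (simp add: power_mult_distrib)
  qed (simp_all add: schwartzD[OF f])
qed

lemma schwartz_scale:
  fixes f :: "'a::euclidean_space \<Rightarrow> complex"
  assumes "schwartz f" "r \<noteq> 0"
  shows "schwartz (\<lambda>x. f (r *\<^sub>R x + c))"
proof (rule schwartz_affine[where K = "1 + 1 / \<bar>r\<bar>"])
  fix x :: 'a
  have "norm x = (1 / \<bar>r\<bar>) * norm (r *\<^sub>R x)" using assms(2) by simp
  also have "\<dots> \<le> (1 + 1 / \<bar>r\<bar>) * norm (r *\<^sub>R x)" by (rule mult_right_mono) auto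
  finally show "norm x \<le> (1 + 1 / \<bar>r\<bar>) * norm (r *\<^sub>R x)" .
qed (simp_all add: assms(1) bounded_linear_scaleR_right)

lemma iter_deriv_zero_open:
  assumes "open S" "\<And>x. x \<in> S \<Longrightarrow> f x = 0"
  shows "x \<in> S \<Longrightarrow> iter_deriv bs f x = 0"
proof (induction bs arbitrary: x)
  case (Cons b bs)
  have "((\<lambda>_. 0) has_derivative (\<lambda>_. 0)) (at x)" by simp
  then have "(iter_deriv bs f has_derivative (\<lambda>_. 0)) (at x)"
    by (rule has_derivative_transform_within_open[OF _ assms(1) Cons.prems]) (use Cons.IH in auto)
  from fun_cong[OF frechet_derivative_at[OF this], of b] show ?case by simp
qed (use assms in auto)

lemma supp_zero: "x \<notin> supp f \<Longrightarrow> f x = 0"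
  using closure_subset[of "{x. f x \<noteq> 0}"] by (auto simp: supp_def)

lemma test_function_schwartz:
  assumes "test_function f"
  shows "schwartz f"
  unfolding schwartz_def
proof (intro conjI allI impI)
  show sm: "smooth f" using assms by (simp add: test_function_def)
  fix bs :: "'a list" and N assume bs: "set bs \<subseteq> Basis"
  define g where "g = (\<lambda>x. norm x ^ N * norm (iter_deriv bs f x))"
  have cont: "continuous_on S g" for S
    unfolding g_def by (intro continuous_intros smooth_continuous_on[OF smooth_iter_deriv[OF sm bs]])
  have cpt: "compact (supp f)" using assms by (simp add: test_function_def)
  have zero: "g x = 0" if "x \<notin> supp f" for x
  proof -
    have "iter_deriv bs f x = 0"
    proof (rule iter_deriv_zero_open[where S = "- supp f"])
      show "open (- supp f)" unfolding supp_def by (intro open_Compl closed_closure)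
      show "f y = 0" if "y \<in> - supp f" for y using that supp_zero[of y f] by blast
      show "x \<in> - supp f" using that by blast
    qed
    then show ?thesis by (simp add: g_def)
  qed
  have "bounded (g ` supp f)"
    by (rule compact_imp_bounded, rule compact_continuous_image[OF cont cpt])
  then have "bounded (insert 0 (g ` supp f))" by simp
  then show "bounded (range (\<lambda>x. norm x ^ N * norm (iter_deriv bs f x)))"
    unfolding g_def[symmetric]
    by (rule bounded_subset) (use zero in blast)
qed

section \<open>The Fourier transform on Schwartz functions\<close>

text \<open>The Fourier transform on an arbitrary Euclidean space, since it is needed for functions
  of one frequency and for symbols on the product space alike; \<open>fourier_eq_ft\<close> links it
  to \<open>fourier\<close>.\<close>

definition ft :: "('a::euclidean_space \<Rightarrow> complex) \<Rightarrow> 'a \<Rightarrow> complex" where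
  "ft f \<xi> = (LINT x|lborel. ech (- (x \<bullet> \<xi>)) * f x)"

lemma borel_ft [measurable]:
  assumes [measurable]: "f \<in> borel_measurable borel"
  shows "ft f \<in> borel_measurable borel"
  unfolding ft_def by measurable

section \<open>Integration by parts and decay of the Fourier transform\<close>

lemma iter_deriv_translate:
  assumes "smooth f" "set bs \<subseteq> Basis"
  shows "iter_deriv bs (\<lambda>x. f (x + t)) = (\<lambda>x. iter_deriv bs f (x + t))"
  using assms(2)
proof (induction bs)
  case (Cons b bs)
  have "iter_deriv bs f differentiable (at y)" for y
    using Cons.prems assms(1) by (auto simp: smooth_def)
  from has_derivative_affine[OF bounded_linear_ident this, THEN frechet_derivative_at, THEN fun_cong]
  show ?case using Cons by auto
qed simp

lemma smooth_translate: "smooth f \<Longrightarrow> smooth (\<lambda>x. f (x + t))"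
  unfolding smooth_def
proof safe
  fix bs x assume f: "\<forall>bs. set bs \<subseteq> Basis \<longrightarrow> (\<forall>x. iter_deriv bs f differentiable at x)"
    and bs: "set bs \<subseteq> (Basis :: 'a set)"
  then have "iter_deriv bs f differentiable (at (x + t))" by blast
  from has_derivative_affine[OF bounded_linear_ident this] show "iter_deriv bs (\<lambda>x. f (x + t)) differentiable at x"
    using iter_deriv_translate[OF _ bs, of f t] f by (auto simp: smooth_def differentiable_def)
qed

text \<open>By translation invariance the integral of \<open>f (x + t)\<close> over \<open>t\<close>
  does not depend on \<open>x\<close>; differentiating under the integral sign at
  \<open>x = 0\<close> gives the claim without any boundary terms.\<close>

lemma integral_pd_zero:
  assumes f: "schwartz f" and b: "b \<in> Basis"
  shows "(LINT x|lborel. pd b f x) = 0"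
proof -
  define D where "D = 2 * DIM('a)"
  note sm = schwartz_smooth[OF f]
  have dom: "\<exists>B. integrable lborel B \<and> (\<forall>x t. norm x \<le> r \<longrightarrow> t \<in> space lborel \<longrightarrow> norm (iter_deriv bs (\<lambda>x. f (x + t)) x) \<le> B t)"
    if bs: "set bs \<subseteq> Basis" for r bs
  proof -
    obtain C where C: "\<And>x. norm (iter_deriv bs f x) \<le> C * dec x ^ D"
      using schwartz_dominated[OF schwartz_iter_deriv[OF f bs]] by (auto simp: dominated_def)
    have "norm (iter_deriv bs (\<lambda>x. f (x + t)) x) \<le> \<bar>C\<bar> * ((1 + \<bar>r\<bar>) ^ D * dec t ^ D)" if "norm x \<le> r" for x t
    proof -
      have "norm (iter_deriv bs (\<lambda>x. f (x + t)) x) \<le> C * dec (x + t) ^ D"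
        using C by (simp add: iter_deriv_translate[OF sm bs])
      also have "\<dots> \<le> \<bar>C\<bar> * dec (x + t) ^ D" by (rule mult_right_mono) auto
      also have "\<dots> \<le> \<bar>C\<bar> * ((1 + norm x) ^ D * dec t ^ D)"
        using dec_shift_power'[of t x D] by (intro mult_left_mono) (auto simp: add.commute)
      also have "\<dots> \<le> \<bar>C\<bar> * ((1 + \<bar>r\<bar>) ^ D * dec t ^ D)"
        using that by (intro mult_left_mono mult_right_mono power_mono) auto
      finally show ?thesis .
    qed
    moreover have "integrable lborel (\<lambda>t::'a. \<bar>C\<bar> * ((1 + \<bar>r\<bar>) ^ D * dec t ^ D))"
      by (intro integrable_mult_right integrable_dec_power) (simp add: D_def)
    ultimately show ?thesis by blast
  qed
  have eq: "iter_deriv [b] (\<lambda>x. LINT t|lborel. f (x + t)) = (\<lambda>x. LINT t|lborel. iter_deriv [b] (\<lambda>x. f (x + t)) x)"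
  proof (rule smooth_integral_param(2))
    show "(\<lambda>t. iter_deriv bs (\<lambda>x. f (x + t)) x) \<in> borel_measurable lborel" if bs: "set bs \<subseteq> Basis" for x bs
    proof -
      have [measurable]: "iter_deriv bs f \<in> borel_measurable borel"
        by (rule schwartz_borel[OF schwartz_iter_deriv[OF f bs]])
      show ?thesis unfolding iter_deriv_translate[OF sm bs] by measurable
    qed
  qed (use dom b in \<open>auto intro: smooth_translate sm\<close>)
  have const: "(LINT t|lborel. f (x + t)) = (LINT t|lborel. f t)" for x
  proof -
    have [measurable]: "f \<in> borel_measurable borel" by (rule schwartz_borel[OF f])
    have "(LINT t|lborel. f t) = (LINT t|distr lborel borel ((+) x). f t)" by (simp add: lborel_distr_plus)
    also have "\<dots> = (LINT t|lborel. f (x + t))" by (rule integral_distr) auto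
    finally show ?thesis by simp
  qed
  have "(LINT t|lborel. iter_deriv [b] (\<lambda>x. f (x + t)) 0) = pd b (\<lambda>_. LINT t|lborel. f t) 0"
    using fun_cong[OF eq, of 0, symmetric] unfolding const by simp
  moreover have "iter_deriv [b] (\<lambda>x. f (x + t)) 0 = pd b f t" for t
    using iter_deriv_translate[OF sm, of "[b]" t] b by simp
  ultimately show ?thesis by simp
qed

lemma schwartz_ech_mult: "schwartz f \<Longrightarrow> schwartz (\<lambda>x. ech (x \<bullet> v) * f x)"
  by (rule schwartz_mult_bd[OF _ smooth_bd_ech])

text \<open>Integration by parts: \<open>integral_pd_zero\<close> is applied to the character times
  \<open>f\<close>.\<close>

lemma ft_pd:
  assumes f: "schwartz f" and b: "b \<in> Basis"
  shows "ft (pd b f) \<xi> = 2 * pi * \<i> * (b \<bullet> \<xi>) * ft f \<xi>"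
proof -
  define g where "g = (\<lambda>x. ech (x \<bullet> (- \<xi>)) * f x)"
  have g: "schwartz g" unfolding g_def by (rule schwartz_ech_mult[OF f])
  have "pd b g x = ech (- (x \<bullet> \<xi>)) * pd b f x - (2 * pi * \<i> * (b \<bullet> \<xi>)) * (ech (- (x \<bullet> \<xi>)) * f x)" for x
  proof -
    have "pd b g x = ech (x \<bullet> (- \<xi>)) * pd b f x + pd b (\<lambda>x. ech (x \<bullet> (- \<xi>))) x * f x"
      unfolding g_def by (rule pd_mult[OF differentiable_ech smooth_differentiable[OF schwartz_smooth[OF f]]])
    also have "pd b (\<lambda>x. ech (x \<bullet> (- \<xi>))) x = (2 * pi * \<i> * (b \<bullet> (- \<xi>))) * ech (x \<bullet> (- \<xi>))"
      using fun_cong[OF frechet_derivative_at[OF has_derivative_ech[of "- \<xi>" x]], of b] by simp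
    finally show ?thesis by simp
  qed
  then have "0 = (LINT x|lborel. ech (- (x \<bullet> \<xi>)) * pd b f x - (2 * pi * \<i> * (b \<bullet> \<xi>)) * (ech (- (x \<bullet> \<xi>)) * f x))"
    using integral_pd_zero[OF g b] by simp
  also have "\<dots> = ft (pd b f) \<xi> - 2 * pi * \<i> * (b \<bullet> \<xi>) * ft f \<xi>"
  proof -
    have "integrable lborel (\<lambda>x. ech (- (x \<bullet> \<xi>)) * h x)" if "schwartz h" for h
      using schwartz_integrable[OF schwartz_ech_mult[OF that, of "- \<xi>"]] by simp
    from this[OF f] this[OF schwartz_pd[OF f b]] show ?thesis
      unfolding ft_def by (subst Bochner_Integration.integral_diff) auto
  qed
  finally show ?thesis by simp
qed

lemma norm_ft_le:
  shows "norm (ft f \<xi>) \<le> (LINT x|lborel. norm (f x))"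
  unfolding ft_def using integral_norm_bound[of lborel "\<lambda>x. ech (- (x \<bullet> \<xi>)) * f x"] by (simp add: norm_mult)

lemma ft_coord_decay:
  assumes f: "schwartz f" and b: "b \<in> Basis"
  shows "\<exists>C. \<forall>\<xi>. \<bar>b \<bullet> \<xi>\<bar> ^ N * norm (ft f \<xi>) \<le> C"
  using f
proof (induction N arbitrary: f)
  case (Suc N)
  from Suc.IH[OF schwartz_pd[OF Suc.prems b]]
  obtain C where C: "\<And>\<xi>. \<bar>b \<bullet> \<xi>\<bar> ^ N * norm (ft (pd b f) \<xi>) \<le> C" by blast
  have "\<bar>b \<bullet> \<xi>\<bar> ^ Suc N * norm (ft f \<xi>) \<le> C / (2 * pi)" for \<xi>
    using C[of \<xi>] by (simp add: ft_pd[OF Suc.prems b] norm_mult field_simps)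
  then show ?case by blast
qed (use norm_ft_le in auto)

text \<open>Some coordinate realises the maximum norm, which controls the Euclidean norm up to a
  dimensional factor; summing the constants over all coordinates removes the dependence on which one
  it is. The set \<open>S\<close> is the whole space for Fourier transforms and the lattice for
  Fourier coefficients.\<close>

lemma decay_from_coords:
  fixes F :: "'a::euclidean_space \<Rightarrow> complex"
  assumes "\<And>b. b \<in> Basis \<Longrightarrow> \<exists>C. \<forall>\<xi>\<in>S. \<bar>b \<bullet> \<xi>\<bar> ^ N * norm (F \<xi>) \<le> C" and "\<exists>C. \<forall>\<xi>\<in>S. norm (F \<xi>) \<le> C"
  shows "\<exists>C. \<forall>\<xi>\<in>S. norm (F \<xi>) \<le> C * dec \<xi> ^ N"
proof -
  obtain C where C: "\<And>b \<xi>. b \<in> Basis \<Longrightarrow> \<xi> \<in> S \<Longrightarrow> \<bar>b \<bullet> \<xi>\<bar> ^ N * norm (F \<xi>) \<le> C b" using assms(1) by metis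
  obtain C0 where C0: "\<And>\<xi>. \<xi> \<in> S \<Longrightarrow> norm (F \<xi>) \<le> C0" using assms(2) by blast
  define d where "d = real DIM('a)"
  define K where "K = 2 ^ N * (C0 + d ^ N * (\<Sum>b\<in>Basis. \<bar>C b\<bar>))"
  have "norm (F \<xi>) \<le> K * dec \<xi> ^ N" if S: "\<xi> \<in> S" for \<xi>
  proof -
    obtain b where b: "b \<in> Basis" "infnorm \<xi> = \<bar>b \<bullet> \<xi>\<bar>"
    proof -
      have "infnorm \<xi> = Max ((\<lambda>b. \<bar>\<xi> \<bullet> b\<bar>) ` Basis)" by (rule infnorm_Max)
      then have "infnorm \<xi> \<in> (\<lambda>b. \<bar>\<xi> \<bullet> b\<bar>) ` Basis" by simp
      then show ?thesis using that by (auto simp: inner_commute)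
    qed
    have "norm \<xi> \<le> sqrt d * infnorm \<xi>" unfolding d_def by (rule norm_le_infnorm)
    also have "\<dots> \<le> d * \<bar>b \<bullet> \<xi>\<bar>"
    proof -
      have "1 \<le> d" unfolding d_def using DIM_positive[where 'a='a] by (simp add: Suc_le_eq)
      then have "sqrt d \<le> d" by (simp add: real_sqrt_le_iff real_le_lsqrt power2_eq_square)
      then show ?thesis using b by (intro mult_mono) (auto simp: d_def)
    qed
    finally have le: "norm \<xi> \<le> d * \<bar>b \<bullet> \<xi>\<bar>" .
    have "(1 + norm \<xi>) ^ N * norm (F \<xi>) \<le> (2 ^ N * (1 + norm \<xi> ^ N)) * norm (F \<xi>)"
      by (intro mult_right_mono one_plus_power_le) auto
    also have "\<dots> \<le> (2 ^ N * (1 + (d * \<bar>b \<bullet> \<xi>\<bar>) ^ N)) * norm (F \<xi>)"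
      by (intro mult_right_mono mult_left_mono add_left_mono power_mono le) auto
    also have "\<dots> = 2 ^ N * (norm (F \<xi>) + d ^ N * (\<bar>b \<bullet> \<xi>\<bar> ^ N * norm (F \<xi>)))"
      by (simp add: algebra_simps power_mult_distrib)
    also have "\<dots> \<le> K" unfolding K_def
    proof (intro mult_left_mono add_mono C0 S)
      have "C b \<le> (\<Sum>b\<in>Basis. \<bar>C b\<bar>)"
        using member_le_sum[of b Basis "\<lambda>b. \<bar>C b\<bar>"] b by auto
      then show "\<bar>b \<bullet> \<xi>\<bar> ^ N * norm (F \<xi>) \<le> (\<Sum>b\<in>Basis. \<bar>C b\<bar>)" using C[OF b(1) S] by linarith
    qed (auto simp: d_def)
    finally have "(1 + norm \<xi>) ^ N * norm (F \<xi>) * dec \<xi> ^ N \<le> K * dec \<xi> ^ N"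
      by (rule mult_right_mono) simp
    moreover have "(1 + norm \<xi>) ^ N * norm (F \<xi>) * dec \<xi> ^ N = norm (F \<xi>) * ((1 + norm \<xi>) ^ N * dec \<xi> ^ N)"
      by (simp only: mult_ac)
    ultimately show ?thesis by (simp only: dec_inverse_power mult_1_right)
  qed
  then show ?thesis by blast
qed

lemma ft_decay:
  assumes f: "schwartz f"
  shows "dominated (\<lambda>\<xi>. dec \<xi> ^ N) (ft f)"
  using decay_from_coords[of UNIV N "ft f"] ft_coord_decay[OF f] norm_ft_le[of f]
  by (auto simp: dominated_def)

lemma iter_deriv_ech:
  "iter_deriv bs (\<lambda>x. ech (x \<bullet> v) * c) = (\<lambda>x. (\<Prod>b\<leftarrow>bs. 2 * pi * \<i> * (b \<bullet> v)) * (ech (x \<bullet> v) * c))"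
proof (induction bs)
  case (Cons b bs)
  define K where "K = (\<Prod>b\<leftarrow>bs. 2 * pi * \<i> * complex_of_real (b \<bullet> v)) * c"
  have eq: "iter_deriv bs (\<lambda>x. ech (x \<bullet> v) * c) = (\<lambda>x. K * ech (x \<bullet> v))"
    unfolding Cons K_def by (simp add: mult_ac)
  show ?case
  proof
    fix x
    have "pd b (\<lambda>x. K * ech (x \<bullet> v)) x = K * ((2 * pi * \<i> * (b \<bullet> v)) * ech (x \<bullet> v))"
      using pd_linear[OF bounded_linear_mult_right[of K] differentiable_ech[of v x], of b]
        fun_cong[OF frechet_derivative_at[OF has_derivative_ech[of v x]], of b]
      by simp
    then show "iter_deriv (b # bs) (\<lambda>x. ech (x \<bullet> v) * c) x = (\<Prod>b\<leftarrow>b # bs. 2 * pi * \<i> * (b \<bullet> v)) * (ech (x \<bullet> v) * c)"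
      unfolding iter_deriv.simps eq by (simp add: K_def mult_ac)
  qed
qed simp

lemma smooth_ech: "smooth (\<lambda>x. ech (x \<bullet> v) * c)"
  using smooth_bd_iff[of "\<lambda>_. 1", THEN iffD1, OF allI, OF smooth_bd_linear[OF bounded_linear_mult_left smooth_bd_ech]]
  by blast

lemma norm_prod_coords_le:
  assumes "set bs \<subseteq> Basis"
  shows "norm (\<Prod>b\<leftarrow>bs. 2 * pi * \<i> * complex_of_real (b \<bullet> v)) \<le> (2 * pi) ^ length bs * (1 + norm v) ^ length bs"
  using assms
proof (induction bs)
  case (Cons b bs)
  have "\<bar>b \<bullet> v\<bar> \<le> 1 + norm v" using Cons.prems Basis_le_norm[of b v] by (auto simp: inner_commute)
  then have le: "norm (2 * pi * \<i> * complex_of_real (b \<bullet> v)) \<le> (2 * pi) * (1 + norm v)"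
    by (simp add: norm_mult)
  from Cons.prems have IH: "norm (\<Prod>b\<leftarrow>bs. 2 * pi * \<i> * complex_of_real (b \<bullet> v)) \<le> (2 * pi) ^ length bs * (1 + norm v) ^ length bs"
    by (intro Cons.IH) simp
  from le have "norm (2 * pi * \<i> * complex_of_real (b \<bullet> v)) * norm (\<Prod>b\<leftarrow>bs. 2 * pi * \<i> * complex_of_real (b \<bullet> v))
     \<le> ((2 * pi) * (1 + norm v)) * ((2 * pi) ^ length bs * (1 + norm v) ^ length bs)"
    by (rule mult_mono[OF _ IH]) auto
  also have "\<dots> = (2 * pi) ^ length (b # bs) * (1 + norm v) ^ length (b # bs)"
    by (simp add: mult_ac)
  finally show ?case by (simp only: list.map prod_list.Cons norm_mult)
qed simp

text \<open>Only measurability and decay of \<open>u\<close> enter, because decay is traded for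
  derivatives of the transform. This generality serves the indicator function of a ball in
  \<open>cutoff_exists\<close>.\<close>

lemma smooth_ft:
  fixes u :: "'a::euclidean_space \<Rightarrow> complex"
  assumes [measurable]: "u \<in> borel_measurable borel" and u: "\<And>N. dominated (\<lambda>x. dec x ^ N) u"
  shows "smooth (ft u)"
    and "set bs \<subseteq> Basis \<Longrightarrow> iter_deriv bs (ft u) = ft (\<lambda>x. (\<Prod>b\<leftarrow>bs. 2 * pi * \<i> * (b \<bullet> (- x))) * u x)"
proof -
  have F: "ft u = (\<lambda>\<xi>. LINT x|lborel. ech (\<xi> \<bullet> (- x)) * u x)"
    by (simp add: ft_def fun_eq_iff inner_commute)
  have prod_meas [measurable]: "(\<lambda>x::'a. \<Prod>b\<leftarrow>bs. 2 * pi * \<i> * complex_of_real (b \<bullet> (- x))) \<in> borel_measurable borel" for bs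
    by (induction bs) auto
  have dom: "\<exists>B. integrable lborel B \<and> (\<forall>\<xi> x. norm \<xi> \<le> r \<longrightarrow> x \<in> space lborel \<longrightarrow> norm (iter_deriv bs (\<lambda>\<xi>. ech (\<xi> \<bullet> (- x)) * u x) \<xi>) \<le> B x)"
    if bs: "set bs \<subseteq> Basis" for r bs
  proof -
    define l D where "l = length bs" and "D = 2 * DIM('a)"
    obtain C where C: "\<And>x. norm (u x) \<le> C * dec x ^ (l + D)" using u by (auto simp: dominated_def)
    have "norm (iter_deriv bs (\<lambda>\<xi>. ech (\<xi> \<bullet> (- x)) * u x) \<xi>) \<le> (2 * pi) ^ l * (C * dec x ^ D)" for x \<xi>
    proof -
      have "norm (iter_deriv bs (\<lambda>\<xi>. ech (\<xi> \<bullet> (- x)) * u x) \<xi>)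
         = norm (\<Prod>b\<leftarrow>bs. 2 * pi * \<i> * complex_of_real (b \<bullet> (- x))) * norm (u x)"
        unfolding iter_deriv_ech by (simp only: norm_mult norm_ech mult_1)
      also have "\<dots> \<le> ((2 * pi) ^ l * (1 + norm (- x)) ^ l) * (C * dec x ^ (l + D))"
        unfolding l_def by (intro mult_mono norm_prod_coords_le bs C[unfolded l_def]) auto
      also have "\<dots> = (2 * pi) ^ l * (C * dec x ^ D)"
        using dec_inverse_power[of x l] by (simp add: power_add mult_ac)
      finally show ?thesis .
    qed
    moreover have "integrable lborel (\<lambda>x::'a. (2 * pi) ^ l * (C * dec x ^ D))"
      by (intro integrable_mult_right integrable_dec_power) (simp add: D_def)
    ultimately show ?thesis by blast
  qed
  have meas: "(\<lambda>x. iter_deriv bs (\<lambda>\<xi>. ech (\<xi> \<bullet> (- x)) * u x) \<xi>) \<in> borel_measurable lborel" for bs \<xi>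
    unfolding iter_deriv_ech by measurable
  show "smooth (ft u)" unfolding F
    by (rule smooth_integral_param(1)[OF smooth_ech meas dom])
  show "iter_deriv bs (ft u) = ft (\<lambda>x. (\<Prod>b\<leftarrow>bs. 2 * pi * \<i> * (b \<bullet> (- x))) * u x)" if "set bs \<subseteq> Basis"
  proof -
    have "iter_deriv bs (ft u) = (\<lambda>\<xi>. LINT x|lborel. iter_deriv bs (\<lambda>\<xi>. ech (\<xi> \<bullet> (- x)) * u x) \<xi>)"
      unfolding F by (rule smooth_integral_param(2)[OF smooth_ech meas dom that])
    then show ?thesis unfolding iter_deriv_ech ft_def by (simp add: inner_commute mult_ac)
  qed
qed

lemma smooth_bd_ft:
  fixes u :: "'a::euclidean_space \<Rightarrow> complex"
  assumes "u \<in> borel_measurable borel" and u: "\<And>N. dominated (\<lambda>x. dec x ^ N) u"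
  shows "smooth_bd n (\<lambda>_. 1) (ft u)"
proof -
  have "dominated (\<lambda>_. 1) (iter_deriv bs (ft u))" if "set bs \<subseteq> Basis" for bs
    unfolding smooth_ft(2)[OF assms that] dominated_def using norm_ft_le by auto
  then show ?thesis using smooth_bd_iff[of "\<lambda>_. 1" "ft u"] smooth_ft(1)[OF assms] by simp
qed

lemma smooth_bd_coord: "b \<in> Basis \<Longrightarrow> smooth_bd n (\<lambda>x. (1 + norm x) ^ 1) (\<lambda>x. 2 * pi * \<i> * complex_of_real (b \<bullet> (- x)))"
proof -
  assume b: "b \<in> Basis"
  define L where "L = (\<lambda>x. 2 * pi * \<i> * complex_of_real (b \<bullet> (- x)))"
  have "bounded_linear L" unfolding L_def
    by (intro bounded_linear_const_mult bounded_linear_compose[OF bounded_linear_of_real]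
      bounded_linear_compose[OF bounded_linear_inner_right] bounded_linear_minus bounded_linear_ident)
  then have L: "(L has_derivative L) (at x)" for x by (rule bounded_linear_imp_has_derivative)
  have dom: "dominated (\<lambda>x. (1 + norm x) ^ 1) L"
    unfolding dominated_def
  proof (intro exI allI)
    fix x
    have "\<bar>b \<bullet> x\<bar> \<le> 1 + norm x" using b Basis_le_norm[of b x] by (auto simp: inner_commute)
    then show "norm (L x) \<le> (2 * pi) * (1 + norm x) ^ 1" unfolding L_def by (simp add: norm_mult)
  qed
  have "smooth_bd n (\<lambda>x. (1 + norm x) ^ 1) (pd b' L)" for n and b' :: 'a
  proof -
    have "pd b' L = (\<lambda>_. L b')" by (simp add: frechet_derivative_at[OF L, symmetric])
    moreover have "smooth_bd n (\<lambda>x. (1 + norm x) ^ 1) (\<lambda>_. L b')"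
      by (rule smooth_bd_mono[OF smooth_bd_const, where K=1]) auto
    ultimately show ?thesis by simp
  qed
  then have "smooth_bd n (\<lambda>x. (1 + norm x) ^ 1) L"
    using L dom by (cases n) (auto intro: differentiableI)
  then show ?thesis unfolding L_def .
qed

text \<open>Each derivative of \<open>ft f\<close> is the transform of a polynomial multiple of
  \<open>f\<close>, again a Schwartz function, so \<open>ft_decay\<close> bounds all
  derivatives.\<close>

lemma schwartz_ft:
  assumes f: "schwartz f"
  shows "schwartz (ft f)"
proof -
  have "schwartz (\<lambda>x. (\<Prod>b\<leftarrow>bs. 2 * pi * \<i> * complex_of_real (b \<bullet> (- x))) * f x)" if "set bs \<subseteq> Basis" for bs
    using that
  proof (induction bs)
    case (Cons b bs)
    from schwartz_mult[OF Cons.IH smooth_bd_coord] Cons.prems show ?case by (simp add: mult.assoc)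
  qed (use f in simp)
  then have "dominated (\<lambda>x. dec x ^ N) (iter_deriv bs (ft f))" if "set bs \<subseteq> Basis" for bs N
    unfolding smooth_ft(2)[OF schwartz_borel[OF f] schwartz_dominated[OF f] that] using that by (intro ft_decay) auto
  then show ?thesis
    using smooth_ft(1)[OF schwartz_borel[OF f] schwartz_dominated[OF f]] by (intro schwartzI) auto
qed

section \<open>Sums over a countable index set as integrals\<close>

text \<open>The bridge from the sums in the definitions to integrals over counting measure, where
  Fubini's theorem and dominated convergence apply.\<close>

lemma infsum_eq_LINT:
  fixes f :: "'i \<Rightarrow> 'b::{banach, second_countable_topology}"
  assumes "integrable (count_space UNIV) f"
  shows "infsum f UNIV = (LINT k|count_space UNIV. f k)"
  using infsetsum_infsum[of f UNIV] assms
  by (simp add: Infinite_Set_Sum.abs_summable_on_def infsetsum_def)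

text \<open>Fubini's theorem with one counting measure, its hypothesis in the shape that estimates
  produce. \<open>M\<close> may itself be a counting measure, which covers the exchange of two
  sums.\<close>

lemma integral_sum_swap:
  fixes G :: "'i::countable \<Rightarrow> 'x \<Rightarrow> 'b::{banach, second_countable_topology}"
  assumes M: "sigma_finite_measure M" and G: "\<And>k. G k \<in> borel_measurable M"
    and fin: "(\<integral>\<^sup>+k. (\<integral>\<^sup>+x. ennreal (norm (G k x)) \<partial>M) \<partial>count_space UNIV) < \<infinity>"
  shows "(LINT x|M. (LINT k|count_space UNIV. G k x)) = (LINT k|count_space UNIV. (LINT x|M. G k x))"
proof -
  interpret M: sigma_finite_measure M by (rule M)
  interpret C: sigma_finite_measure "count_space (UNIV :: 'i set)"
    by (rule sigma_finite_measure_count_space_countable) auto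
  interpret P: pair_sigma_finite "count_space (UNIV :: 'i set)" M ..
  have meas [measurable]: "case_prod G \<in> borel_measurable (count_space UNIV \<Otimes>\<^sub>M M)"
    by (rule measurable_pair_measure_countable1) (use G in auto)
  have int: "integrable (count_space UNIV \<Otimes>\<^sub>M M) (case_prod G)"
  proof (rule integrableI_bounded[OF meas])
    have "(\<integral>\<^sup>+z. ennreal (norm (case_prod G z)) \<partial>(count_space UNIV \<Otimes>\<^sub>M M))
        = (\<integral>\<^sup>+k. (\<integral>\<^sup>+x. ennreal (norm (case_prod G (k, x))) \<partial>M) \<partial>count_space UNIV)"
      by (rule M.nn_integral_fst[symmetric]) measurable
    then show "(\<integral>\<^sup>+z. ennreal (norm (case_prod G z)) \<partial>(count_space UNIV \<Otimes>\<^sub>M M)) < \<infinity>" using fin by simp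
  qed
  show "(LINT x|M. (LINT k|count_space UNIV. G k x)) = (LINT k|count_space UNIV. (LINT x|M. G k x))"
    by (rule P.Fubini_integral[OF int])
qed

lemma borel_measurable_LINT_count_space:
  fixes G :: "'i::countable \<Rightarrow> 'x \<Rightarrow> 'b::{banach, second_countable_topology}"
  assumes G: "\<And>k. G k \<in> borel_measurable M"
  shows "(\<lambda>x. LINT k|count_space UNIV. G k x) \<in> borel_measurable M"
proof -
  interpret C: sigma_finite_measure "count_space (UNIV :: 'i set)"
    by (rule sigma_finite_measure_count_space_countable) auto
  have "(\<lambda>(k, x). G k x) \<in> borel_measurable (count_space UNIV \<Otimes>\<^sub>M M)"
    by (rule measurable_pair_measure_countable1) (use G in auto)
  from measurable_compose[OF measurable_pair_swap'[of M "count_space UNIV"] this]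
  have "(\<lambda>(x, k). G k x) \<in> borel_measurable (M \<Otimes>\<^sub>M count_space UNIV)"
    by (simp add: case_prod_beta' )
  then show ?thesis by (rule C.borel_measurable_lebesgue_integral)
qed

lemma borel_measurable_nn_integral_count_space:
  fixes h :: "'i::countable \<Rightarrow> 'x \<Rightarrow> ennreal"
  assumes "\<And>j. h j \<in> borel_measurable M"
  shows "(\<lambda>x. \<integral>\<^sup>+j. h j x \<partial>count_space UNIV) \<in> borel_measurable M"
proof -
  interpret C: sigma_finite_measure "count_space (UNIV :: 'i set)"
    by (rule sigma_finite_measure_count_space_countable) auto
  have "(\<lambda>(k, x). h k x) \<in> borel_measurable (count_space UNIV \<Otimes>\<^sub>M M)"
    by (rule measurable_pair_measure_countable1) (use assms in auto)
  from measurable_compose[OF measurable_pair_swap'[of M "count_space UNIV"] this]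
  have "(\<lambda>(x, k). h k x) \<in> borel_measurable (M \<Otimes>\<^sub>M count_space UNIV)"
    by (simp add: case_prod_beta')
  then show ?thesis by (rule C.borel_measurable_nn_integral)
qed

lemma norm_LINT_le_nn_integral:
  fixes f :: "'x \<Rightarrow> 'b::{banach, second_countable_topology}"
  shows "ennreal (norm (LINT x|M. f x)) \<le> (\<integral>\<^sup>+x. ennreal (norm (f x)) \<partial>M)"
  by (cases "integrable M f") (simp_all add: integral_norm_bound_ennreal not_integrable_integral_eq)

lemma LINT_count_space_single:
  fixes c :: "'b::{banach, second_countable_topology}"
  shows "(LINT k|count_space UNIV. (if k = a then c else 0)) = c"
proof (cases "c = 0")
  case False
  then have "{k \<in> UNIV. (if k = a then c else 0) \<noteq> 0} = {a}" by auto
  then show ?thesis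
    by (subst lebesgue_integral_count_space_finite_support) auto
qed (simp cong: if_cong)

lemma nn_count_space_finiteI:
  fixes f :: "'i \<Rightarrow> real"
  assumes "integrable (count_space UNIV) f"
  shows "(\<integral>\<^sup>+k. ennreal (f k) \<partial>count_space UNIV) < \<infinity>"
proof -
  have "(\<integral>\<^sup>+k. ennreal (f k) \<partial>count_space UNIV) \<le> (\<integral>\<^sup>+k. ennreal (norm (f k)) \<partial>count_space UNIV)"
    by (intro nn_integral_mono ennreal_leI) auto
  then show ?thesis using assms unfolding integrable_iff_bounded by (auto intro: le_less_trans)
qed

lemma lborel_integral_translate:
  fixes h :: "'a::euclidean_space \<Rightarrow> 'b::{banach, second_countable_topology}"
  assumes "h \<in> borel_measurable borel"
  shows "(LINT x|lborel. h (x + c)) = (LINT x|lborel. h x)"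
proof -
  have "(LINT x|lborel. h x) = (LINT x|distr lborel borel ((+) c). h x)" by (simp add: lborel_distr_plus)
  also have "\<dots> = (LINT x|lborel. h (c + x))" by (rule integral_distr) (use assms in auto)
  finally show ?thesis by (simp add: add.commute)
qed

lemma lborel_nn_integral_translate:
  fixes h :: "'a::euclidean_space \<Rightarrow> ennreal"
  assumes "h \<in> borel_measurable borel"
  shows "(\<integral>\<^sup>+x. h (x + c) \<partial>lborel) = (\<integral>\<^sup>+x. h x \<partial>lborel)"
proof -
  have "(\<integral>\<^sup>+x. h x \<partial>lborel) = (\<integral>\<^sup>+x. h x \<partial>distr lborel borel ((+) c))" by (simp add: lborel_distr_plus)
  also have "\<dots> = (\<integral>\<^sup>+x. h (c + x) \<partial>lborel)" by (rule nn_integral_distr) (use assms in auto)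
  finally show ?thesis by (simp add: add.commute)
qed

section \<open>The unit cube\<close>

text \<open>Half-open, so that the lattice translates tile the space exactly, see
  \<open>ex1_cube\<close>; on arbitrary Euclidean spaces, because the product space needs it
  too.\<close>

definition cube :: "'a::euclidean_space set" where
  "cube = {x. \<forall>b\<in>Basis. - 1/2 < x \<bullet> b \<and> x \<bullet> b \<le> 1/2}"

abbreviation cubeM :: "'a::euclidean_space measure" where
  "cubeM \<equiv> restrict_space lborel cube"

lemma cube_sets [measurable]: "(cube :: 'a::euclidean_space set) \<in> sets borel"
proof -
  have "(cube :: 'a set) = (\<Inter>b\<in>Basis. {x. - 1/2 < x \<bullet> b} \<inter> {x. x \<bullet> b \<le> 1/2})"
    by (auto simp: cube_def)
  also have "\<dots> \<in> sets borel"
    by (intro sets.countable_INT'' sets.finite_INT sets.Int borel_open borel_closed open_Collect_less closed_Collect_le continuous_intros) auto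
  finally show ?thesis .
qed

lemma space_cubeM [simp]: "space cubeM = cube"
  by (simp add: space_restrict_space)

lemma emeasure_cube: "emeasure lborel (cube :: 'a::euclidean_space set) = 1"
proof (rule antisym)
  have o: "(One :: 'a) \<bullet> b = 1" if "b \<in> Basis" for b using that by (simp add: inner_sum_left inner_Basis)
  have 1: "cube \<subseteq> cbox (- (1/2) *\<^sub>R One) ((1/2) *\<^sub>R (One::'a))"
    by (force simp: cube_def mem_box o)
  have 2: "box (- (1/2) *\<^sub>R One) ((1/2) *\<^sub>R (One::'a)) \<subseteq> cube"
    by (auto simp: cube_def mem_box o intro: less_imp_le)
  have prod: "(\<Prod>b\<in>Basis. ((1/2) *\<^sub>R (One::'a) - (- (1/2) *\<^sub>R One)) \<bullet> b) = 1"
    by (rule prod.neutral) (simp add: inner_diff_left inner_add_left o)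
  show "emeasure lborel (cube :: 'a set) \<le> 1"
    using emeasure_mono[OF 1, of lborel] prod by (simp add: emeasure_lborel_cbox o)
  show "1 \<le> emeasure lborel (cube :: 'a set)"
    using emeasure_mono[OF 2, of lborel] prod by (simp add: emeasure_lborel_box o)
qed

lemma prob_space_cubeM: "prob_space cubeM"
  by (rule prob_spaceI) (simp add: emeasure_restrict_space emeasure_cube)

lemma finite_measure_cubeM: "finite_measure cubeM"
  using prob_space_cubeM prob_space.finite_measure by blast

lemma sigma_finite_cubeM: "sigma_finite_measure cubeM"
  using finite_measure_cubeM by (rule finite_measure.axioms(1))

lemma borel_measurable_cubeM: "f \<in> borel_measurable borel \<Longrightarrow> f \<in> borel_measurable cubeM"
  by (rule measurable_restrict_space1) simp

lemma integrable_cubeM_bounded: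
  fixes f :: "'a::euclidean_space \<Rightarrow> 'b::{banach, second_countable_topology}"
  assumes "f \<in> borel_measurable borel" "\<And>x. x \<in> cube \<Longrightarrow> norm (f x) \<le> C"
  shows "integrable cubeM f"
proof -
  interpret finite_measure "cubeM :: 'a measure" by (rule finite_measure_cubeM)
  show ?thesis
    by (rule integrable_const_bound[where B=C])
       (use assms borel_measurable_cubeM in \<open>auto intro!: AE_I2\<close>)
qed

lemma integral_cubeM:
  fixes f :: "'a::euclidean_space \<Rightarrow> 'b::{banach, second_countable_topology}"
  shows "(LINT x|cubeM. f x) = (LINT x|lborel. indicator cube x *\<^sub>R f x)"
  by (rule integral_restrict_space) simp

lemma nn_integral_cubeM:
  "(\<integral>\<^sup>+x. f x \<partial>cubeM) = (\<integral>\<^sup>+x. f x * indicator cube x \<partial>lborel)"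
  by (rule nn_integral_restrict_space) simp

lemma norm_cube_le: "x \<in> cube \<Longrightarrow> norm (x :: 'a::euclidean_space) \<le> real DIM('a)"
proof -
  assume "x \<in> cube"
  then have "\<bar>x \<bullet> b\<bar> \<le> 1" if "b \<in> Basis" for b using that unfolding cube_def by force
  then have "(\<Sum>b\<in>Basis. \<bar>x \<bullet> b\<bar>) \<le> (\<Sum>b\<in>(Basis::'a set). 1)" by (rule sum_mono)
  with norm_le_l1[of x] show ?thesis by simp
qed

section \<open>Lattices\<close>

text \<open>Abstracts the embedding of the integer points, so that Fourier series and Poisson
  summation are proved once and used both for single frequencies and for pairs of
  frequencies.\<close>

locale lattice =
  fixes \<iota> :: "'i::{countable, ab_group_add} \<Rightarrow> 'a::euclidean_space"
  assumes inj: "inj \<iota>" and add: "\<iota> (k + l) = \<iota> k + \<iota> l"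
    and range: "range \<iota> = {x. \<forall>b\<in>Basis. x \<bullet> b \<in> \<int>}"
begin

lemma zero [simp]: "\<iota> 0 = 0"
  using add[of 0 0] by simp

lemma minus: "\<iota> (- k) = - \<iota> k"
  using add[of k "- k"] by (simp add: eq_neg_iff_add_eq_0 add.commute)

lemma diff: "\<iota> (k - l) = \<iota> k - \<iota> l"
  using add[of k "- l"] by (simp add: minus)

lemma eq_iff: "\<iota> k = \<iota> l \<longleftrightarrow> k = l"
  using inj by (auto simp: inj_def)

lemma inner_Ints: "b \<in> Basis \<Longrightarrow> \<iota> k \<bullet> b \<in> \<int>"
  using range by blast

lemma inner_inner_Ints: "\<iota> k \<bullet> \<iota> l \<in> \<int>"
  by (subst euclidean_inner) (intro Ints_sum Ints_mult inner_Ints)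

lemma ech_inner [simp]: "ech (\<iota> k \<bullet> \<iota> l) = 1" "ech (- (\<iota> k \<bullet> \<iota> l)) = 1"
  by (simp_all add: ech_Ints inner_inner_Ints)

lemma Basis_in_range: "b \<in> Basis \<Longrightarrow> b \<in> range \<iota>"
  unfolding range by (auto simp: inner_Basis)

text \<open>Existence is rounding: subtracting the ceiling of t - 1/2 from a coordinate t lands in
  (-1/2, 1/2]. Uniqueness holds because two integers at distance less than 1 are equal.\<close>

lemma ex1_cube: "\<exists>!k. x + \<iota> k \<in> cube"
proof
  define y where "y = (\<Sum>b\<in>Basis. - real_of_int \<lceil>x \<bullet> b - 1/2\<rceil> *\<^sub>R b)"
  have yb: "y \<bullet> b = - real_of_int \<lceil>x \<bullet> b - 1/2\<rceil>" if "b \<in> Basis" for b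
    unfolding y_def by (rule inner_sum_left_Basis[OF that])
  then have "y \<in> range \<iota>" unfolding range by simp
  then obtain k where k: "\<iota> k = y" by force
  have *: "- 1/2 < r - real_of_int \<lceil>r - 1/2\<rceil> \<and> r - real_of_int \<lceil>r - 1/2\<rceil> \<le> 1/2" for r :: real by linarith
  have "x + y \<in> cube" using *[of "x \<bullet> _"] yb by (simp add: cube_def inner_add_left)
  then show "x + \<iota> (SOME k. x + \<iota> k \<in> cube) \<in> cube" using k by (metis someI)
  fix l assume l: "x + \<iota> l \<in> cube"
  define m where "m = (SOME k. x + \<iota> k \<in> cube)"
  have m: "x + \<iota> m \<in> cube" unfolding m_def using k \<open>x + y \<in> cube\<close> by (metis someI)
  have "\<iota> l = \<iota> m"
  proof (rule euclidean_eqI)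
    fix b :: 'a assume b: "b \<in> Basis"
    have "\<bar>\<iota> l \<bullet> b - \<iota> m \<bullet> b\<bar> < 1"
      using l m b unfolding cube_def by (force simp: inner_add_left)
    moreover have "\<iota> l \<bullet> b - \<iota> m \<bullet> b \<in> \<int>" by (intro Ints_diff inner_Ints b)
    ultimately show "\<iota> l \<bullet> b = \<iota> m \<bullet> b" using Ints_nonzero_abs_less1 by fastforce
  qed
  then show "l = (SOME k. x + \<iota> k \<in> cube)" unfolding m_def[symmetric] by (simp add: eq_iff)
qed

lemma sum_indicator_cube:
  fixes c :: "'b::{banach, second_countable_topology}"
  shows "(LINT k|count_space UNIV. indicator cube (x + \<iota> k) *\<^sub>R c) = c"
proof -
  obtain k0 where k0: "\<And>k. x + \<iota> k \<in> cube \<longleftrightarrow> k = k0" using ex1_cube[of x] by metis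
  have "(\<lambda>k. indicator cube (x + \<iota> k) *\<^sub>R c) = (\<lambda>k. if k = k0 then c else 0)"
    by (auto simp: indicator_def k0)
  then show ?thesis using LINT_count_space_single[of k0 c] by (simp only:)
qed

lemma nn_sum_indicator_cube: "(\<integral>\<^sup>+k. indicator cube (x + \<iota> k) * c \<partial>count_space UNIV) = c"
proof -
  obtain k0 where k0: "\<And>k. x + \<iota> k \<in> cube \<longleftrightarrow> k = k0" using ex1_cube[of x] by metis
  have "(\<integral>\<^sup>+k. indicator cube (x + \<iota> k) * c \<partial>count_space UNIV) = (\<integral>\<^sup>+k. c * indicator {k0} k \<partial>count_space UNIV)"
    by (intro nn_integral_cong) (auto simp: indicator_def k0)
  also have "\<dots> = c" by (simp add: nn_integral_cmult_indicator)
  finally show ?thesis .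
qed

lemma bij_minus: "bij_betw (\<lambda>k::'i. l - k) UNIV UNIV"
  by (rule bij_betwI[of _ _ _ "\<lambda>k. l - k"]) auto

lemma bij_plus: "bij_betw (\<lambda>k::'i. k + l) UNIV UNIV"
  by (rule bij_betwI[of _ _ _ "\<lambda>k. k - l"]) auto

lemma sum_shift:
  fixes f :: "'i \<Rightarrow> 'b::{banach, second_countable_topology}"
  shows "(LINT k|count_space UNIV. f (k + l)) = (LINT k|count_space UNIV. f k)"
  by (rule integral_bij_count_space[OF bij_plus])

lemma sum_minus:
  fixes f :: "'i \<Rightarrow> 'b::{banach, second_countable_topology}"
  shows "(LINT k|count_space UNIV. f (l - k)) = (LINT k|count_space UNIV. f k)"
  by (rule integral_bij_count_space[OF bij_minus])

text \<open>The indicators of the translated cubes sum to 1 at every point. Insert this sum,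
  exchange it with the integral, translate each cube to the origin and reflect the index.\<close>

lemma nn_unfold:
  assumes [measurable]: "h \<in> borel_measurable borel"
  shows "(\<integral>\<^sup>+x. h x \<partial>lborel) = (\<integral>\<^sup>+k. (\<integral>\<^sup>+x. h (x + \<iota> k) \<partial>cubeM) \<partial>count_space UNIV)"
proof -
  have "(\<integral>\<^sup>+x. h x \<partial>lborel) = (\<integral>\<^sup>+x. (\<integral>\<^sup>+k. indicator cube (x + \<iota> k) * h x \<partial>count_space UNIV) \<partial>lborel)"
    by (simp add: nn_sum_indicator_cube)
  also have "\<dots> = (\<integral>\<^sup>+k. (\<integral>\<^sup>+x. indicator cube (x + \<iota> k) * h x \<partial>lborel) \<partial>count_space UNIV)"
    by (rule nn_integral_count_space_nn_integral) auto
  also have "\<dots> = (\<integral>\<^sup>+k. (\<integral>\<^sup>+x. h (x + - \<iota> k) * indicator cube x \<partial>lborel) \<partial>count_space UNIV)"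
  proof (rule nn_integral_cong)
    fix k
    have "(\<integral>\<^sup>+x. indicator cube (x + \<iota> k) * h x \<partial>lborel) = (\<integral>\<^sup>+x. indicator cube (x + - \<iota> k + \<iota> k) * h (x + - \<iota> k) \<partial>lborel)"
      by (rule lborel_nn_integral_translate[symmetric, where h = "\<lambda>x. indicator cube (x + \<iota> k) * h x"]) measurable
    then show "(\<integral>\<^sup>+x. indicator cube (x + \<iota> k) * h x \<partial>lborel) = (\<integral>\<^sup>+x. h (x + - \<iota> k) * indicator cube x \<partial>lborel)"
      by (simp add: mult.commute)
  qed
  \<comment> \<open>The reflected index is written \<open>0 - k\<close> so that it matches the
    bijection \<open>bij_minus\<close>.\<close>
  also have "\<dots> = (\<integral>\<^sup>+k. (\<integral>\<^sup>+x. h (x + \<iota> (0 - k)) \<partial>cubeM) \<partial>count_space UNIV)"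
    by (simp add: nn_integral_cubeM minus)
  also have "\<dots> = (\<integral>\<^sup>+k. (\<integral>\<^sup>+x. h (x + \<iota> k) \<partial>cubeM) \<partial>count_space UNIV)"
    by (rule nn_integral_bij_count_space[OF bij_minus])
  finally show ?thesis .
qed

text \<open>The same argument for Bochner integrals; \<open>nn_unfold\<close> then justifies moving
  the lattice sum inside the integral over the cube, where it is the periodization of
  \<open>h\<close>.\<close>

lemma unfold:
  fixes h :: "'a \<Rightarrow> 'b::{banach, second_countable_topology}"
  assumes h: "integrable lborel h"
  shows "(LINT x|lborel. h x) = (LINT x|cubeM. (LINT k|count_space UNIV. h (x + \<iota> k)))"
proof -
  have [measurable]: "h \<in> borel_measurable borel" using h by auto
  interpret finite_measure "cubeM :: 'a measure" by (rule finite_measure_cubeM)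
  have fin: "(\<integral>\<^sup>+x. ennreal (norm (h x)) \<partial>lborel) < \<infinity>" using h unfolding integrable_iff_bounded by blast
  have "(LINT x|lborel. h x) = (LINT x|lborel. (LINT k|count_space UNIV. indicator cube (x + \<iota> k) *\<^sub>R h x))"
    by (simp add: sum_indicator_cube)
  also have "\<dots> = (LINT k|count_space UNIV. (LINT x|lborel. indicator cube (x + \<iota> k) *\<^sub>R h x))"
  proof (rule integral_sum_swap)
    have "(\<integral>\<^sup>+k. (\<integral>\<^sup>+x. ennreal (norm (indicator cube (x + \<iota> k) *\<^sub>R h x)) \<partial>lborel) \<partial>count_space UNIV)
      = (\<integral>\<^sup>+k. (\<integral>\<^sup>+x. indicator cube (x + \<iota> k) * ennreal (norm (h x)) \<partial>lborel) \<partial>count_space UNIV)"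
      by (intro nn_integral_cong) (auto simp: indicator_def)
    also have "\<dots> = (\<integral>\<^sup>+x. (\<integral>\<^sup>+k. indicator cube (x + \<iota> k) * ennreal (norm (h x)) \<partial>count_space UNIV) \<partial>lborel)"
      by (rule nn_integral_count_space_nn_integral[symmetric]) auto
    also have "\<dots> < \<infinity>" using fin by (simp add: nn_sum_indicator_cube)
    finally show "(\<integral>\<^sup>+k. (\<integral>\<^sup>+x. ennreal (norm (indicator cube (x + \<iota> k) *\<^sub>R h x)) \<partial>lborel) \<partial>count_space UNIV) < \<infinity>" .
  qed (auto simp: sigma_finite_lborel)
  also have "\<dots> = (LINT k|count_space UNIV. (LINT x|lborel. indicator cube x *\<^sub>R h (x + \<iota> (0 - k))))"
  proof (rule Bochner_Integration.integral_cong[OF refl])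
    fix k
    have "(LINT x|lborel. indicator cube (x + \<iota> k) *\<^sub>R h x) = (LINT x|lborel. indicator cube (x + - \<iota> k + \<iota> k) *\<^sub>R h (x + - \<iota> k))"
      by (rule lborel_integral_translate[symmetric, where h = "\<lambda>x. indicator cube (x + \<iota> k) *\<^sub>R h x"]) measurable
    then show "(LINT x|lborel. indicator cube (x + \<iota> k) *\<^sub>R h x) = (LINT x|lborel. indicator cube x *\<^sub>R h (x + \<iota> (0 - k)))"
      by (simp add: minus)
  qed
  also have "\<dots> = (LINT k|count_space UNIV. (LINT x|lborel. indicator cube x *\<^sub>R h (x + \<iota> k)))"
    by (rule sum_minus)
  finally have *: "(LINT x|lborel. h x) = (LINT k|count_space UNIV. (LINT x|cubeM. h (x + \<iota> k)))"
    by (simp add: integral_cubeM)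
  have "(LINT x|cubeM. (LINT k|count_space UNIV. h (x + \<iota> k))) = (LINT k|count_space UNIV. (LINT x|cubeM. h (x + \<iota> k)))"
  proof (rule integral_sum_swap)
    show "sigma_finite_measure cubeM" by (rule sigma_finite_cubeM)
    show "(\<lambda>x. h (x + \<iota> k)) \<in> borel_measurable cubeM" for k
      by (intro borel_measurable_cubeM) auto
    show "(\<integral>\<^sup>+k. (\<integral>\<^sup>+x. ennreal (norm (h (x + \<iota> k))) \<partial>cubeM) \<partial>count_space UNIV) < \<infinity>"
      using fin nn_unfold[of "\<lambda>x. ennreal (norm (h x))"] by simp
  qed
  with * show "(LINT x|lborel. h x) = (LINT x|cubeM. (LINT k|count_space UNIV. h (x + \<iota> k)))" by simp
qed

text \<open>A sum compared with an integral: Peetre's inequality replaces the value at a lattice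
  point by values on the cube around it, the cube has measure 1, and \<open>nn_unfold\<close>
  reassembles the integral over the whole space.\<close>

lemma integrable_dec_lattice:
  assumes "2 * DIM('a) \<le> N"
  shows "integrable (count_space UNIV) (\<lambda>k. dec (\<iota> k) ^ N)"
proof (rule integrableI_bounded)
  interpret prob_space "cubeM :: 'a measure" by (rule prob_space_cubeM)
  define K where "K = (1 + real DIM('a)) ^ N"
  have le: "dec (\<iota> k) ^ N \<le> K * dec (x + \<iota> k) ^ N" if "x \<in> cube" for x k
  proof -
    have "dec (\<iota> k) ^ N \<le> (1 + norm x) ^ N * dec (x + \<iota> k) ^ N"
      using dec_shift_power[of "\<iota> k" N x] by (simp add: add.commute)
    also have "\<dots> \<le> K * dec (x + \<iota> k) ^ N"
      unfolding K_def using norm_cube_le[OF that] by (intro mult_right_mono power_mono) auto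
    finally show ?thesis .
  qed
  have "(\<integral>\<^sup>+k. ennreal (norm (dec (\<iota> k) ^ N)) \<partial>count_space UNIV)
      = (\<integral>\<^sup>+k. (\<integral>\<^sup>+x. ennreal (dec (\<iota> k) ^ N) \<partial>(cubeM :: 'a measure)) \<partial>count_space UNIV)"
    using emeasure_space_1 by simp
  also have "\<dots> \<le> (\<integral>\<^sup>+k. (\<integral>\<^sup>+x. ennreal (K * dec (x + \<iota> k) ^ N) \<partial>cubeM) \<partial>count_space UNIV)"
    by (intro nn_integral_mono ennreal_leI le) auto
  also have "\<dots> = (\<integral>\<^sup>+x. ennreal (K * dec (x::'a) ^ N) \<partial>lborel)"
    by (rule nn_unfold[symmetric]) measurable
  also have "\<dots> < \<infinity>"
  proof -
    have "integrable lborel (\<lambda>x::'a. K * dec x ^ N)" using integrable_dec_power[OF assms] by simp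
    then show ?thesis unfolding integrable_iff_bounded by (simp add: K_def)
  qed
  finally show "(\<integral>\<^sup>+k. ennreal (norm (dec (\<iota> k) ^ N)) \<partial>count_space UNIV) < \<infinity>" .
qed auto

text \<open>The translated cube tiles the space as well: unfolding the integral of \<open>G\<close>
  over it, the periodic \<open>G\<close> factors out of the lattice sum and the indicators sum to
  1.\<close>

lemma torus_translate:
  fixes G :: "'a \<Rightarrow> complex"
  assumes [measurable]: "G \<in> borel_measurable borel" and C: "\<And>x. norm (G x) \<le> C"
    and per: "\<And>k x. G (x + \<iota> k) = G x"
  shows "(LINT x|cubeM. G (x + s)) = (LINT x|cubeM. G x)"
proof -
  define h where "h x = indicator cube (x - s) *\<^sub>R G x" for x
  have [measurable]: "h \<in> borel_measurable borel" unfolding h_def by measurable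
  have "integrable lborel h"
  proof (rule integrableI_bounded)
    have "(\<integral>\<^sup>+x. ennreal (norm (h x)) \<partial>lborel) \<le> (\<integral>\<^sup>+x. ennreal C * indicator cube ((x::'a) + (- s)) \<partial>lborel)"
      using C by (intro nn_integral_mono) (auto simp: h_def indicator_def intro: ennreal_leI)
    also have "\<dots> = (\<integral>\<^sup>+x. ennreal C * indicator cube (x::'a) \<partial>lborel)"
      by (rule lborel_nn_integral_translate[where h = "\<lambda>x. ennreal C * indicator cube (x::'a)"]) measurable
    also have "\<dots> < \<infinity>" by (simp add: nn_integral_cmult_indicator emeasure_cube)
    finally show "(\<integral>\<^sup>+x. ennreal (norm (h x)) \<partial>lborel) < \<infinity>" .
  qed simp
  have "(LINT x|cubeM. G (x + s)) = (LINT x|lborel. h (x + s))"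
    by (simp add: integral_cubeM h_def)
  also have "\<dots> = (LINT x|lborel. h x)" by (rule lborel_integral_translate) measurable
  also have "\<dots> = (LINT x|cubeM. (LINT k|count_space UNIV. h (x + \<iota> k)))" by (rule unfold) fact
  also have "\<dots> = (LINT x|cubeM. (LINT k|count_space UNIV. indicator cube ((x - s) + \<iota> k) *\<^sub>R G x))"
    by (simp add: h_def per algebra_simps)
  also have "\<dots> = (LINT x|cubeM. G x)" by (simp only: sum_indicator_cube)
  finally show ?thesis .
qed

end

section \<open>Fourier series\<close>

lemma continuous_on_integral_param:
  fixes f :: "'a::euclidean_space \<Rightarrow> 't \<Rightarrow> 'b::{banach, second_countable_topology}"
  assumes "\<And>t. continuous_on UNIV (\<lambda>x. f x t)" "\<And>x. f x \<in> borel_measurable M" "integrable M B"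
    "\<And>x t. norm (f x t) \<le> B t"
  shows "continuous_on UNIV (\<lambda>x. LINT t|M. f x t)"
  unfolding continuous_on_sequentially
proof (intro ballI allI impI)
  fix X x assume "(\<forall>n. X n \<in> (UNIV::'a set)) \<and> X \<longlonglongrightarrow> x"
  then have X: "X \<longlonglongrightarrow> x" by simp
  have "(\<lambda>n. LINT t|M. f (X n) t) \<longlonglongrightarrow> (LINT t|M. f x t)"
  proof (rule integral_dominated_convergence[where w = B])
    show "AE t in M. (\<lambda>n. f (X n) t) \<longlonglongrightarrow> f x t"
      using assms(1) X by (intro AE_I2) (auto simp: continuous_on_eq_continuous_at intro: isCont_tendsto_compose)
  qed (use assms in auto)
  then show "((\<lambda>x. LINT t|M. f x t) \<circ> X) \<longlonglongrightarrow> (LINT t|M. f x t)" by (simp add: o_def)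
qed

lemma ech_half: "ech (1/2) = - 1"
  by (simp add: ech_def)

lemma cos_ech: "complex_of_real ((1 + cos (2 * pi * t)) / 2) = 1/2 + ech t / 4 + ech (- t) / 4"
  by (simp add: ech_def complex_eq_iff field_simps)

lemma ech_cancel_left: "ech (- s) * (ech (a + s) * z) = ech a * z"
proof -
  have "ech a = ech (- s) * ech (a + s)" using ech_add[of "- s" "a + s"] by simp
  then show ?thesis by simp
qed

lemma bounded_on_cube:
  fixes d :: "'a::euclidean_space \<Rightarrow> 'b::real_normed_vector"
  assumes "continuous_on UNIV d"
  shows "\<exists>M. \<forall>x\<in>cube. norm (d x) \<le> M"
proof -
  have "bounded (d ` cball 0 (real DIM('a)))"
    by (intro compact_imp_bounded compact_continuous_image continuous_on_subset[OF assms]) auto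
  then obtain M where M: "\<And>y. y \<in> d ` cball 0 (real DIM('a)) \<Longrightarrow> norm y \<le> M"
    unfolding bounded_iff by blast
  have "norm (d x) \<le> M" if "x \<in> cube" for x
    by (rule M, rule imageI) (use norm_cube_le[OF that] in simp)
  then show ?thesis by blast
qed

text \<open>Each factor is the squared cosine of pi times the coordinate. The product is a
  nonnegative trigonometric polynomial with values at most 1 that attains 1 on the cube only at the
  origin, so its powers act as test functions in the span of the lattice characters.\<close>

definition peak :: "'a::euclidean_space \<Rightarrow> real" where
  "peak x = (\<Prod>b\<in>Basis. (1 + cos (2 * pi * (x \<bullet> b))) / 2)"

lemma half_cos_bounds:
  fixes t :: real
  shows "0 \<le> (1 + cos t) / 2" "(1 + cos t) / 2 \<le> 1"
proof -
  have "0 \<le> 1 + cos t" using cos_ge_minus_one[of t] by linarith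
  then show "0 \<le> (1 + cos t) / 2" by simp
  show "(1 + cos t) / 2 \<le> 1" using cos_le_one[of t] by simp
qed

lemma peak_nonneg: "0 \<le> peak x"
  unfolding peak_def by (intro prod_nonneg half_cos_bounds)

lemma peak_0: "peak 0 = 1"
  by (simp add: peak_def)

lemma continuous_peak: "continuous_on S peak"
  unfolding peak_def by (intro continuous_intros) auto

lemma peak_le:
  assumes x: "x \<in> cube" and b: "b \<in> Basis" and \<delta>: "0 \<le> \<delta>" "\<delta> \<le> \<bar>x \<bullet> b\<bar>"
  shows "peak x \<le> (1 + cos (2 * pi * \<delta>)) / 2"
proof -
  have "peak x = (1 + cos (2 * pi * (x \<bullet> b))) / 2 * (\<Prod>b\<in>Basis - {b}. (1 + cos (2 * pi * (x \<bullet> b))) / 2)"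
    unfolding peak_def using b by (subst prod.remove[of _ b]) auto
  also have "\<dots> \<le> (1 + cos (2 * pi * (x \<bullet> b))) / 2 * 1"
    by (intro mult_left_mono prod_le_1) (use half_cos_bounds in auto)
  also have "cos (2 * pi * (x \<bullet> b)) = cos (2 * pi * \<bar>x \<bullet> b\<bar>)"
    by (cases "0 \<le> x \<bullet> b") auto
  also have "\<bar>x \<bullet> b\<bar> \<le> 1/2" using x b unfolding cube_def by force
  then have "cos (2 * pi * \<bar>x \<bullet> b\<bar>) \<le> cos (2 * pi * \<delta>)"
    using \<delta> by (intro cos_monotone_0_pi_le) auto
  finally show ?thesis by simp
qed

section \<open>Uniqueness of Fourier coefficients and absolutely convergent Fourier series\<close>

context lattice
begin

text \<open>A translation by half a period along \<open>\<iota> \<nu>\<close> changes the sign of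
  the character but not its integral.\<close>

lemma orthogonality: "(LINT x|cubeM. ech (\<iota> \<nu> \<bullet> x)) = (if \<nu> = 0 then 1 else 0)"
proof (cases "\<nu> = 0")
  case True
  interpret prob_space "cubeM :: 'a measure" by (rule prob_space_cubeM)
  show ?thesis using True prob_space by simp
next
  case False
  then have "\<iota> \<nu> \<noteq> 0" using eq_iff[of \<nu> 0] by simp
  define s where "s = (1 / (2 * (\<iota> \<nu> \<bullet> \<iota> \<nu>))) *\<^sub>R \<iota> \<nu>"
  have s: "\<iota> \<nu> \<bullet> s = 1/2" using \<open>\<iota> \<nu> \<noteq> 0\<close> by (simp add: s_def)
  have "(LINT x|cubeM. ech (\<iota> \<nu> \<bullet> (x + s))) = (LINT x|cubeM. ech (\<iota> \<nu> \<bullet> x))"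
    by (rule torus_translate[where C=1]) (auto simp: inner_add_right ech_add)
  moreover have "ech (\<iota> \<nu> \<bullet> (x + s)) = - ech (\<iota> \<nu> \<bullet> x)" for x
    unfolding inner_add_right s ech_add ech_half by simp
  ultimately have "- (LINT x|cubeM. ech (\<iota> \<nu> \<bullet> x)) = (LINT x|cubeM. ech (\<iota> \<nu> \<bullet> x))" by simp
  then show ?thesis using False by simp
qed

text \<open>Multiplication by (1 + cos)/2 mixes three neighbouring frequencies, so vanishing of all
  coefficients is inherited while vanishing of a single one is not. Hence the invariant
  \<open>V\<close> carries all frequencies, and frequency 0 is read off at the end.\<close>

lemma coeffs_zero_peak:
  fixes d :: "'a \<Rightarrow> complex"
  assumes [measurable]: "d \<in> borel_measurable borel" and M: "\<And>x. x \<in> cube \<Longrightarrow> norm (d x) \<le> M"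
    and d0: "\<And>\<nu>. (LINT x|cubeM. ech (\<iota> \<nu> \<bullet> x) * d x) = 0"
  shows "(LINT x|cubeM. complex_of_real (peak x ^ N) * d x) = 0"
proof -
  define V where "V \<phi> \<longleftrightarrow> \<phi> \<in> borel_measurable borel \<and> (\<forall>x::'a. norm (\<phi> x) \<le> (1::real)) \<and>
    (\<forall>\<nu>. (LINT x|cubeM. ech (\<iota> \<nu> \<bullet> x) * (complex_of_real (\<phi> x) * d x)) = 0)" for \<phi>
  have step: "V (\<lambda>x. (1 + cos (2 * pi * (x \<bullet> b))) / 2 * \<phi> x)" if V: "V \<phi>" and b: "b \<in> Basis" for \<phi> b
    unfolding V_def
  proof (intro conjI allI)
    have [measurable]: "\<phi> \<in> borel_measurable borel" using V by (simp add: V_def)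
    have \<phi>1: "norm (\<phi> x) \<le> 1" for x using V by (simp add: V_def)
    show "(\<lambda>x. (1 + cos (2 * pi * (x \<bullet> b))) / 2 * \<phi> x) \<in> borel_measurable borel" by measurable
    show "norm ((1 + cos (2 * pi * (x \<bullet> b))) / 2 * \<phi> x) \<le> 1" for x
      using mult_mono[OF half_cos_bounds(2)[of "2 * pi * (x \<bullet> b)"] \<phi>1[of x]] half_cos_bounds(1)[of "2 * pi * (x \<bullet> b)"]
      unfolding norm_mult by (simp only: real_norm_def abs_of_nonneg) simp
    fix \<nu>
    obtain \<beta> where \<beta>: "b = \<iota> \<beta>" using Basis_in_range[OF b] by auto
    define I where "I \<nu> = (\<lambda>x. ech (\<iota> \<nu> \<bullet> x) * (complex_of_real (\<phi> x) * d x))" for \<nu>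
    have I0: "(LINT x|cubeM. I \<nu> x) = 0" for \<nu> using V by (simp add: V_def I_def)
    have int: "integrable cubeM (I \<nu>)" for \<nu>
    proof (rule integrable_cubeM_bounded[where C = M])
      fix x :: 'a assume "x \<in> cube"
      from mult_mono[OF \<phi>1[of x] M[OF this]] show "norm (I \<nu> x) \<le> M" by (simp add: I_def norm_mult)
    qed (simp add: I_def)
    have "ech (\<iota> \<nu> \<bullet> x) * (complex_of_real ((1 + cos (2 * pi * (x \<bullet> b))) / 2 * \<phi> x) * d x)
       = (1/2) * I \<nu> x + (1/4) * I (\<nu> + \<beta>) x + (1/4) * I (\<nu> - \<beta>) x" for x
    proof -
      have "ech (\<iota> (\<nu> + \<beta>) \<bullet> x) = ech (\<iota> \<nu> \<bullet> x) * ech (x \<bullet> b)"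
        "ech (\<iota> (\<nu> - \<beta>) \<bullet> x) = ech (\<iota> \<nu> \<bullet> x) * ech (- (x \<bullet> b))"
        unfolding add diff inner_add_left inner_diff_left \<beta> ech_add ech_diff inner_commute[of x] by simp_all
      then show ?thesis unfolding of_real_mult cos_ech I_def by (simp add: algebra_simps)
    qed
    then have "(LINT x|cubeM. ech (\<iota> \<nu> \<bullet> x) * (complex_of_real ((1 + cos (2 * pi * (x \<bullet> b))) / 2 * \<phi> x) * d x))
      = (LINT x|cubeM. (1/2) * I \<nu> x + (1/4) * I (\<nu> + \<beta>) x + (1/4) * I (\<nu> - \<beta>) x)" by (simp only:)
    also have "\<dots> = 0"
      by (simp only: Bochner_Integration.integral_add Bochner_Integration.integrable_add integrable_mult_right int
          integral_mult_right_zero I0 mult_zero_right add_0)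
    finally show "(LINT x|cubeM. ech (\<iota> \<nu> \<bullet> x) * (complex_of_real ((1 + cos (2 * pi * (x \<bullet> b))) / 2 * \<phi> x) * d x)) = 0" .
  qed
  have peak_step: "V (\<lambda>x. (\<Prod>b\<in>A. (1 + cos (2 * pi * (x \<bullet> b))) / 2) * \<phi> x)" if "V \<phi>" "finite A" "A \<subseteq> Basis" for \<phi> A
    using that(2,3)
  proof (induction A)
    case (insert b A)
    then have "V (\<lambda>x. (1 + cos (2 * pi * (x \<bullet> b))) / 2 * ((\<Prod>b\<in>A. (1 + cos (2 * pi * (x \<bullet> b))) / 2) * \<phi> x))"
      by (intro step) auto
    then show ?case using insert by (simp add: mult.assoc)
  qed (use that in simp)
  have "V (\<lambda>x. peak x ^ N)"
  proof (induction N)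
    case 0
    show ?case unfolding V_def using d0 by simp
  next
    case (Suc N)
    from peak_step[OF this, of Basis] show ?case by (simp add: peak_def)
  qed
  then have "(LINT x|cubeM. ech (\<iota> 0 \<bullet> x) * (complex_of_real (peak x ^ N) * d x)) = 0"
    unfolding V_def by blast
  then show ?thesis by simp
qed

text \<open>The powers of the trigonometric polynomial \<open>peak\<close> concentrate at the origin.\<close>

lemma coeffs_zero_at_0:
  fixes d :: "'a \<Rightarrow> complex"
  assumes cont: "continuous_on UNIV d"
    and d0: "\<And>\<nu>. (LINT x|cubeM. ech (\<iota> \<nu> \<bullet> x) * d x) = 0"
  shows "d 0 = 0"
proof (rule ccontr)
  assume nz: "d 0 \<noteq> 0"
  interpret prob_space "cubeM :: 'a measure" by (rule prob_space_cubeM)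
  have [measurable]: "d \<in> borel_measurable borel" by (rule borel_measurable_continuous_onI[OF cont])
  have [measurable]: "(peak :: 'a \<Rightarrow> real) \<in> borel_measurable borel"
    by (rule borel_measurable_continuous_onI[OF continuous_peak])
  obtain M0 where M0: "\<And>x. x \<in> cube \<Longrightarrow> norm (d x) \<le> M0"
    using bounded_on_cube[OF cont] by blast
  \<comment> \<open>Dividing by \<open>d 0\<close> and taking real parts gives a real function with
    value 1 at the origin whose integrals against all powers of \<open>peak\<close> still
    vanish.\<close>
  define g where "g x = Re (d x / d 0)" for x
  define M where "M = \<bar>M0\<bar> / norm (d 0)"
  have gM: "\<bar>g x\<bar> \<le> M" if "x \<in> cube" for x
  proof -
    have "\<bar>g x\<bar> \<le> norm (d x / d 0)" unfolding g_def by (rule abs_Re_le_cmod)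
    also have "\<dots> \<le> M" using M0[OF that] by (simp add: M_def norm_divide divide_right_mono)
    finally show ?thesis .
  qed
  have contg: "continuous_on UNIV g" unfolding g_def by (intro continuous_intros cont) (use nz in auto)
  have [measurable]: "g \<in> borel_measurable borel" by (rule borel_measurable_continuous_onI[OF contg])
  have g0: "(LINT x|cubeM. peak x ^ N * g x) = 0" for N
  proof -
    have "(LINT x|cubeM. complex_of_real (peak x ^ N) * d x) = 0"
      by (rule coeffs_zero_peak) (use M0 d0 in auto)
    then have "(LINT x|cubeM. (complex_of_real (peak x ^ N) * d x) * inverse (d 0)) = 0"
      by (simp only: integral_mult_left_zero mult_zero_left)
    moreover have int: "integrable cubeM (\<lambda>x. (complex_of_real (peak x ^ N) * d x) * inverse (d 0))"
    proof (rule integrable_cubeM_bounded[where C = "1 * M0 * norm (inverse (d 0))"])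
      fix x :: 'a assume x: "x \<in> cube"
      have "peak x \<le> 1" using peak_le[OF x SOME_Basis, of 0] by simp
      then have "\<bar>peak x ^ N\<bar> \<le> 1" using peak_nonneg[of x] by (simp add: power_le_one power_abs)
      then show "norm ((complex_of_real (peak x ^ N) * d x) * inverse (d 0)) \<le> 1 * M0 * norm (inverse (d 0))"
        unfolding norm_mult norm_of_real
        by (intro mult_mono M0 x) (use order_trans[OF norm_ge_zero M0[OF x]] in auto)
    qed measurable
    ultimately have "(LINT x|cubeM. Re ((complex_of_real (peak x ^ N) * d x) * inverse (d 0))) = 0"
      by (simp only: integral_Re[OF int] zero_complex.sel)
    moreover have "Re ((complex_of_real (peak x ^ N) * d x) * inverse (d 0)) = peak x ^ N * g x" for x
    proof -
      have "(complex_of_real (peak x ^ N) * d x) * inverse (d 0) = complex_of_real (peak x ^ N) * (d x / d 0)"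
        by (simp add: divide_inverse)
      then show ?thesis unfolding g_def by (simp only: times_complex.sel Re_complex_of_real Im_complex_of_real mult_zero_left diff_0_right)
    qed
    ultimately show ?thesis by simp
  qed
  have "isCont g 0" "isCont peak (0::'a)"
    using contg continuous_peak[of UNIV] by (auto simp: continuous_on_eq_continuous_at)
  have "g 0 = 1" using nz by (simp add: g_def)
  then obtain e where e: "e > 0" "\<And>x. norm x < e \<Longrightarrow> \<bar>g x - 1\<bar> < 1/2"
    using \<open>isCont g 0\<close>[unfolded continuous_at_eps_delta, rule_format, of "1/2"] by (auto simp: dist_real_def)
  define D where "D = real DIM('a)"
  have D: "D > 0" by (simp add: D_def)
  have norm_small: "norm x < r" if "\<And>b. b \<in> Basis \<Longrightarrow> \<bar>x \<bullet> b\<bar> < r / D" for x :: 'a and r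
  proof -
    have "(\<Sum>b\<in>Basis. \<bar>x \<bullet> b\<bar>) < (\<Sum>b\<in>(Basis::'a set). r / D)" by (rule sum_strict_mono) (use that in auto)
    with norm_le_l1[of x] D show ?thesis by (simp add: D_def)
  qed
  \<comment> \<open>Where all coordinates are below \<open>\<delta>\<close>, \<open>g\<close>
    exceeds 1/2. The cap 1/4 keeps such a box inside the cube and \<open>2 * pi * \<delta>\<close>
    in the range where the cosine decreases.\<close>
  define \<delta> where "\<delta> = min (e / D) (1/4)"
  have \<delta>: "0 < \<delta>" "\<delta> \<le> 1/4" using e D unfolding \<delta>_def by simp (rule min.cobounded2)
  define \<kappa> where "\<kappa> = (1 + cos (2 * pi * \<delta>)) / 2"
  have \<kappa>: "0 \<le> \<kappa>" "\<kappa> < 1"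
  proof -
    show "0 \<le> \<kappa>" unfolding \<kappa>_def by (rule half_cos_bounds)
    have "cos (2 * pi * \<delta>) < cos 0" by (rule cos_monotone_0_pi) (use \<delta> in auto)
    then show "\<kappa> < 1" by (simp add: \<kappa>_def)
  qed
  \<comment> \<open>On the cube \<open>peak\<close> is at most \<open>\<kappa>\<close> where some
    coordinate reaches \<open>\<delta>\<close>, and at least \<open>\<kappa>'\<close> on the smaller
    box \<open>U\<close>; the gap between these bounds yields the contradiction.\<close>
  define \<kappa>' where "\<kappa>' = (1 + \<kappa>) / 2"
  have \<kappa>': "\<kappa> < \<kappa>'" "\<kappa>' < 1" "0 < \<kappa>'" using \<kappa> by (auto simp: \<kappa>'_def)
  obtain e' where e': "e' > 0" "\<And>x::'a. norm x < e' \<Longrightarrow> \<bar>peak x - 1\<bar> < 1 - \<kappa>'"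
    using \<open>isCont peak (0::'a)\<close>[unfolded continuous_at_eps_delta peak_0, rule_format, of "1 - \<kappa>'"] \<kappa>'
    by (auto simp: dist_real_def)
  define \<delta>' where "\<delta>' = min \<delta> (e' / D)"
  have \<delta>': "0 < \<delta>'" using e' \<delta> D by (auto simp: \<delta>'_def)
  define U where "U = {x::'a. \<forall>b\<in>Basis. \<bar>x \<bullet> b\<bar> < \<delta>'}"
  have U_box: "U = box (- \<delta>' *\<^sub>R One) (\<delta>' *\<^sub>R One)"
  proof -
    have o: "(One :: 'a) \<bullet> b = 1" if "b \<in> Basis" for b using that by (simp add: inner_sum_left inner_Basis)
    have "\<bar>t\<bar> < \<delta>' \<longleftrightarrow> - \<delta>' < t \<and> t < \<delta>'" for t by linarith
    then show ?thesis by (simp add: U_def mem_box set_eq_iff o)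
  qed
  have [measurable]: "U \<in> sets borel" unfolding U_box by simp
  have U_cube: "U \<subseteq> cube" using \<delta> by (force simp: U_def cube_def \<delta>'_def)
  define v where "v = measure cubeM U"
  have v: "v > 0"
  proof -
    have "emeasure cubeM U = emeasure lborel U" using U_cube by (simp add: emeasure_restrict_space)
    also have "emeasure lborel U = ennreal (\<Prod>b\<in>(Basis::'a set). 2 * \<delta>')"
      unfolding U_box using \<delta>'
      by (subst emeasure_lborel_box) (auto simp: inner_diff_left inner_sum_left inner_Basis inner_add_left algebra_simps intro!: arg_cong[where f=ennreal])
    finally show ?thesis unfolding v_def measure_def using \<delta>' by simp
  qed
  have pw: "(1/2) * \<kappa>' ^ N * indicator U x - M * \<kappa> ^ N \<le> peak x ^ N * g x" if x: "x \<in> cube" for x N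
  proof (cases "\<forall>b\<in>Basis. \<bar>x \<bullet> b\<bar> < \<delta>")
    case True
    have M0: "0 \<le> M * \<kappa> ^ N" using \<kappa> by (simp add: M_def)
    have "norm x < e" by (rule norm_small) (use True in \<open>auto simp: \<delta>_def\<close>)
    then have g: "1/2 \<le> g x" using e(2)[of x] by linarith
    have "(1/2) * \<kappa>' ^ N * indicator U x \<le> peak x ^ N * g x"
    proof (cases "x \<in> U")
      case True
      then have "norm x < e'" by (intro norm_small) (auto simp: U_def \<delta>'_def)
      then have "\<kappa>' \<le> peak x" using e'(2)[of x] by linarith
      then have "\<kappa>' ^ N \<le> peak x ^ N" using \<kappa>' by (intro power_mono) auto
      then have "\<kappa>' ^ N * (1/2) \<le> peak x ^ N * g x" using g \<kappa>' peak_nonneg[of x] by (intro mult_mono) auto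
      then show ?thesis using True by simp
    qed (use g peak_nonneg[of x] in auto)
    then show ?thesis using M0 by linarith
  next
    case False
    then obtain b where b: "b \<in> Basis" "\<delta> \<le> \<bar>x \<bullet> b\<bar>" by force
    have "peak x \<le> \<kappa>" unfolding \<kappa>_def by (rule peak_le[OF x b(1) _ b(2)]) (use \<delta> in auto)
    then have "peak x ^ N \<le> \<kappa> ^ N" using peak_nonneg by (intro power_mono) auto
    then have "peak x ^ N * \<bar>g x\<bar> \<le> \<kappa> ^ N * M" using gM[OF x] \<kappa> by (intro mult_mono) auto
    moreover have "- (peak x ^ N * \<bar>g x\<bar>) \<le> peak x ^ N * g x"
      using mult_left_mono[of "- \<bar>g x\<bar>" "g x" "peak x ^ N"] peak_nonneg[of x] by simp
    moreover have "x \<notin> U" using False by (force simp: U_def \<delta>'_def)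
    ultimately show ?thesis by (simp add: mult.commute)
  qed
  \<comment> \<open>Integrating \<open>pw\<close>, whose right-hand side has integral 0. For large
    \<open>N\<close> the inequality fails, because the left side decays like powers of
    \<open>\<kappa>'\<close> and the right side like powers of the smaller
    \<open>\<kappa>\<close>.\<close>
  have main: "(1/2) * \<kappa>' ^ N * v \<le> M * \<kappa> ^ N" for N
  proof -
    have "(LINT x|cubeM. (1/2) * \<kappa>' ^ N * indicator U x - M * \<kappa> ^ N) \<le> (LINT x|cubeM. peak x ^ N * g x)"
    proof (rule integral_mono)
      show "integrable cubeM (\<lambda>x. (1/2) * \<kappa>' ^ N * indicator U x - M * \<kappa> ^ N)"
      proof (rule integrable_cubeM_bounded[where C = "(1/2) * \<kappa>' ^ N + M * \<kappa> ^ N"])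
        fix x :: 'a
        have "norm ((1/2) * \<kappa>' ^ N * indicator U x) \<le> (1/2) * \<kappa>' ^ N" "norm (M * \<kappa> ^ N) \<le> M * \<kappa> ^ N"
          using \<kappa> \<kappa>' by (auto simp: indicator_def M_def)
        then show "norm ((1/2) * \<kappa>' ^ N * indicator U x - M * \<kappa> ^ N) \<le> (1/2) * \<kappa>' ^ N + M * \<kappa> ^ N"
          by (rule order_trans[OF norm_triangle_ineq4 add_mono])
      qed measurable
      show "integrable cubeM (\<lambda>x. peak x ^ N * g x)"
      proof (rule integrable_cubeM_bounded[where C = "1 * M"])
        fix x :: 'a assume x: "x \<in> cube"
        have "peak x \<le> 1" using peak_le[OF x SOME_Basis, of 0] by simp
        then have "\<bar>peak x ^ N\<bar> \<le> 1" using peak_nonneg[of x] by (simp add: power_le_one power_abs)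
        then show "norm (peak x ^ N * g x) \<le> 1 * M" unfolding norm_mult by (intro mult_mono) (use gM[OF x] in auto)
      qed measurable
    qed (use pw in auto)
    also have "(LINT x|cubeM. (1/2) * \<kappa>' ^ N * indicator U x - M * \<kappa> ^ N) = (1/2) * \<kappa>' ^ N * v - M * \<kappa> ^ N"
    proof -
      have "U \<in> sets cubeM" using U_cube by (simp add: sets_restrict_space_iff)
      moreover have "prob cube = 1" using prob_space unfolding space_cubeM .
      ultimately show ?thesis
        by (subst Bochner_Integration.integral_diff)
           (auto simp: v_def less_top[symmetric] Int_absorb2[OF U_cube])
    qed
    finally show ?thesis unfolding g0 by simp
  qed
  have "(\<lambda>N. M * (\<kappa> / \<kappa>') ^ N) \<longlonglongrightarrow> M * 0"
    by (intro tendsto_mult_left LIMSEQ_power_zero) (use \<kappa> \<kappa>' in auto)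
  then have "\<forall>\<^sub>F N in sequentially. M * (\<kappa> / \<kappa>') ^ N < v / 2" using v by (intro order_tendstoD) auto
  then obtain N where "M * (\<kappa> / \<kappa>') ^ N < v / 2" by (auto simp: eventually_sequentially)
  with main[of N] \<kappa>' show False by (simp add: power_divide field_simps)
qed

text \<open>A translation multiplies each coefficient by a number of modulus 1, so the statement at
  the origin applies to the translate of \<open>d\<close> by \<open>s\<close>.\<close>

lemma coeffs_zero:
  fixes d :: "'a \<Rightarrow> complex"
  assumes cont: "continuous_on UNIV d" and per: "\<And>k x. d (x + \<iota> k) = d x"
    and d0: "\<And>\<nu>. (LINT x|cubeM. ech (\<iota> \<nu> \<bullet> x) * d x) = 0"
  shows "d s = 0"
proof -
  have [measurable]: "d \<in> borel_measurable borel" by (rule borel_measurable_continuous_onI[OF cont])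
  obtain M where M: "\<And>x. x \<in> cube \<Longrightarrow> norm (d x) \<le> M"
    using bounded_on_cube[OF cont] by blast
  have M': "norm (d x) \<le> M" for x
  proof -
    obtain k where "x + \<iota> k \<in> cube" using ex1_cube[of x] by blast
    from M[OF this] show ?thesis by (simp only: per)
  qed
  have "d (0 + s) = 0"
  proof (rule coeffs_zero_at_0)
    show "continuous_on UNIV (\<lambda>x. d (x + s))"
      by (intro continuous_on_compose2[OF cont] continuous_intros) auto
    fix \<nu>
    have "(LINT x|cubeM. ech (\<iota> \<nu> \<bullet> x) * d (x + s)) = (LINT x|cubeM. ech (- (\<iota> \<nu> \<bullet> s)) * (ech (\<iota> \<nu> \<bullet> (x + s)) * d (x + s)))"
      unfolding inner_add_right ech_cancel_left ..
    also have "\<dots> = ech (- (\<iota> \<nu> \<bullet> s)) * (LINT x|cubeM. ech (\<iota> \<nu> \<bullet> (x + s)) * d (x + s))"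
      by simp
    also have "(LINT x|cubeM. ech (\<iota> \<nu> \<bullet> (x + s)) * d (x + s)) = (LINT x|cubeM. ech (\<iota> \<nu> \<bullet> x) * d x)"
      by (rule torus_translate[where C=M]) (use M' in \<open>auto simp: norm_mult per inner_add_right ech_add\<close>)
    finally show "(LINT x|cubeM. ech (\<iota> \<nu> \<bullet> x) * d (x + s)) = 0" by (simp add: d0)
  qed
  then show ?thesis by simp
qed

text \<open>Absolute summability makes the series a continuous periodic function, and orthogonality
  shows that it has the coefficients of \<open>F\<close>; the difference vanishes by
  uniqueness.\<close>

theorem fourier_series:
  fixes F :: "'a \<Rightarrow> complex"
  assumes cont: "continuous_on UNIV F" and per: "\<And>k x. F (x + \<iota> k) = F x"
    and c: "\<And>\<nu>. c \<nu> = (LINT x|cubeM. ech (- (\<iota> \<nu> \<bullet> x)) * F x)"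
    and int: "integrable (count_space UNIV) c"
  shows "F x = (LINT \<nu>|count_space UNIV. c \<nu> * ech (\<iota> \<nu> \<bullet> x))"
proof -
  interpret prob_space "cubeM :: 'a measure" by (rule prob_space_cubeM)
  define S where "S x = (LINT \<nu>|count_space UNIV. c \<nu> * ech (\<iota> \<nu> \<bullet> x))" for x
  have contS: "continuous_on UNIV S" unfolding S_def
    by (rule continuous_on_integral_param[where B = "\<lambda>\<nu>. norm (c \<nu>)"])
       (use int in \<open>auto simp: norm_mult intro!: continuous_intros\<close>)
  have [measurable]: "F \<in> borel_measurable borel" by (rule borel_measurable_continuous_onI[OF cont])
  have [measurable]: "S \<in> borel_measurable borel" by (rule borel_measurable_continuous_onI[OF contS])
  have fin: "(\<integral>\<^sup>+\<nu>. ennreal (norm (c \<nu>)) \<partial>count_space UNIV) < \<infinity>" using int unfolding integrable_iff_bounded by blast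
  have "F x - S x = 0"
  proof (rule coeffs_zero)
    show "continuous_on UNIV (\<lambda>x. F x - S x)" by (intro continuous_intros cont contS)
    show "F (x + \<iota> k) - S (x + \<iota> k) = F x - S x" for k x
      by (simp add: per S_def inner_add_right ech_add)
    fix \<mu>
    have intd: "integrable cubeM (\<lambda>x. ech (\<iota> \<mu> \<bullet> x) * d x)" if d: "continuous_on UNIV d" for d :: "'a \<Rightarrow> complex"
    proof -
      obtain M where M: "\<And>x. x \<in> cube \<Longrightarrow> norm (d x) \<le> M" using bounded_on_cube[OF d] by blast
      have [measurable]: "d \<in> borel_measurable borel" by (rule borel_measurable_continuous_onI[OF d])
      show ?thesis by (rule integrable_cubeM_bounded[where C=M]) (use M in \<open>auto simp: norm_mult\<close>)
    qed
    have "(LINT x|cubeM. ech (\<iota> \<mu> \<bullet> x) * S x) = (LINT x|cubeM. (LINT \<nu>|count_space UNIV. c \<nu> * ech (\<iota> (\<nu> + \<mu>) \<bullet> x)))"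
    proof (rule Bochner_Integration.integral_cong[OF refl])
      fix x
      have "(LINT \<nu>|count_space UNIV. c \<nu> * ech (\<iota> (\<nu> + \<mu>) \<bullet> x)) = (LINT \<nu>|count_space UNIV. ech (\<iota> \<mu> \<bullet> x) * (c \<nu> * ech (\<iota> \<nu> \<bullet> x)))"
        by (simp add: add inner_add_left ech_add mult_ac)
      then show "ech (\<iota> \<mu> \<bullet> x) * S x = (LINT \<nu>|count_space UNIV. c \<nu> * ech (\<iota> (\<nu> + \<mu>) \<bullet> x))"
        by (simp add: S_def)
    qed
    also have "\<dots> = (LINT \<nu>|count_space UNIV. (LINT x|cubeM. c \<nu> * ech (\<iota> (\<nu> + \<mu>) \<bullet> x)))"
    proof (rule integral_sum_swap)
      show "(\<lambda>x. c \<nu> * ech (\<iota> (\<nu> + \<mu>) \<bullet> x)) \<in> borel_measurable cubeM" for \<nu>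
        by (intro borel_measurable_cubeM) measurable
      show "(\<integral>\<^sup>+\<nu>. (\<integral>\<^sup>+x. ennreal (norm (c \<nu> * ech (\<iota> (\<nu> + \<mu>) \<bullet> x))) \<partial>cubeM) \<partial>count_space UNIV) < \<infinity>"
        using fin emeasure_space_1 by (simp add: norm_mult)
    qed (rule sigma_finite_cubeM)
    \<comment> \<open>The tests use \<open>ech (\<iota> \<mu> \<bullet> x)\<close> while the
      coefficients use the conjugate characters, so the frequency \<open>- \<mu>\<close>
      survives.\<close>
    also have "\<dots> = (LINT \<nu>|count_space UNIV. (if \<nu> = - \<mu> then c (- \<mu>) else 0))"
      by (intro Bochner_Integration.integral_cong refl)
         (simp add: orthogonality flip: eq_neg_iff_add_eq_0)
    also have "\<dots> = c (- \<mu>)" by (rule LINT_count_space_single)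
    finally have "(LINT x|cubeM. ech (\<iota> \<mu> \<bullet> x) * S x) = c (- \<mu>)" .
    moreover have "(LINT x|cubeM. ech (\<iota> \<mu> \<bullet> x) * F x) = c (- \<mu>)"
      by (simp add: c minus)
    ultimately show "(LINT x|cubeM. ech (\<iota> \<mu> \<bullet> x) * (F x - S x)) = 0"
      unfolding right_diff_distrib using intd[OF cont] intd[OF contS] by (subst Bochner_Integration.integral_diff) auto
  qed
  then show ?thesis by (simp add: S_def)
qed

end

section \<open>Periodization, Poisson summation and Fourier inversion\<close>

context lattice
begin

definition periodize :: "('a \<Rightarrow> complex) \<Rightarrow> 'a \<Rightarrow> complex" where
  "periodize h x = (LINT k|count_space UNIV. h (x + \<iota> k))"

text \<open>Summable in \<open>k\<close> and uniform for \<open>x\<close> in a ball: the form of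
  majorant that differentiating a periodization under the sum requires.\<close>

lemma schwartz_lattice_bound:
  assumes h: "schwartz h"
  shows "\<exists>B. integrable (count_space UNIV) B \<and> (\<forall>x k. norm x \<le> r \<longrightarrow> norm (h (x + \<iota> k)) \<le> B k)"
proof -
  define D where "D = 2 * DIM('a)"
  obtain C where C: "\<And>x. norm (h x) \<le> C * dec x ^ D"
    using schwartz_dominated[OF h] by (auto simp: dominated_def)
  have "norm (h (x + \<iota> k)) \<le> \<bar>C\<bar> * ((1 + \<bar>r\<bar>) ^ D * dec (\<iota> k) ^ D)" if "norm x \<le> r" for x k
  proof -
    have "norm (h (x + \<iota> k)) \<le> C * dec (x + \<iota> k) ^ D" by (rule C)
    also have "\<dots> \<le> \<bar>C\<bar> * dec (x + \<iota> k) ^ D" by (rule mult_right_mono) auto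
    also have "\<dots> \<le> \<bar>C\<bar> * ((1 + norm x) ^ D * dec (\<iota> k) ^ D)"
      using dec_shift_power'[of "\<iota> k" x D] by (intro mult_left_mono) (auto simp: add.commute)
    also have "\<dots> \<le> \<bar>C\<bar> * ((1 + \<bar>r\<bar>) ^ D * dec (\<iota> k) ^ D)"
      using that by (intro mult_left_mono mult_right_mono power_mono) auto
    finally show ?thesis .
  qed
  moreover have "integrable (count_space UNIV) (\<lambda>k. \<bar>C\<bar> * ((1 + \<bar>r\<bar>) ^ D * dec (\<iota> k) ^ D))"
    by (intro integrable_mult_right integrable_dec_lattice) (simp add: D_def)
  ultimately show ?thesis by blast
qed

lemma schwartz_lattice_integrable:
  assumes h: "schwartz h"
  shows "integrable (count_space UNIV) (\<lambda>k. h (x + \<iota> k))"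
proof -
  obtain B where B: "integrable (count_space UNIV) B" "\<And>k. norm (h (x + \<iota> k)) \<le> B k"
    using schwartz_lattice_bound[OF h, of "norm x"] by blast
  show ?thesis
    by (rule Bochner_Integration.integrable_bound[OF B(1)]) (auto intro!: AE_I2 order_trans[OF B(2) abs_ge_self])
qed

lemma smooth_periodize:
  assumes h: "schwartz h"
  shows "smooth (periodize h)"
proof -
  have "smooth (\<lambda>x. LINT k|count_space UNIV. h (x + \<iota> k))"
  proof (rule smooth_integral_param(1))
    show "smooth (\<lambda>x. h (x + \<iota> k))" for k by (rule smooth_translate[OF schwartz_smooth[OF h]])
    fix r and bs :: "'a list" assume bs: "set bs \<subseteq> Basis"
    show "\<exists>B. integrable (count_space UNIV) B \<and> (\<forall>x k. norm x \<le> r \<longrightarrow> k \<in> space (count_space UNIV) \<longrightarrow>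
        norm (iter_deriv bs (\<lambda>x. h (x + \<iota> k)) x) \<le> B k)"
      unfolding iter_deriv_translate[OF schwartz_smooth[OF h] bs]
      using schwartz_lattice_bound[OF schwartz_iter_deriv[OF h bs], of r] by (simp only: space_count_space UNIV_I simp_thms)
  qed simp
  then show ?thesis unfolding periodize_def[abs_def] .
qed

lemma periodize_periodic: "periodize h (x + \<iota> l) = periodize h x"
proof -
  have eq: "x + \<iota> l + \<iota> k = x + \<iota> (k + l)" for k by (simp add: add add.assoc add.commute[of "\<iota> l"])
  show ?thesis unfolding periodize_def eq by (rule sum_shift[of "\<lambda>k. h (x + \<iota> k)" l])
qed

text \<open>Unfold the integral defining \<open>ft h\<close> at a lattice frequency; the character
  there is periodic and leaves the lattice sum.\<close>

lemma coeff_periodize: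
  assumes h: "schwartz h"
  shows "(LINT x|cubeM. ech (- (\<iota> \<nu> \<bullet> x)) * periodize h x) = ft h (\<iota> \<nu>)"
proof -
  have "integrable lborel (\<lambda>x. ech (x \<bullet> (- \<iota> \<nu>)) * h x)"
    by (rule schwartz_integrable[OF schwartz_ech_mult[OF h]])
  from unfold[OF this]
  have "ft h (\<iota> \<nu>) = (LINT x|cubeM. (LINT k|count_space UNIV. ech ((x + \<iota> k) \<bullet> (- \<iota> \<nu>)) * h (x + \<iota> k)))"
    by (simp add: ft_def)
  also have "\<dots> = (LINT x|cubeM. ech (- (\<iota> \<nu> \<bullet> x)) * periodize h x)"
  proof -
    have "(x + \<iota> k) \<bullet> (- \<iota> \<nu>) = - (\<iota> \<nu> \<bullet> x) + - (\<iota> k \<bullet> \<iota> \<nu>)" for x k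
      by (simp add: inner_add_left inner_commute[of x])
    then have "ech ((x + \<iota> k) \<bullet> (- \<iota> \<nu>)) = ech (- (\<iota> \<nu> \<bullet> x))" for x k
      by (simp only: ech_add ech_inner mult_1_right)
    then show ?thesis by (simp only: periodize_def integral_mult_right_zero)
  qed
  finally show ?thesis by simp
qed

lemma ft_lattice_integrable:
  assumes h: "schwartz h"
  shows "integrable (count_space UNIV) (\<lambda>\<nu>. ft h (\<iota> \<nu>))"
  using schwartz_lattice_integrable[OF schwartz_ft[OF h], of 0] by simp

theorem poisson:
  assumes h: "schwartz h"
  shows "(LINT k|count_space UNIV. h (x + \<iota> k)) = (LINT \<nu>|count_space UNIV. ft h (\<iota> \<nu>) * ech (\<iota> \<nu> \<bullet> x))"
proof -
  have "periodize h x = (LINT \<nu>|count_space UNIV. ft h (\<iota> \<nu>) * ech (\<iota> \<nu> \<bullet> x))"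
    by (rule fourier_series[OF smooth_continuous_on[OF smooth_periodize[OF h]] periodize_periodic
          coeff_periodize[OF h, symmetric] ft_lattice_integrable[OF h]])
  then show ?thesis by (simp only: periodize_def)
qed

text \<open>Unfold the integral over the cube and apply Poisson summation, for each \<open>x\<close> in the cube, to
  \<open>\<eta> \<mapsto> ech (\<eta> \<bullet> x) * u (\<eta> + \<xi>)\<close>.\<close>

theorem ft_inversion:
  fixes u :: "'a \<Rightarrow> complex"
  assumes u: "schwartz u"
  shows "ft (\<lambda>x. ft u (- x)) \<xi> = u \<xi>"
proof -
  define g where "g x = ft u (- x)" for x
  have g: "schwartz g"
    using schwartz_scale[OF schwartz_ft[OF u], of "-1" 0] by (simp add: g_def[abs_def])
  have [measurable]: "u \<in> borel_measurable borel" by (rule schwartz_borel[OF u])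
  define h where "h x = (\<lambda>\<eta>. ech (\<eta> \<bullet> x) * u (\<eta> + \<xi>))" for x
  have h: "schwartz (h x)" for x unfolding h_def
    using schwartz_scale[OF u, of 1 \<xi>] by (intro schwartz_ech_mult) simp
  \<comment> \<open>Since \<open>g\<close> is the reflected transform of \<open>u\<close>, the terms
    on the coset of \<open>x\<close> are samples of the transform of \<open>h x\<close>, taken at
    the lattice points \<open>- k\<close>.\<close>
  have hft: "ech ((x + \<iota> k) \<bullet> (- \<xi>)) * g (x + \<iota> k) = ft (h x) (\<iota> (0 - k))" for x k
  proof -
    have "ft (h x) (\<iota> (0 - k)) = (LINT \<eta>|lborel. ech ((\<eta> + \<xi> - \<xi>) \<bullet> (x + \<iota> k)) * u (\<eta> + \<xi>))"
      unfolding ft_def h_def by (simp add: minus inner_add_right ech_add mult_ac)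
    also have "\<dots> = (LINT \<eta>|lborel. ech ((\<eta> - \<xi>) \<bullet> (x + \<iota> k)) * u \<eta>)"
      by (rule lborel_integral_translate[where h = "\<lambda>\<eta>. ech ((\<eta> - \<xi>) \<bullet> (x + \<iota> k)) * u \<eta>"]) measurable
    also have "\<dots> = (LINT \<eta>|lborel. ech ((x + \<iota> k) \<bullet> (- \<xi>)) * (ech (- (\<eta> \<bullet> (- (x + \<iota> k)))) * u \<eta>))"
    proof -
      have "ech ((\<eta> - \<xi>) \<bullet> w) * u \<eta> = ech (w \<bullet> (- \<xi>)) * (ech (- (\<eta> \<bullet> (- w))) * u \<eta>)" for \<eta> w
        unfolding inner_diff_left ech_diff inner_minus_right minus_minus inner_commute[of w] by (simp only: mult_ac)
      then show ?thesis by (simp only:)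
    qed
    also have "\<dots> = ech ((x + \<iota> k) \<bullet> (- \<xi>)) * g (x + \<iota> k)"
      unfolding g_def ft_def by (rule integral_mult_right_zero)
    finally show ?thesis by simp
  qed
  have "integrable lborel (\<lambda>x. ech (x \<bullet> (- \<xi>)) * g x)"
    by (rule schwartz_integrable[OF schwartz_ech_mult[OF g]])
  from unfold[OF this]
  have "ft g \<xi> = (LINT x|cubeM. (LINT k|count_space UNIV. ech ((x + \<iota> k) \<bullet> (- \<xi>)) * g (x + \<iota> k)))"
    by (simp add: ft_def)
  also have "\<dots> = (LINT x|cubeM. (LINT k|count_space UNIV. ft (h x) (\<iota> (0 - k))))"
    by (simp only: hft)
  also have "\<dots> = (LINT x|cubeM. (LINT k|count_space UNIV. ft (h x) (\<iota> k)))"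
    by (simp only: sum_minus[of "\<lambda>k. ft (h _) (\<iota> k)" 0])
  also have "\<dots> = (LINT x|cubeM. (LINT k|count_space UNIV. h x (\<iota> k)))"
    using poisson[OF h, of _ 0] by simp
  also have "\<dots> = (LINT x|cubeM. (LINT k|count_space UNIV. ech (\<iota> k \<bullet> x) * u (\<iota> k + \<xi>)))"
    by (simp add: h_def)
  also have "\<dots> = (LINT k|count_space UNIV. (LINT x|cubeM. ech (\<iota> k \<bullet> x) * u (\<iota> k + \<xi>)))"
  proof (rule integral_sum_swap)
    interpret prob_space "cubeM :: 'a measure" by (rule prob_space_cubeM)
    have "(\<integral>\<^sup>+k. ennreal (norm (u (\<iota> k + \<xi>))) \<partial>count_space UNIV) < \<infinity>"
      using schwartz_lattice_integrable[OF u, of \<xi>] unfolding integrable_iff_bounded by (simp add: add.commute)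
    then show "(\<integral>\<^sup>+k. (\<integral>\<^sup>+x. ennreal (norm (ech (\<iota> k \<bullet> x) * u (\<iota> k + \<xi>))) \<partial>cubeM) \<partial>count_space UNIV) < \<infinity>"
      using emeasure_space_1 by (simp add: norm_mult)
    show "(\<lambda>x. ech (\<iota> k \<bullet> x) * u (\<iota> k + \<xi>)) \<in> borel_measurable cubeM" for k
      by (intro borel_measurable_cubeM) measurable
  qed (rule sigma_finite_cubeM)
  \<comment> \<open>Averaging over the cube removes every character except the trivial one, and the
    term \<open>k = 0\<close> is \<open>u \<xi>\<close>.\<close>
  also have "\<dots> = (LINT k|count_space UNIV. (if k = (0::'i) then u \<xi> else 0))"
    by (intro Bochner_Integration.integral_cong refl) (simp add: orthogonality)
  also have "\<dots> = u \<xi>" by (rule LINT_count_space_single)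
  finally show ?thesis unfolding g_def .
qed

section \<open>Smooth periodic functions\<close>

text \<open>Derivatives of a periodic function are periodic and continuous, hence bounded. So smooth
  periodic functions are admissible multipliers of Schwartz functions.\<close>

lemma periodic_smooth_bd:
  assumes sm: "smooth F" and per: "\<And>k x. F (x + \<iota> k) = F x"
  shows "smooth_bd n (\<lambda>_. 1) F"
proof -
  have "dominated (\<lambda>_. 1) (iter_deriv bs F)" if bs: "set bs \<subseteq> Basis" for bs
  proof -
    have "continuous_on UNIV (iter_deriv bs F)" by (rule smooth_continuous_on[OF smooth_iter_deriv[OF sm bs]])
    then obtain M where M: "\<And>x. x \<in> cube \<Longrightarrow> norm (iter_deriv bs F x) \<le> M"
      using bounded_on_cube by blast
    have "norm (iter_deriv bs F x) \<le> M" for x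
    proof -
      obtain k where k: "x + \<iota> k \<in> cube" using ex1_cube[of x] by blast
      have "iter_deriv bs F (x + \<iota> k) = iter_deriv bs (\<lambda>x. F (x + \<iota> k)) x"
        by (simp only: iter_deriv_translate[OF sm bs])
      also have "\<dots> = iter_deriv bs F x" by (simp only: per)
      finally show ?thesis using M[OF k] by simp
    qed
    then show ?thesis by (auto simp: dominated_def)
  qed
  then show ?thesis using smooth_bd_iff[of "\<lambda>_. 1" F, THEN iffD2] sm by simp
qed

text \<open>The argument of \<open>integral_pd_zero\<close>, with \<open>torus_translate\<close> in
  place of translation invariance of Lebesgue measure.\<close>

lemma torus_integral_pd_zero:
  fixes F :: "'a \<Rightarrow> complex"
  assumes sm: "smooth F" and per: "\<And>k x. F (x + \<iota> k) = F x" and b: "b \<in> Basis"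
  shows "(LINT x|cubeM. pd b F x) = 0"
proof -
  interpret prob_space "cubeM :: 'a measure" by (rule prob_space_cubeM)
  have [measurable]: "F \<in> borel_measurable borel" by (rule smooth_borel[OF sm])
  have dominated: "dominated (\<lambda>_. 1) (iter_deriv bs F)" if "set bs \<subseteq> Basis" for bs
    using smooth_bd_iff[of "\<lambda>_. 1" F, THEN iffD1] periodic_smooth_bd[OF sm per] that by simp
  obtain C where C: "\<And>x. norm (F x) \<le> C" using dominated[of "[]"] by (auto simp: dominated_def)
  have eq: "iter_deriv [b] (\<lambda>x. LINT t|cubeM. F (x + t)) = (\<lambda>x. LINT t|cubeM. iter_deriv [b] (\<lambda>x. F (x + t)) x)"
  proof (rule smooth_integral_param(2))
    show "(\<lambda>t. iter_deriv bs (\<lambda>x. F (x + t)) x) \<in> borel_measurable cubeM" if bs: "set bs \<subseteq> Basis" for x bs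
    proof -
      have [measurable]: "iter_deriv bs F \<in> borel_measurable borel"
        by (rule smooth_borel[OF smooth_iter_deriv[OF sm bs]])
      show ?thesis unfolding iter_deriv_translate[OF sm bs] by (intro borel_measurable_cubeM) measurable
    qed
    show "\<exists>B. integrable cubeM B \<and> (\<forall>x t. norm x \<le> r \<longrightarrow> t \<in> space cubeM \<longrightarrow> norm (iter_deriv bs (\<lambda>x. F (x + t)) x) \<le> B t)"
      if bs: "set bs \<subseteq> Basis" for r bs
    proof -
      obtain M where "\<And>x. norm (iter_deriv bs F x) \<le> M" using dominated[OF bs] by (auto simp: dominated_def)
      then show ?thesis unfolding iter_deriv_translate[OF sm bs] by (intro exI[of _ "\<lambda>_. M"]) auto
    qed
  qed (use b in \<open>auto intro: smooth_translate sm\<close>)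
  have const: "(LINT t|cubeM. F (x + t)) = (LINT t|cubeM. F t)" for x
    using torus_translate[OF _ C per, of x] by (simp add: add.commute)
  have "(LINT t|cubeM. iter_deriv [b] (\<lambda>x. F (x + t)) 0) = pd b (\<lambda>_. LINT t|cubeM. F t) 0"
    using fun_cong[OF eq, of 0, symmetric] unfolding const by simp
  moreover have "iter_deriv [b] (\<lambda>x. F (x + t)) 0 = pd b F t" for t
    using iter_deriv_translate[OF sm, of "[b]" t] b by simp
  ultimately show ?thesis by simp
qed

definition coeff :: "('a \<Rightarrow> complex) \<Rightarrow> 'i \<Rightarrow> complex" where
  "coeff F \<nu> = (LINT x|cubeM. ech (- (\<iota> \<nu> \<bullet> x)) * F x)"

lemma smooth_pd: "smooth F \<Longrightarrow> b \<in> Basis \<Longrightarrow> smooth (pd b F)"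
  using smooth_iter_deriv[of F "[b]"] by simp

lemma periodic_pd:
  fixes F :: "'a \<Rightarrow> complex"
  assumes sm: "smooth F" and per: "\<And>k x. F (x + \<iota> k) = F x" and b: "b \<in> Basis"
  shows "pd b F (x + \<iota> k) = pd b F x"
  using fun_cong[OF iter_deriv_translate[OF sm, of "[b]" "\<iota> k"], of x] b by (simp add: per)

lemma smooth_ech_mult: "smooth F \<Longrightarrow> (\<And>k x. F (x + \<iota> k) = F x) \<Longrightarrow> smooth (\<lambda>x. ech (x \<bullet> v) * F x)"
proof -
  assume F: "smooth F" "\<And>k x. F (x + \<iota> k) = F x"
  have "smooth_bd n (\<lambda>x. 1 * 1) (\<lambda>x. ech (x \<bullet> v) * F x)" for n
    by (rule smooth_bd_mult[OF smooth_bd_ech periodic_smooth_bd[OF F]])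
  then show ?thesis using smooth_bd_iff[of "\<lambda>x. 1 * 1" "\<lambda>x. ech (x \<bullet> v) * F x", THEN iffD1] by simp
qed

lemma coeff_pd:
  assumes sm: "smooth F" and per: "\<And>k x. F (x + \<iota> k) = F x" and b: "b \<in> Basis"
  shows "coeff (pd b F) \<nu> = 2 * pi * \<i> * (b \<bullet> \<iota> \<nu>) * coeff F \<nu>"
proof -
  define G where "G = (\<lambda>x. ech (x \<bullet> (- \<iota> \<nu>)) * F x)"
  have G: "smooth G" unfolding G_def by (rule smooth_ech_mult[OF sm per])
  have Gper: "G (x + \<iota> k) = G x" for x k unfolding G_def by (simp add: per inner_add_left ech_diff)
  have "pd b G x = ech (- (\<iota> \<nu> \<bullet> x)) * pd b F x - (2 * pi * \<i> * (b \<bullet> \<iota> \<nu>)) * (ech (- (\<iota> \<nu> \<bullet> x)) * F x)" for x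
  proof -
    have "pd b G x = ech (x \<bullet> (- \<iota> \<nu>)) * pd b F x + pd b (\<lambda>x. ech (x \<bullet> (- \<iota> \<nu>))) x * F x"
      unfolding G_def by (rule pd_mult[OF differentiable_ech smooth_differentiable[OF sm]])
    also have "pd b (\<lambda>x. ech (x \<bullet> (- \<iota> \<nu>))) x = (2 * pi * \<i> * (b \<bullet> (- \<iota> \<nu>))) * ech (x \<bullet> (- \<iota> \<nu>))"
      using fun_cong[OF frechet_derivative_at[OF has_derivative_ech[of "- \<iota> \<nu>" x]], of b] by simp
    finally show ?thesis by (simp add: inner_commute)
  qed
  then have "0 = (LINT x|cubeM. ech (- (\<iota> \<nu> \<bullet> x)) * pd b F x - (2 * pi * \<i> * (b \<bullet> \<iota> \<nu>)) * (ech (- (\<iota> \<nu> \<bullet> x)) * F x))"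
    using torus_integral_pd_zero[OF G Gper b] by simp
  also have "\<dots> = coeff (pd b F) \<nu> - 2 * pi * \<i> * (b \<bullet> \<iota> \<nu>) * coeff F \<nu>"
  proof -
    have "integrable cubeM (\<lambda>x. ech (- (\<iota> \<nu> \<bullet> x)) * H x)" if H: "smooth H" for H :: "'a \<Rightarrow> complex"
    proof -
      obtain M where M: "\<And>x. x \<in> cube \<Longrightarrow> norm (H x) \<le> M"
        using bounded_on_cube[OF smooth_continuous_on[OF H]] by blast
      have [measurable]: "H \<in> borel_measurable borel" by (rule smooth_borel[OF H])
      show ?thesis by (rule integrable_cubeM_bounded[where C=M]) (use M in \<open>auto simp: norm_mult\<close>)
    qed
    from this[OF sm] this[OF smooth_pd[OF sm b]] show ?thesis
      unfolding coeff_def by (subst Bochner_Integration.integral_diff) auto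
  qed
  finally show ?thesis by simp
qed

lemma norm_coeff_le:
  assumes "smooth F"
  shows "\<exists>C. \<forall>\<nu>. norm (coeff F \<nu>) \<le> C"
proof -
  have "norm (coeff F \<nu>) \<le> (LINT x|cubeM. norm (F x))" for \<nu>
    unfolding coeff_def using integral_norm_bound[of cubeM "\<lambda>x. ech (- (\<iota> \<nu> \<bullet> x)) * F x"] by (simp add: norm_mult)
  then show ?thesis by blast
qed

lemma coeff_coord_decay:
  assumes "smooth F" "\<And>k x. F (x + \<iota> k) = F x" and b: "b \<in> Basis"
  shows "\<exists>C. \<forall>\<nu>. \<bar>b \<bullet> \<iota> \<nu>\<bar> ^ N * norm (coeff F \<nu>) \<le> C"
  using assms(1,2)
proof (induction N arbitrary: F)
  case (Suc N)
  obtain C where C: "\<And>\<nu>. \<bar>b \<bullet> \<iota> \<nu>\<bar> ^ N * norm (coeff (pd b F) \<nu>) \<le> C"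
    using Suc.IH[OF smooth_pd[OF Suc.prems(1) b] periodic_pd[OF Suc.prems b]] by blast
  have "\<bar>b \<bullet> \<iota> \<nu>\<bar> ^ Suc N * norm (coeff F \<nu>) \<le> C / (2 * pi)" for \<nu>
    using C[of \<nu>] by (simp add: coeff_pd[OF Suc.prems b] norm_mult field_simps)
  then show ?case by blast
next
  case 0
  then show ?case using norm_coeff_le by simp
qed

lemma coeff_decay:
  assumes "smooth F" "\<And>k x. F (x + \<iota> k) = F x"
  shows "\<exists>C. \<forall>\<nu>. norm (coeff F \<nu>) \<le> C * dec (\<iota> \<nu>) ^ N"
proof -
  \<comment> \<open>\<open>decay_from_coords\<close> speaks of functions on the Euclidean space, so
    the coefficients are transported to the lattice points.\<close>
  define G where "G \<xi> = coeff F (inv \<iota> \<xi>)" for \<xi>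
  have G: "G (\<iota> \<nu>) = coeff F \<nu>" for \<nu> by (simp add: G_def inv_f_f[OF inj])
  have "\<exists>C. \<forall>\<xi>\<in>range \<iota>. norm (G \<xi>) \<le> C * dec \<xi> ^ N"
  proof (rule decay_from_coords)
    show "\<exists>C. \<forall>\<xi>\<in>range \<iota>. \<bar>b \<bullet> \<xi>\<bar> ^ N * norm (G \<xi>) \<le> C" if "b \<in> Basis" for b
      using coeff_coord_decay[OF assms that, of N] by (simp add: G)
    show "\<exists>C. \<forall>\<xi>\<in>range \<iota>. norm (G \<xi>) \<le> C"
      using norm_coeff_le[OF assms(1)] by (simp add: G)
  qed
  then show ?thesis by (simp add: G)
qed

lemma coeff_integrable:
  assumes "smooth F" "\<And>k x. F (x + \<iota> k) = F x"
  shows "integrable (count_space UNIV) (coeff F)"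
proof -
  define D where "D = 2 * DIM('a)"
  obtain C where C: "\<And>\<nu>. norm (coeff F \<nu>) \<le> C * dec (\<iota> \<nu>) ^ D"
    using coeff_decay[OF assms, of D] by blast
  have "integrable (count_space UNIV) (\<lambda>\<nu>. C * dec (\<iota> \<nu>) ^ D)"
    by (intro integrable_mult_right integrable_dec_lattice) (simp add: D_def)
  then show ?thesis
    by (rule Bochner_Integration.integrable_bound) (auto intro!: AE_I2 order_trans[OF C abs_ge_self])
qed

lemma smooth_periodic_series:
  assumes "smooth F" "\<And>k x. F (x + \<iota> k) = F x"
  shows "F x = (LINT \<nu>|count_space UNIV. coeff F \<nu> * ech (\<iota> \<nu> \<bullet> x))"
  by (rule fourier_series[OF smooth_continuous_on[OF assms(1)] assms(2) coeff_def coeff_integrable[OF assms]])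

end

section \<open>Quasi-norm estimates\<close>

lemma epowr_top [simp]: "epowr \<infinity> r = \<infinity>" "epowr top r = top"
  by (simp_all add: epowr_def)

lemma epowr_ennreal: "0 \<le> x \<Longrightarrow> epowr (ennreal x) r = ennreal (x powr r)"
  by (simp add: epowr_def)

lemma epowr_0 [simp]: "epowr 0 r = 0"
  by (simp add: epowr_def)

lemma epowr_mono: "0 \<le> r \<Longrightarrow> x \<le> y \<Longrightarrow> epowr x r \<le> epowr y r"
  by (cases x; cases y) (auto simp: epowr_ennreal intro!: ennreal_leI powr_mono2 simp: top_unique)

lemma epowr_mult: "epowr (x * y) r = epowr x r * epowr y r"
proof (cases "x = 0 \<or> y = 0")
  case False
  then show ?thesis
    by (cases x; cases y)
       (auto simp: epowr_ennreal ennreal_mult[symmetric] powr_mult ennreal_top_mult ennreal_mult_top ennreal_eq_0_iff)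
qed auto

lemma epowr_epowr: "epowr (epowr x r) s = epowr x (r * s)"
  by (cases x) (auto simp: epowr_ennreal powr_powr)

lemma epowr_1 [simp]: "epowr x 1 = x"
  by (cases x) (auto simp: epowr_ennreal)

lemma epowr_inverse: "r > 0 \<Longrightarrow> epowr (epowr x r) (1 / r) = x" "r > 0 \<Longrightarrow> epowr (epowr x (1 / r)) r = x"
  by (simp_all add: epowr_epowr)

lemma epowr_less_top: "x < top \<Longrightarrow> epowr x r < top"
  by (cases x) (auto simp: epowr_ennreal)

lemma epowr_le_iff: "r > 0 \<Longrightarrow> epowr x r \<le> epowr y r \<longleftrightarrow> x \<le> y"
  using epowr_mono[of r x y] epowr_mono[of "1/r" "epowr x r" "epowr y r"] by (auto simp: epowr_inverse)

lemma borel_measurable_epowr [measurable]: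
  "f \<in> borel_measurable M \<Longrightarrow> (\<lambda>x. epowr (f x) r) \<in> borel_measurable M"
proof -
  assume f [measurable]: "f \<in> borel_measurable M"
  have "f -` {\<infinity>} \<inter> space M \<in> sets M" by (rule measurable_sets[OF f]) simp
  also have "f -` {\<infinity>} \<inter> space M = {x \<in> space M. f x = \<infinity>}" by auto
  finally have [measurable]: "Measurable.pred M (\<lambda>x. f x = \<infinity>)" by (simp add: pred_def)
  show "(\<lambda>x. epowr (f x) r) \<in> borel_measurable M" unfolding epowr_def by measurable
qed

lemma Lp_norm_finite: "p \<noteq> \<infinity> \<Longrightarrow>
    Lp_norm p M g = epowr (\<integral>\<^sup>+ x. epowr (g x) (enn2real p) \<partial>M) (1 / enn2real p)"
  by (simp add: Lp_norm_def)

lemma enn2real_exponent: "0 < p \<Longrightarrow> p \<noteq> \<infinity> \<Longrightarrow> 0 < enn2real p"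
  by (simp add: enn2real_positive_iff less_top)

lemma epowr_Lp_norm: "0 < p \<Longrightarrow> p \<noteq> \<infinity> \<Longrightarrow>
    epowr (Lp_norm p M g) (enn2real p) = (\<integral>\<^sup>+ x. epowr (g x) (enn2real p) \<partial>M)"
  by (simp add: Lp_norm_finite epowr_inverse enn2real_exponent)

lemma Lp_norm_leI:
  assumes "0 < p" "p \<noteq> \<infinity>" "(\<integral>\<^sup>+ x. epowr (g x) (enn2real p) \<partial>M) \<le> epowr K (enn2real p)"
  shows "Lp_norm p M g \<le> K"
proof -
  have "epowr (Lp_norm p M g) (enn2real p) \<le> epowr K (enn2real p)"
    using assms(3) by (simp only: epowr_Lp_norm[OF assms(1,2)])
  then show ?thesis using epowr_le_iff[OF enn2real_exponent[OF assms(1,2)]] by simp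
qed

text \<open>Measurability of the smaller function matters for \<open>p = \<infinity>\<close>, since
  \<open>esssup\<close> takes the value \<open>top\<close> on non-measurable functions.\<close>

lemma Lp_norm_mono:
  assumes "0 < p" "g \<in> borel_measurable M" "\<And>x. x \<in> space M \<Longrightarrow> g x \<le> h x"
  shows "Lp_norm p M g \<le> Lp_norm p M h"
proof (cases "p = \<infinity>")
  case True
  then show ?thesis using assms by (auto simp: Lp_norm_def intro!: esssup_AE_mono AE_I2)
next
  case False
  show ?thesis
    using assms enn2real_exponent[OF assms(1) False]
    by (auto simp: Lp_norm_finite[OF False] intro!: epowr_mono nn_integral_mono)
qed

lemma Lp_norm_cmult:
  assumes p: "0 < p" and [measurable]: "g \<in> borel_measurable M"
  shows "Lp_norm p M (\<lambda>x. c * g x) \<le> c * Lp_norm p M g"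
proof (cases "p = \<infinity>")
  case True
  have "AE x in M. c * g x \<le> c * esssup M g"
    using esssup_AE[where M = M and f = g] by (auto intro: mult_left_mono elim!: eventually_mono)
  then show ?thesis using True by (auto simp: Lp_norm_def intro!: esssup_I)
next
  case False
  show ?thesis
    by (rule Lp_norm_leI[OF p False]) (simp add: epowr_mult nn_integral_cmult epowr_Lp_norm[OF p False])
qed

lemma Lp_norm_zero:
  assumes "0 < p"
  shows "Lp_norm p M (\<lambda>x. 0) = 0"
  using Lp_norm_cmult[OF assms, of "\<lambda>_. 0" M 0] by simp

lemma epowr_SUP_le:
  assumes r: "r > 0"
  shows "epowr (SUP j. y j) r \<le> (\<integral>\<^sup>+j. epowr (y j) r \<partial>count_space UNIV)"
proof -
  have "y j \<le> epowr (\<integral>\<^sup>+j. epowr (y j) r \<partial>count_space UNIV) (1 / r)" for j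
  proof -
    have "epowr (y j) r = (\<integral>\<^sup>+i. epowr (y j) r * indicator {j} i \<partial>count_space UNIV)"
      by (simp add: nn_integral_cmult_indicator)
    also have "\<dots> \<le> (\<integral>\<^sup>+j. epowr (y j) r \<partial>count_space UNIV)"
      by (intro nn_integral_mono) (auto simp: indicator_def)
    finally have "epowr (epowr (y j) r) (1/r) \<le> epowr (\<integral>\<^sup>+j. epowr (y j) r \<partial>count_space UNIV) (1 / r)"
      using r by (intro epowr_mono) auto
    then show ?thesis by (simp add: epowr_inverse r)
  qed
  then have "(SUP j. y j) \<le> epowr (\<integral>\<^sup>+j. epowr (y j) r \<partial>count_space UNIV) (1 / r)" by (rule SUP_least)
  from epowr_mono[OF less_imp_le[OF r] this] show ?thesis by (simp add: epowr_inverse r)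
qed

text \<open>Summable weights replace Minkowski's inequality: a weighted sum is dominated by a weighted supremum,
  and \<open>(sup\<^sub>j y\<^sub>j)\<^sup>p \<le> \<Sum>\<^sub>j y\<^sub>j\<^sup>p\<close> holds for every exponent \<open>p > 0\<close>.\<close>

definition weight_const :: "ennreal \<Rightarrow> ('i \<Rightarrow> ennreal) \<Rightarrow> ennreal" where
  "weight_const p w = (if p = \<infinity> then 1 else epowr (\<integral>\<^sup>+j. epowr (w j) (enn2real p) \<partial>count_space UNIV) (1 / enn2real p))"

text \<open>The three powers of the weight have separate tasks: one is summed, one makes the sum of
  \<open>p\<close>-th powers finite through \<open>weight_const\<close>, and one stays with the
  quasi-norm in the supremum, where it may compensate growth in \<open>j\<close>. For
  \<open>p = \<infinity>\<close> the spare powers are bounded by 1.\<close>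

lemma Lp_norm_weighted_sum:
  fixes w :: "'i::countable \<Rightarrow> ennreal"
  assumes p: "0 < p" and w1: "\<And>j. w j \<le> 1" and [measurable]: "\<And>j. g j \<in> borel_measurable M"
  shows "Lp_norm p M (\<lambda>x. \<integral>\<^sup>+j. w j ^ 3 * g j x \<partial>count_space UNIV)
    \<le> (\<integral>\<^sup>+j. w j \<partial>count_space UNIV) * weight_const p w * (SUP j. w j * Lp_norm p M (g j))"
proof -
  define S where "S = (\<integral>\<^sup>+j. w j \<partial>count_space UNIV)"
  define K where "K = (SUP j. w j * Lp_norm p M (g j))"
  note [measurable] = borel_measurable_nn_integral_count_space
  have "Lp_norm p M (\<lambda>x. \<integral>\<^sup>+j. w j ^ 3 * g j x \<partial>count_space UNIV) \<le> S * weight_const p w * K"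
  proof (cases "p = \<infinity>")
    case True
    have "AE x in M. \<forall>j. g j x \<le> esssup M (g j)"
      unfolding AE_all_countable using esssup_AE by blast
    then have "AE x in M. (\<integral>\<^sup>+j. w j ^ 3 * g j x \<partial>count_space UNIV) \<le> S * K"
    proof (rule eventually_mono)
      fix x assume x: "\<forall>j. g j x \<le> esssup M (g j)"
      have "w j ^ 3 * g j x \<le> w j * K" for j
      proof -
        have "w j * g j x \<le> w j * Lp_norm p M (g j)" using x True by (intro mult_left_mono) (auto simp: Lp_norm_def)
        also have "\<dots> \<le> K" unfolding K_def by (rule SUP_upper) simp
        finally have "w j * w j * (w j * g j x) \<le> w j * 1 * K" by (intro mult_mono w1) auto
        then show ?thesis by (simp add: power3_eq_cube mult_ac)
      qed
      then have "(\<integral>\<^sup>+j. w j ^ 3 * g j x \<partial>count_space UNIV) \<le> (\<integral>\<^sup>+j. w j * K \<partial>count_space UNIV)"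
        by (intro nn_integral_mono)
      then show "(\<integral>\<^sup>+j. w j ^ 3 * g j x \<partial>count_space UNIV) \<le> S * K"
        by (simp add: S_def nn_integral_multc)
    qed
    then have "esssup M (\<lambda>x. \<integral>\<^sup>+j. w j ^ 3 * g j x \<partial>count_space UNIV) \<le> S * K"
      by (intro esssup_I) measurable
    then show ?thesis using True by (simp add: Lp_norm_def weight_const_def)
  next
    case False
    define r where "r = enn2real p"
    have r: "r > 0" unfolding r_def by (rule enn2real_exponent[OF p False])
    have pw: "epowr (\<integral>\<^sup>+j. w j ^ 3 * g j x \<partial>count_space UNIV) r
      \<le> epowr S r * (\<integral>\<^sup>+j. epowr (w j) r * (epowr (w j) r * epowr (g j x) r) \<partial>count_space UNIV)" for x
    proof -
      have "w j ^ 3 * g j x \<le> w j * (SUP j. w j * (w j * g j x))" for j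
      proof -
        have "w j * (w j * (w j * g j x)) \<le> w j * (SUP j. w j * (w j * g j x))"
          by (intro mult_left_mono SUP_upper) auto
        then show ?thesis by (simp add: power3_eq_cube mult_ac)
      qed
      then have "(\<integral>\<^sup>+j. w j ^ 3 * g j x \<partial>count_space UNIV) \<le> (\<integral>\<^sup>+j. w j * (SUP j. w j * (w j * g j x)) \<partial>count_space UNIV)"
        by (intro nn_integral_mono)
      also have "\<dots> = S * (SUP j. w j * (w j * g j x))" by (simp add: S_def nn_integral_multc)
      finally have "epowr (\<integral>\<^sup>+j. w j ^ 3 * g j x \<partial>count_space UNIV) r \<le> epowr (S * (SUP j. w j * (w j * g j x))) r"
        by (rule epowr_mono[OF less_imp_le[OF r]])
      also have "\<dots> \<le> epowr S r * (\<integral>\<^sup>+j. epowr (w j * (w j * g j x)) r \<partial>count_space UNIV)"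
        unfolding epowr_mult[of S] by (intro mult_left_mono epowr_SUP_le r) simp
      finally show ?thesis by (simp add: epowr_mult)
    qed
    have "(\<integral>\<^sup>+x. epowr (\<integral>\<^sup>+j. w j ^ 3 * g j x \<partial>count_space UNIV) r \<partial>M)
      \<le> (\<integral>\<^sup>+x. epowr S r * (\<integral>\<^sup>+j. epowr (w j) r * (epowr (w j) r * epowr (g j x) r) \<partial>count_space UNIV) \<partial>M)"
      by (intro nn_integral_mono pw)
    also have "\<dots> = epowr S r * (\<integral>\<^sup>+x. (\<integral>\<^sup>+j. epowr (w j) r * (epowr (w j) r * epowr (g j x) r) \<partial>count_space UNIV) \<partial>M)"
      by (rule nn_integral_cmult) measurable
    also have "(\<integral>\<^sup>+x. (\<integral>\<^sup>+j. epowr (w j) r * (epowr (w j) r * epowr (g j x) r) \<partial>count_space UNIV) \<partial>M)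
      = (\<integral>\<^sup>+j. (\<integral>\<^sup>+x. epowr (w j) r * (epowr (w j) r * epowr (g j x) r) \<partial>M) \<partial>count_space UNIV)"
      by (rule nn_integral_count_space_nn_integral) auto
    also have "\<dots> = (\<integral>\<^sup>+j. epowr (w j) r * epowr (w j * Lp_norm p M (g j)) r \<partial>count_space UNIV)"
      by (simp add: nn_integral_cmult epowr_mult epowr_Lp_norm[OF p False] r_def)
    also have "\<dots> \<le> (\<integral>\<^sup>+j. epowr (w j) r * epowr K r \<partial>count_space UNIV)"
      unfolding K_def by (intro nn_integral_mono mult_left_mono epowr_mono[OF less_imp_le[OF r]] SUP_upper) auto
    also have "\<dots> = (\<integral>\<^sup>+j. epowr (w j) r \<partial>count_space UNIV) * epowr K r"
      by (simp add: nn_integral_multc)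
    also have "epowr S r * ((\<integral>\<^sup>+j. epowr (w j) r \<partial>count_space UNIV) * epowr K r) = epowr (S * weight_const p w * K) r"
      using False r by (simp add: epowr_mult weight_const_def epowr_inverse mult_ac flip: r_def)
    finally show ?thesis
      unfolding r_def by (intro Lp_norm_leI[OF p False]) (simp add: mult_left_mono)
  qed
  then show ?thesis unfolding S_def K_def .
qed

text \<open>Bounding the \<open>q\<close>-th power of the supremum by the sum of \<open>q\<close>-th
  powers reduces the claim to the convolution of two summable sequences, whatever \<open>q\<close>
  is.\<close>

lemma lq_convolution_sup:
  fixes w b :: "'i::{countable, ab_group_add} \<Rightarrow> ennreal"
  assumes q: "0 < q" and w1: "\<And>j. w j \<le> 1"
  shows "Lp_norm q (count_space UNIV) (\<lambda>k. SUP m. w (k - m) * b m) \<le> weight_const q w * Lp_norm q (count_space UNIV) b"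
proof (cases "q = \<infinity>")
  case True
  have "(SUP m. w (k - m) * b m) \<le> esssup (count_space UNIV) b" for k
  proof (rule SUP_least)
    fix m
    have "b m \<le> esssup (count_space UNIV) b" using esssup_AE[where M = "count_space UNIV" and f = b] by (simp add: AE_count_space)
    then have "w (k - m) * b m \<le> 1 * esssup (count_space UNIV) b" by (intro mult_mono w1) auto
    then show "w (k - m) * b m \<le> esssup (count_space UNIV) b" by simp
  qed
  then show ?thesis using True by (auto simp: Lp_norm_def weight_const_def intro!: esssup_I AE_I2)
next
  case False
  define r where "r = enn2real q"
  have r: "r > 0" unfolding r_def by (rule enn2real_exponent[OF q False])
  define S where "S = (\<integral>\<^sup>+j. epowr (w j) r \<partial>count_space UNIV)"
  have "(\<integral>\<^sup>+k. epowr (SUP m. w (k - m) * b m) r \<partial>count_space UNIV)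
     \<le> (\<integral>\<^sup>+k. (\<integral>\<^sup>+m. epowr (w (k - m)) r * epowr (b m) r \<partial>count_space UNIV) \<partial>count_space UNIV)"
    by (intro nn_integral_mono order_trans[OF epowr_SUP_le[OF r]]) (simp add: epowr_mult)
  also have "\<dots> = (\<integral>\<^sup>+m. (\<integral>\<^sup>+k. epowr (w (k - m)) r * epowr (b m) r \<partial>count_space UNIV) \<partial>count_space UNIV)"
    by (rule nn_integral_count_space_nn_integral) auto
  also have "\<dots> = (\<integral>\<^sup>+m. S * epowr (b m) r \<partial>count_space UNIV)"
  proof -
    have "bij_betw (\<lambda>k::'i. k - m) UNIV UNIV" for m by (rule bij_betwI[of _ _ _ "\<lambda>k. k + m"]) auto
    from nn_integral_bij_count_space[OF this, of "\<lambda>k. epowr (w k) r"] show ?thesis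
      by (simp add: S_def nn_integral_multc)
  qed
  also have "\<dots> = epowr (weight_const q w * Lp_norm q (count_space UNIV) b) r"
    using False r by (simp add: nn_integral_cmult epowr_mult weight_const_def epowr_inverse S_def
        epowr_Lp_norm[OF q False, of "count_space UNIV" b, folded r_def] flip: r_def)
  finally show ?thesis unfolding r_def by (intro Lp_norm_leI[OF q False])
qed

lemma le_Lp_norm_count_space:
  fixes b :: "'i \<Rightarrow> ennreal"
  assumes q: "0 < q"
  shows "b k \<le> Lp_norm q (count_space UNIV) b"
proof (cases "q = \<infinity>")
  case True
  then show ?thesis using esssup_AE[where M = "count_space UNIV" and f = b] by (simp add: AE_count_space Lp_norm_def)
next
  case False
  note r = enn2real_exponent[OF q False]
  have "b k \<le> (SUP k. b k)" by (rule SUP_upper) simp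
  also have "\<dots> \<le> Lp_norm q (count_space UNIV) b"
    using epowr_SUP_le[OF r, of b] epowr_le_iff[OF r] by (simp add: epowr_Lp_norm[OF q False, symmetric])
  finally show ?thesis .
qed

text \<open>From s^q1 <= t^q2 follows s t <= t^(q2/q1 + 1). The exponent times q is q2 q (1/q1 +
  1/q2), at least q2 by the condition on the exponents, and t <= 1 makes powers decrease in the
  exponent.\<close>

lemma powr_product_le:
  fixes s t q q1 q2 :: real
  assumes st: "0 \<le> s" "s \<le> 1" "0 \<le> t" "t \<le> 1" and q: "0 < q" "0 < q1" "0 < q2" and le: "1 / q \<le> 1 / q1 + 1 / q2"
    and c: "s powr q1 \<le> t powr q2"
  shows "(s * t) powr q \<le> t powr q2"
proof (cases "t = 0")
  case False
  have "s = (s powr q1) powr (1 / q1)" using st q by (simp add: powr_powr)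
  also have "\<dots> \<le> (t powr q2) powr (1 / q1)" using c q by (intro powr_mono2) auto
  also have "\<dots> = t powr (q2 / q1)" by (simp add: powr_powr)
  finally have "s * t \<le> t powr (q2 / q1) * t powr 1" using st by (intro mult_mono) auto
  also have "\<dots> = t powr (q2 / q1 + 1)" by (simp add: powr_add)
  finally have "(s * t) powr q \<le> (t powr (q2 / q1 + 1)) powr q" using st q by (intro powr_mono2) auto
  also have "\<dots> = t powr ((q2 / q1 + 1) * q)" by (simp add: powr_powr)
  also have "\<dots> \<le> t powr q2"
  proof (rule powr_mono')
    have "q2 * (q * (1 / q)) \<le> q2 * (q * (1 / q1 + 1 / q2))" using le q by (intro mult_left_mono) auto
    moreover have "q2 * (q * (1 / q1 + 1 / q2)) = (q2 / q1 + 1) * q" using q by (simp add: field_simps)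
    ultimately show "q2 \<le> (q2 / q1 + 1) * q" using q by simp
  qed (use st in auto)
  finally show ?thesis .
qed simp

text \<open>After normalising both quasi-norms to 1, every term is at most 1, so
  \<open>1 / q\<close> may be smaller than the sum of the other reciprocals. Pointwise (s t)^q <=
  s^q1 + t^q2 holds with the larger summand alone, and summing gives 2; hence the constant.\<close>

lemma lq_hoelder:
  fixes A B :: "'i \<Rightarrow> ennreal"
  assumes q: "0 < q" "0 < q1" "0 < q2" and le: "1 / q \<le> 1 / q1 + 1 / q2"
    and fin: "Lp_norm q1 (count_space UNIV) A < \<infinity>" "Lp_norm q2 (count_space UNIV) B < \<infinity>"
  shows "Lp_norm q (count_space UNIV) (\<lambda>k. A k * B k)
    \<le> (if q = \<infinity> then 1 else epowr 2 (1 / enn2real q)) * (Lp_norm q1 (count_space UNIV) A * Lp_norm q2 (count_space UNIV) B)"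
proof -
  let ?N = "\<lambda>q. Lp_norm q (count_space (UNIV :: 'i set))"
  obtain \<alpha> \<beta> where \<alpha>: "?N q1 A = ennreal \<alpha>" "0 \<le> \<alpha>" and \<beta>: "?N q2 B = ennreal \<beta>" "0 \<le> \<beta>"
    using fin by (metis ennreal_cases infinity_ennreal_def less_irrefl)
  have A: "A k \<le> ennreal \<alpha>" and B: "B k \<le> ennreal \<beta>" for k
    using le_Lp_norm_count_space[OF q(2), of A k] le_Lp_norm_count_space[OF q(3), of B k] by (simp_all add: \<alpha> \<beta>)
  show ?thesis
  proof (cases "q = \<infinity>")
    case True
    have "A k * B k \<le> ennreal \<alpha> * ennreal \<beta>" for k by (intro mult_mono A B) auto
    then show ?thesis using True unfolding \<alpha> \<beta> by (auto simp: Lp_norm_def intro!: esssup_I AE_I2)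
  next
    case False
    define r where "r = enn2real q"
    have r: "r > 0" unfolding r_def by (rule enn2real_exponent[OF q(1) False])
    show ?thesis
    proof (cases "\<alpha> = 0 \<or> \<beta> = 0")
      case True
      then have "A k * B k = 0" for k using A[of k] B[of k] by auto
      then have "?N q (\<lambda>k. A k * B k) = 0" using Lp_norm_zero[OF q(1), of "count_space UNIV"] by (simp only:)
      then show ?thesis by simp
    next
      case nz: False
      define s where "s k = enn2real (A k) / \<alpha>" for k
      define t where "t k = enn2real (B k) / \<beta>" for k
      have As: "A k = ennreal (\<alpha> * s k)" and st: "0 \<le> s k" "s k \<le> 1" for k
        using A[of k] nz \<alpha>(2) by (cases "A k"; auto simp: s_def top_unique divide_simps)+
      have Bt: "B k = ennreal (\<beta> * t k)" and tt: "0 \<le> t k" "t k \<le> 1" for k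
        using B[of k] nz \<beta>(2) by (cases "B k"; auto simp: t_def top_unique divide_simps)+
      have one: "(\<integral>\<^sup>+k. ennreal (u k powr enn2real Q) \<partial>count_space UNIV) = 1"
        if Q: "0 < Q" "Q \<noteq> \<infinity>" and N: "?N Q X = ennreal \<gamma>" "0 < \<gamma>" and X: "\<And>k. X k = ennreal (\<gamma> * u k)" "\<And>k. 0 \<le> u k"
        for Q X \<gamma> and u :: "'i \<Rightarrow> real"
      proof -
        have "ennreal (\<gamma> powr enn2real Q) = (\<integral>\<^sup>+k. epowr (X k) (enn2real Q) \<partial>count_space UNIV)"
          using epowr_Lp_norm[OF Q, of "count_space UNIV" X] N by (simp add: epowr_ennreal)
        also have "\<dots> = (\<integral>\<^sup>+k. ennreal (\<gamma> powr enn2real Q) * ennreal (u k powr enn2real Q) \<partial>count_space UNIV)"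
          using X N by (simp add: epowr_mult epowr_ennreal ennreal_mult)
        also have "\<dots> = ennreal (\<gamma> powr enn2real Q) * (\<integral>\<^sup>+k. ennreal (u k powr enn2real Q) \<partial>count_space UNIV)"
          by (simp add: nn_integral_cmult)
        finally have "ennreal (\<gamma> powr enn2real Q) * 1 = ennreal (\<gamma> powr enn2real Q) * (\<integral>\<^sup>+k. ennreal (u k powr enn2real Q) \<partial>count_space UNIV)"
          by simp
        then show ?thesis using N by (subst (asm) ennreal_mult_cancel_left) auto
      qed
      \<comment> \<open>An infinite exponent contributes 0: its factor is at most 1, and the other
        exponent alone controls the product.\<close>
      define P where "P = (\<lambda>Q (u :: real). if Q = \<infinity> then 0 else u powr enn2real Q)"
      have sumP: "(\<integral>\<^sup>+k. ennreal (P q1 (s k)) \<partial>count_space UNIV) \<le> 1" "(\<integral>\<^sup>+k. ennreal (P q2 (t k)) \<partial>count_space UNIV) \<le> 1"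
        using one[OF q(2) _ \<alpha>(1) _ As st(1)] one[OF q(3) _ \<beta>(1) _ Bt tt(1)] nz \<alpha>(2) \<beta>(2)
        by (cases "q1 = \<infinity>"; cases "q2 = \<infinity>"; simp add: P_def)+
      have fin_exp: "1 / Q = ennreal (1 / enn2real Q)" if "0 < Q" "Q \<noteq> \<infinity>" for Q
        using that enn2real_exponent[OF that] by (cases Q) (auto simp: divide_ennreal simp flip: ennreal_1)
      have key: "(s k * t k) powr r \<le> P q1 (s k) + P q2 (t k)" for k
      proof (cases "q1 = \<infinity>")
        case q1: True
        show ?thesis
        proof (cases "q2 = \<infinity>")
          \<comment> \<open>Two infinite exponents would force \<open>1 / q = 0\<close>, contrary to
            \<open>q \<noteq> \<infinity>\<close>.\<close>
          case True
          then have "1 / q = 0" using le q1 by (simp add: ennreal_divide_top)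
          then have False using fin_exp[OF q(1) False] r by (simp add: r_def)
          then show ?thesis ..
        next
          case q2: False
          then have "1 / r \<le> 1 / enn2real q2"
            using le q1 enn2real_exponent[OF q(3) q2]
            by (simp add: fin_exp[OF q(1) False] fin_exp[OF q(3) q2] r_def ennreal_divide_top)
          then have "enn2real q2 \<le> r" using r enn2real_exponent[OF q(3) q2] by (simp add: field_simps)
          have "(s k * t k) powr r \<le> (1 * t k) powr r" using st[of k] tt[of k] r by (intro powr_mono2 mult_right_mono) auto
          also have "\<dots> \<le> t k powr enn2real q2"
            using \<open>enn2real q2 \<le> r\<close> tt[of k] by (simp add: powr_mono')
          finally show ?thesis using q1 q2 by (simp add: P_def)
        qed
      next
        case q1: False
        show ?thesis
        proof (cases "q2 = \<infinity>")
          case q2: True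
          then have "1 / r \<le> 1 / enn2real q1"
            using le q2 enn2real_exponent[OF q(2) q1]
            by (simp add: fin_exp[OF q(1) False] fin_exp[OF q(2) q1] r_def ennreal_divide_top)
          then have "enn2real q1 \<le> r" using r enn2real_exponent[OF q(2) q1] by (simp add: field_simps)
          have "(s k * t k) powr r \<le> (s k * 1) powr r" using st[of k] tt[of k] r by (intro powr_mono2 mult_left_mono) auto
          also have "\<dots> \<le> s k powr enn2real q1"
            using \<open>enn2real q1 \<le> r\<close> st[of k] by (simp add: powr_mono')
          finally show ?thesis using q1 q2 by (simp add: P_def)
        next
          case q2: False
          note pos = enn2real_exponent[OF q(2) q1] enn2real_exponent[OF q(3) q2]
          have "1 / q1 + 1 / q2 = ennreal (1 / enn2real q1 + 1 / enn2real q2)"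
            using pos
            by (simp add: fin_exp[OF q(2) q1] fin_exp[OF q(3) q2] ennreal_plus[symmetric] del: ennreal_plus)
          then have le': "1 / r \<le> 1 / enn2real q1 + 1 / enn2real q2"
            using le pos
            by (simp add: fin_exp[OF q(1) False] r_def del: ennreal_plus)
          have nn: "0 \<le> s k powr enn2real q1" "0 \<le> t k powr enn2real q2" by simp_all
          show ?thesis
          proof (cases "s k powr enn2real q1 \<le> t k powr enn2real q2")
            case True
            from powr_product_le[OF st tt r pos le' True] nn
            have "(s k * t k) powr r \<le> s k powr enn2real q1 + t k powr enn2real q2" by linarith
            then show ?thesis using q1 q2 by (simp add: P_def)
          next
            case False
            then have "t k powr enn2real q2 \<le> s k powr enn2real q1" by simp
            from powr_product_le[OF tt st r pos(2,1) _ this] le'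
            have "(s k * t k) powr r \<le> s k powr enn2real q1" by (simp add: mult.commute add.commute)
            then have "(s k * t k) powr r \<le> s k powr enn2real q1 + t k powr enn2real q2" using nn by linarith
            then show ?thesis using q1 q2 by (simp add: P_def)
          qed
        qed
      qed
      have P0: "0 \<le> P Q u" for Q u by (simp add: P_def)
      have "(\<integral>\<^sup>+k. epowr (A k * B k) r \<partial>count_space UNIV)
         = (\<integral>\<^sup>+k. epowr (ennreal \<alpha> * ennreal \<beta>) r * ennreal ((s k * t k) powr r) \<partial>count_space UNIV)"
      proof (rule nn_integral_cong)
        fix k
        have "A k * B k = (ennreal \<alpha> * ennreal \<beta>) * ennreal (s k * t k)"
          using \<alpha>(2) \<beta>(2) st[of k] tt[of k] by (simp add: As Bt ennreal_mult[symmetric] mult_ac)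
        then show "epowr (A k * B k) r = epowr (ennreal \<alpha> * ennreal \<beta>) r * ennreal ((s k * t k) powr r)"
          using st[of k] tt[of k] by (simp only: epowr_mult[of "ennreal \<alpha> * ennreal \<beta>"] epowr_ennreal mult_nonneg_nonneg)
      qed
      also have "\<dots> \<le> (\<integral>\<^sup>+k. epowr (ennreal \<alpha> * ennreal \<beta>) r * (ennreal (P q1 (s k)) + ennreal (P q2 (t k))) \<partial>count_space UNIV)"
        using key P0 by (intro nn_integral_mono mult_left_mono) (auto simp: ennreal_plus[symmetric] simp del: ennreal_plus intro: ennreal_leI)
      also have "\<dots> \<le> epowr (ennreal \<alpha> * ennreal \<beta>) r * (1 + 1)"
        using add_mono[OF sumP] by (subst nn_integral_cmult) (auto simp: nn_integral_add intro!: mult_left_mono)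
      also have "\<dots> = epowr (epowr 2 (1 / r) * (ennreal \<alpha> * ennreal \<beta>)) r"
        using r by (simp add: epowr_mult epowr_inverse mult_ac)
      finally have "?N q (\<lambda>k. A k * B k) \<le> epowr 2 (1 / r) * (ennreal \<alpha> * ennreal \<beta>)"
        unfolding r_def by (rule Lp_norm_leI[OF q(1) False])
      then show ?thesis using False unfolding \<alpha> \<beta> r_def by simp
    qed
  qed
qed

context lattice
begin

definition wt :: "nat \<Rightarrow> 'i \<Rightarrow> ennreal" where
  "wt N k = ennreal (dec (\<iota> k) ^ N)"

lemma wt_le_1: "wt N k \<le> 1"
  unfolding wt_def using power_le_one[of "dec (\<iota> k)" N] by (simp add: ennreal_le_1)

lemma wt_sum_finite:
  assumes "2 * DIM('a) \<le> N"
  shows "(\<integral>\<^sup>+k. wt N k \<partial>count_space UNIV) < \<infinity>"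
  unfolding wt_def by (rule nn_count_space_finiteI[OF integrable_dec_lattice[OF assms]])

lemma weight_const_wt_finite:
  assumes p: "0 < p" and N: "p \<noteq> \<infinity> \<Longrightarrow> 2 * real DIM('a) \<le> real N * enn2real p"
  shows "weight_const p (wt N) < \<infinity>"
proof (cases "p = \<infinity>")
  case False
  have "epowr (wt N k) (enn2real p) \<le> wt (2 * DIM('a)) k" for k
  proof -
    have "(dec (\<iota> k) ^ N) powr enn2real p = dec (\<iota> k) powr (real N * enn2real p)"
      by (simp add: powr_powr flip: powr_realpow)
    also have "\<dots> \<le> dec (\<iota> k) powr (2 * real DIM('a))"
      using N[OF False] by (intro powr_mono') auto
    also have "\<dots> = dec (\<iota> k) ^ (2 * DIM('a))"
      using powr_realpow[of "dec (\<iota> k)" "2 * DIM('a)"] by simp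
    finally show ?thesis by (simp add: wt_def epowr_ennreal ennreal_leI)
  qed
  then have "(\<integral>\<^sup>+k. epowr (wt N k) (enn2real p) \<partial>count_space UNIV) \<le> (\<integral>\<^sup>+k. wt (2 * DIM('a)) k \<partial>count_space UNIV)"
    by (intro nn_integral_mono)
  also have "\<dots> < \<infinity>" by (rule wt_sum_finite) simp
  finally show ?thesis using False by (simp add: weight_const_def epowr_less_top)
qed (simp add: weight_const_def)

end

section \<open>The integer lattice and the operators on Euclidean space\<close>

lemma lat_add: "lat (k + l) = lat k + lat l"
  by (simp add: lat_def vec_eq_iff)

lemma lat_inj: "lat k = lat l \<Longrightarrow> k = l"
  by (simp add: lat_def vec_eq_iff)

lemma range_lat: "range (lat :: int ^ 'n \<Rightarrow> real ^ 'n) = {x. \<forall>b\<in>Basis. x \<bullet> b \<in> \<int>}"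
proof safe
  fix k :: "int ^ 'n" and b :: "real ^ 'n" assume "b \<in> Basis"
  then obtain i where "b = axis i 1" by (auto simp: Basis_vec_def)
  then show "lat k \<bullet> b \<in> \<int>" by (simp add: lat_def inner_axis)
next
  fix x :: "real ^ 'n" assume x: "\<forall>b\<in>Basis. x \<bullet> b \<in> \<int>"
  have "x $ i \<in> \<int>" for i
    using x[rule_format, of "axis i 1"] by (simp add: inner_axis Basis_vec_def axis_eq_axis)
  then have "x = lat (\<chi> i. \<lfloor>x $ i\<rfloor>)" by (simp add: lat_def vec_eq_iff)
  then show "x \<in> range lat" by blast
qed

interpretation L: lattice "lat :: int ^ 'n::finite \<Rightarrow> real ^ 'n"
  by unfold_locales (auto simp: inj_def lat_add range_lat intro: lat_inj)

interpretation L2: lattice "map_prod lat lat :: (int ^ 'n::finite) \<times> (int ^ 'n) \<Rightarrow> (real ^ 'n) \<times> (real ^ 'n)"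
proof unfold_locales
  show "inj (map_prod lat lat :: (int ^ 'n) \<times> (int ^ 'n) \<Rightarrow> _)"
    by (auto simp: inj_def intro: lat_inj)
  show "map_prod lat lat (k + l) = map_prod lat lat k + map_prod lat lat l" for k l :: "(int ^ 'n) \<times> (int ^ 'n)"
    by (cases k; cases l) (simp add: lat_add)
  have "range (map_prod lat lat :: (int ^ 'n) \<times> (int ^ 'n) \<Rightarrow> _) = range lat \<times> range lat"
    by (simp add: map_prod_surj_on[of lat UNIV "range lat" lat UNIV "range lat"] flip: UNIV_Times_UNIV)
  also have "\<dots> = {x. \<forall>b\<in>Basis. x \<bullet> b \<in> \<int>}"
    unfolding range_lat Basis_prod_def by (simp add: set_eq_iff ball_Un inner_prod_def)
  finally show "range (map_prod lat lat :: (int ^ 'n) \<times> (int ^ 'n) \<Rightarrow> _) = {x. \<forall>b\<in>Basis. x \<bullet> b \<in> \<int>}" .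
qed

lemma unit_cube_eq: "unit_cube = (cube :: (real ^ 'n) set)"
  unfolding unit_cube_def cube_def by (auto simp: Basis_vec_def inner_axis)

section \<open>From Lebesgue measure in the definitions to Borel measure\<close>

lemma integral_lebesgue:
  fixes f :: "'a::euclidean_space \<Rightarrow> 'b::{banach, second_countable_topology}"
  assumes "f \<in> borel_measurable borel"
  shows "(LINT x|lebesgue. f x) = (LINT x|lborel. f x)"
  by (rule integral_completion) (use assms in simp)

lemma nn_integral_lebesgue_on_shift:
  fixes h :: "'a::euclidean_space \<Rightarrow> ennreal"
  assumes [measurable]: "h \<in> borel_measurable borel"
  shows "(\<integral>\<^sup>+x. h x \<partial>lebesgue_on ((+) c ` cube)) = (\<integral>\<^sup>+x. h (x + c) \<partial>cubeM)"
proof -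
  have S: "(+) c ` cube = {x. x + (- c) \<in> cube}" 
  proof safe
    fix x assume "x + (- c) \<in> cube"
    then show "x \<in> (+) c ` cube" by (intro image_eqI[where x = "x + (- c)"]) auto
  qed simp
  have [measurable]: "{x. x + (- c) \<in> cube} \<in> sets borel" by measurable
  have "(\<integral>\<^sup>+x. h x \<partial>lebesgue_on ((+) c ` cube)) = (\<integral>\<^sup>+x. h x * indicator {x. x + (- c) \<in> cube} x \<partial>lebesgue)"
    unfolding S by (rule nn_integral_restrict_space) simp
  also have "\<dots> = (\<integral>\<^sup>+x. h x * indicator {x. x + (- c) \<in> cube} x \<partial>lborel)" by (rule nn_integral_completion)
  also have "\<dots> = (\<integral>\<^sup>+x. h (x + c) * indicator {x. x + (- c) \<in> cube} (x + c) \<partial>lborel)"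
    by (rule lborel_nn_integral_translate[symmetric, where h = "\<lambda>x. h x * indicator {x. x + (- c) \<in> cube} x"]) measurable
  also have "\<dots> = (\<integral>\<^sup>+x. h (x + c) \<partial>cubeM)" by (simp add: nn_integral_cubeM indicator_def)
  finally show ?thesis .
qed

text \<open>Essential suprema are compared through null sets: a bound holds almost everywhere if and
  only if the integral of the indicator of its violation vanishes, and such integrals transfer by
  translation.\<close>

lemma Lp_norm_shift:
  fixes g :: "'a::euclidean_space \<Rightarrow> ennreal"
  assumes [measurable]: "g \<in> borel_measurable borel"
  shows "Lp_norm p (lebesgue_on ((+) c ` cube)) g = Lp_norm p cubeM (\<lambda>x. g (x + c))"
proof -
  have 1 [measurable]: "g \<in> borel_measurable (lebesgue_on ((+) c ` cube))"
    by (intro measurable_restrict_space1 measurable_completion) simp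
  have 2 [measurable]: "(\<lambda>x. g (x + c)) \<in> borel_measurable cubeM"
    by (intro borel_measurable_cubeM) measurable
  have "(AE x in lebesgue_on ((+) c ` cube). g x \<le> z) \<longleftrightarrow> (AE x in cubeM. g (x + c) \<le> z)" for z
  proof -
    have "(AE x in lebesgue_on ((+) c ` cube). g x \<le> z) \<longleftrightarrow>
        (\<integral>\<^sup>+x. indicator {z<..} (g x) \<partial>lebesgue_on ((+) c ` cube)) = 0"
      by (subst nn_integral_0_iff_AE) (auto simp: indicator_eq_0_iff not_less)
    also have "\<dots> \<longleftrightarrow> (\<integral>\<^sup>+x. indicator {z<..} (g (x + c)) \<partial>cubeM) = 0"
      by (subst nn_integral_lebesgue_on_shift) auto
    also have "\<dots> \<longleftrightarrow> (AE x in cubeM. g (x + c) \<le> z)"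
      by (subst nn_integral_0_iff_AE) (auto simp: indicator_eq_0_iff not_less)
    finally show ?thesis .
  qed
  then have "esssup (lebesgue_on ((+) c ` cube)) g = esssup cubeM (\<lambda>x. g (x + c))"
    by (simp add: esssup_eq_AE)
  then show ?thesis
    unfolding Lp_norm_def by (simp add: nn_integral_lebesgue_on_shift)
qed

lemma integral_lebesgue_on_cube:
  fixes f :: "'a::euclidean_space \<Rightarrow> 'b::{banach, second_countable_topology}"
  assumes [measurable]: "f \<in> borel_measurable borel"
  shows "(LINT x|lebesgue_on cube. f x) = (LINT x|cubeM. f x)"
proof -
  have "(LINT x|lebesgue_on cube. f x) = (LINT x|lebesgue. indicator cube x *\<^sub>R f x)"
    by (rule integral_restrict_space) simp
  also have "\<dots> = (LINT x|lborel. indicator cube x *\<^sub>R f x)" by (rule integral_lebesgue) measurable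
  finally show ?thesis by (simp add: integral_cubeM)
qed

lemma amalgam_norm_eq:
  fixes f :: "real ^ 'n \<Rightarrow> complex"
  assumes [measurable]: "f \<in> borel_measurable borel"
  shows "amalgam_norm p q f = Lp_norm q (count_space UNIV) (\<lambda>k. Lp_norm p cubeM (\<lambda>x. ennreal (norm (f (x + lat k)))))"
proof -
  have "f \<in> borel_measurable lebesgue" by (intro measurable_completion) simp
  then show ?thesis
    unfolding amalgam_norm_def unit_cube_eq by (simp add: Lp_norm_shift)
qed

lemma torus_norm_eq:
  fixes f :: "real ^ 'n \<Rightarrow> complex"
  assumes [measurable]: "f \<in> borel_measurable borel"
  shows "torus_norm p f = Lp_norm p cubeM (\<lambda>x. ennreal (norm (f x)))"
  using Lp_norm_shift[of "\<lambda>x. ennreal (norm (f x))" p 0] unfolding torus_norm_def unit_cube_eq by (simp add: image_def)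

lemma fourier_eq_ft:
  fixes f :: "real ^ 'n \<Rightarrow> complex"
  assumes [measurable]: "f \<in> borel_measurable borel"
  shows "fourier f = ft f"
proof
  fix \<xi>
  have "fourier f \<xi> = (LINT x|lebesgue. ech (- (x \<bullet> \<xi>)) * f x)"
    unfolding fourier_def ech_cis ..
  also have "\<dots> = ft f \<xi>" unfolding ft_def by (rule integral_lebesgue) measurable
  finally show "fourier f \<xi> = ft f \<xi>" .
qed

lemma fourier_coeff_eq:
  fixes F :: "real ^ 'n \<Rightarrow> complex"
  assumes [measurable]: "F \<in> borel_measurable borel"
  shows "fourier_coeff F \<mu> = L.coeff F \<mu>"
proof -
  have "fourier_coeff F \<mu> = (LINT x|lebesgue_on cube. ech (- (lat \<mu> \<bullet> x)) * F x)"
    unfolding fourier_coeff_def ech_cis unit_cube_eq by (simp only: mult.commute)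
  also have "\<dots> = L.coeff F \<mu>" unfolding L.coeff_def by (rule integral_lebesgue_on_cube) measurable
  finally show ?thesis .
qed

lemma borel_measurable_fst:
  "fst \<in> borel_measurable (borel :: ('a::topological_space \<times> 'b::topological_space) measure)"
  by (intro borel_measurable_continuous_onI continuous_intros)

lemma borel_measurable_snd:
  "snd \<in> borel_measurable (borel :: ('a::topological_space \<times> 'b::topological_space) measure)"
  by (intro borel_measurable_continuous_onI continuous_intros)

lemma bilin_mult_eq:
  fixes \<sigma> :: "(real ^ 'n) \<times> (real ^ 'n) \<Rightarrow> complex"
  assumes [measurable]: "\<sigma> \<in> borel_measurable borel" and f: "schwartz f1" "schwartz f2"
  shows "bilin_mult \<sigma> f1 f2 x = (LINT \<xi>|lborel. ech (x \<bullet> (fst \<xi> + snd \<xi>)) * \<sigma> \<xi> * ft f1 (fst \<xi>) * ft f2 (snd \<xi>))"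
proof -
  note [measurable] = schwartz_borel[OF f(1)] schwartz_borel[OF f(2)] borel_measurable_fst borel_measurable_snd
  have "bilin_mult \<sigma> f1 f2 x = (LINT \<xi>|lebesgue. ech (x \<bullet> (fst \<xi> + snd \<xi>)) * \<sigma> \<xi> * ft f1 (fst \<xi>) * ft f2 (snd \<xi>))"
    unfolding bilin_mult_def ech_cis by (simp add: fourier_eq_ft case_prod_beta')
  also have "\<dots> = (LINT \<xi>|lborel. ech (x \<bullet> (fst \<xi> + snd \<xi>)) * \<sigma> \<xi> * ft f1 (fst \<xi>) * ft f2 (snd \<xi>))"
    by (rule integral_lebesgue) measurable
  finally show ?thesis .
qed

lemma integral_lborel_pair:
  fixes f g :: "'a::euclidean_space \<Rightarrow> complex"
  assumes "integrable lborel f" "integrable lborel g"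
  shows "integrable lborel (\<lambda>z. f (fst z) * g (snd z))"
    and "(LINT z|lborel. f (fst z) * g (snd z)) = (LINT x|lborel. f x) * (LINT y|lborel. g y)"
proof -
  have [measurable]: "f \<in> borel_measurable borel" "g \<in> borel_measurable borel" using assms by auto
  have int: "integrable (lborel \<Otimes>\<^sub>M lborel) (\<lambda>z. f (fst z) * g (snd z))"
  proof (rule lborel_pair.Fubini_integrable)
    show "integrable lborel (\<lambda>x. LINT y|lborel. norm (f (fst (x, y)) * g (snd (x, y))))"
      using assms by (simp add: norm_mult)
    show "AE x in lborel. integrable lborel (\<lambda>y. f (fst (x, y)) * g (snd (x, y)))"
      using assms by simp
  qed measurable
  then show "integrable lborel (\<lambda>z. f (fst z) * g (snd z))" by (simp add: lborel_prod)
  have "(LINT z|lborel. f (fst z) * g (snd z)) = (LINT x|lborel. (LINT y|lborel. f x * g y))"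
    using lborel_pair.integral_fst'[OF int] by (simp add: lborel_prod)
  then show "(LINT z|lborel. f (fst z) * g (snd z)) = (LINT x|lborel. f x) * (LINT y|lborel. g y)"
    by simp
qed

section \<open>Lattice symbols and periodic operators as absolutely convergent sums\<close>

abbreviation lat2 :: "(int ^ 'n) \<times> (int ^ 'n) \<Rightarrow> (real ^ 'n) \<times> (real ^ 'n)" where
  "lat2 \<equiv> map_prod lat lat"

lemma integrable_bounded_mult:
  fixes a f :: "'i \<Rightarrow> complex"
  assumes f: "integrable (count_space UNIV) f" and a: "\<And>k. norm (a k) \<le> A"
  shows "integrable (count_space UNIV) (\<lambda>k. a k * f k)"
proof (rule Bochner_Integration.integrable_bound)
  show "integrable (count_space UNIV) (\<lambda>k. A * norm (f k))" using f by simp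
  show "AE k in count_space UNIV. norm (a k * f k) \<le> norm (A * norm (f k))"
  proof (rule AE_I2)
    fix k
    have "norm (a k) * norm (f k) \<le> A * norm (f k)" by (rule mult_right_mono[OF a]) simp
    then show "norm (a k * f k) \<le> norm (A * norm (f k))" by (simp add: norm_mult)
  qed
qed simp

lemma lattice_symbol_eq:
  assumes \<Phi>: "schwartz \<Phi>" and a: "\<And>\<mu>. norm (a \<mu>) \<le> A"
  shows "lattice_symbol a \<Phi> \<xi> = (LINT \<mu>|count_space UNIV. a \<mu> * \<Phi> (\<xi> - lat2 \<mu>))"
proof -
  have "integrable (count_space UNIV) (\<lambda>\<mu>. \<Phi> (\<xi> + lat2 (0 - \<mu>)))"
    unfolding integrable_bij_count_space[OF L2.bij_minus, of "\<lambda>\<mu>. \<Phi> (\<xi> + lat2 \<mu>)"]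
    by (rule L2.schwartz_lattice_integrable[OF \<Phi>])
  then have "integrable (count_space UNIV) (\<lambda>\<mu>. \<Phi> (\<xi> - lat2 \<mu>))"
    by (simp only: L2.minus diff_0 add_uminus_conv_diff)
  then have int: "integrable (count_space UNIV) (\<lambda>\<mu>. a \<mu> * \<Phi> (\<xi> - lat2 \<mu>))"
    by (rule integrable_bounded_mult[OF _ a])
  have "lattice_symbol a \<Phi> \<xi> = (\<Sum>\<^sub>\<infinity>\<mu>\<in>UNIV. a \<mu> * \<Phi> (\<xi> - lat2 \<mu>))"
    by (cases \<xi>) (simp add: lattice_symbol_def case_prod_beta' map_prod_def)
  then show "lattice_symbol a \<Phi> \<xi> = (LINT \<mu>|count_space UNIV. a \<mu> * \<Phi> (\<xi> - lat2 \<mu>))"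
    by (simp add: infsum_eq_LINT[OF int])
qed

lemma lattice_symbol_borel:
  assumes \<Phi>: "schwartz \<Phi>" and a: "\<And>\<mu>. norm (a \<mu>) \<le> A"
  shows "lattice_symbol a \<Phi> \<in> borel_measurable borel"
proof -
  have [measurable]: "\<Phi> \<in> borel_measurable borel" by (rule schwartz_borel[OF \<Phi>])
  have "(\<lambda>\<xi>. LINT \<mu>|count_space UNIV. a \<mu> * \<Phi> (\<xi> - lat2 \<mu>)) \<in> borel_measurable borel"
    by (rule borel_measurable_LINT_count_space) measurable
  moreover have "lattice_symbol a \<Phi> = (\<lambda>\<xi>. LINT \<mu>|count_space UNIV. a \<mu> * \<Phi> (\<xi> - lat2 \<mu>))"
    by (rule ext) (rule lattice_symbol_eq[OF \<Phi> a])
  ultimately show ?thesis by simp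
qed

lemma nn_integral_pair_count:
  fixes f g :: "'i \<Rightarrow> ennreal"
  shows "(\<integral>\<^sup>+\<mu>. f (fst \<mu>) * g (snd \<mu>) \<partial>count_space UNIV) = (\<integral>\<^sup>+k. f k \<partial>count_space UNIV) * (\<integral>\<^sup>+l. g l \<partial>count_space UNIV)"
proof -
  have "(\<integral>\<^sup>+\<mu>. f (fst \<mu>) * g (snd \<mu>) \<partial>count_space UNIV) = (\<integral>\<^sup>+k. (\<integral>\<^sup>+l. f k * g l \<partial>count_space UNIV) \<partial>count_space UNIV)"
    using nn_integral_fst_count_space[of "\<lambda>\<mu>. f (fst \<mu>) * g (snd \<mu>)", symmetric] by simp
  then show ?thesis by (simp add: nn_integral_cmult nn_integral_multc)
qed

lemma integrable_pair_count:
  fixes f g :: "'i \<Rightarrow> complex"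
  assumes "integrable (count_space UNIV) f" "integrable (count_space UNIV) g"
  shows "integrable (count_space UNIV) (\<lambda>\<mu>. f (fst \<mu>) * g (snd \<mu>))"
proof (rule integrableI_bounded)
  have "(\<integral>\<^sup>+\<mu>. ennreal (norm (f (fst \<mu>) * g (snd \<mu>))) \<partial>count_space UNIV)
     = (\<integral>\<^sup>+k. ennreal (norm (f k)) \<partial>count_space UNIV) * (\<integral>\<^sup>+l. ennreal (norm (g l)) \<partial>count_space UNIV)"
    by (simp add: norm_mult ennreal_mult nn_integral_pair_count[of "\<lambda>k. ennreal (norm (f k))" "\<lambda>k. ennreal (norm (g k))"])
  also have "\<dots> < \<infinity>" using assms unfolding integrable_iff_bounded by (simp add: ennreal_mult_less_top)
  finally show "(\<integral>\<^sup>+\<mu>. ennreal (norm (f (fst \<mu>) * g (snd \<mu>))) \<partial>count_space UNIV) < \<infinity>" .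
qed simp

lemma smooth_torus_iff: "smooth_torus F \<longleftrightarrow> smooth F \<and> (\<forall>k x. F (x + lat k) = F x)"
  by (simp add: smooth_torus_def)

lemma bilin_period_eq:
  assumes F: "smooth_torus F1" "smooth_torus F2" and a: "\<And>\<mu>. norm (a \<mu>) \<le> A"
  shows "bilin_period a F1 F2 x = (LINT \<mu>|count_space UNIV.
      ech (x \<bullet> (lat (fst \<mu>) + lat (snd \<mu>))) * a \<mu> * (L.coeff F1 (fst \<mu>) * L.coeff F2 (snd \<mu>)))"
proof -
  have sm: "smooth F1" "smooth F2" and per: "\<And>k x. F1 (x + lat k) = F1 x" "\<And>k x. F2 (x + lat k) = F2 x"
    using F by (auto simp: smooth_torus_iff)
  have "integrable (count_space UNIV) (\<lambda>\<mu>. L.coeff F1 (fst \<mu>) * L.coeff F2 (snd \<mu>))"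
    by (rule integrable_pair_count[OF L.coeff_integrable[OF sm(1) per(1)] L.coeff_integrable[OF sm(2) per(2)]])
  then have int: "integrable (count_space UNIV)
      (\<lambda>\<mu>. ech (x \<bullet> (lat (fst \<mu>) + lat (snd \<mu>))) * a \<mu> * (L.coeff F1 (fst \<mu>) * L.coeff F2 (snd \<mu>)))"
    by (rule integrable_bounded_mult) (use a in \<open>simp add: norm_mult\<close>)
  have "bilin_period a F1 F2 x = (\<Sum>\<^sub>\<infinity>\<mu>\<in>UNIV. ech (x \<bullet> (lat (fst \<mu>) + lat (snd \<mu>))) * a \<mu> * (L.coeff F1 (fst \<mu>) * L.coeff F2 (snd \<mu>)))"
    unfolding bilin_period_def ech_cis fourier_coeff_eq[OF smooth_borel[OF sm(1)]] fourier_coeff_eq[OF smooth_borel[OF sm(2)]]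
    by (simp add: case_prod_beta' mult.assoc)
  then show "bilin_period a F1 F2 x = (LINT \<mu>|count_space UNIV.
      ech (x \<bullet> (lat (fst \<mu>) + lat (snd \<mu>))) * a \<mu> * (L.coeff F1 (fst \<mu>) * L.coeff F2 (snd \<mu>)))"
    by (simp add: infsum_eq_LINT[OF int])
qed

lemma bilin_period_borel:
  assumes F: "smooth_torus F1" "smooth_torus F2" and a: "\<And>\<mu>. norm (a \<mu>) \<le> A"
  shows "bilin_period a F1 F2 \<in> borel_measurable borel"
proof -
  have "(\<lambda>x. LINT \<mu>|count_space UNIV. ech (x \<bullet> (lat (fst \<mu>) + lat (snd \<mu>))) * a \<mu> * (L.coeff F1 (fst \<mu>) * L.coeff F2 (snd \<mu>)))
      \<in> borel_measurable borel"
    by (rule borel_measurable_LINT_count_space) measurable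
  moreover have "bilin_period a F1 F2 = (\<lambda>x. LINT \<mu>|count_space UNIV.
      ech (x \<bullet> (lat (fst \<mu>) + lat (snd \<mu>))) * a \<mu> * (L.coeff F1 (fst \<mu>) * L.coeff F2 (snd \<mu>)))"
    by (rule ext) (rule bilin_period_eq[OF F a])
  ultimately show ?thesis by simp
qed

section \<open>Bump functions and cutoffs\<close>

text \<open>The bump functions are squared moduli of rescaled slices of \<open>\<Phi>\<close>, so that no bump function
  has to be constructed from scratch.\<close>

lemma test_function_support:
  fixes \<Phi> :: "'a::euclidean_space \<Rightarrow> complex"
  assumes "test_function \<Phi>"
  obtains r where "1 \<le> r" "\<And>\<xi>. \<Phi> \<xi> \<noteq> 0 \<Longrightarrow> norm \<xi> \<le> r"
proof -
  have "bounded (supp \<Phi>)" using assms by (simp add: test_function_def compact_imp_bounded)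
  then obtain r where r: "\<And>\<xi>. \<xi> \<in> supp \<Phi> \<Longrightarrow> norm \<xi> \<le> r" unfolding bounded_iff by blast
  show ?thesis
  proof (rule that[of "max 1 r"])
    fix \<xi> assume "\<Phi> \<xi> \<noteq> 0"
    then have "\<xi> \<in> supp \<Phi>" using supp_zero[of \<xi> \<Phi>] by blast
    then show "norm \<xi> \<le> max 1 r" using r[of \<xi>] by simp
  qed simp
qed

lemma test_functionI:
  fixes u :: "'a::euclidean_space \<Rightarrow> complex"
  assumes "smooth u" "\<And>y. u y \<noteq> 0 \<Longrightarrow> norm y \<le> \<rho>"
  shows "test_function u"
proof -
  have "supp u \<subseteq> cball 0 \<rho>" unfolding supp_def
    by (rule closure_minimal) (use assms(2) in auto)
  then have "bounded (supp u)" using bounded_cball bounded_subset by blast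
  then show ?thesis using assms(1) by (simp add: test_function_def compact_eq_bounded_closed supp_def)
qed

lemma integral_pos_continuous:
  fixes v :: "'a::euclidean_space \<Rightarrow> real"
  assumes int: "integrable lborel v" and cont: "continuous_on UNIV v" and nn: "\<And>y. 0 \<le> v y" and pos: "0 < v 0"
  shows "0 < (LINT y|lborel. v y)"
proof -
  have "isCont v 0" using cont by (simp add: continuous_on_eq_continuous_at)
  then obtain d where d: "d > 0" "\<And>y. norm y < d \<Longrightarrow> \<bar>v y - v 0\<bar> < v 0 / 2"
    unfolding continuous_at_eps_delta using pos by (metis dist_norm diff_zero half_gt_zero real_norm_def)
  have "v 0 / 2 * measure lborel (ball (0::'a) d) = (LINT y|lborel. v 0 / 2 * indicator (ball (0::'a) d) y)" by simp
  also have "\<dots> \<le> (LINT y|lborel. v y)"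
  proof (rule Bochner_Integration.integral_mono[OF _ int])
    show "integrable lborel (\<lambda>y::'a. v 0 / 2 * indicator (ball 0 d) y)"
      by (rule integrable_mult_right, rule integrable_real_indicator) (use emeasure_bounded_finite[OF bounded_ball] in auto)
    fix y :: 'a
    show "v 0 / 2 * indicator (ball 0 d) y \<le> v y"
    proof (cases "norm y < d")
      case True
      then have "v 0 / 2 \<le> v y" using d(2)[of y] by linarith
      then show ?thesis using nn[of y] by (simp add: indicator_def)
    qed (use nn[of y] in simp)
  qed
  finally have "v 0 / 2 * measure lborel (ball (0::'a) d) \<le> (LINT y|lborel. v y)" .
  moreover have "0 < measure lborel (ball (0::'a) d)" using d(1) by (simp add: content_ball_pos)
  ultimately show ?thesis using pos by (metis half_gt_zero less_le_trans mult_pos_pos)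
qed

text \<open>The third clause says that \<open>u\<close> is real and nonnegative while keeping the
  complex type on which \<open>schwartz\<close> and \<open>ft\<close> operate.\<close>

definition bump :: "real \<Rightarrow> ('a::euclidean_space \<Rightarrow> complex) \<Rightarrow> bool" where
  "bump \<rho> u \<longleftrightarrow> schwartz u \<and> (\<forall>y. u y \<noteq> 0 \<longrightarrow> norm y \<le> \<rho>) \<and> (\<forall>y. u y = complex_of_real (norm (u y)))
     \<and> 0 < (LINT y|lborel. norm (u y))"

lemma bump_integral:
  assumes "bump \<rho> u"
  shows "(LINT y|lborel. u y) = complex_of_real (LINT y|lborel. norm (u y))"
proof -
  have "u = (\<lambda>y. complex_of_real (norm (u y)))" using assms by (auto simp: bump_def)
  then have "(LINT y|lborel. u y) = (LINT y|lborel. complex_of_real (norm (u y)))" by metis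
  then show ?thesis by simp
qed

lemma bump_exists:
  fixes \<Phi> :: "(real ^ 'n) \<times> (real ^ 'n) \<Rightarrow> complex"
  assumes \<Phi>: "test_function \<Phi>" and nz: "\<Phi> \<xi>0 \<noteq> 0" and \<rho>: "0 < \<rho>"
  shows "\<exists>u :: real ^ 'n \<Rightarrow> complex. bump \<rho> u"
proof -
  obtain r where r: "1 \<le> r" "\<And>\<xi>. \<Phi> \<xi> \<noteq> 0 \<Longrightarrow> norm \<xi> \<le> r"
    using test_function_support[OF \<Phi>] by blast
  \<comment> \<open>Chosen so that \<open>t * norm y\<close> at most \<open>r + norm \<xi>0\<close>
    means \<open>norm y \<le> \<rho>\<close>; the slice through \<open>\<xi>0\<close> varies the
    first component.\<close>
  define t where "t = (r + norm \<xi>0) / \<rho>"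
  have t: "0 < t" using r \<rho> by (simp add: t_def add_pos_nonneg)
  define A :: "real ^ 'n \<Rightarrow> (real ^ 'n) \<times> (real ^ 'n)" where "A y = (t *\<^sub>R y, 0)" for y
  have A: "bounded_linear A" unfolding A_def[abs_def]
    by (intro bounded_linear_Pair bounded_linear_scaleR_right bounded_linear_zero)
  define g where "g y = \<Phi> (A y + \<xi>0)" for y
  define u where "u y = g y * cnj (g y)" for y
  have g: "smooth_bd n (\<lambda>_. 1) g" for n
    unfolding g_def by (rule smooth_bd_affine[OF A _ _ schwartz_smooth_bd[OF test_function_schwartz[OF \<Phi>]], where K=1]) auto
  have "smooth_bd n (\<lambda>x. 1 * 1) u" for n
    unfolding u_def by (intro smooth_bd_mult g smooth_bd_linear[OF bounded_linear_cnj])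
  then have "smooth u" using smooth_bd_iff[of "\<lambda>x. 1 * 1" u, THEN iffD1] by simp
  moreover have supp_u: "norm y \<le> \<rho>" if "u y \<noteq> 0" for y
  proof -
    have "\<Phi> (A y + \<xi>0) \<noteq> 0" using that by (auto simp: u_def g_def)
    then have "norm (A y + \<xi>0) \<le> r" by (rule r)
    then have "norm (A y) \<le> r + norm \<xi>0" using norm_diff_ineq[of "A y" \<xi>0] by linarith
    moreover have "norm (A y) = t * norm y" using t by (simp add: A_def norm_prod_def)
    ultimately have "t * norm y \<le> t * \<rho>" using \<rho> by (simp add: t_def)
    then show ?thesis using t by simp
  qed
  ultimately have u: "schwartz u" by (intro test_function_schwartz test_functionI)
  have u_real: "u y = complex_of_real (norm (u y))" for y
  proof -
    have eq: "u y = complex_of_real ((norm (g y))\<^sup>2)" by (simp only: u_def complex_norm_square)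
    then have "norm (u y) = (norm (g y))\<^sup>2" by (simp only: norm_of_real) simp
    then show ?thesis by (simp only: eq)
  qed
  have "0 < (LINT y|lborel. norm (u y))"
  proof (rule integral_pos_continuous)
    show "integrable lborel (\<lambda>y. norm (u y))" using schwartz_integrable[OF u] by simp
    show "continuous_on UNIV (\<lambda>y. norm (u y))"
      by (intro continuous_intros smooth_continuous_on schwartz_smooth u)
    show "0 < norm (u 0)" using nz by (simp add: u_def g_def A_def zero_prod_def[symmetric])
  qed simp
  then show ?thesis using u supp_u u_real unfolding bump_def by blast
qed

lemma ft_convolution:
  fixes f g :: "'a::euclidean_space \<Rightarrow> complex"
  assumes f: "integrable lborel f" and g: "integrable lborel g"
  shows "ft (\<lambda>\<eta>. LINT y|lborel. f (\<eta> - y) * g y) \<xi> = ft f \<xi> * ft g \<xi>"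
proof -
  have [measurable]: "f \<in> borel_measurable borel" "g \<in> borel_measurable borel" using f g by auto
  define G where "G y \<eta> = ech (- (\<eta> \<bullet> \<xi>)) * (f (\<eta> - y) * g y)" for y \<eta>
  have trans: "(LINT \<eta>|lborel. norm (f (\<eta> - y))) = (LINT \<eta>|lborel. norm (f \<eta>))" for y
    using lborel_integral_translate[of "\<lambda>\<eta>. norm (f \<eta>)" "- y"] by simp
  have trans': "integrable lborel (\<lambda>\<eta>. f (\<eta> - y))" for y
  proof (rule integrableI_bounded)
    show "(\<integral>\<^sup>+\<eta>. ennreal (norm (f (\<eta> - y))) \<partial>lborel) < \<infinity>"
      using lborel_nn_integral_translate[of "\<lambda>\<eta>. ennreal (norm (f \<eta>))" "- y"] f
      unfolding integrable_iff_bounded by simp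
  qed measurable
  have ech_int: "integrable lborel (\<lambda>\<eta>. ech (- (\<eta> \<bullet> \<xi>)) * h \<eta>)" if h: "integrable lborel h" for h :: "'a \<Rightarrow> complex"
  proof (rule Bochner_Integration.integrable_bound[OF h])
    have [measurable]: "h \<in> borel_measurable borel" using h by auto
    show "(\<lambda>\<eta>. ech (- (\<eta> \<bullet> \<xi>)) * h \<eta>) \<in> borel_measurable lborel" by measurable
  qed (simp add: norm_mult)
  have int: "integrable (lborel \<Otimes>\<^sub>M lborel) (case_prod G)"
  proof (rule lborel_pair.Fubini_integrable)
    show "case_prod G \<in> borel_measurable (lborel \<Otimes>\<^sub>M lborel)" unfolding G_def by measurable
    have "(\<lambda>y. LINT \<eta>|lborel. norm (case_prod G (y, \<eta>))) = (\<lambda>y. (LINT \<eta>|lborel. norm (f \<eta>)) * norm (g y))"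
      by (simp add: G_def norm_mult trans)
    then show "integrable lborel (\<lambda>y. LINT \<eta>|lborel. norm (case_prod G (y, \<eta>)))" using g by simp
    show "AE y in lborel. integrable lborel (\<lambda>\<eta>. case_prod G (y, \<eta>))"
      unfolding G_def by (intro AE_I2) (auto intro!: ech_int trans')
  qed
  have "ft (\<lambda>\<eta>. LINT y|lborel. f (\<eta> - y) * g y) \<xi> = (LINT \<eta>|lborel. (LINT y|lborel. G y \<eta>))"
    unfolding ft_def G_def by simp
  also have "\<dots> = (LINT y|lborel. (LINT \<eta>|lborel. G y \<eta>))"
    by (rule lborel_pair.Fubini_integral[OF int])
  also have "\<dots> = (LINT y|lborel. ft f \<xi> * (ech (- (y \<bullet> \<xi>)) * g y))"
  proof (rule Bochner_Integration.integral_cong[OF refl])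
    fix y
    have "(LINT \<eta>|lborel. G y \<eta>) = (LINT \<eta>|lborel. G y (\<eta> + y))"
      by (rule lborel_integral_translate[symmetric]) (simp add: G_def)
    also have "\<dots> = (LINT \<eta>|lborel. (ech (- (\<eta> \<bullet> \<xi>)) * f \<eta>) * (ech (- (y \<bullet> \<xi>)) * g y))"
    proof -
      have "ech (- ((\<eta> + y) \<bullet> \<xi>)) = ech (- (\<eta> \<bullet> \<xi>)) * ech (- (y \<bullet> \<xi>))" for \<eta>
        unfolding ech_add[symmetric] by (simp add: inner_add_left)
      then show ?thesis unfolding G_def by (simp add: mult_ac)
    qed
    also have "\<dots> = ft f \<xi> * (ech (- (y \<bullet> \<xi>)) * g y)" unfolding ft_def by (rule integral_mult_left_zero)
    finally show "(LINT \<eta>|lborel. G y \<eta>) = ft f \<xi> * (ech (- (y \<bullet> \<xi>)) * g y)" .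
  qed
  also have "\<dots> = ft f \<xi> * ft g \<xi>" unfolding ft_def[of g] by (rule integral_mult_right_zero)
  finally show ?thesis .
qed

lemma ft_mult_const: "ft (\<lambda>x. c * f x) \<xi> = c * ft f \<xi>"
proof -
  have "ft (\<lambda>x. c * f x) \<xi> = (LINT x|lborel. c * (ech (- (x \<bullet> \<xi>)) * f x))"
    unfolding ft_def by (simp only: mult_ac)
  then show ?thesis unfolding ft_def by simp
qed

text \<open>The indicator of the ball of radius \<open>r + 1\<close> is mollified by a normalised
  bump of radius 1, so the plateau has radius \<open>r\<close> and the support radius
  \<open>r + 2\<close>. The transform is the product of those of the indicator and of the bump; the
  former is smooth with bounded derivatives, the latter a Schwartz function.\<close>

lemma cutoff_exists:
  fixes u :: "'a::euclidean_space \<Rightarrow> complex"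
  assumes u: "bump 1 u" and r: "0 \<le> r"
  shows "\<exists>\<theta> :: 'a \<Rightarrow> complex. \<theta> \<in> borel_measurable borel \<and> (\<forall>\<eta>. norm \<eta> \<le> r \<longrightarrow> \<theta> \<eta> = 1) \<and>
    (\<forall>\<eta>. \<theta> \<eta> \<noteq> 0 \<longrightarrow> norm \<eta> \<le> r + 2) \<and> (\<forall>\<eta>. norm (\<theta> \<eta>) \<le> 1) \<and> schwartz (ft \<theta>)"
proof -
  define I where "I = (LINT y|lborel. norm (u y))"
  have I: "0 < I" using u by (simp add: bump_def I_def)
  have su: "schwartz u" and supp_u: "\<And>y. u y \<noteq> 0 \<Longrightarrow> norm y \<le> 1" using u by (auto simp: bump_def)
  have [measurable]: "u \<in> borel_measurable borel" by (rule schwartz_borel[OF su])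
  have intu: "integrable lborel u" by (rule schwartz_integrable[OF su])
  define B :: "'a \<Rightarrow> complex" where "B = indicator (cball 0 (r + 1))"
  have [measurable]: "B \<in> borel_measurable borel" unfolding B_def by (intro borel_measurable_indicator) simp
  have "integrable lborel (indicator (cball 0 (r + 1)) :: 'a \<Rightarrow> real)"
    by (rule integrable_real_indicator) (use emeasure_bounded_finite[OF bounded_cball] in auto)
  then have intB: "integrable lborel B"
  proof (rule Bochner_Integration.integrable_bound)
    show "B \<in> borel_measurable lborel" by simp
  qed (auto simp: B_def indicator_def)
  have Bu: "integrable lborel (\<lambda>y. B (\<eta> - y) * u y)" for \<eta>
    by (rule Bochner_Integration.integrable_bound[OF intu]) (auto simp: B_def indicator_def)
  define \<theta> where "\<theta> \<eta> = complex_of_real (1 / I) * (LINT y|lborel. B (\<eta> - y) * u y)" for \<eta>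
  have ft\<theta>: "ft \<theta> = (\<lambda>\<xi>. complex_of_real (1 / I) * (ft B \<xi> * ft u \<xi>))"
    unfolding \<theta>_def[abs_def] ft_mult_const ft_convolution[OF intB intu] ..
  have domB: "dominated (\<lambda>x. dec x ^ N) B" for N
    unfolding dominated_def
  proof (intro exI allI)
    fix x :: 'a
    have "1 \<le> (2 + r) ^ N * dec x ^ N" if "norm x \<le> r + 1"
    proof -
      have "1 = (1 + norm x) ^ N * dec x ^ N" by (rule dec_inverse_power[symmetric])
      also have "\<dots> \<le> (2 + r) ^ N * dec x ^ N" using that by (intro mult_right_mono power_mono) auto
      finally show ?thesis .
    qed
    then show "norm (B x) \<le> (2 + r) ^ N * dec x ^ N" using r by (auto simp: B_def indicator_def)
  qed
  have "schwartz (\<lambda>\<xi>. complex_of_real (1 / I) * ft B \<xi> * ft u \<xi>)"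
  proof (rule schwartz_mult_bd[OF schwartz_ft[OF su]])
    show "smooth_bd n (\<lambda>_. 1) (\<lambda>\<xi>. complex_of_real (1 / I) * ft B \<xi>)" for n
      by (intro smooth_bd_linear[OF bounded_linear_mult_right] smooth_bd_ft domB) simp
  qed
  then have S: "schwartz (ft \<theta>)" unfolding ft\<theta> by (simp only: mult.assoc)
  have one: "\<theta> \<eta> = 1" if "norm \<eta> \<le> r" for \<eta>
  proof -
    have "B (\<eta> - y) * u y = u y" for y
    proof (cases "u y = 0")
      case False
      then have "norm (\<eta> - y) \<le> r + 1" using supp_u[OF False] that norm_triangle_ineq4[of \<eta> y] by linarith
      then show ?thesis by (simp add: B_def)
    qed simp
    then have "\<theta> \<eta> = complex_of_real (1 / I) * complex_of_real I"
      by (simp only: \<theta>_def bump_integral[OF u] I_def)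
    then show ?thesis using I by (simp flip: of_real_mult)
  qed
  have zero: "norm \<eta> \<le> r + 2" if "\<theta> \<eta> \<noteq> 0" for \<eta>
  proof (rule ccontr)
    assume far: "\<not> norm \<eta> \<le> r + 2"
    have "B (\<eta> - y) * u y = 0" for y
    proof (cases "u y = 0")
      case False
      then have "norm (\<eta> - y) > r + 1" using supp_u[OF False] far norm_triangle_ineq2[of \<eta> y] by linarith
      then show ?thesis by (simp add: B_def)
    qed simp
    then have "\<theta> \<eta> = complex_of_real (1 / I) * (LINT y|(lborel :: 'a measure). 0)" unfolding \<theta>_def by (simp only:)
    then show False using that by simp
  qed
  have le1: "norm (\<theta> \<eta>) \<le> 1" for \<eta>
  proof -
    have "norm (LINT y|lborel. B (\<eta> - y) * u y) \<le> (LINT y|lborel. norm (u y))"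
      by (rule integral_norm_bound_mono) (use Bu intu in \<open>auto simp: B_def indicator_def\<close>)
    then have "norm (\<theta> \<eta>) \<le> 1 / I * I"
      unfolding \<theta>_def norm_mult norm_of_real using I by (intro mult_mono) (auto simp: I_def)
    then show ?thesis using I by simp
  qed
  have "\<theta> \<in> borel_measurable borel" unfolding \<theta>_def[abs_def] by measurable
  then show ?thesis using one zero le1 S by blast
qed

text \<open>Multiplication becomes convolution by inserting the integral for
  \<open>ft \<theta>\<close> and applying Fubini's theorem. On the right stands the piece of
  \<open>ft f\<close> near \<open>\<mu>\<close> with the phase of the window centre
  \<open>w\<close>.\<close>

lemma ft_product:
  fixes f \<theta> :: "'a::euclidean_space \<Rightarrow> complex"
  assumes f: "integrable lborel f" and \<theta>: "integrable lborel \<theta>"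
  shows "ft (\<lambda>y. f y * ft \<theta> (y - w)) \<mu> = (LINT \<xi>|lborel. ech (w \<bullet> (\<xi> - \<mu>)) * \<theta> (\<xi> - \<mu>) * ft f \<xi>)"
proof -
  have [measurable]: "f \<in> borel_measurable borel" "\<theta> \<in> borel_measurable borel" using f \<theta> by auto
  define G where "G y \<eta> = (ech (- (y \<bullet> \<mu>)) * f y) * (ech (- (\<eta> \<bullet> (y - w))) * \<theta> \<eta>)" for y \<eta>
  have int: "integrable (lborel \<Otimes>\<^sub>M lborel) (case_prod G)"
  proof (rule lborel_pair.Fubini_integrable)
    show "case_prod G \<in> borel_measurable (lborel \<Otimes>\<^sub>M lborel)" unfolding G_def by measurable
    have "(\<lambda>y. LINT \<eta>|lborel. norm (case_prod G (y, \<eta>))) = (\<lambda>y. norm (f y) * (LINT \<eta>|lborel. norm (\<theta> \<eta>)))"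
      by (simp add: G_def norm_mult)
    then show "integrable lborel (\<lambda>y. LINT \<eta>|lborel. norm (case_prod G (y, \<eta>)))" using f by simp
    have "integrable lborel (\<lambda>\<eta>. G y \<eta>)" for y
    proof (rule Bochner_Integration.integrable_bound)
      show "integrable lborel (\<lambda>\<eta>. norm (f y) * norm (\<theta> \<eta>))" using \<theta> by simp
      show "(\<lambda>\<eta>. G y \<eta>) \<in> borel_measurable lborel" unfolding G_def by measurable
    qed (simp add: G_def norm_mult)
    then show "AE y in lborel. integrable lborel (\<lambda>\<eta>. case_prod G (y, \<eta>))" by simp
  qed
  have "ft (\<lambda>y. f y * ft \<theta> (y - w)) \<mu> = (LINT y|lborel. (LINT \<eta>|lborel. G y \<eta>))"
    unfolding ft_def G_def by (simp add: mult.assoc)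
  also have "\<dots> = (LINT \<eta>|lborel. (LINT y|lborel. G y \<eta>))"
    by (rule lborel_pair.Fubini_integral[OF int, symmetric])
  also have "\<dots> = (LINT \<eta>|lborel. ech (w \<bullet> \<eta>) * \<theta> \<eta> * ft f (\<eta> + \<mu>))"
  proof (rule Bochner_Integration.integral_cong[OF refl])
    fix \<eta>
    have "G y \<eta> = (ech (w \<bullet> \<eta>) * \<theta> \<eta>) * (ech (- (y \<bullet> (\<eta> + \<mu>))) * f y)" for y
    proof -
      have "ech (- (y \<bullet> \<mu>)) * ech (- (\<eta> \<bullet> (y - w))) = ech (w \<bullet> \<eta>) * ech (- (y \<bullet> (\<eta> + \<mu>)))"
        unfolding ech_add[symmetric] by (simp add: inner_add_right inner_diff_right inner_commute algebra_simps)
      then show ?thesis unfolding G_def by (simp add: mult_ac)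
    qed
    then show "(LINT y|lborel. G y \<eta>) = ech (w \<bullet> \<eta>) * \<theta> \<eta> * ft f (\<eta> + \<mu>)"
      unfolding ft_def by (simp only: integral_mult_right_zero)
  qed
  also have "\<dots> = (LINT \<xi>|lborel. ech (w \<bullet> (\<xi> - \<mu>)) * \<theta> (\<xi> - \<mu>) * ft f (\<xi> - \<mu> + \<mu>))"
    using lborel_integral_translate[of "\<lambda>\<eta>. ech (w \<bullet> \<eta>) * \<theta> \<eta> * ft f (\<eta> + \<mu>)" "- \<mu>"] by simp
  finally show ?thesis by simp
qed

section \<open>Expansion of the symbol into tensor products\<close>

text \<open>The Fourier coefficients of \<open>\<Phi>\<close> times the character of
  \<open>z\<close> with respect to the period \<open>R\<close>, after rescaling the period to 1: the
  character only shifts the frequency by \<open>R *\<^sub>R (z, z)\<close>.\<close>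

definition sampling_coeff :: "real \<Rightarrow> ((real ^ 'n) \<times> (real ^ 'n) \<Rightarrow> complex) \<Rightarrow> real ^ 'n \<Rightarrow> (int ^ 'n) \<times> (int ^ 'n) \<Rightarrow> complex" where
  "sampling_coeff R \<Phi> z \<nu> = ft (\<lambda>\<zeta>. \<Phi> (R *\<^sub>R \<zeta>)) (lat2 \<nu> - R *\<^sub>R (z, z))"

lemma norm_lat_less_1: "norm (lat k) < 1 \<Longrightarrow> k = 0"
proof -
  assume k: "norm (lat k) < 1"
  have "\<bar>k $ i\<bar> < 1" for i
  proof -
    have "\<bar>lat k $ i\<bar> \<le> norm (lat k)" by (rule component_le_norm_cart)
    then have "\<bar>real_of_int (k $ i)\<bar> < 1" using k by (simp add: lat_def)
    then show ?thesis by linarith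
  qed
  then show "k = 0" by (simp add: vec_eq_iff)
qed

lemma schwartz_scaled: "schwartz \<Phi> \<Longrightarrow> R \<noteq> 0 \<Longrightarrow> schwartz (\<lambda>\<zeta>. \<Phi> (R *\<^sub>R \<zeta>))"
  using schwartz_scale[of \<Phi> R 0] by simp

text \<open>\<open>z\<close> enters through a shift of the frequency that is bounded for
  \<open>z\<close> in the cube, so Peetre's inequality makes the decay uniform in
  \<open>z\<close>.\<close>

lemma sampling_coeff_bound:
  fixes \<Phi> :: "(real ^ 'n) \<times> (real ^ 'n) \<Rightarrow> complex"
  assumes \<Phi>: "schwartz \<Phi>" and R: "R \<noteq> 0"
  shows "\<exists>C>0. \<forall>z\<in>cube. \<forall>\<nu>. norm (sampling_coeff R \<Phi> z \<nu>) \<le> C * dec (lat2 \<nu>) ^ M"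
proof -
  obtain C where C: "\<And>x. norm (ft (\<lambda>\<zeta>. \<Phi> (R *\<^sub>R \<zeta>)) x) \<le> C * dec x ^ M"
    using ft_decay[OF schwartz_scaled[OF \<Phi> R], of M] by (auto simp: dominated_def)
  define K where "K = (1 + \<bar>R\<bar> * (2 * real DIM(real ^ 'n))) ^ M"
  have K: "0 < K" unfolding K_def by (intro zero_less_power add_pos_nonneg) auto
  have "norm (sampling_coeff R \<Phi> z \<nu>) \<le> ((\<bar>C\<bar> + 1) * K) * dec (lat2 \<nu>) ^ M" if z: "z \<in> cube" for z \<nu>
  proof -
    have "norm (z, z) \<le> norm z + norm z" by (rule norm_Pair_le)
    also have "\<dots> \<le> 2 * real DIM(real ^ 'n)" using norm_cube_le[OF z] by simp
    finally have le: "norm (R *\<^sub>R (z, z)) \<le> \<bar>R\<bar> * (2 * real DIM(real ^ 'n))"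
      unfolding norm_scaleR by (rule mult_left_mono) simp
    have shift: "dec (lat2 \<nu> - w) ^ M \<le> (1 + norm w) ^ M * dec (lat2 \<nu>) ^ M" for w
      using dec_shift_power'[of "lat2 \<nu>" "- w" M] by simp
    have "norm (sampling_coeff R \<Phi> z \<nu>) \<le> C * dec (lat2 \<nu> - R *\<^sub>R (z, z)) ^ M"
      unfolding sampling_coeff_def by (rule C)
    also have "\<dots> \<le> (\<bar>C\<bar> + 1) * dec (lat2 \<nu> - R *\<^sub>R (z, z)) ^ M" by (rule mult_right_mono) auto
    also have "\<dots> \<le> (\<bar>C\<bar> + 1) * ((1 + norm (R *\<^sub>R (z, z))) ^ M * dec (lat2 \<nu>) ^ M)"
      by (intro mult_left_mono shift) simp
    also have "\<dots> \<le> (\<bar>C\<bar> + 1) * (K * dec (lat2 \<nu>) ^ M)"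
      unfolding K_def using le by (intro mult_left_mono mult_right_mono power_mono) auto
    finally show ?thesis by (simp add: mult_ac)
  qed
  moreover have "0 < (\<bar>C\<bar> + 1) * K" using K by (intro mult_pos_pos) auto
  ultimately show ?thesis by blast
qed

lemma sampling_coeff_integrable:
  assumes \<Phi>: "schwartz \<Phi>" and R: "R \<noteq> 0"
  shows "integrable (count_space UNIV) (sampling_coeff R \<Phi> z)"
  using L2.schwartz_lattice_integrable[OF schwartz_ft[OF schwartz_scaled[OF \<Phi> R]], of "- (R *\<^sub>R (z, z))"]
  unfolding sampling_coeff_def[abs_def] by (simp only: uminus_add_conv_diff)

text \<open>Poisson summation expands the \<open>R\<close>-periodization, and the cutoffs select the
  copy at the origin. A component of size at most \<open>r + 2\<close> reaches the ball of radius
  \<open>r\<close> only by a translation of length at most \<open>2 * r + 2\<close>, which is less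
  than \<open>R\<close>; this is the reason for \<open>2 * r + 3\<close>.\<close>

lemma symbol_expansion:
  fixes \<Phi> :: "(real ^ 'n) \<times> (real ^ 'n) \<Rightarrow> complex" and \<theta> :: "real ^ 'n \<Rightarrow> complex"
  assumes \<Phi>: "schwartz \<Phi>" and supp: "\<And>\<xi>. \<Phi> \<xi> \<noteq> 0 \<Longrightarrow> norm \<xi> \<le> r"
    and one: "\<And>\<eta>. norm \<eta> \<le> r \<Longrightarrow> \<theta> \<eta> = 1" and zero: "\<And>\<eta>. \<theta> \<eta> \<noteq> 0 \<Longrightarrow> norm \<eta> \<le> r + 2"
    and r: "0 \<le> r" and R: "R = 2 * r + 3"
  shows "\<Phi> \<eta> * ech (z \<bullet> (fst \<eta> + snd \<eta>)) = (LINT \<nu>|count_space UNIV. sampling_coeff R \<Phi> z \<nu> *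
     ((ech (((1 / R) *\<^sub>R lat (fst \<nu>)) \<bullet> fst \<eta>) * \<theta> (fst \<eta>)) * (ech (((1 / R) *\<^sub>R lat (snd \<nu>)) \<bullet> snd \<eta>) * \<theta> (snd \<eta>))))"
proof -
  have R0: "R \<noteq> 0" "R > 0" using r R by auto
  define h where "h = (\<lambda>\<zeta>. ech (\<zeta> \<bullet> (R *\<^sub>R (z, z))) * \<Phi> (R *\<^sub>R \<zeta>))"
  have h: "schwartz h" unfolding h_def by (rule schwartz_ech_mult[OF schwartz_scaled[OF \<Phi> R0(1)]])
  have fth: "ft h (lat2 \<nu>) = sampling_coeff R \<Phi> z \<nu>" for \<nu>
  proof -
    have "ech (- (\<zeta> \<bullet> lat2 \<nu>)) * (ech (\<zeta> \<bullet> (R *\<^sub>R (z, z))) * w) = ech (- (\<zeta> \<bullet> (lat2 \<nu> - R *\<^sub>R (z, z)))) * w" for \<zeta> w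
    proof -
      have "- (\<zeta> \<bullet> (lat2 \<nu> - R *\<^sub>R (z, z))) = - (\<zeta> \<bullet> lat2 \<nu>) + \<zeta> \<bullet> (R *\<^sub>R (z, z))"
        unfolding inner_diff_right by simp
      then show ?thesis by (simp only: ech_add mult.assoc)
    qed
    then show ?thesis unfolding sampling_coeff_def ft_def h_def by (simp only:)
  qed
  \<comment> \<open>The tensor product of the cutoffs leaves \<open>\<Phi>\<close> unchanged, see
    \<open>\<Phi>t\<close>, but makes each term of the expansion compactly supported in both
    variables.\<close>
  define t where "t = \<theta> (fst \<eta>) * \<theta> (snd \<eta>)"
  define x where "x = (1 / R) *\<^sub>R \<eta>"
  have Rx: "R *\<^sub>R x = \<eta>" using R0 by (simp add: x_def)
  have \<Phi>t: "\<Phi> \<eta> * t = \<Phi> \<eta>"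
  proof (cases "\<Phi> \<eta> = 0")
    case False
    then have "norm \<eta> \<le> r" by (rule supp)
    then have "norm (fst \<eta>) \<le> r" "norm (snd \<eta>) \<le> r"
      using norm_fst_le[of "fst \<eta>" "snd \<eta>"] norm_snd_le[of "snd \<eta>" "fst \<eta>"] by auto
    then show ?thesis by (simp add: t_def one)
  qed simp
  have ht: "h x * t = \<Phi> \<eta> * ech (z \<bullet> (fst \<eta> + snd \<eta>))"
  proof -
    have "x \<bullet> (R *\<^sub>R (z, z)) = \<eta> \<bullet> (z, z)"
      unfolding x_def inner_scaleR_left inner_scaleR_right using R0 by simp
    also have "\<dots> = z \<bullet> (fst \<eta> + snd \<eta>)" by (cases \<eta>) (simp add: inner_add_right inner_commute)
    finally have "h x * t = ech (z \<bullet> (fst \<eta> + snd \<eta>)) * (\<Phi> \<eta> * t)" by (simp add: h_def Rx)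
    then show ?thesis by (simp add: \<Phi>t)
  qed
  have ech_split: "ech (lat2 \<nu> \<bullet> x) = ech (((1 / R) *\<^sub>R lat (fst \<nu>)) \<bullet> fst \<eta>) * ech (((1 / R) *\<^sub>R lat (snd \<nu>)) \<bullet> snd \<eta>)" for \<nu>
    by (cases \<nu>; cases \<eta>) (simp add: x_def add_divide_distrib ech_add)
  have "h x * t = (LINT \<nu>|count_space UNIV. sampling_coeff R \<Phi> z \<nu> * ech (lat2 \<nu> \<bullet> x)) * t"
  proof (cases "t = 0")
    case False
    then have "\<theta> (fst \<eta>) \<noteq> 0" "\<theta> (snd \<eta>) \<noteq> 0" by (auto simp: t_def)
    then have \<eta>: "norm (fst \<eta>) \<le> r + 2" "norm (snd \<eta>) \<le> r + 2" by (auto intro: zero)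
    have "h (x + lat2 k) = (if k = 0 then h x else 0)" for k
    proof (cases "k = 0")
      case nz: False
      have "\<Phi> (\<eta> + R *\<^sub>R lat2 k) = 0"
      proof (rule ccontr)
        assume "\<Phi> (\<eta> + R *\<^sub>R lat2 k) \<noteq> 0"
        then have le: "norm (\<eta> + R *\<^sub>R lat2 k) \<le> r" by (rule supp)
        obtain k1 k2 where k: "k = (k1, k2)" by fastforce
        have small: "l = 0" if "norm (y + R *\<^sub>R lat l) \<le> r" "norm y \<le> r + 2" for y l
        proof (rule norm_lat_less_1)
          have "norm (R *\<^sub>R lat l) \<le> norm (y + R *\<^sub>R lat l) + norm y"
            using norm_triangle_ineq4[of "y + R *\<^sub>R lat l" y] by simp
          also have "\<dots> < R" using that unfolding R by linarith
          finally have "R * norm (lat l) < R * 1" using R0 by simp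
          then show "norm (lat l) < 1" using R0(2) by (simp only: mult_less_cancel_left_pos)
        qed
        have "norm (fst \<eta> + R *\<^sub>R lat k1) \<le> r" "norm (snd \<eta> + R *\<^sub>R lat k2) \<le> r"
          using le norm_fst_le[of "fst \<eta> + R *\<^sub>R lat k1" "snd \<eta> + R *\<^sub>R lat k2"]
            norm_snd_le[of "snd \<eta> + R *\<^sub>R lat k2" "fst \<eta> + R *\<^sub>R lat k1"]
          by (cases \<eta>; simp add: k)+
        then have "k1 = 0" "k2 = 0" using small \<eta> by blast+
        then show False using nz by (simp add: k zero_prod_def)
      qed
      then show ?thesis using nz by (simp add: h_def scaleR_add_right Rx)
    qed (simp only: L2.zero add_0_right if_True simp_thms)
    then have "h x = (LINT k|count_space UNIV. h (x + lat2 k))"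
      by (simp only: LINT_count_space_single)
    also have "\<dots> = (LINT \<nu>|count_space UNIV. sampling_coeff R \<Phi> z \<nu> * ech (lat2 \<nu> \<bullet> x))"
      unfolding L2.poisson[OF h] fth ..
    finally show ?thesis by (simp only:)
  qed simp
  then have "h x * t = (LINT \<nu>|count_space UNIV. (sampling_coeff R \<Phi> z \<nu> * ech (lat2 \<nu> \<bullet> x)) * t)"
    by (simp only: integral_mult_left_zero)
  then have "\<Phi> \<eta> * ech (z \<bullet> (fst \<eta> + snd \<eta>)) = (LINT \<nu>|count_space UNIV. (sampling_coeff R \<Phi> z \<nu> * ech (lat2 \<nu> \<bullet> x)) * t)"
    unfolding ht .
  then show ?thesis unfolding ech_split t_def by (simp only: mult_ac)
qed

section \<open>Reduction of the multiplier operator to the periodic operator\<close>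

text \<open>Chosen so that the Fourier coefficients of the periodization are integrals of
  \<open>ft f\<close> against the cutoff at \<open>\<mu>\<close>, with \<open>w\<close> visible as a
  phase only; the rapid decay of \<open>ft \<theta>\<close> localises \<open>f\<close> near
  \<open>w\<close>.\<close>

definition windowed :: "(real ^ 'n \<Rightarrow> complex) \<Rightarrow> (real ^ 'n \<Rightarrow> complex) \<Rightarrow> real ^ 'n \<Rightarrow> real ^ 'n \<Rightarrow> complex" where
  "windowed \<theta> f w y = f y * ft \<theta> (y - w)"

lemma schwartz_windowed:
  assumes f: "schwartz f" and \<theta>: "schwartz (ft \<theta>)"
  shows "schwartz (windowed \<theta> f w)"
proof -
  have "schwartz (\<lambda>y. ft \<theta> (y - w) * f y)"
    by (rule schwartz_mult_bd[OF f schwartz_smooth_bd]) (use schwartz_scale[OF \<theta>, of 1 "- w"] in simp)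
  then show ?thesis by (simp add: windowed_def[abs_def] mult.commute)
qed

lemma smooth_torus_windowed:
  assumes f: "schwartz f" and \<theta>: "schwartz (ft \<theta>)"
  shows "smooth_torus (L.periodize (windowed \<theta> f w))"
  unfolding smooth_torus_iff
  using L.smooth_periodize[OF schwartz_windowed[OF f \<theta>]] L.periodize_periodic by blast

lemma cutoff_dominated:
  fixes \<theta> :: "'a::euclidean_space \<Rightarrow> complex"
  assumes "\<And>\<eta>. \<theta> \<eta> \<noteq> 0 \<Longrightarrow> norm \<eta> \<le> \<rho>" "\<And>\<eta>. norm (\<theta> \<eta>) \<le> 1" "0 \<le> \<rho>"
  shows "dominated (\<lambda>x. dec x ^ N) \<theta>"
  unfolding dominated_def
proof (intro exI allI)
  fix x
  show "norm (\<theta> x) \<le> (1 + \<rho>) ^ N * dec x ^ N"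
  proof (cases "\<theta> x = 0")
    case True
    then show ?thesis using assms(3) by simp
  next
    case False
    have "norm (\<theta> x) \<le> (1 + norm x) ^ N * dec x ^ N" unfolding dec_inverse_power by (rule assms(2))
    also have "\<dots> \<le> (1 + \<rho>) ^ N * dec x ^ N" using assms(1)[OF False] by (intro mult_right_mono power_mono) auto
    finally show ?thesis .
  qed
qed

text \<open>The cutoff keeps \<open>\<xi>\<close> within distance \<open>\<rho>\<close> of the
  lattice point, so decay of \<open>ft f\<close> in \<open>\<xi>\<close> becomes decay in
  \<open>\<mu>\<close>. All exchanges in \<open>bilin_mult_expansion\<close> draw their absolute
  convergence from this.\<close>

lemma cutoff_sum_finite:
  fixes \<theta> f :: "real ^ 'n \<Rightarrow> complex"
  assumes [measurable]: "\<theta> \<in> borel_measurable borel"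
    and supp: "\<And>\<eta>. \<theta> \<eta> \<noteq> 0 \<Longrightarrow> norm \<eta> \<le> \<rho>" and le1: "\<And>\<eta>. norm (\<theta> \<eta>) \<le> 1" and \<rho>: "0 \<le> \<rho>"
    and f: "schwartz f"
  shows "(\<integral>\<^sup>+\<mu>. (\<integral>\<^sup>+\<xi>. ennreal (norm (\<theta> (\<xi> - lat \<mu>) * ft f \<xi>)) \<partial>lborel) \<partial>count_space UNIV) < \<infinity>"
proof -
  define D where "D = 2 * DIM(real ^ 'n)"
  obtain C0 where C0: "\<And>x. norm (ft f x) \<le> C0 * dec x ^ D"
    using ft_decay[OF f, of D] by (auto simp: dominated_def)
  define C where "C = \<bar>C0\<bar>"
  have C: "norm (ft f x) \<le> C * dec x ^ D" for x
    by (rule order_trans[OF C0]) (auto simp: C_def intro: mult_right_mono)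
  define V where "V = emeasure lborel (cball (0 :: real ^ 'n) \<rho>)"
  have [measurable]: "cball (0 :: real ^ 'n) \<rho> \<in> sets borel" by simp
  have V: "V < \<infinity>" unfolding V_def by (rule emeasure_bounded_finite) simp
  have "(\<integral>\<^sup>+\<xi>. ennreal (norm (\<theta> (\<xi> - lat \<mu>) * ft f \<xi>)) \<partial>lborel) \<le> ennreal (C * (1 + \<rho>) ^ D) * V * L.wt D \<mu>" for \<mu>
  proof -
    have "(\<integral>\<^sup>+\<xi>. ennreal (norm (\<theta> (\<xi> - lat \<mu>) * ft f \<xi>)) \<partial>lborel)
      \<le> (\<integral>\<^sup>+\<xi>. ennreal (C * (1 + \<rho>) ^ D) * L.wt D \<mu> * indicator (cball 0 \<rho>) (\<xi> + (- lat \<mu>)) \<partial>lborel)"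
    proof (rule nn_integral_mono)
      fix \<xi>
      show "ennreal (norm (\<theta> (\<xi> - lat \<mu>) * ft f \<xi>)) \<le> ennreal (C * (1 + \<rho>) ^ D) * L.wt D \<mu> * indicator (cball 0 \<rho>) (\<xi> + (- lat \<mu>))"
      proof (cases "\<theta> (\<xi> - lat \<mu>) = 0")
        case False
        from supp[OF False] have near: "norm (\<xi> - lat \<mu>) \<le> \<rho>" .
        have "dec \<xi> ^ D \<le> (1 + norm (lat \<mu> - \<xi>)) ^ D * dec (\<xi> + (lat \<mu> - \<xi>)) ^ D" by (rule dec_shift_power)
        also have "\<dots> \<le> (1 + \<rho>) ^ D * dec (lat \<mu>) ^ D"
          using near by (auto simp: norm_minus_commute intro!: mult_mono power_mono)
        finally have dec: "dec \<xi> ^ D \<le> (1 + \<rho>) ^ D * dec (lat \<mu>) ^ D" .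
        have "norm (\<theta> (\<xi> - lat \<mu>) * ft f \<xi>) \<le> 1 * (C * dec \<xi> ^ D)"
          unfolding norm_mult by (intro mult_mono le1 C) auto
        also have "\<dots> \<le> 1 * (C * ((1 + \<rho>) ^ D * dec (lat \<mu>) ^ D))"
          using dec by (intro mult_left_mono) (auto simp: C_def)
        finally have "ennreal (norm (\<theta> (\<xi> - lat \<mu>) * ft f \<xi>)) \<le> ennreal (C * (1 + \<rho>) ^ D * dec (lat \<mu>) ^ D)"
          by (intro ennreal_leI) (simp add: mult_ac)
        also have "\<dots> = ennreal (C * (1 + \<rho>) ^ D) * L.wt D \<mu>"
          unfolding L.wt_def using \<rho> by (intro ennreal_mult) (auto simp: C_def)
        finally show ?thesis using near by (simp add: norm_minus_commute)
      qed simp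
    qed
    also have "\<dots> = (\<integral>\<^sup>+\<xi>. ennreal (C * (1 + \<rho>) ^ D) * L.wt D \<mu> * indicator (cball 0 \<rho>) (\<xi> :: real ^ 'n) \<partial>lborel)"
      by (rule lborel_nn_integral_translate[where h = "\<lambda>\<xi>. ennreal (C * (1 + \<rho>) ^ D) * L.wt D \<mu> * indicator (cball 0 \<rho>) \<xi>"]) measurable
    also have "\<dots> = ennreal (C * (1 + \<rho>) ^ D) * V * L.wt D \<mu>"
      unfolding V_def by (subst nn_integral_cmult_indicator) (simp_all add: mult_ac)
    finally show ?thesis .
  qed
  then have "(\<integral>\<^sup>+\<mu>. (\<integral>\<^sup>+\<xi>. ennreal (norm (\<theta> (\<xi> - lat \<mu>) * ft f \<xi>)) \<partial>lborel) \<partial>count_space UNIV)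
    \<le> (\<integral>\<^sup>+\<mu>. ennreal (C * (1 + \<rho>) ^ D) * V * (L.wt D :: int ^ 'n \<Rightarrow> ennreal) \<mu> \<partial>count_space UNIV)"
    by (intro nn_integral_mono)
  also have "\<dots> = ennreal (C * (1 + \<rho>) ^ D) * V * (\<integral>\<^sup>+\<mu>. (L.wt D :: int ^ 'n \<Rightarrow> ennreal) \<mu> \<partial>count_space UNIV)"
    by (rule nn_integral_cmult) simp
  also have "\<dots> < \<infinity>"
    using V L.wt_sum_finite[of D] by (auto simp: D_def ennreal_mult_less_top)
  finally show ?thesis .
qed

lemma nn_integral_lborel_pair:
  fixes f g :: "'a::euclidean_space \<Rightarrow> ennreal"
  assumes [measurable]: "f \<in> borel_measurable borel" "g \<in> borel_measurable borel"
  shows "(\<integral>\<^sup>+z. f (fst z) * g (snd z) \<partial>lborel) = (\<integral>\<^sup>+x. f x \<partial>lborel) * (\<integral>\<^sup>+y. g y \<partial>lborel)"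
proof -
  have "(\<integral>\<^sup>+z. f (fst z) * g (snd z) \<partial>lborel) = (\<integral>\<^sup>+z. f (fst z) * g (snd z) \<partial>(lborel \<Otimes>\<^sub>M lborel))"
    by (simp add: lborel_prod)
  also have "\<dots> = (\<integral>\<^sup>+x. (\<integral>\<^sup>+y. f x * g y \<partial>lborel) \<partial>lborel)"
    by (subst lborel.nn_integral_fst[symmetric]) (auto simp del: lborel_prod)
  also have "\<dots> = (\<integral>\<^sup>+x. f x \<partial>lborel) * (\<integral>\<^sup>+y. g y \<partial>lborel)"
    by (simp add: nn_integral_cmult nn_integral_multc)
  finally show ?thesis .
qed

text \<open>The operator is written with an integral over \<open>\<xi>\<close> and sums over
  \<open>\<mu>\<close> and \<open>\<nu>\<close>. Integrating over \<open>\<xi>\<close> first turns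
  each term into a product of two Fourier coefficients of periodized windowed functions; summing
  over \<open>\<mu>\<close> then produces the periodic operator at \<open>z\<close>.\<close>

theorem bilin_mult_expansion:
  fixes \<Phi> :: "(real ^ 'n) \<times> (real ^ 'n) \<Rightarrow> complex" and \<theta> :: "real ^ 'n \<Rightarrow> complex"
  assumes \<Phi>: "schwartz \<Phi>" and supp: "\<And>\<xi>. \<Phi> \<xi> \<noteq> 0 \<Longrightarrow> norm \<xi> \<le> r"
    and \<theta>_borel: "\<theta> \<in> borel_measurable borel"
    and one: "\<And>\<eta>. norm \<eta> \<le> r \<Longrightarrow> \<theta> \<eta> = 1" and zero: "\<And>\<eta>. \<theta> \<eta> \<noteq> 0 \<Longrightarrow> norm \<eta> \<le> r + 2"
    and le1: "\<And>\<eta>. norm (\<theta> \<eta>) \<le> 1" and \<theta>: "schwartz (ft \<theta>)"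
    and r: "0 \<le> r" and R: "R = 2 * r + 3" and a: "\<And>\<mu>. norm (a \<mu>) \<le> A"
    and f: "schwartz f1" "schwartz f2"
  shows "bilin_mult (lattice_symbol a \<Phi>) f1 f2 (lat k + z) = (LINT \<nu>|count_space UNIV. sampling_coeff R \<Phi> z \<nu> *
     bilin_period a (L.periodize (windowed \<theta> f1 (lat k + (1 / R) *\<^sub>R lat (fst \<nu>))))
       (L.periodize (windowed \<theta> f2 (lat k + (1 / R) *\<^sub>R lat (snd \<nu>)))) z)"
proof -
  have R0: "R \<noteq> 0" using r R by auto
  note [measurable] = schwartz_borel[OF \<Phi>] \<theta>_borel schwartz_borel[OF f(1)] schwartz_borel[OF f(2)]
    borel_measurable_fst borel_measurable_snd
  have int\<theta>: "integrable lborel \<theta>"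
    by (rule integrable_dominated[OF \<theta>_borel cutoff_dominated[OF zero le1, where N = "2 * DIM(real ^ 'n)"]]) (use r in auto)
  define c where "c = sampling_coeff R \<Phi> z"
  have intc: "integrable (count_space UNIV) c" unfolding c_def by (rule sampling_coeff_integrable[OF \<Phi> R0])
  have finc: "(\<integral>\<^sup>+\<nu>. ennreal (norm (c \<nu>)) \<partial>count_space UNIV) < \<infinity>"
    using intc unfolding integrable_iff_bounded by blast
  have A: "0 \<le> A" using a[of 0] norm_ge_zero order_trans by blast
  define w where "w \<nu> = lat k + (1 / R) *\<^sub>R lat \<nu>" for \<nu>
  \<comment> \<open>This is \<open>E\<close> below without its phase. The integrals \<open>S\<close>
    therefore do not depend on \<open>k\<close> or \<open>\<nu>\<close>, and one summable bound
    serves all exchanges.\<close>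
  define Q where "Q f \<mu> \<xi> = \<theta> (\<xi> - lat \<mu>) * ft f \<xi>" for f \<mu> \<xi>
  have [measurable]: "Q f1 \<mu> \<in> borel_measurable borel" "Q f2 \<mu> \<in> borel_measurable borel" for \<mu>
    unfolding Q_def by measurable
  define S where "S f \<mu> = (\<integral>\<^sup>+\<xi>. ennreal (norm (Q f \<mu> \<xi>)) \<partial>lborel)" for f \<mu>
  have finS: "(\<integral>\<^sup>+\<mu>. S f \<mu> \<partial>count_space UNIV) < \<infinity>" if "schwartz f" for f
    unfolding S_def Q_def by (rule cutoff_sum_finite[OF \<theta>_borel zero le1 _ that]) (use r in auto)
  have S1: "S f \<mu> < \<infinity>" if "schwartz f" for f \<mu>
  proof -
    have "S f \<mu> = (\<integral>\<^sup>+m. S f \<mu> * indicator {\<mu>} m \<partial>count_space UNIV)" by (simp add: nn_integral_cmult_indicator)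
    also have "\<dots> \<le> (\<integral>\<^sup>+\<mu>. S f \<mu> \<partial>count_space UNIV)" by (intro nn_integral_mono) (auto simp: indicator_def)
    also have "\<dots> < \<infinity>" by (rule finS[OF that])
    finally show ?thesis .
  qed
  define E where "E f \<nu> \<mu> \<xi> = ech (w \<nu> \<bullet> (\<xi> - lat \<mu>)) * \<theta> (\<xi> - lat \<mu>) * ft f \<xi>" for f \<nu> \<mu> \<xi>
  have normE: "norm (E f \<nu> \<mu> \<xi>) = norm (Q f \<mu> \<xi>)" for f \<nu> \<mu> \<xi> by (simp add: E_def Q_def norm_mult)
  have [measurable]: "E f1 \<nu> \<mu> \<in> borel_measurable borel" "E f2 \<nu> \<mu> \<in> borel_measurable borel" for \<nu> \<mu>
    unfolding E_def by measurable
  have intE: "integrable lborel (E f1 \<nu> \<mu>)" "integrable lborel (E f2 \<nu> \<mu>)" for \<nu> \<mu>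
    using S1[OF f(1)] S1[OF f(2)] by (auto intro!: integrableI_bounded simp: normE S_def)
  define F where "F f \<nu> = L.periodize (windowed \<theta> f (w \<nu>))" for f \<nu>
  have coeffF: "L.coeff (F f \<nu>) \<mu> = (LINT \<xi>|lborel. E f \<nu> \<mu> \<xi>)" if fs: "schwartz f" for f \<nu> \<mu>
  proof -
    have "L.coeff (F f \<nu>) \<mu> = ft (windowed \<theta> f (w \<nu>)) (lat \<mu>)"
      unfolding L.coeff_def F_def by (rule L.coeff_periodize[OF schwartz_windowed[OF fs \<theta>]])
    also have "\<dots> = (LINT \<xi>|lborel. E f \<nu> \<mu> \<xi>)"
      unfolding windowed_def[abs_def] E_def by (rule ft_product[OF schwartz_integrable[OF fs] int\<theta>])
    finally show ?thesis .
  qed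
  obtain M where M: "\<And>\<xi>. norm (\<Phi> \<xi>) \<le> M" using schwartz_dominated[OF \<Phi>, of 0] by (auto simp: dominated_def)
  have M0: "0 \<le> M" using M[of 0] norm_ge_zero order_trans by blast
  \<comment> \<open>Bounding \<open>\<Phi>\<close> by the cutoffs turns integrals over pairs of
    frequencies into products of the one-variable integrals \<open>S\<close>.\<close>
  have norm\<Phi>: "norm (\<Phi> \<eta>) \<le> M * (norm (\<theta> (fst \<eta>)) * norm (\<theta> (snd \<eta>)))" for \<eta>
  proof (cases "\<Phi> \<eta> = 0")
    case False
    then have "norm \<eta> \<le> r" by (rule supp)
    then have "norm (fst \<eta>) \<le> r" "norm (snd \<eta>) \<le> r"
      using norm_fst_le[of "fst \<eta>" "snd \<eta>"] norm_snd_le[of "snd \<eta>" "fst \<eta>"] by auto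
    then show ?thesis using M by (simp add: one)
  qed (use M0 in simp)
  define x where "x = lat k + z"
  define G1 where "G1 \<mu> \<xi> = ech (x \<bullet> (fst \<xi> + snd \<xi>)) * (a \<mu> * \<Phi> (\<xi> - lat2 \<mu>)) * ft f1 (fst \<xi>) * ft f2 (snd \<xi>)" for \<mu> \<xi>
  define b where "b \<mu> = ech (z \<bullet> (lat (fst \<mu>) + lat (snd \<mu>))) * a \<mu>" for \<mu>
  define G2 where "G2 \<mu> \<nu> \<xi> = b \<mu> * c \<nu> * (E f1 (fst \<nu>) (fst \<mu>) (fst \<xi>) * E f2 (snd \<nu>) (snd \<mu>) (snd \<xi>))" for \<mu> \<nu> \<xi>
  have normb: "norm (b \<mu>) \<le> A" for \<mu> using a by (simp add: b_def norm_mult)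
  have pairS: "(\<integral>\<^sup>+\<xi>. ennreal (norm (Q f1 m1 (fst \<xi>))) * ennreal (norm (Q f2 m2 (snd \<xi>))) \<partial>lborel) = S f1 m1 * S f2 m2" for m1 m2
    unfolding S_def by (rule nn_integral_lborel_pair) measurable
  have sumS: "(\<integral>\<^sup>+\<mu>. S f1 (fst \<mu>) * S f2 (snd \<mu>) \<partial>count_space UNIV) < \<infinity>"
    unfolding nn_integral_pair_count using finS[OF f(1)] finS[OF f(2)] by (simp add: ennreal_mult_less_top)
  have G12: "G1 \<mu> \<xi> = (LINT \<nu>|count_space UNIV. G2 \<mu> \<nu> \<xi>)" for \<mu> \<xi>
  proof -
    obtain m1 m2 where \<mu>: "\<mu> = (m1, m2)" by fastforce
    obtain x1 x2 where \<xi>: "\<xi> = (x1, x2)" by fastforce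
    define \<eta> where "\<eta> = (x1 - lat m1, x2 - lat m2)"
    \<comment> \<open>The factorisation of the character for \<open>x = lat k + z\<close>; the
      integers \<open>lat k \<bullet> lat m1\<close> and \<open>lat k \<bullet> lat m2\<close> drop
      out.\<close>
    have kz: "ech (x \<bullet> (x1 + x2)) = ech (z \<bullet> (lat m1 + lat m2)) * ech (z \<bullet> (fst \<eta> + snd \<eta>)) * (ech (lat k \<bullet> fst \<eta>) * ech (lat k \<bullet> snd \<eta>))"
    proof -
      have "x \<bullet> (x1 + x2) = z \<bullet> (lat m1 + lat m2) + z \<bullet> (fst \<eta> + snd \<eta>) + (lat k \<bullet> fst \<eta> + lat k \<bullet> snd \<eta>) + (lat k \<bullet> lat m1 + lat k \<bullet> lat m2)"
        by (simp add: x_def \<eta>_def inner_add_left inner_add_right inner_diff_right)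
      then show ?thesis by (simp only: ech_add L.ech_inner mult_1_right)
    qed
    have "G1 \<mu> \<xi> = b \<mu> * (ech (lat k \<bullet> fst \<eta>) * ech (lat k \<bullet> snd \<eta>)) * (ft f1 x1 * ft f2 x2) * (\<Phi> \<eta> * ech (z \<bullet> (fst \<eta> + snd \<eta>)))"
      unfolding G1_def \<mu> \<xi> fst_conv snd_conv kz by (simp add: b_def \<mu> \<eta>_def)
    also have "\<dots> = (LINT \<nu>|count_space UNIV. b \<mu> * (ech (lat k \<bullet> fst \<eta>) * ech (lat k \<bullet> snd \<eta>)) * (ft f1 x1 * ft f2 x2) *
      (c \<nu> * ((ech (((1 / R) *\<^sub>R lat (fst \<nu>)) \<bullet> fst \<eta>) * \<theta> (fst \<eta>)) * (ech (((1 / R) *\<^sub>R lat (snd \<nu>)) \<bullet> snd \<eta>) * \<theta> (snd \<eta>)))))"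
    proof -
      have "\<Phi> \<eta> * ech (z \<bullet> (fst \<eta> + snd \<eta>)) = (LINT \<nu>|count_space UNIV. c \<nu> *
          ((ech (((1 / R) *\<^sub>R lat (fst \<nu>)) \<bullet> fst \<eta>) * \<theta> (fst \<eta>)) * (ech (((1 / R) *\<^sub>R lat (snd \<nu>)) \<bullet> snd \<eta>) * \<theta> (snd \<eta>))))"
        unfolding c_def by (rule symbol_expansion[OF \<Phi> supp one zero r R])
      then show ?thesis by (simp only: integral_mult_right_zero)
    qed
    also have "\<dots> = (LINT \<nu>|count_space UNIV. G2 \<mu> \<nu> \<xi>)"
    proof (rule Bochner_Integration.integral_cong[OF refl])
      fix \<nu>
      have "E f1 (fst \<nu>) m1 x1 = ech (lat k \<bullet> fst \<eta>) * ech (((1 / R) *\<^sub>R lat (fst \<nu>)) \<bullet> fst \<eta>) * \<theta> (fst \<eta>) * ft f1 x1"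
        "E f2 (snd \<nu>) m2 x2 = ech (lat k \<bullet> snd \<eta>) * ech (((1 / R) *\<^sub>R lat (snd \<nu>)) \<bullet> snd \<eta>) * \<theta> (snd \<eta>) * ft f2 x2"
        unfolding E_def w_def \<eta>_def fst_conv snd_conv inner_add_left ech_add by (rule refl)+
      then show "b \<mu> * (ech (lat k \<bullet> fst \<eta>) * ech (lat k \<bullet> snd \<eta>)) * (ft f1 x1 * ft f2 x2) *
      (c \<nu> * ((ech (((1 / R) *\<^sub>R lat (fst \<nu>)) \<bullet> fst \<eta>) * \<theta> (fst \<eta>)) * (ech (((1 / R) *\<^sub>R lat (snd \<nu>)) \<bullet> snd \<eta>) * \<theta> (snd \<eta>)))) = G2 \<mu> \<nu> \<xi>"
        unfolding G2_def \<mu> \<xi> fst_conv snd_conv by (simp only: mult_ac)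
    qed
    finally show ?thesis .
  qed
  have "bilin_mult (lattice_symbol a \<Phi>) f1 f2 x = (LINT \<xi>|lborel. (LINT \<mu>|count_space UNIV. G1 \<mu> \<xi>))"
    unfolding bilin_mult_eq[OF lattice_symbol_borel[OF \<Phi> a] f] lattice_symbol_eq[OF \<Phi> a] G1_def
    by (simp only: integral_mult_right_zero integral_mult_left_zero)
  also have "\<dots> = (LINT \<mu>|count_space UNIV. (LINT \<xi>|lborel. G1 \<mu> \<xi>))"
  proof (rule integral_sum_swap)
    show "G1 \<mu> \<in> borel_measurable lborel" for \<mu> unfolding G1_def by measurable
    have "(\<integral>\<^sup>+\<xi>. ennreal (norm (G1 \<mu> \<xi>)) \<partial>lborel) \<le> ennreal (A * M) * (S f1 (fst \<mu>) * S f2 (snd \<mu>))" for \<mu>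
    proof -
      have "(\<integral>\<^sup>+\<xi>. ennreal (norm (G1 \<mu> \<xi>)) \<partial>lborel)
        \<le> (\<integral>\<^sup>+\<xi>. ennreal (A * M) * (ennreal (norm (Q f1 (fst \<mu>) (fst \<xi>))) * ennreal (norm (Q f2 (snd \<mu>) (snd \<xi>)))) \<partial>lborel)"
      proof (rule nn_integral_mono)
        fix \<xi>
        have "norm (G1 \<mu> \<xi>) = norm (a \<mu>) * norm (\<Phi> (\<xi> - lat2 \<mu>)) * (norm (ft f1 (fst \<xi>)) * norm (ft f2 (snd \<xi>)))"
          by (simp add: G1_def norm_mult)
        also have "\<dots> \<le> A * (M * (norm (\<theta> (fst (\<xi> - lat2 \<mu>))) * norm (\<theta> (snd (\<xi> - lat2 \<mu>))))) * (norm (ft f1 (fst \<xi>)) * norm (ft f2 (snd \<xi>)))"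
          by (intro mult_right_mono mult_mono a norm\<Phi>) (use A in auto)
        also have "\<dots> = (A * M) * (norm (Q f1 (fst \<mu>) (fst \<xi>)) * norm (Q f2 (snd \<mu>) (snd \<xi>)))"
          by (cases \<xi>; cases \<mu>) (simp add: Q_def norm_mult mult_ac)
        finally show "ennreal (norm (G1 \<mu> \<xi>)) \<le> ennreal (A * M) * (ennreal (norm (Q f1 (fst \<mu>) (fst \<xi>))) * ennreal (norm (Q f2 (snd \<mu>) (snd \<xi>))))"
          using A M0 by (simp add: ennreal_mult[symmetric] ennreal_leI)
      qed
      also have "\<dots> = ennreal (A * M) * (S f1 (fst \<mu>) * S f2 (snd \<mu>))"
        by (subst nn_integral_cmult) (simp_all add: pairS)
      finally show ?thesis .
    qed
    then have "(\<integral>\<^sup>+\<mu>. (\<integral>\<^sup>+\<xi>. ennreal (norm (G1 \<mu> \<xi>)) \<partial>lborel) \<partial>count_space UNIV)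
      \<le> (\<integral>\<^sup>+\<mu>. ennreal (A * M) * (S f1 (fst \<mu>) * S f2 (snd \<mu>)) \<partial>count_space UNIV)" by (intro nn_integral_mono)
    also have "\<dots> < \<infinity>" using sumS by (subst nn_integral_cmult) (auto simp: ennreal_mult_less_top)
    finally show "(\<integral>\<^sup>+\<mu>. (\<integral>\<^sup>+\<xi>. ennreal (norm (G1 \<mu> \<xi>)) \<partial>lborel) \<partial>count_space UNIV) < \<infinity>" .
  qed (rule sigma_finite_lborel)
  also have "\<dots> = (LINT \<mu>|count_space UNIV. (LINT \<nu>|count_space UNIV. (LINT \<xi>|lborel. G2 \<mu> \<nu> \<xi>)))"
  proof (rule Bochner_Integration.integral_cong[OF refl])
    fix \<mu>
    show "(LINT \<xi>|lborel. G1 \<mu> \<xi>) = (LINT \<nu>|count_space UNIV. (LINT \<xi>|lborel. G2 \<mu> \<nu> \<xi>))"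
      unfolding G12
    proof (rule integral_sum_swap)
      show "G2 \<mu> \<nu> \<in> borel_measurable lborel" for \<nu> unfolding G2_def by measurable
      have "(\<integral>\<^sup>+\<xi>. ennreal (norm (G2 \<mu> \<nu> \<xi>)) \<partial>lborel) = ennreal (norm (b \<mu>)) * (S f1 (fst \<mu>) * S f2 (snd \<mu>)) * ennreal (norm (c \<nu>))" for \<nu>
      proof -
        have "(\<integral>\<^sup>+\<xi>. ennreal (norm (G2 \<mu> \<nu> \<xi>)) \<partial>lborel) = (\<integral>\<^sup>+\<xi>. ennreal (norm (b \<mu>) * norm (c \<nu>)) *
            (ennreal (norm (Q f1 (fst \<mu>) (fst \<xi>))) * ennreal (norm (Q f2 (snd \<mu>) (snd \<xi>)))) \<partial>lborel)"
          by (simp add: G2_def norm_mult normE ennreal_mult mult_ac)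
        also have "\<dots> = ennreal (norm (b \<mu>) * norm (c \<nu>)) * (S f1 (fst \<mu>) * S f2 (snd \<mu>))"
          by (subst nn_integral_cmult) (simp_all add: pairS)
        finally show ?thesis by (simp add: ennreal_mult mult_ac)
      qed
      then show "(\<integral>\<^sup>+\<nu>. (\<integral>\<^sup>+\<xi>. ennreal (norm (G2 \<mu> \<nu> \<xi>)) \<partial>lborel) \<partial>count_space UNIV) < \<infinity>"
        using finc S1[OF f(1)] S1[OF f(2)] by (simp add: nn_integral_cmult ennreal_mult_less_top)
    qed (rule sigma_finite_lborel)
  qed
  also have "\<dots> = (LINT \<mu>|count_space UNIV. (LINT \<nu>|count_space UNIV.
      b \<mu> * c \<nu> * (L.coeff (F f1 (fst \<nu>)) (fst \<mu>) * L.coeff (F f2 (snd \<nu>)) (snd \<mu>))))"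
    unfolding G2_def by (simp add: integral_lborel_pair(2)[OF intE] coeffF f)
  \<comment> \<open>After this exchange the inner sum over \<open>\<mu>\<close> is, for fixed
    \<open>\<nu>\<close>, the series of the periodic operator.\<close>
  also have "\<dots> = (LINT \<nu>|count_space UNIV. (LINT \<mu>|count_space UNIV.
      b \<mu> * c \<nu> * (L.coeff (F f1 (fst \<nu>)) (fst \<mu>) * L.coeff (F f2 (snd \<nu>)) (snd \<mu>))))"
  proof (rule integral_sum_swap[symmetric])
    show "sigma_finite_measure (count_space (UNIV :: ((int ^ 'n) \<times> (int ^ 'n)) set))"
      by (rule sigma_finite_measure_count_space_countable) simp
    have coeff_le: "ennreal (norm (L.coeff (F f \<nu>) \<mu>)) \<le> S f \<mu>" if fs: "schwartz f" for f \<nu> \<mu>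
      unfolding coeffF[OF fs] S_def
      using integral_norm_bound_ennreal[of lborel "E f \<nu> \<mu>"] S1[OF fs, of \<mu>]
      by (cases "integrable lborel (E f \<nu> \<mu>)") (auto simp: normE not_integrable_integral_eq)
    have "(\<integral>\<^sup>+\<mu>. (\<integral>\<^sup>+\<nu>. ennreal (norm (b \<mu> * c \<nu> * (L.coeff (F f1 (fst \<nu>)) (fst \<mu>) * L.coeff (F f2 (snd \<nu>)) (snd \<mu>)))) \<partial>count_space UNIV) \<partial>count_space UNIV)
      \<le> (\<integral>\<^sup>+\<mu>. (\<integral>\<^sup>+\<nu>. ennreal (A * norm (c \<nu>)) * (S f1 (fst \<mu>) * S f2 (snd \<mu>)) \<partial>count_space UNIV) \<partial>count_space UNIV)"
    proof (intro nn_integral_mono)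
      fix \<mu> \<nu>
      have "ennreal (norm (b \<mu> * c \<nu> * (L.coeff (F f1 (fst \<nu>)) (fst \<mu>) * L.coeff (F f2 (snd \<nu>)) (snd \<mu>))))
        = ennreal (norm (b \<mu>) * norm (c \<nu>)) * (ennreal (norm (L.coeff (F f1 (fst \<nu>)) (fst \<mu>))) * ennreal (norm (L.coeff (F f2 (snd \<nu>)) (snd \<mu>))))"
        by (simp add: norm_mult ennreal_mult)
      also have "\<dots> \<le> ennreal (A * norm (c \<nu>)) * (S f1 (fst \<mu>) * S f2 (snd \<mu>))"
        by (intro mult_mono coeff_le f ennreal_leI normb) (use A in auto)
      finally show "ennreal (norm (b \<mu> * c \<nu> * (L.coeff (F f1 (fst \<nu>)) (fst \<mu>) * L.coeff (F f2 (snd \<nu>)) (snd \<mu>))))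
        \<le> ennreal (A * norm (c \<nu>)) * (S f1 (fst \<mu>) * S f2 (snd \<mu>))" .
    qed
    also have "\<dots> = ennreal A * (\<integral>\<^sup>+\<nu>. ennreal (norm (c \<nu>)) \<partial>count_space UNIV) * (\<integral>\<^sup>+\<mu>. S f1 (fst \<mu>) * S f2 (snd \<mu>) \<partial>count_space UNIV)"
      using A by (simp add: nn_integral_cmult nn_integral_multc ennreal_mult)
    also have "\<dots> < \<infinity>" using finc sumS by (simp add: ennreal_mult_less_top)
    finally show "(\<integral>\<^sup>+\<mu>. (\<integral>\<^sup>+\<nu>. ennreal (norm (b \<mu> * c \<nu> * (L.coeff (F f1 (fst \<nu>)) (fst \<mu>) * L.coeff (F f2 (snd \<nu>)) (snd \<mu>)))) \<partial>count_space UNIV) \<partial>count_space UNIV) < \<infinity>" .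
  qed simp
  also have "\<dots> = (LINT \<nu>|count_space UNIV. c \<nu> * bilin_period a (F f1 (fst \<nu>)) (F f2 (snd \<nu>)) z)"
  proof (rule Bochner_Integration.integral_cong[OF refl])
    fix \<nu>
    have st: "smooth_torus (F f1 (fst \<nu>))" "smooth_torus (F f2 (snd \<nu>))"
      unfolding F_def by (intro smooth_torus_windowed f \<theta>)+
    have "c \<nu> * bilin_period a (F f1 (fst \<nu>)) (F f2 (snd \<nu>)) z
      = (LINT \<mu>|count_space UNIV. c \<nu> * (b \<mu> * (L.coeff (F f1 (fst \<nu>)) (fst \<mu>) * L.coeff (F f2 (snd \<nu>)) (snd \<mu>))))"
      unfolding bilin_period_eq[OF st a] b_def by (simp only: integral_mult_right_zero)
    then show "(LINT \<mu>|count_space UNIV. b \<mu> * c \<nu> * (L.coeff (F f1 (fst \<nu>)) (fst \<mu>) * L.coeff (F f2 (snd \<nu>)) (snd \<mu>)))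
      = c \<nu> * bilin_period a (F f1 (fst \<nu>)) (F f2 (snd \<nu>)) z" by (simp only: mult_ac)
  qed
  finally show ?thesis unfolding x_def c_def F_def w_def .
qed

section \<open>The upper estimate\<close>

text \<open>Phrased for all large \<open>N\<close>, so that one \<open>N\<close> can serve several
  exponents at once.\<close>

lemma (in lattice) wt_eventually:
  assumes p: "0 < p"
  shows "\<exists>N0. \<forall>N\<ge>N0. (\<integral>\<^sup>+k. wt N k \<partial>count_space UNIV) < \<infinity> \<and> weight_const p (wt N) < \<infinity>"
proof -
  obtain N1 :: nat where N1: "2 * real DIM('a) / enn2real p \<le> real N1" using real_arch_simple by blast
  have "(\<integral>\<^sup>+k. wt N k \<partial>count_space UNIV) < \<infinity> \<and> weight_const p (wt N) < \<infinity>" if N: "N \<ge> N1 + 2 * DIM('a)" for N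
  proof
    show "(\<integral>\<^sup>+k. wt N k \<partial>count_space UNIV) < \<infinity>" by (rule wt_sum_finite) (use N in simp)
    show "weight_const p (wt N) < \<infinity>"
    proof (rule weight_const_wt_finite[OF p])
      assume "p \<noteq> \<infinity>"
      then have r: "0 < enn2real p" by (rule enn2real_exponent[OF p])
      have "2 * real DIM('a) / enn2real p \<le> real N" using N1 N by linarith
      then show "2 * real DIM('a) \<le> real N * enn2real p" using r by (simp add: field_simps)
    qed
  qed
  then show ?thesis by blast
qed

section \<open>Local norms and periodized windows\<close>

definition local_norm :: "ennreal \<Rightarrow> (real ^ 'n \<Rightarrow> complex) \<Rightarrow> int ^ 'n \<Rightarrow> ennreal" where
  "local_norm p f m = Lp_norm p cubeM (\<lambda>x. ennreal (norm (f (x + lat m))))"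

lemma amalgam_norm_local:
  fixes f :: "real ^ 'n \<Rightarrow> complex"
  shows "f \<in> borel_measurable borel \<Longrightarrow> amalgam_norm p q f = Lp_norm q (count_space UNIV) (local_norm p f)"
  by (simp add: amalgam_norm_eq local_norm_def[abs_def])

text \<open>Displacing the window by \<open>(1 / R) *\<^sub>R v\<close> costs a polynomial in
  \<open>v\<close>, which the decay of the sampling coefficients has to pay for later.\<close>

lemma norm_power_dec_shift:
  fixes y v :: "'a::euclidean_space"
  assumes y: "y \<in> cube" and R: "1 \<le> R"
  shows "dec (x + (y - (1 / R) *\<^sub>R v)) ^ N \<le> (1 + real DIM('a)) ^ N * (1 + norm v) ^ N * dec x ^ N"
proof -
  have "norm (y - (1 / R) *\<^sub>R v) \<le> norm y + norm ((1 / R) *\<^sub>R v)" by (rule norm_triangle_ineq4)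
  also have "norm ((1 / R) *\<^sub>R v) \<le> norm v" 
    using R mult_left_mono[of 1 R "norm v"] by (simp add: divide_le_eq)
  finally have "1 + norm (y - (1 / R) *\<^sub>R v) \<le> 1 + real DIM('a) + norm v" using norm_cube_le[OF y] by simp
  also have "\<dots> \<le> (1 + real DIM('a)) * (1 + norm v)" by (simp add: algebra_simps)
  finally have "(1 + norm (y - (1 / R) *\<^sub>R v)) ^ N \<le> ((1 + real DIM('a)) * (1 + norm v)) ^ N"
    by (rule power_mono) simp
  then have "(1 + norm (y - (1 / R) *\<^sub>R v)) ^ N * dec x ^ N \<le> ((1 + real DIM('a)) * (1 + norm v)) ^ N * dec x ^ N"
    by (rule mult_right_mono) simp
  from order_trans[OF dec_shift_power'[of x "y - (1 / R) *\<^sub>R v" N] this] show ?thesis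
    by (simp only: power_mult_distrib)
qed

lemma wt_cube: "L.wt N k ^ 3 = ennreal (dec (lat k) ^ (3 * N))"
  by (simp add: L.wt_def ennreal_power power_mult mult.commute[of 3])

lemma weight_const_reflect:
  "weight_const p (\<lambda>m::int ^ 'n. L.wt N (k - m)) = weight_const p (L.wt N :: int ^ 'n \<Rightarrow> ennreal)"
  unfolding weight_const_def
  using nn_integral_bij_count_space[OF L.bij_minus[of k], of "\<lambda>m. epowr (L.wt N m) (enn2real p)"] by simp

text \<open>On the cube the periodization is a sum of pieces of \<open>f\<close> over all cubes
  \<open>m\<close>, weighted by the decay of the window in \<open>k - m\<close>. The order
  \<open>3 * N\<close> is what \<open>Lp_norm_weighted_sum\<close> consumes, and it reappears as
  growth in \<open>\<nu>\<close>.\<close>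

lemma torus_norm_windowed:
  fixes \<theta> :: "real ^ 'n \<Rightarrow> complex"
  assumes \<theta>: "schwartz (ft \<theta>)" and R: "1 \<le> R" and p: "0 < p"
    and N: "(\<integral>\<^sup>+k. L.wt N (k :: int ^ 'n) \<partial>count_space UNIV) < \<infinity>" "weight_const p (L.wt N :: int ^ 'n \<Rightarrow> ennreal) < \<infinity>"
  shows "\<exists>C<\<infinity>. \<forall>f k \<nu>. schwartz f \<longrightarrow>
    torus_norm p (L.periodize (windowed \<theta> f (lat k + (1 / R) *\<^sub>R lat \<nu>)))
      \<le> C * ennreal ((1 + norm (lat \<nu>)) ^ (3 * N)) * (SUP m. L.wt N (k - m) * local_norm p f m)"
proof -
  obtain C0 where C0: "\<And>x. norm (ft \<theta> x) \<le> C0 * dec x ^ (3 * N)"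
    using schwartz_dominated[OF \<theta>, of "3 * N"] by (auto simp: dominated_def)
  define K where "K = \<bar>C0\<bar> * (1 + real DIM(real ^ 'n)) ^ (3 * N)"
  have K: "0 \<le> K" by (simp add: K_def)
  define S where "S = (\<integral>\<^sup>+k. L.wt N (k :: int ^ 'n) \<partial>count_space UNIV) * weight_const p (L.wt N :: int ^ 'n \<Rightarrow> ennreal)"
  have "torus_norm p (L.periodize (windowed \<theta> f (lat k + (1 / R) *\<^sub>R lat \<nu>)))
      \<le> ennreal K * S * ennreal ((1 + norm (lat \<nu>)) ^ (3 * N)) * (SUP m. L.wt N (k - m) * local_norm p f m)"
    if f: "schwartz f" for f k \<nu>
  proof -
    define w where "w = lat k + (1 / R) *\<^sub>R lat \<nu>"
    define F where "F = L.periodize (windowed \<theta> f w)"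
    define V where "V = (1 + norm (lat \<nu>)) ^ (3 * N)"
    have V: "0 \<le> V" by (simp add: V_def)
    have [measurable]: "f \<in> borel_measurable borel" by (rule schwartz_borel[OF f])
    have "smooth F" using smooth_torus_windowed[OF f \<theta>] by (simp add: F_def smooth_torus_def)
    then have F_borel: "F \<in> borel_measurable borel" by (rule smooth_borel)
    define g where "g m y = ennreal (norm (f (y + lat m)))" for m y
    have g_meas: "g m \<in> borel_measurable cubeM" for m
      unfolding g_def by (intro borel_measurable_cubeM) measurable
    have pw: "ennreal (norm (F y)) \<le> ennreal (K * V) * (\<integral>\<^sup>+m. L.wt N (k - m) ^ 3 * g m y \<partial>count_space UNIV)"
      if y: "y \<in> cube" for y
    proof -
      have "ennreal (norm (F y)) \<le> (\<integral>\<^sup>+m. ennreal (norm (windowed \<theta> f w (y + lat m))) \<partial>count_space UNIV)"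
        unfolding F_def L.periodize_def by (rule norm_LINT_le_nn_integral)
      also have "\<dots> \<le> (\<integral>\<^sup>+m. ennreal (K * V) * (L.wt N (k - m) ^ 3 * g m y) \<partial>count_space UNIV)"
      proof (rule nn_integral_mono)
        fix m
        have arg: "y + lat m - w = lat (m - k) + (y - (1 / R) *\<^sub>R lat \<nu>)" by (simp add: w_def L.diff)
        have "norm (ft \<theta> (y + lat m - w)) \<le> \<bar>C0\<bar> * dec (y + lat m - w) ^ (3 * N)"
          by (rule order_trans[OF C0]) (auto intro: mult_right_mono)
        also have "\<dots> \<le> \<bar>C0\<bar> * ((1 + real DIM(real ^ 'n)) ^ (3 * N) * V * dec (lat (m - k)) ^ (3 * N))"
          unfolding arg V_def by (intro mult_left_mono norm_power_dec_shift y R) auto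
        also have "\<dots> = K * V * dec (lat (k - m)) ^ (3 * N)"
          using L.minus[of "k - m"] by (simp add: K_def mult_ac)
        finally have "norm (windowed \<theta> f w (y + lat m)) \<le> norm (f (y + lat m)) * (K * V * dec (lat (k - m)) ^ (3 * N))"
          unfolding windowed_def norm_mult by (rule mult_left_mono) simp
        also have "\<dots> = K * V * (dec (lat (k - m)) ^ (3 * N) * norm (f (y + lat m)))" by (simp only: mult_ac)
        finally have "ennreal (norm (windowed \<theta> f w (y + lat m))) \<le> ennreal (K * V * (dec (lat (k - m)) ^ (3 * N) * norm (f (y + lat m))))"
          by (rule ennreal_leI)
        also have "\<dots> = ennreal (K * V) * (L.wt N (k - m) ^ 3 * g m y)"
          unfolding wt_cube g_def using K V by (simp add: ennreal_mult)
        finally show "ennreal (norm (windowed \<theta> f w (y + lat m))) \<le> ennreal (K * V) * (L.wt N (k - m) ^ 3 * g m y)" .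
      qed
      also have "\<dots> = ennreal (K * V) * (\<integral>\<^sup>+m. L.wt N (k - m) ^ 3 * g m y \<partial>count_space UNIV)"
        by (rule nn_integral_cmult) simp
      finally show ?thesis .
    qed
    have meas: "(\<lambda>y. \<integral>\<^sup>+m. L.wt N (k - m) ^ 3 * g m y \<partial>count_space UNIV) \<in> borel_measurable cubeM"
      by (rule borel_measurable_nn_integral_count_space) (use g_meas in measurable)
    have "torus_norm p F = Lp_norm p cubeM (\<lambda>y. ennreal (norm (F y)))" by (rule torus_norm_eq[OF F_borel])
    also have "\<dots> \<le> Lp_norm p cubeM (\<lambda>y. ennreal (K * V) * (\<integral>\<^sup>+m. L.wt N (k - m) ^ 3 * g m y \<partial>count_space UNIV))"
      by (rule Lp_norm_mono[OF p]) (use pw borel_measurable_cubeM[OF F_borel] in auto)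
    also have "\<dots> \<le> ennreal (K * V) * Lp_norm p cubeM (\<lambda>y. \<integral>\<^sup>+m. L.wt N (k - m) ^ 3 * g m y \<partial>count_space UNIV)"
      by (rule Lp_norm_cmult[OF p meas])
    also have "\<dots> \<le> ennreal (K * V) * ((\<integral>\<^sup>+m. L.wt N (k - m) \<partial>count_space UNIV) * weight_const p (\<lambda>m. L.wt N (k - m)) *
        (SUP m. L.wt N (k - m) * Lp_norm p cubeM (g m)))"
      by (intro mult_left_mono Lp_norm_weighted_sum[OF p L.wt_le_1 g_meas]) simp
    also have "\<dots> = ennreal (K * V) * (S * (SUP m. L.wt N (k - m) * local_norm p f m))"
      unfolding S_def weight_const_reflect nn_integral_bij_count_space[OF L.bij_minus[of k], of "L.wt N"] g_def local_norm_def ..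
    also have "\<dots> = ennreal K * S * ennreal V * (SUP m. L.wt N (k - m) * local_norm p f m)"
      using K V by (simp add: ennreal_mult mult_ac)
    finally show ?thesis unfolding F_def w_def V_def .
  qed
  moreover have "ennreal K * S < \<infinity>" using N by (simp add: S_def ennreal_mult_less_top)
  ultimately show ?thesis by blast
qed

lemma torus_norm_zero: "0 < p \<Longrightarrow> torus_norm p (\<lambda>_. 0) = 0"
  using Lp_norm_zero by (simp add: torus_norm_def)

lemma ennreal_le_divide_imp:
  fixes t d A :: ennreal
  assumes "t / d \<le> A" "d < \<infinity>" "A < \<infinity>"
  shows "t \<le> A * d"
proof (cases "d = 0")
  case True
  \<comment> \<open>\<open>t / 0\<close> is infinite unless \<open>t = 0\<close>, so the finite
    bound decides this case.\<close>
  then have "t = 0" using assms by (auto simp: ennreal_divide_zero top_unique split: if_splits)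
  then show ?thesis by simp
next
  case False
  have "t = t / d * d" using False assms(2) by (simp add: ennreal_divide_times ennreal_divide_self)
  also have "\<dots> \<le> A * d" by (rule mult_right_mono[OF assms(1)]) simp
  finally show ?thesis .
qed

text \<open>The supremum ranges over non-zero functions, so the zero function is treated apart.
  Finiteness of the norms is what allows multiplying the quotient out.\<close>

lemma bilin_period_norm_bound:
  fixes F1 F2 :: "real ^ 'n \<Rightarrow> complex"
  assumes F: "smooth_torus F1" "smooth_torus F2" and p: "0 < p" and a: "\<And>\<mu>. norm (a \<mu>) \<le> B"
    and fin: "bilin_period_norm a p1 p2 p < \<infinity>" "torus_norm p1 F1 < \<infinity>" "torus_norm p2 F2 < \<infinity>"
  shows "torus_norm p (bilin_period a F1 F2) \<le> bilin_period_norm a p1 p2 p * (torus_norm p1 F1 * torus_norm p2 F2)"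
proof (cases "F1 = (\<lambda>_. 0) \<or> F2 = (\<lambda>_. 0)")
  case True
  have "L.coeff (\<lambda>_ :: real ^ 'n. 0) = (\<lambda>_. 0)" by (simp add: L.coeff_def fun_eq_iff)
  then have "bilin_period a F1 F2 = (\<lambda>_. 0)"
    using True by (intro ext) (auto simp: bilin_period_eq[OF F a])
  then show ?thesis by (simp add: torus_norm_zero[OF p])
next
  case False
  have "torus_norm p (bilin_period a F1 F2) / (torus_norm p1 F1 * torus_norm p2 F2) \<le> bilin_period_norm a p1 p2 p"
    unfolding bilin_period_norm_def by (rule Sup_upper) (use F False in blast)
  then show ?thesis by (rule ennreal_le_divide_imp) (use fin in \<open>auto simp: ennreal_mult_less_top\<close>)
qed

lemma bilin_mult_borel:
  fixes \<sigma> :: "(real ^ 'n) \<times> (real ^ 'n) \<Rightarrow> complex"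
  assumes [measurable]: "\<sigma> \<in> borel_measurable borel" and f: "schwartz f1" "schwartz f2"
  shows "bilin_mult \<sigma> f1 f2 \<in> borel_measurable borel"
proof -
  note [measurable] = schwartz_borel[OF f(1)] schwartz_borel[OF f(2)] borel_measurable_fst borel_measurable_snd
  have "(\<lambda>x. LINT \<xi>|lborel. ech (x \<bullet> (fst \<xi> + snd \<xi>)) * \<sigma> \<xi> * ft f1 (fst \<xi>) * ft f2 (snd \<xi>)) \<in> borel_measurable borel"
    by measurable
  moreover have "bilin_mult \<sigma> f1 f2 = (\<lambda>x. LINT \<xi>|lborel. ech (x \<bullet> (fst \<xi> + snd \<xi>)) * \<sigma> \<xi> * ft f1 (fst \<xi>) * ft f2 (snd \<xi>))"
    by (rule ext) (rule bilin_mult_eq[OF assms])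
  ultimately show ?thesis by simp
qed

text \<open>On the cube at \<open>k\<close> the expansion bounds the local norm of the output by a
  constant times the periodic norm times \<open>B1 k * B2 k\<close>; Hoelder's inequality in
  \<open>k\<close> and the convolution bound finish. The sequence \<open>a\<close> enters
  quantitatively through \<open>bilin_period_norm\<close>, its boundedness only ensuring
  convergence.\<close>

theorem amalgam_upper_bound:
  fixes \<Phi> :: "(real ^ 'n) \<times> (real ^ 'n) \<Rightarrow> complex"
  assumes test: "test_function \<Phi>" and nz: "\<Phi> \<xi>0 \<noteq> 0"
    and pos: "0 < p1" "0 < p2" "0 < p" "0 < q1" "0 < q2" "0 < q" and le: "1 / q \<le> 1 / q1 + 1 / q2"
  shows "\<exists>C<\<infinity>. \<forall>a f1 f2. bounded (range a) \<longrightarrow> bilin_period_norm a p1 p2 p < \<infinity> \<longrightarrow> schwartz f1 \<longrightarrow> schwartz f2 \<longrightarrow>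
     amalgam_norm p1 q1 f1 < \<infinity> \<longrightarrow> amalgam_norm p2 q2 f2 < \<infinity> \<longrightarrow>
     amalgam_norm p q (bilin_mult (lattice_symbol a \<Phi>) f1 f2)
       \<le> C * bilin_period_norm a p1 p2 p * amalgam_norm p1 q1 f1 * amalgam_norm p2 q2 f2"
proof -
  have \<Phi>: "schwartz \<Phi>" by (rule test_function_schwartz[OF test])
  obtain r where r: "1 \<le> r" "\<And>\<xi>. \<Phi> \<xi> \<noteq> 0 \<Longrightarrow> norm \<xi> \<le> r" using test_function_support[OF test] by blast
  have r0: "0 \<le> r" using r by simp
  obtain u :: "real ^ 'n \<Rightarrow> complex" where u: "bump 1 u" using bump_exists[OF test nz, of 1] by auto
  obtain \<theta> :: "real ^ 'n \<Rightarrow> complex" where \<theta>_borel: "\<theta> \<in> borel_measurable borel"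
    and one: "\<And>\<eta>. norm \<eta> \<le> r \<Longrightarrow> \<theta> \<eta> = 1" and zero: "\<And>\<eta>. \<theta> \<eta> \<noteq> 0 \<Longrightarrow> norm \<eta> \<le> r + 2"
    and le1: "\<And>\<eta>. norm (\<theta> \<eta>) \<le> 1" and \<theta>: "schwartz (ft \<theta>)"
    using cutoff_exists[OF u r0] by blast
  define R where "R = 2 * r + 3"
  have R: "1 \<le> R" "R \<noteq> 0" using r by (auto simp: R_def)
  let ?wt = "L.wt :: nat \<Rightarrow> int ^ 'n \<Rightarrow> ennreal"
  let ?wt2 = "L2.wt :: nat \<Rightarrow> (int ^ 'n) \<times> (int ^ 'n) \<Rightarrow> ennreal"
  obtain N1 where N1: "\<And>N. N \<ge> N1 \<Longrightarrow> (\<integral>\<^sup>+k. ?wt N k \<partial>count_space UNIV) < \<infinity> \<and> weight_const p1 (?wt N) < \<infinity>"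
    using L.wt_eventually[OF pos(1)] by blast
  obtain N2 where N2: "\<And>N. N \<ge> N2 \<Longrightarrow> (\<integral>\<^sup>+k. ?wt N k \<partial>count_space UNIV) < \<infinity> \<and> weight_const p2 (?wt N) < \<infinity>"
    using L.wt_eventually[OF pos(2)] by blast
  obtain N3 where N3: "\<And>N. N \<ge> N3 \<Longrightarrow> (\<integral>\<^sup>+k. ?wt N k \<partial>count_space UNIV) < \<infinity> \<and> weight_const q1 (?wt N) < \<infinity>"
    using L.wt_eventually[OF pos(4)] by blast
  obtain N4 where N4: "\<And>N. N \<ge> N4 \<Longrightarrow> (\<integral>\<^sup>+k. ?wt N k \<partial>count_space UNIV) < \<infinity> \<and> weight_const q2 (?wt N) < \<infinity>"
    using L.wt_eventually[OF pos(5)] by blast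
  obtain N5 where N5: "\<And>N. N \<ge> N5 \<Longrightarrow> (\<integral>\<^sup>+k. ?wt2 N k \<partial>count_space UNIV) < \<infinity> \<and> weight_const p (?wt2 N) < \<infinity>"
    using L2.wt_eventually[OF pos(3)] by blast
  define N where "N = N1 + N2 + N3 + N4 + N5"
  \<comment> \<open>The two windows grow in \<open>\<nu>\<close> with order \<open>3 * N\<close>
    each, so one power of the weight of order \<open>M\<close> absorbs both.\<close>
  define M where "M = 6 * N"
  have sumN: "(\<integral>\<^sup>+k. ?wt N k \<partial>count_space UNIV) < \<infinity>"
    and wc: "weight_const p1 (?wt N) < \<infinity>" "weight_const p2 (?wt N) < \<infinity>" "weight_const q1 (?wt N) < \<infinity>" "weight_const q2 (?wt N) < \<infinity>"
    using N1[of N] N2[of N] N3[of N] N4[of N] by (auto simp: N_def)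
  have sumM: "(\<integral>\<^sup>+k. ?wt2 M k \<partial>count_space UNIV) < \<infinity>" "weight_const p (?wt2 M) < \<infinity>"
    using N5[of M] by (auto simp: N_def M_def)
  obtain C1 where C1: "C1 < \<infinity>" "\<And>f k \<nu>. schwartz f \<Longrightarrow>
    torus_norm p1 (L.periodize (windowed \<theta> f (lat k + (1 / R) *\<^sub>R lat \<nu>)))
      \<le> C1 * ennreal ((1 + norm (lat \<nu>)) ^ (3 * N)) * (SUP m. ?wt N (k - m) * local_norm p1 f m)"
    using torus_norm_windowed[OF \<theta> R(1) pos(1) sumN wc(1)] by blast
  obtain C2 where C2: "C2 < \<infinity>" "\<And>f k \<nu>. schwartz f \<Longrightarrow>
    torus_norm p2 (L.periodize (windowed \<theta> f (lat k + (1 / R) *\<^sub>R lat \<nu>)))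
      \<le> C2 * ennreal ((1 + norm (lat \<nu>)) ^ (3 * N)) * (SUP m. ?wt N (k - m) * local_norm p2 f m)"
    using torus_norm_windowed[OF \<theta> R(1) pos(2) sumN wc(2)] by blast
  \<comment> \<open>Order \<open>3 * M\<close> because \<open>Lp_norm_weighted_sum\<close> needs the
    cube of the weight of order \<open>M\<close>.\<close>
  obtain Cc where Cc: "0 < Cc" "\<And>z \<nu>. z \<in> cube \<Longrightarrow> norm (sampling_coeff R \<Phi> z \<nu>) \<le> Cc * dec (lat2 \<nu>) ^ (3 * M)"
    using sampling_coeff_bound[OF \<Phi> R(2), of "3 * M"] by blast
  define S2 where "S2 = (\<integral>\<^sup>+k. ?wt2 M k \<partial>count_space UNIV) * weight_const p (?wt2 M)"
  define H where "H = (if q = \<infinity> then 1 else epowr 2 (1 / enn2real q))"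
  define C where "C = ennreal Cc * S2 * (C1 * C2) * (H * (weight_const q1 (?wt N) * weight_const q2 (?wt N)))"
  have H: "H < \<infinity>" by (auto simp: H_def intro: epowr_less_top)
  have "C < \<infinity>" using C1 C2 sumM wc H by (simp add: C_def S2_def ennreal_mult_less_top)
  moreover have "amalgam_norm p q (bilin_mult (lattice_symbol a \<Phi>) f1 f2)
       \<le> C * bilin_period_norm a p1 p2 p * amalgam_norm p1 q1 f1 * amalgam_norm p2 q2 f2"
    if bdd: "bounded (range a)" and finA: "bilin_period_norm a p1 p2 p < \<infinity>" and f: "schwartz f1" "schwartz f2"
      and fin: "amalgam_norm p1 q1 f1 < \<infinity>" "amalgam_norm p2 q2 f2 < \<infinity>" for a f1 f2
  proof -
    obtain B where a: "\<And>\<mu>. norm (a \<mu>) \<le> B" using bdd by (auto simp: bounded_iff)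
    define A where "A = bilin_period_norm a p1 p2 p"
    define T where "T = bilin_mult (lattice_symbol a \<Phi>) f1 f2"
    have T_borel [measurable]: "T \<in> borel_measurable borel"
      unfolding T_def by (rule bilin_mult_borel[OF lattice_symbol_borel[OF \<Phi> a] f])
    \<comment> \<open>The local norms of the input smeared out by the weights: what the tails of the
      window can collect at \<open>k\<close>.\<close>
    define B1 where "B1 k = (SUP m. ?wt N (k - m) * local_norm p1 f1 m)" for k
    define B2 where "B2 k = (SUP m. ?wt N (k - m) * local_norm p2 f2 m)" for k
    have amal: "amalgam_norm p1 q1 f1 = Lp_norm q1 (count_space UNIV) (local_norm p1 f1)"
      "amalgam_norm p2 q2 f2 = Lp_norm q2 (count_space UNIV) (local_norm p2 f2)"
      by (intro amalgam_norm_local schwartz_borel f)+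
    have B1_le: "Lp_norm q1 (count_space UNIV) B1 \<le> weight_const q1 (?wt N) * amalgam_norm p1 q1 f1"
      unfolding B1_def[abs_def] amal by (rule lq_convolution_sup[OF pos(4) L.wt_le_1])
    have B2_le: "Lp_norm q2 (count_space UNIV) B2 \<le> weight_const q2 (?wt N) * amalgam_norm p2 q2 f2"
      unfolding B2_def[abs_def] amal by (rule lq_convolution_sup[OF pos(5) L.wt_le_1])
    have finB: "Lp_norm q1 (count_space UNIV) B1 < \<infinity>" "Lp_norm q2 (count_space UNIV) B2 < \<infinity>"
      using B1_le B2_le wc fin by (auto simp: ennreal_mult_less_top intro: le_less_trans)
    have B1k: "B1 k < \<infinity>" and B2k: "B2 k < \<infinity>" for k
      using le_Lp_norm_count_space[OF pos(4), of B1 k] le_Lp_norm_count_space[OF pos(5), of B2 k] finB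
      by (auto intro: le_less_trans)
    have loc: "local_norm p T k \<le> ennreal Cc * S2 * (C1 * C2) * A * (B1 k * B2 k)" for k
    proof -
      define F1 where "F1 \<nu> = L.periodize (windowed \<theta> f1 (lat k + (1 / R) *\<^sub>R lat \<nu>))" for \<nu>
      define F2 where "F2 \<nu> = L.periodize (windowed \<theta> f2 (lat k + (1 / R) *\<^sub>R lat \<nu>))" for \<nu>
      define P where "P \<nu> = bilin_period a (F1 (fst \<nu>)) (F2 (snd \<nu>))" for \<nu>
      have st: "smooth_torus (F1 \<nu>)" "smooth_torus (F2 \<nu>)" for \<nu>
        unfolding F1_def F2_def by (intro smooth_torus_windowed f \<theta>)+
      have P_borel: "P \<nu> \<in> borel_measurable borel" for \<nu> unfolding P_def by (rule bilin_period_borel[OF st a])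
      define g where "g \<nu> z = ennreal (norm (P \<nu> z))" for \<nu> z
      have g_meas: "g \<nu> \<in> borel_measurable cubeM" for \<nu>
        unfolding g_def using borel_measurable_cubeM[OF P_borel[of \<nu>]] by measurable
      have meas: "(\<lambda>z. \<integral>\<^sup>+\<nu>. ?wt2 M \<nu> ^ 3 * g \<nu> z \<partial>count_space UNIV) \<in> borel_measurable cubeM"
        by (rule borel_measurable_nn_integral_count_space) (use g_meas in measurable)
      have pw: "ennreal (norm (T (z + lat k))) \<le> ennreal Cc * (\<integral>\<^sup>+\<nu>. ?wt2 M \<nu> ^ 3 * g \<nu> z \<partial>count_space UNIV)"
        if z: "z \<in> cube" for z
      proof -
        have "T (z + lat k) = (LINT \<nu>|count_space UNIV. sampling_coeff R \<Phi> z \<nu> * P \<nu> z)"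
          unfolding T_def P_def F1_def F2_def add.commute[of z]
          by (rule bilin_mult_expansion[OF \<Phi> r(2) \<theta>_borel one zero le1 \<theta> r0 R_def a f])
        then have "ennreal (norm (T (z + lat k))) \<le> (\<integral>\<^sup>+\<nu>. ennreal (norm (sampling_coeff R \<Phi> z \<nu> * P \<nu> z)) \<partial>count_space UNIV)"
          by (simp only: norm_LINT_le_nn_integral)
        also have "\<dots> \<le> (\<integral>\<^sup>+\<nu>. ennreal Cc * (?wt2 M \<nu> ^ 3 * g \<nu> z) \<partial>count_space UNIV)"
        proof (rule nn_integral_mono)
          fix \<nu>
          have "ennreal (norm (sampling_coeff R \<Phi> z \<nu> * P \<nu> z)) \<le> ennreal (Cc * dec (lat2 \<nu>) ^ (3 * M) * norm (P \<nu> z))"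
            unfolding norm_mult by (intro ennreal_leI mult_right_mono Cc(2) z) simp
          also have "\<dots> = ennreal Cc * (?wt2 M \<nu> ^ 3 * g \<nu> z)"
            using Cc(1) by (simp add: L2.wt_def g_def ennreal_mult ennreal_power power_mult mult.commute[of 3] mult.assoc)
          finally show "ennreal (norm (sampling_coeff R \<Phi> z \<nu> * P \<nu> z)) \<le> ennreal Cc * (?wt2 M \<nu> ^ 3 * g \<nu> z)" .
        qed
        also have "\<dots> = ennreal Cc * (\<integral>\<^sup>+\<nu>. ?wt2 M \<nu> ^ 3 * g \<nu> z \<partial>count_space UNIV)"
          by (rule nn_integral_cmult) simp
        finally show ?thesis .
      qed
      have each: "?wt2 M \<nu> * Lp_norm p cubeM (g \<nu>) \<le> C1 * C2 * A * (B1 k * B2 k)" for \<nu>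
      proof -
        define V1 where "V1 = (1 + norm (lat (fst \<nu>))) ^ (3 * N)"
        define V2 where "V2 = (1 + norm (lat (snd \<nu>))) ^ (3 * N)"
        have n1: "torus_norm p1 (F1 (fst \<nu>)) \<le> C1 * ennreal V1 * B1 k"
          unfolding F1_def V1_def B1_def by (rule C1(2)[OF f(1)])
        have n2: "torus_norm p2 (F2 (snd \<nu>)) \<le> C2 * ennreal V2 * B2 k"
          unfolding F2_def V2_def B2_def by (rule C2(2)[OF f(2)])
        have fins: "torus_norm p1 (F1 (fst \<nu>)) < \<infinity>" "torus_norm p2 (F2 (snd \<nu>)) < \<infinity>"
          using n1 n2 C1(1) C2(1) B1k[of k] B2k[of k] by (auto simp: ennreal_mult_less_top intro: le_less_trans)
        \<comment> \<open>The remaining power of the weight beats the growth of both window norms,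
          uniformly in \<open>\<nu>\<close>; this makes the supremum over \<open>\<nu>\<close>
          finite.\<close>
        have VV: "dec (lat2 \<nu>) ^ M * (V1 * V2) \<le> 1"
        proof -
          have le: "norm (lat (fst \<nu>)) \<le> norm (lat2 \<nu>)" "norm (lat (snd \<nu>)) \<le> norm (lat2 \<nu>)"
            by (cases \<nu>; simp add: norm_fst_le norm_snd_le)+
          have "V1 * V2 \<le> (1 + norm (lat2 \<nu>)) ^ (3 * N) * (1 + norm (lat2 \<nu>)) ^ (3 * N)"
            unfolding V1_def V2_def using le by (intro mult_mono power_mono) auto
          also have "\<dots> = (1 + norm (lat2 \<nu>)) ^ M" by (simp add: M_def flip: power_add)
          finally have "V1 * V2 * dec (lat2 \<nu>) ^ M \<le> (1 + norm (lat2 \<nu>)) ^ M * dec (lat2 \<nu>) ^ M"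
            by (rule mult_right_mono) simp
          then show ?thesis unfolding dec_inverse_power by (simp only: mult_ac)
        qed
        have "Lp_norm p cubeM (g \<nu>) = torus_norm p (P \<nu>)"
          unfolding g_def by (rule torus_norm_eq[OF P_borel, symmetric])
        also have "\<dots> \<le> A * (torus_norm p1 (F1 (fst \<nu>)) * torus_norm p2 (F2 (snd \<nu>)))"
          unfolding P_def A_def by (rule bilin_period_norm_bound[OF st pos(3) a finA fins])
        also have "\<dots> \<le> A * ((C1 * ennreal V1 * B1 k) * (C2 * ennreal V2 * B2 k))"
          by (intro mult_left_mono mult_mono n1 n2) auto
        finally have "?wt2 M \<nu> * Lp_norm p cubeM (g \<nu>) \<le> ?wt2 M \<nu> * (A * ((C1 * ennreal V1 * B1 k) * (C2 * ennreal V2 * B2 k)))"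
          by (rule mult_left_mono) simp
        also have "\<dots> = (?wt2 M \<nu> * (ennreal V1 * ennreal V2)) * (C1 * C2 * A * (B1 k * B2 k))" by (simp only: mult_ac)
        also have "?wt2 M \<nu> * (ennreal V1 * ennreal V2) = ennreal (dec (lat2 \<nu>) ^ M * (V1 * V2))"
          unfolding L2.wt_def by (simp add: ennreal_mult V1_def V2_def)
        also have "\<dots> * (C1 * C2 * A * (B1 k * B2 k)) \<le> 1 * (C1 * C2 * A * (B1 k * B2 k))"
          using VV by (intro mult_right_mono) (auto simp: ennreal_le_1)
        finally show ?thesis by simp
      qed
      have "local_norm p T k \<le> Lp_norm p cubeM (\<lambda>z. ennreal Cc * (\<integral>\<^sup>+\<nu>. ?wt2 M \<nu> ^ 3 * g \<nu> z \<partial>count_space UNIV))"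
        unfolding local_norm_def
      proof (rule Lp_norm_mono[OF pos(3)])
        show "(\<lambda>x. ennreal (norm (T (x + lat k)))) \<in> borel_measurable cubeM"
          by (intro borel_measurable_cubeM) measurable
      qed (use pw in auto)
      also have "\<dots> \<le> ennreal Cc * Lp_norm p cubeM (\<lambda>z. \<integral>\<^sup>+\<nu>. ?wt2 M \<nu> ^ 3 * g \<nu> z \<partial>count_space UNIV)"
        by (rule Lp_norm_cmult[OF pos(3) meas])
      also have "\<dots> \<le> ennreal Cc * (S2 * (SUP \<nu>. ?wt2 M \<nu> * Lp_norm p cubeM (g \<nu>)))"
        unfolding S2_def by (intro mult_left_mono Lp_norm_weighted_sum[OF pos(3) L2.wt_le_1 g_meas]) simp
      also have "\<dots> \<le> ennreal Cc * (S2 * (C1 * C2 * A * (B1 k * B2 k)))"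
        by (intro mult_left_mono SUP_least each) auto
      finally show ?thesis by (simp only: mult_ac)
    qed
    have "amalgam_norm p q T = Lp_norm q (count_space UNIV) (local_norm p T)" by (rule amalgam_norm_local[OF T_borel])
    also have "\<dots> \<le> Lp_norm q (count_space UNIV) (\<lambda>k. ennreal Cc * S2 * (C1 * C2) * A * (B1 k * B2 k))"
      by (rule Lp_norm_mono[OF pos(6)]) (use loc in auto)
    also have "\<dots> \<le> ennreal Cc * S2 * (C1 * C2) * A * Lp_norm q (count_space UNIV) (\<lambda>k. B1 k * B2 k)"
      by (rule Lp_norm_cmult[OF pos(6)]) simp
    also have "\<dots> \<le> ennreal Cc * S2 * (C1 * C2) * A * (H * (Lp_norm q1 (count_space UNIV) B1 * Lp_norm q2 (count_space UNIV) B2))"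
      unfolding H_def by (intro mult_left_mono lq_hoelder pos le finB) simp
    also have "\<dots> \<le> ennreal Cc * S2 * (C1 * C2) * A *
        (H * ((weight_const q1 (?wt N) * amalgam_norm p1 q1 f1) * (weight_const q2 (?wt N) * amalgam_norm p2 q2 f2)))"
      by (intro mult_left_mono mult_mono B1_le B2_le) auto
    also have "\<dots> = C * A * amalgam_norm p1 q1 f1 * amalgam_norm p2 q2 f2"
      unfolding C_def by (simp only: mult_ac)
    finally show ?thesis unfolding T_def A_def .
  qed
  ultimately show ?thesis by blast
qed

section \<open>The lower estimate\<close>

text \<open>The summable weights are bounded below on a ball, so the counting measure of its lattice
  points is finite.\<close>

lemma (in lattice) finite_lattice_ball: "finite {k. norm (\<iota> k) \<le> \<rho>}"
proof -
  define S where "S = {k. norm (\<iota> k) \<le> \<rho>}"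
  define D where "D = 2 * DIM('a)"
  define c where "c = ennreal ((1 + \<bar>\<rho>\<bar>) ^ D)"
  have "1 \<le> c * wt D k" if "k \<in> S" for k
  proof -
    have "1 = (1 + norm (\<iota> k)) ^ D * dec (\<iota> k) ^ D" by (rule dec_inverse_power[symmetric])
    also have "\<dots> \<le> (1 + \<bar>\<rho>\<bar>) ^ D * dec (\<iota> k) ^ D"
      using that by (intro mult_right_mono power_mono) (auto simp: S_def)
    finally have "ennreal 1 \<le> ennreal ((1 + \<bar>\<rho>\<bar>) ^ D * dec (\<iota> k) ^ D)" by (rule ennreal_leI)
    then show ?thesis by (simp add: c_def wt_def ennreal_mult)
  qed
  then have "(\<integral>\<^sup>+k. indicator S k \<partial>count_space UNIV) \<le> (\<integral>\<^sup>+k. c * wt D k \<partial>count_space UNIV)"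
    by (intro nn_integral_mono) (auto simp: indicator_def)
  also have "\<dots> = c * (\<integral>\<^sup>+k. wt D k \<partial>count_space UNIV)" by (rule nn_integral_cmult) simp
  also have "\<dots> < \<infinity>" using wt_sum_finite[of D] by (simp add: c_def D_def ennreal_mult_less_top)
  finally have "emeasure (count_space UNIV) S < \<infinity>" by simp
  then have "finite S" using emeasure_count_space_infinite[of S UNIV] by (cases "finite S") simp_all
  then show ?thesis by (simp add: S_def)
qed

text \<open>Only finitely many translates of the support come near \<open>\<xi>0\<close>. Each of
  these supports is closed and misses \<open>\<xi>0\<close>, so a whole ball around
  \<open>\<xi>0\<close> misses them all.\<close>

lemma condition_B_neighborhood:
  fixes \<Phi> :: "(real ^ 'n) \<times> (real ^ 'n) \<Rightarrow> complex"
  assumes supp: "\<And>\<xi>. \<Phi> \<xi> \<noteq> 0 \<Longrightarrow> norm \<xi> \<le> r"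
    and B: "\<xi>0 \<notin> (\<Union>\<mu>\<in>UNIV - {0}. Defs.supp (\<lambda>\<xi>. \<Phi> (\<xi> - lat2 \<mu>)))"
  shows "\<exists>\<delta>>0. \<forall>\<zeta> \<mu>. norm \<zeta> < \<delta> \<longrightarrow> \<mu> \<noteq> 0 \<longrightarrow> \<Phi> (\<xi>0 + \<zeta> - lat2 \<mu>) = 0"
proof -
  \<comment> \<open>The lattice points whose translate of the support can meet the unit ball around
    \<open>\<xi>0\<close>; hence the summand 1 and the radius \<open>min e 1\<close> at the
    end.\<close>
  define J where "J = {\<mu> :: (int ^ 'n) \<times> (int ^ 'n). norm (lat2 \<mu>) \<le> r + norm \<xi>0 + 1} - {0}"
  have "finite J" unfolding J_def by (intro finite_Diff L2.finite_lattice_ball)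
  define W where "W = (\<Inter>\<mu>\<in>J. - Defs.supp (\<lambda>\<xi>. \<Phi> (\<xi> - lat2 \<mu>)))"
  have "open W" unfolding W_def Defs.supp_def by (intro open_INT \<open>finite J\<close>) (auto intro: open_Compl)
  moreover have "\<xi>0 \<in> W" using B unfolding W_def J_def by blast
  ultimately obtain e where e: "e > 0" "ball \<xi>0 e \<subseteq> W" by (auto elim: openE)
  have "\<Phi> (\<xi>0 + \<zeta> - lat2 \<mu>) = 0" if \<zeta>: "norm \<zeta> < min e 1" and \<mu>: "\<mu> \<noteq> 0" for \<zeta> \<mu>
  proof (rule ccontr)
    assume nz: "\<Phi> (\<xi>0 + \<zeta> - lat2 \<mu>) \<noteq> 0"
    then have "norm (\<xi>0 + \<zeta> - lat2 \<mu>) \<le> r" by (rule supp)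
    moreover have "norm (lat2 \<mu>) \<le> norm (\<xi>0 + \<zeta>) + norm (\<xi>0 + \<zeta> - lat2 \<mu>)"
      using norm_triangle_ineq4[of "\<xi>0 + \<zeta>" "\<xi>0 + \<zeta> - lat2 \<mu>"] by simp
    moreover have "norm (\<xi>0 + \<zeta>) \<le> norm \<xi>0 + norm \<zeta>" by (rule norm_triangle_ineq)
    ultimately have "\<mu> \<in> J" using \<zeta> \<mu> by (simp add: J_def)
    moreover have "\<xi>0 + \<zeta> \<in> W" using e(2) \<zeta> by (auto simp: dist_norm)
    ultimately have "\<xi>0 + \<zeta> \<notin> Defs.supp (\<lambda>\<xi>. \<Phi> (\<xi> - lat2 \<mu>))" by (auto simp: W_def)
    from supp_zero[OF this] nz show False by simp
  qed
  then show ?thesis using e(1) by (intro exI[of _ "min e 1"]) auto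
qed

section \<open>Test functions with spectrum near a translate of the lattice\<close>

lemma integral_pair_count:
  fixes f g :: "'i::countable \<Rightarrow> complex"
  assumes "integrable (count_space UNIV) f" "integrable (count_space UNIV) g"
  shows "(LINT \<mu>|count_space UNIV. f (fst \<mu>) * g (snd \<mu>)) = (LINT k|count_space UNIV. f k) * (LINT l|count_space UNIV. g l)"
proof -
  interpret C: sigma_finite_measure "count_space (UNIV :: 'i set)"
    by (rule sigma_finite_measure_count_space_countable) auto
  interpret P: pair_sigma_finite "count_space (UNIV :: 'i set)" "count_space (UNIV :: 'i set)" ..
  have eq: "count_space (UNIV :: 'i set) \<Otimes>\<^sub>M count_space (UNIV :: 'i set) = count_space UNIV"
    by (simp add: pair_measure_countable)
  have "integrable (count_space (UNIV :: 'i set) \<Otimes>\<^sub>M count_space UNIV) (\<lambda>\<mu>. f (fst \<mu>) * g (snd \<mu>))"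
    unfolding eq by (rule integrable_pair_count[OF assms])
  from P.integral_fst'[OF this] show ?thesis unfolding eq by simp
qed

text \<open>\<open>ft u (- x)\<close> is the inverse Fourier transform of \<open>u\<close>, so
  multiplying by \<open>F\<close> places a copy of \<open>u\<close> at each point of the lattice
  shifted by \<open>v\<close>, with the Fourier coefficients of \<open>F\<close> as factors.\<close>

definition modulated :: "(real ^ 'n \<Rightarrow> complex) \<Rightarrow> (real ^ 'n \<Rightarrow> complex) \<Rightarrow> real ^ 'n \<Rightarrow> real ^ 'n \<Rightarrow> complex" where
  "modulated F u v x = F x * (ech (x \<bullet> v) * ft u (- x))"

lemma schwartz_reflect_ft: "schwartz u \<Longrightarrow> schwartz (\<lambda>x. ft u (- x))"
  using schwartz_scale[OF schwartz_ft, of u "-1" 0] by simp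

lemma schwartz_modulated:
  assumes "smooth_torus F" "schwartz u"
  shows "schwartz (modulated F u v)"
  unfolding modulated_def[abs_def]
  using assms by (intro schwartz_mult_bd[OF schwartz_ech_mult[OF schwartz_reflect_ft]] L.periodic_smooth_bd)
    (auto simp: smooth_torus_iff)

text \<open>Insert the Fourier series of \<open>F\<close> and transform term by term; each term is a
  modulation of \<open>g\<close>, whose transform is \<open>u\<close> by Fourier inversion.\<close>

lemma ft_modulated:
  fixes F u :: "real ^ 'n \<Rightarrow> complex"
  assumes F: "smooth_torus F" and u: "schwartz u"
  shows "ft (modulated F u v) \<xi> = (LINT m|count_space UNIV. L.coeff F m * u (\<xi> - v - lat m))"
proof -
  have sm: "smooth F" "\<And>k x. F (x + lat k) = F x" using F by (auto simp: smooth_torus_iff)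
  define g where "g = (\<lambda>x. ft u (- x))"
  have g: "schwartz g" unfolding g_def by (rule schwartz_reflect_ft[OF u])
  have [measurable]: "g \<in> borel_measurable borel" by (rule schwartz_borel[OF g])
  have intg: "integrable lborel g" by (rule schwartz_integrable[OF g])
  have "ft (modulated F u v) \<xi> = (LINT x|lborel. (LINT m|count_space UNIV. L.coeff F m * (ech (- (x \<bullet> (\<xi> - v - lat m))) * g x)))"
    unfolding ft_def[of "modulated F u v"]
  proof (rule Bochner_Integration.integral_cong[OF refl])
    fix x
    have "ech (- (x \<bullet> \<xi>)) * modulated F u v x
      = (ech (- (x \<bullet> \<xi>)) * (ech (x \<bullet> v) * g x)) * (LINT m|count_space UNIV. L.coeff F m * ech (lat m \<bullet> x))"
      unfolding modulated_def g_def L.smooth_periodic_series[OF sm, of x, symmetric] by (simp only: mult_ac)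
    also have "\<dots> = (LINT m|count_space UNIV. (ech (- (x \<bullet> \<xi>)) * (ech (x \<bullet> v) * g x)) * (L.coeff F m * ech (lat m \<bullet> x)))"
      by (rule integral_mult_right_zero[symmetric])
    also have "\<dots> = (LINT m|count_space UNIV. L.coeff F m * (ech (- (x \<bullet> (\<xi> - v - lat m))) * g x))"
    proof -
      have "ech (- (x \<bullet> (\<xi> - v - lat m))) = ech (- (x \<bullet> \<xi>)) * ech (x \<bullet> v) * ech (lat m \<bullet> x)" for m
        unfolding ech_add[symmetric] by (simp add: inner_diff_right inner_commute algebra_simps)
      then show ?thesis by (simp only: mult_ac)
    qed
    finally show "ech (- (x \<bullet> \<xi>)) * modulated F u v x = (LINT m|count_space UNIV. L.coeff F m * (ech (- (x \<bullet> (\<xi> - v - lat m))) * g x))" .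
  qed
  also have "\<dots> = (LINT m|count_space UNIV. (LINT x|lborel. L.coeff F m * (ech (- (x \<bullet> (\<xi> - v - lat m))) * g x)))"
  proof (rule integral_sum_swap)
    have "(\<integral>\<^sup>+m. ennreal (norm (L.coeff F m)) \<partial>count_space UNIV) < \<infinity>" "(\<integral>\<^sup>+x. ennreal (norm (g x)) \<partial>lborel) < \<infinity>"
      using L.coeff_integrable[OF sm] intg unfolding integrable_iff_bounded by auto
    then show "(\<integral>\<^sup>+m. (\<integral>\<^sup>+x. ennreal (norm (L.coeff F m * (ech (- (x \<bullet> (\<xi> - v - lat m))) * g x))) \<partial>lborel) \<partial>count_space UNIV) < \<infinity>"
      by (simp add: norm_mult ennreal_mult nn_integral_cmult nn_integral_multc ennreal_mult_less_top)
    show "(\<lambda>x. L.coeff F m * (ech (- (x \<bullet> (\<xi> - v - lat m))) * g x)) \<in> borel_measurable lborel" for m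
      by measurable
  qed (rule sigma_finite_lborel)
  also have "\<dots> = (LINT m|count_space UNIV. L.coeff F m * ft g (\<xi> - v - lat m))"
    unfolding ft_def by (simp only: integral_mult_right_zero)
  also have "\<dots> = (LINT m|count_space UNIV. L.coeff F m * u (\<xi> - v - lat m))"
    unfolding g_def by (simp only: L.ft_inversion[OF u])
  finally show ?thesis .
qed

lemma coeff_bump_integrable:
  fixes F u :: "real ^ 'n \<Rightarrow> complex"
  assumes F: "smooth_torus F" and u: "schwartz u"
  shows "integrable (count_space UNIV) (\<lambda>m. L.coeff F m * u (\<xi> - lat m))"
proof -
  have sm: "smooth F" "\<And>k x. F (x + lat k) = F x" using F by (auto simp: smooth_torus_iff)
  obtain C where C: "\<And>x. norm (u x) \<le> C" using schwartz_dominated[OF u, of 0] by (auto simp: dominated_def)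
  have "integrable (count_space UNIV) (\<lambda>m. u (\<xi> - lat m) * L.coeff F m)"
    by (rule integrable_bounded_mult[OF L.coeff_integrable[OF sm] C])
  then show ?thesis by (simp only: mult.commute)
qed

lemma norm_le_fst_snd: "norm z \<le> norm (fst z) + norm (snd z)"
  by (cases z) (simp add: norm_Pair_le)

text \<open>On the support of the copy of the bump product belonging to \<open>\<mu>\<close> the
  symbol reduces to its term at \<open>\<mu>\<close>. Translating by \<open>\<mu>\<close> extracts
  the character of the periodic operator and leaves an integral that does not depend on
  \<open>\<mu>\<close>.\<close>

lemma bilin_mult_modulated:
  fixes \<Phi> :: "(real ^ 'n) \<times> (real ^ 'n) \<Rightarrow> complex" and u F1 F2 :: "real ^ 'n \<Rightarrow> complex"
  assumes \<Phi>: "schwartz \<Phi>" and a: "\<And>\<mu>. norm (a \<mu>) \<le> A" and F: "smooth_torus F1" "smooth_torus F2"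
    and u: "schwartz u" and supp_u: "\<And>y. u y \<noteq> 0 \<Longrightarrow> norm y \<le> \<rho>" and \<rho>: "2 * \<rho> < \<delta>"
    and vanish: "\<And>\<zeta> \<mu>. norm \<zeta> < \<delta> \<Longrightarrow> \<mu> \<noteq> 0 \<Longrightarrow> \<Phi> (\<xi>0 + \<zeta> - lat2 \<mu>) = 0"
  shows "bilin_mult (lattice_symbol a \<Phi>) (modulated F1 u (fst \<xi>0)) (modulated F2 u (snd \<xi>0)) x
    = bilin_period a F1 F2 x * (LINT \<eta>|lborel. ech (x \<bullet> (fst \<eta> + snd \<eta>)) * \<Phi> \<eta> * (u (fst \<eta> - fst \<xi>0) * u (snd \<eta> - snd \<xi>0)))"
proof -
  note [measurable] = schwartz_borel[OF \<Phi>] schwartz_borel[OF u] borel_measurable_fst borel_measurable_snd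
  have sm: "smooth F1" "smooth F2" and per: "\<And>k x. F1 (x + lat k) = F1 x" "\<And>k x. F2 (x + lat k) = F2 x"
    using F by (auto simp: smooth_torus_iff)
  define U where "U \<eta> = u (fst \<eta> - fst \<xi>0) * u (snd \<eta> - snd \<xi>0)" for \<eta>
  have [measurable]: "U \<in> borel_measurable borel" unfolding U_def by measurable
  define c where "c \<mu> = L.coeff F1 (fst \<mu>) * L.coeff F2 (snd \<mu>)" for \<mu>
  have intc: "integrable (count_space UNIV) c"
    unfolding c_def by (rule integrable_pair_count[OF L.coeff_integrable[OF sm(1) per(1)] L.coeff_integrable[OF sm(2) per(2)]])
  have A: "0 \<le> A" using a[of 0] norm_ge_zero order_trans by blast
  have transint: "integrable lborel (\<lambda>y. u (y - v))" for v
    using schwartz_integrable[OF schwartz_scale[OF u, of 1 "- v"]] by simp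
  have intU: "integrable lborel U" unfolding U_def
    by (rule integral_lborel_pair(1)) (rule transint)+
  have U_supp: "norm (\<eta> - \<xi>0) < \<delta>" if "U \<eta> \<noteq> 0" for \<eta>
  proof -
    have "norm (fst \<eta> - fst \<xi>0) \<le> \<rho>" "norm (snd \<eta> - snd \<xi>0) \<le> \<rho>" using that by (auto simp: U_def intro: supp_u)
    moreover have "norm (\<eta> - \<xi>0) \<le> norm (fst \<eta> - fst \<xi>0) + norm (snd \<eta> - snd \<xi>0)"
      using norm_le_fst_snd[of "\<eta> - \<xi>0"] by simp
    ultimately show ?thesis using \<rho> by linarith
  qed
  define G where "G \<mu> \<xi> = ech (x \<bullet> (fst \<xi> + snd \<xi>)) * (a \<mu> * \<Phi> (\<xi> - lat2 \<mu>)) * (c \<mu> * U (\<xi> - lat2 \<mu>))" for \<mu> \<xi>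
  have pw: "ech (x \<bullet> (fst \<xi> + snd \<xi>)) * lattice_symbol a \<Phi> \<xi> * ft (modulated F1 u (fst \<xi>0)) (fst \<xi>) * ft (modulated F2 u (snd \<xi>0)) (snd \<xi>)
    = (LINT \<mu>|count_space UNIV. G \<mu> \<xi>)" for \<xi>
  proof -
    have "ft (modulated F1 u (fst \<xi>0)) (fst \<xi>) * ft (modulated F2 u (snd \<xi>0)) (snd \<xi>) = (LINT \<mu>|count_space UNIV. c \<mu> * U (\<xi> - lat2 \<mu>))"
    proof -
      have "ft (modulated F1 u (fst \<xi>0)) (fst \<xi>) * ft (modulated F2 u (snd \<xi>0)) (snd \<xi>)
        = (LINT \<mu>|count_space UNIV. (L.coeff F1 (fst \<mu>) * u (fst \<xi> - fst \<xi>0 - lat (fst \<mu>))) * (L.coeff F2 (snd \<mu>) * u (snd \<xi> - snd \<xi>0 - lat (snd \<mu>))))"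
        unfolding ft_modulated[OF F(1) u] ft_modulated[OF F(2) u]
        by (rule integral_pair_count[symmetric]) (intro coeff_bump_integrable F u)+
      also have "\<dots> = (LINT \<mu>|count_space UNIV. c \<mu> * U (\<xi> - lat2 \<mu>))"
      proof (rule Bochner_Integration.integral_cong[OF refl])
        fix \<mu> :: "(int ^ 'n) \<times> (int ^ 'n)"
        have "fst (\<xi> - lat2 \<mu>) - fst \<xi>0 = fst \<xi> - fst \<xi>0 - lat (fst \<mu>)" "snd (\<xi> - lat2 \<mu>) - snd \<xi>0 = snd \<xi> - snd \<xi>0 - lat (snd \<mu>)"
          by (simp_all add: algebra_simps)
        then show "(L.coeff F1 (fst \<mu>) * u (fst \<xi> - fst \<xi>0 - lat (fst \<mu>))) * (L.coeff F2 (snd \<mu>) * u (snd \<xi> - snd \<xi>0 - lat (snd \<mu>))) = c \<mu> * U (\<xi> - lat2 \<mu>)"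
          unfolding c_def U_def by (simp only: mult_ac)
      qed
      finally show ?thesis .
    qed
    then have "ech (x \<bullet> (fst \<xi> + snd \<xi>)) * lattice_symbol a \<Phi> \<xi> * ft (modulated F1 u (fst \<xi>0)) (fst \<xi>) * ft (modulated F2 u (snd \<xi>0)) (snd \<xi>)
      = (LINT \<mu>|count_space UNIV. ech (x \<bullet> (fst \<xi> + snd \<xi>)) * lattice_symbol a \<Phi> \<xi> * (c \<mu> * U (\<xi> - lat2 \<mu>)))"
      by (simp only: mult.assoc integral_mult_right_zero)
    also have "\<dots> = (LINT \<mu>|count_space UNIV. G \<mu> \<xi>)"
    proof (rule Bochner_Integration.integral_cong[OF refl])
      fix \<mu>
      show "ech (x \<bullet> (fst \<xi> + snd \<xi>)) * lattice_symbol a \<Phi> \<xi> * (c \<mu> * U (\<xi> - lat2 \<mu>)) = G \<mu> \<xi>"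
      proof (cases "U (\<xi> - lat2 \<mu>) = 0")
        case False
        \<comment> \<open>The displacement of \<open>\<xi> - lat2 \<mu>\<close> from
          \<open>\<xi>0\<close>. For \<open>l \<noteq> \<mu>\<close> the non-zero lattice point
          \<open>l - \<mu>\<close> makes \<open>vanish\<close> applicable, and this isolates
          \<open>a \<mu>\<close>.\<close>
        define \<zeta> where "\<zeta> = \<xi> - lat2 \<mu> - \<xi>0"
        have \<zeta>: "norm \<zeta> < \<delta>" unfolding \<zeta>_def by (rule U_supp[OF False])
        define s where "s = a \<mu> * \<Phi> (\<xi> - lat2 \<mu>)"
        have "a l * \<Phi> (\<xi> - lat2 l) = (if l = \<mu> then s else 0)" for l
        proof (cases "l = \<mu>")
          case False
          have "\<xi> - lat2 l = \<xi>0 + \<zeta> - lat2 (l - \<mu>)" unfolding \<zeta>_def L2.diff by simp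
          moreover have "\<Phi> (\<xi>0 + \<zeta> - lat2 (l - \<mu>)) = 0" by (rule vanish[OF \<zeta>]) (use False in simp)
          ultimately show ?thesis using False by (simp only: mult_zero_right if_False)
        qed (simp add: s_def)
        then have "lattice_symbol a \<Phi> \<xi> = s"
          unfolding lattice_symbol_eq[OF \<Phi> a] by (simp only: LINT_count_space_single)
        then show ?thesis by (simp only: G_def s_def)
      qed (simp add: G_def)
    qed
    finally show ?thesis .
  qed
  define H where "H = (LINT \<eta>|lborel. ech (x \<bullet> (fst \<eta> + snd \<eta>)) * \<Phi> \<eta> * U \<eta>)"
  obtain M where M: "\<And>\<xi>. norm (\<Phi> \<xi>) \<le> M" using schwartz_dominated[OF \<Phi>, of 0] by (auto simp: dominated_def)
  have M0: "0 \<le> M" using M[of 0] norm_ge_zero order_trans by blast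
  have "bilin_mult (lattice_symbol a \<Phi>) (modulated F1 u (fst \<xi>0)) (modulated F2 u (snd \<xi>0)) x
    = (LINT \<xi>|lborel. (LINT \<mu>|count_space UNIV. G \<mu> \<xi>))"
    unfolding bilin_mult_eq[OF lattice_symbol_borel[OF \<Phi> a] schwartz_modulated[OF F(1) u] schwartz_modulated[OF F(2) u]] pw ..
  also have "\<dots> = (LINT \<mu>|count_space UNIV. (LINT \<xi>|lborel. G \<mu> \<xi>))"
  proof (rule integral_sum_swap)
    show "G \<mu> \<in> borel_measurable lborel" for \<mu> unfolding G_def by measurable
    have "(\<integral>\<^sup>+\<xi>. ennreal (norm (G \<mu> \<xi>)) \<partial>lborel) \<le> ennreal (A * M) * (\<integral>\<^sup>+\<eta>. ennreal (norm (U \<eta>)) \<partial>lborel) * ennreal (norm (c \<mu>))" for \<mu>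
    proof -
      have "(\<integral>\<^sup>+\<xi>. ennreal (norm (G \<mu> \<xi>)) \<partial>lborel) \<le> (\<integral>\<^sup>+\<xi>. ennreal (A * M * norm (c \<mu>)) * ennreal (norm (U (\<xi> + (- lat2 \<mu>)))) \<partial>lborel)"
      proof (rule nn_integral_mono)
        fix \<xi>
        have "norm (G \<mu> \<xi>) = norm (a \<mu>) * norm (\<Phi> (\<xi> - lat2 \<mu>)) * (norm (c \<mu>) * norm (U (\<xi> - lat2 \<mu>)))"
          unfolding G_def norm_mult by simp
        also have "\<dots> \<le> A * M * (norm (c \<mu>) * norm (U (\<xi> - lat2 \<mu>)))"
          by (intro mult_right_mono mult_mono a M) (use A in auto)
        finally have "ennreal (norm (G \<mu> \<xi>)) \<le> ennreal (A * M * norm (c \<mu>) * norm (U (\<xi> - lat2 \<mu>)))"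
          by (intro ennreal_leI) (simp only: mult.assoc)
        then show "ennreal (norm (G \<mu> \<xi>)) \<le> ennreal (A * M * norm (c \<mu>)) * ennreal (norm (U (\<xi> + (- lat2 \<mu>))))"
          using A M0 by (simp add: ennreal_mult)
      qed
      also have "\<dots> = ennreal (A * M * norm (c \<mu>)) * (\<integral>\<^sup>+\<xi>. ennreal (norm (U (\<xi> + (- lat2 \<mu>)))) \<partial>lborel)"
        by (rule nn_integral_cmult) measurable
      also have "(\<integral>\<^sup>+\<xi>. ennreal (norm (U (\<xi> + (- lat2 \<mu>)))) \<partial>lborel) = (\<integral>\<^sup>+\<eta>. ennreal (norm (U \<eta>)) \<partial>lborel)"
        by (rule lborel_nn_integral_translate[where h = "\<lambda>\<eta>. ennreal (norm (U \<eta>))"]) measurable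
      finally show ?thesis using A M0 by (simp add: ennreal_mult mult_ac)
    qed
    then have "(\<integral>\<^sup>+\<mu>. (\<integral>\<^sup>+\<xi>. ennreal (norm (G \<mu> \<xi>)) \<partial>lborel) \<partial>count_space UNIV)
      \<le> (\<integral>\<^sup>+\<mu>. ennreal (A * M) * (\<integral>\<^sup>+\<eta>. ennreal (norm (U \<eta>)) \<partial>lborel) * ennreal (norm (c \<mu>)) \<partial>count_space UNIV)"
      by (intro nn_integral_mono)
    also have "\<dots> = ennreal (A * M) * (\<integral>\<^sup>+\<eta>. ennreal (norm (U \<eta>)) \<partial>lborel) * (\<integral>\<^sup>+\<mu>. ennreal (norm (c \<mu>)) \<partial>count_space UNIV)"
      by (rule nn_integral_cmult) simp
    also have "\<dots> < \<infinity>" using intU intc unfolding integrable_iff_bounded by (simp add: ennreal_mult_less_top)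
    finally show "(\<integral>\<^sup>+\<mu>. (\<integral>\<^sup>+\<xi>. ennreal (norm (G \<mu> \<xi>)) \<partial>lborel) \<partial>count_space UNIV) < \<infinity>" .
  qed (rule sigma_finite_lborel)
  also have "\<dots> = (LINT \<mu>|count_space UNIV. (ech (x \<bullet> (lat (fst \<mu>) + lat (snd \<mu>))) * a \<mu> * c \<mu>) * H)"
  proof (rule Bochner_Integration.integral_cong[OF refl])
    fix \<mu>
    have "(LINT \<xi>|lborel. G \<mu> \<xi>) = (LINT \<xi>|lborel. G \<mu> (\<xi> + lat2 \<mu>))"
      by (rule lborel_integral_translate[symmetric]) (unfold G_def, measurable)
    also have "\<dots> = (LINT \<xi>|lborel. (ech (x \<bullet> (lat (fst \<mu>) + lat (snd \<mu>))) * a \<mu> * c \<mu>) * (ech (x \<bullet> (fst \<xi> + snd \<xi>)) * \<Phi> \<xi> * U \<xi>))"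
    proof (rule Bochner_Integration.integral_cong[OF refl])
      fix \<xi>
      have "x \<bullet> (fst (\<xi> + lat2 \<mu>) + snd (\<xi> + lat2 \<mu>)) = x \<bullet> (lat (fst \<mu>) + lat (snd \<mu>)) + x \<bullet> (fst \<xi> + snd \<xi>)"
        by (cases \<mu>) (simp add: inner_add_right)
      then have "ech (x \<bullet> (fst (\<xi> + lat2 \<mu>) + snd (\<xi> + lat2 \<mu>))) = ech (x \<bullet> (lat (fst \<mu>) + lat (snd \<mu>))) * ech (x \<bullet> (fst \<xi> + snd \<xi>))"
        by (simp only: ech_add)
      then show "G \<mu> (\<xi> + lat2 \<mu>) = (ech (x \<bullet> (lat (fst \<mu>) + lat (snd \<mu>))) * a \<mu> * c \<mu>) * (ech (x \<bullet> (fst \<xi> + snd \<xi>)) * \<Phi> \<xi> * U \<xi>)"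
        unfolding G_def add_diff_cancel_right' by (simp only: mult_ac)
    qed
    also have "\<dots> = (ech (x \<bullet> (lat (fst \<mu>) + lat (snd \<mu>))) * a \<mu> * c \<mu>) * H"
      unfolding H_def by (rule integral_mult_right_zero)
    finally show "(LINT \<xi>|lborel. G \<mu> \<xi>) = (ech (x \<bullet> (lat (fst \<mu>) + lat (snd \<mu>))) * a \<mu> * c \<mu>) * H" .
  qed
  also have "\<dots> = bilin_period a F1 F2 x * H"
    unfolding bilin_period_eq[OF F a] c_def by (rule integral_mult_left_zero)
  finally show ?thesis unfolding H_def U_def .
qed

lemma torus_norm_finite:
  fixes F :: "real ^ 'n \<Rightarrow> complex"
  assumes F: "smooth_torus F" and p: "0 < p"
  shows "torus_norm p F < \<infinity>"
proof -
  interpret prob_space "cubeM :: (real ^ 'n) measure" by (rule prob_space_cubeM)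
  have sm: "smooth F" using F by (simp add: smooth_torus_def)
  obtain M0 where "\<And>x. x \<in> cube \<Longrightarrow> norm (F x) \<le> M0" using bounded_on_cube[OF smooth_continuous_on[OF sm]] by blast
  then have M: "norm (F x) \<le> \<bar>M0\<bar>" if "x \<in> cube" for x using that by (meson abs_ge_self order_trans)
  have meas: "(\<lambda>x. ennreal (norm (F x))) \<in> borel_measurable cubeM"
    using borel_measurable_cubeM[OF smooth_borel[OF sm]] by measurable
  have "torus_norm p F \<le> Lp_norm p cubeM (\<lambda>_ :: real ^ 'n. ennreal \<bar>M0\<bar>)"
    unfolding torus_norm_eq[OF smooth_borel[OF sm]] by (rule Lp_norm_mono[OF p meas]) (use M in \<open>auto intro: ennreal_leI\<close>)
  also have "\<dots> \<le> ennreal \<bar>M0\<bar>"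
  proof (cases "p = \<infinity>")
    case True
    then show ?thesis by (auto simp: Lp_norm_def intro!: esssup_I)
  next
    case False
    have one: "emeasure cubeM (space (cubeM :: (real ^ 'n) measure)) = 1" by (rule emeasure_space_1)
    show ?thesis by (rule Lp_norm_leI[OF p False]) (simp only: nn_integral_const one mult_1_right order.refl)
  qed
  also have "\<dots> < \<infinity>" by simp
  finally show ?thesis .
qed

lemma Lp_norm_wt_le: "0 < q \<Longrightarrow> Lp_norm q (count_space UNIV) (L.wt N :: int ^ 'n \<Rightarrow> ennreal) \<le> weight_const q (L.wt N :: int ^ 'n \<Rightarrow> ennreal)"
  by (auto simp: weight_const_def Lp_norm_def L.wt_le_1 intro!: esssup_I)

text \<open>As \<open>F\<close> is periodic, its modulation restricted to the cube at
  \<open>k\<close> is \<open>F\<close> times the decay of \<open>ft u\<close> at \<open>k\<close>.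
  The local norms are thus bounded by the torus norm times a weight with finite
  \<open>q\<close>-norm.\<close>

lemma amalgam_norm_modulated:
  fixes u :: "real ^ 'n \<Rightarrow> complex"
  assumes u: "schwartz u" and p: "0 < p" and q: "0 < q"
  shows "\<exists>K<\<infinity>. \<forall>F v. smooth_torus F \<longrightarrow> amalgam_norm p q (modulated F u v) \<le> K * torus_norm p F"
proof -
  obtain N where N: "weight_const q (L.wt N :: int ^ 'n \<Rightarrow> ennreal) < \<infinity>" using L.wt_eventually[OF q] by blast
  obtain C0 where C0: "\<And>x. norm (ft u x) \<le> C0 * dec x ^ N"
    using schwartz_dominated[OF schwartz_ft[OF u], of N] by (auto simp: dominated_def)
  define K where "K = \<bar>C0\<bar> * (1 + real DIM(real ^ 'n)) ^ N"
  have K: "0 \<le> K" by (simp add: K_def)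
  have "amalgam_norm p q (modulated F u v) \<le> ennreal K * weight_const q (L.wt N :: int ^ 'n \<Rightarrow> ennreal) * torus_norm p F"
    if F: "smooth_torus F" for F v
  proof -
    have sm: "smooth F" and per: "\<And>k x. F (x + lat k) = F x" using F by (auto simp: smooth_torus_iff)
    note mb [measurable] = schwartz_borel[OF schwartz_modulated[OF F u, of v]] smooth_borel[OF sm]
    have loc: "local_norm p (modulated F u v) k \<le> (ennreal K * torus_norm p F) * L.wt N k" for k
    proof -
      have "local_norm p (modulated F u v) k \<le> Lp_norm p cubeM (\<lambda>x. (ennreal K * L.wt N k) * ennreal (norm (F x)))"
        unfolding local_norm_def
      proof (rule Lp_norm_mono[OF p])
        show "(\<lambda>x. ennreal (norm (modulated F u v (x + lat k)))) \<in> borel_measurable cubeM"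
          by (intro borel_measurable_cubeM) measurable
        fix x :: "real ^ 'n" assume "x \<in> space cubeM"
        then have x: "x \<in> cube" by simp
        have "norm (ft u (- (x + lat k))) \<le> \<bar>C0\<bar> * dec (x + lat k) ^ N"
          by (rule order_trans[OF C0]) (auto intro: mult_right_mono simp del: minus_add_distrib)
        also have "dec (x + lat k) ^ N \<le> (1 + norm x) ^ N * dec (lat k) ^ N"
          using dec_shift_power'[of "lat k" x N] by (simp add: add.commute)
        also have "(1 + norm x) ^ N * dec (lat k) ^ N \<le> (1 + real DIM(real ^ 'n)) ^ N * dec (lat k) ^ N"
          using norm_cube_le[OF x] by (intro mult_right_mono power_mono) auto
        finally have "norm (ft u (- (x + lat k))) \<le> K * dec (lat k) ^ N" by (simp add: K_def mult_left_mono mult.assoc)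
        then have "norm (F x) * norm (ft u (- (x + lat k))) \<le> norm (F x) * (K * dec (lat k) ^ N)" by (rule mult_left_mono) simp
        then have "norm (modulated F u v (x + lat k)) \<le> K * dec (lat k) ^ N * norm (F x)"
          unfolding modulated_def norm_mult norm_ech per by (simp only: mult_1 mult_ac)
        then have "ennreal (norm (modulated F u v (x + lat k))) \<le> ennreal (K * dec (lat k) ^ N * norm (F x))" by (rule ennreal_leI)
        then show "ennreal (norm (modulated F u v (x + lat k))) \<le> (ennreal K * L.wt N k) * ennreal (norm (F x))"
          using K by (simp add: L.wt_def ennreal_mult)
      qed
      also have "\<dots> \<le> (ennreal K * L.wt N k) * torus_norm p F"
        unfolding torus_norm_eq[OF smooth_borel[OF sm]]
        by (rule Lp_norm_cmult[OF p]) (intro borel_measurable_cubeM, measurable)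
      finally show ?thesis by (simp only: mult_ac)
    qed
    have "amalgam_norm p q (modulated F u v) \<le> Lp_norm q (count_space UNIV) (\<lambda>k. (ennreal K * torus_norm p F) * L.wt N (k :: int ^ 'n))"
      unfolding amalgam_norm_local[OF mb(1)] by (rule Lp_norm_mono[OF q]) (use loc in auto)
    also have "\<dots> \<le> (ennreal K * torus_norm p F) * Lp_norm q (count_space UNIV) (L.wt N :: int ^ 'n \<Rightarrow> ennreal)"
      by (rule Lp_norm_cmult[OF q]) simp
    also have "\<dots> \<le> (ennreal K * torus_norm p F) * weight_const q (L.wt N :: int ^ 'n \<Rightarrow> ennreal)"
      by (intro mult_left_mono Lp_norm_wt_le q) simp
    finally show ?thesis by (simp only: mult_ac)
  qed
  moreover have "ennreal K * weight_const q (L.wt N :: int ^ 'n \<Rightarrow> ennreal) < \<infinity>" using N by (simp add: ennreal_mult_less_top)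
  ultimately show ?thesis by blast
qed

lemma divide_le_ennreal:
  fixes t d A :: ennreal
  assumes "t \<le> A * d" "A < \<infinity>"
  shows "t / d \<le> A"
proof (cases "d = 0 \<or> d = \<infinity>")
  \<comment> \<open>For \<open>d = 0\<close> the hypothesis gives \<open>t = 0\<close> and
    \<open>0 / 0 = 0\<close>; division by infinity gives 0.\<close>
  case True
  then show ?thesis using assms by (auto simp: ennreal_divide_top)
next
  case False
  have "t / d \<le> A * d / d" by (rule divide_right_mono_ennreal[OF assms(1)])
  also have "\<dots> = A" using False by (simp add: ennreal_times_divide[symmetric] ennreal_divide_self less_top)
  finally show ?thesis .
qed

text \<open>On the unit cube the exponential factors are almost constant on the support of a sufficiently
  concentrated bump function.\<close>

lemma multiplier_lower_bound:
  fixes \<Phi> :: "(real ^ 'n) \<times> (real ^ 'n) \<Rightarrow> complex"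
  assumes test: "test_function \<Phi>" and nz: "\<Phi> \<xi>0 \<noteq> 0" and \<delta>: "0 < \<delta>"
  shows "\<exists>u \<rho> \<epsilon>. bump \<rho> u \<and> 2 * \<rho> < \<delta> \<and> 0 < \<epsilon> \<and> (\<forall>x\<in>cube.
    \<epsilon> \<le> norm (LINT \<eta>|lborel. ech (x \<bullet> (fst \<eta> + snd \<eta>)) * \<Phi> \<eta> * (u (fst \<eta> - fst \<xi>0) * u (snd \<eta> - snd \<xi>0))))"
proof -
  have \<Phi>: "schwartz \<Phi>" by (rule test_function_schwartz[OF test])
  define n where "n = real DIM(real ^ 'n)"
  have n: "0 < n" by (simp add: n_def)
  have "isCont \<Phi> \<xi>0"
    by (rule continuous_on_eq_continuous_at[OF open_UNIV, THEN iffD1, rule_format])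
       (auto intro: smooth_continuous_on schwartz_smooth \<Phi>)
  from this[unfolded continuous_at_eps_delta, rule_format, of "norm (\<Phi> \<xi>0) / 4"] nz
  obtain d1 where d1: "0 < d1" "\<And>\<eta>. norm (\<eta> - \<xi>0) < d1 \<Longrightarrow> norm (\<Phi> \<eta> - \<Phi> \<xi>0) < norm (\<Phi> \<xi>0) / 4"
    by (auto simp: dist_norm)
  have "isCont ech 0"
    using continuous_on_ech[OF continuous_on_id, of UNIV] by (simp add: continuous_on_eq_continuous_at)
  from this[unfolded continuous_at_eps_delta, rule_format, of "1/4"]
  obtain d2 where d2: "0 < d2" "\<And>t. \<bar>t\<bar> < d2 \<Longrightarrow> norm (ech t - 1) < 1/4"
    by (auto simp: dist_norm)
  \<comment> \<open>The displacements of the two components add up, so \<open>2 * \<rho>\<close> is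
    compared with each threshold; \<open>n\<close> bounds the norm on the cube.\<close>
  define \<rho> where "\<rho> = min (\<delta> / 4) (min (d1 / 4) (d2 / (4 * n)))"
  have \<rho>: "0 < \<rho>" "2 * \<rho> < \<delta>" "2 * \<rho> < d1" "n * (2 * \<rho>) < d2"
  proof -
    show "0 < \<rho>" using \<delta> d1 d2 n by (simp add: \<rho>_def)
    have "\<rho> \<le> \<delta> / 4" "\<rho> \<le> d1 / 4" "\<rho> \<le> d2 / (4 * n)" by (auto simp: \<rho>_def)
    then show "2 * \<rho> < \<delta>" "2 * \<rho> < d1" using \<delta> d1 by linarith+
    have "n * (2 * \<rho>) \<le> n * (2 * (d2 / (4 * n)))" using \<open>\<rho> \<le> d2 / (4 * n)\<close> n by (intro mult_left_mono) auto
    also have "\<dots> = d2 / 2" using n by simp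
    finally show "n * (2 * \<rho>) < d2" using d2 by linarith
  qed
  obtain u :: "real ^ 'n \<Rightarrow> complex" where bump: "bump \<rho> u" using bump_exists[OF test nz \<rho>(1)] by blast
  then have u: "schwartz u" and supp_u: "\<And>y. u y \<noteq> 0 \<Longrightarrow> norm y \<le> \<rho>" and u_real: "\<And>y. u y = complex_of_real (norm (u y))"
    by (auto simp: bump_def)
  note [measurable] = schwartz_borel[OF \<Phi>] schwartz_borel[OF u] borel_measurable_fst borel_measurable_snd
  define I where "I = (LINT y|lborel. norm (u y))"
  have I: "0 < I" using bump by (simp add: bump_def I_def)
  define U where "U \<eta> = u (fst \<eta> - fst \<xi>0) * u (snd \<eta> - snd \<xi>0)" for \<eta>
  have [measurable]: "U \<in> borel_measurable borel" unfolding U_def by measurable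
  have transint: "integrable lborel (\<lambda>y. u (y - v))" "(LINT y|lborel. u (y - v)) = complex_of_real I" for v
    using schwartz_integrable[OF schwartz_scale[OF u, of 1 "- v"]] lborel_integral_translate[OF schwartz_borel[OF u], of "- v"]
      bump_integral[OF bump] by (simp_all add: I_def)
  have intU: "integrable lborel U" and sumU: "(LINT \<eta>|lborel. U \<eta>) = complex_of_real (I * I)"
    unfolding U_def using integral_lborel_pair[OF transint(1)[of "fst \<xi>0"] transint(1)[of "snd \<xi>0"]] transint(2) by simp_all
  have U_real: "U \<eta> = complex_of_real (norm (U \<eta>))" for \<eta>
  proof -
    have "U \<eta> = complex_of_real (norm (u (fst \<eta> - fst \<xi>0))) * complex_of_real (norm (u (snd \<eta> - snd \<xi>0)))"
      unfolding U_def using u_real by (simp only: flip: u_real)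
    then show ?thesis by (simp add: U_def norm_mult)
  qed
  have normU: "(LINT \<eta>|lborel. norm (U \<eta>)) = I * I"
  proof -
    have "(LINT \<eta>|lborel. U \<eta>) = (LINT \<eta>|lborel. complex_of_real (norm (U \<eta>)))"
      by (rule Bochner_Integration.integral_cong[OF refl]) (rule U_real)
    then have "complex_of_real (LINT \<eta>|lborel. norm (U \<eta>)) = complex_of_real (I * I)" using sumU by simp
    then show ?thesis by (simp only: of_real_eq_iff)
  qed
  obtain M where M: "\<And>\<xi>. norm (\<Phi> \<xi>) \<le> M" using schwartz_dominated[OF \<Phi>, of 0] by (auto simp: dominated_def)
  \<comment> \<open>Half of the main term: the variation of \<open>\<Phi>\<close> and that of the
    character cost a quarter each.\<close>
  define \<epsilon> where "\<epsilon> = norm (\<Phi> \<xi>0) / 2 * (I * I)"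
  have "\<epsilon> \<le> norm (LINT \<eta>|lborel. ech (x \<bullet> (fst \<eta> + snd \<eta>)) * \<Phi> \<eta> * U \<eta>)" if x: "x \<in> cube" for x
  proof -
    define J where "J = (\<lambda>\<eta>. ech (x \<bullet> (fst \<eta> + snd \<eta>)) * \<Phi> \<eta> * U \<eta>)"
    have intJ: "integrable lborel J"
    proof (rule Bochner_Integration.integrable_bound)
      show "integrable lborel (\<lambda>\<eta>. M * norm (U \<eta>))" using intU by simp
      show "J \<in> borel_measurable lborel" unfolding J_def by measurable
      show "AE \<eta> in lborel. norm (J \<eta>) \<le> norm (M * norm (U \<eta>))"
      proof (rule AE_I2)
        fix \<eta>
        have "norm (J \<eta>) \<le> M * norm (U \<eta>)" unfolding J_def by (simp add: norm_mult M mult_right_mono)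
        then show "norm (J \<eta>) \<le> norm (M * norm (U \<eta>))" by simp
      qed
    qed
    define e0 where "e0 = ech (x \<bullet> (fst \<xi>0 + snd \<xi>0))"
    have "norm ((LINT \<eta>|lborel. J \<eta>) - e0 * \<Phi> \<xi>0 * complex_of_real (I * I)) = norm (LINT \<eta>|lborel. J \<eta> - e0 * \<Phi> \<xi>0 * U \<eta>)"
      using intJ intU by (simp add: sumU)
    also have "\<dots> \<le> (LINT \<eta>|lborel. norm (\<Phi> \<xi>0) / 2 * norm (U \<eta>))"
    proof (rule integral_norm_bound_mono)
      fix \<eta>
      show "norm (J \<eta> - e0 * \<Phi> \<xi>0 * U \<eta>) \<le> norm (\<Phi> \<xi>0) / 2 * norm (U \<eta>)"
      proof (cases "U \<eta> = 0")
        case False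
        then have near: "norm (fst \<eta> - fst \<xi>0) \<le> \<rho>" "norm (snd \<eta> - snd \<xi>0) \<le> \<rho>" by (auto simp: U_def intro: supp_u)
        moreover have "norm (\<eta> - \<xi>0) \<le> norm (fst \<eta> - fst \<xi>0) + norm (snd \<eta> - snd \<xi>0)"
          using norm_le_fst_snd[of "\<eta> - \<xi>0"] by simp
        ultimately have "norm (\<eta> - \<xi>0) < d1" using \<rho> by linarith
        then have c1: "norm (\<Phi> \<eta> - \<Phi> \<xi>0) < norm (\<Phi> \<xi>0) / 4" by (rule d1)
        define w where "w = (fst \<eta> - fst \<xi>0) + (snd \<eta> - snd \<xi>0)"
        have "norm w \<le> 2 * \<rho>" unfolding w_def using near norm_triangle_ineq[of "fst \<eta> - fst \<xi>0" "snd \<eta> - snd \<xi>0"] by linarith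
        have "\<bar>x \<bullet> w\<bar> \<le> norm x * norm w" by (rule Cauchy_Schwarz_ineq2)
        also have "\<dots> \<le> n * (2 * \<rho>)" using norm_cube_le[OF x] \<open>norm w \<le> 2 * \<rho>\<close> n by (intro mult_mono) (auto simp: n_def)
        also have "\<dots> < d2" by (rule \<rho>)
        finally have c2: "norm (ech (x \<bullet> w) - 1) < 1/4" by (rule d2)
        have split: "ech (x \<bullet> (fst \<eta> + snd \<eta>)) = e0 * ech (x \<bullet> w)"
          unfolding e0_def w_def ech_add[symmetric] by (simp add: inner_add_right inner_diff_right)
        have "J \<eta> - e0 * \<Phi> \<xi>0 * U \<eta> = e0 * ((ech (x \<bullet> w) * (\<Phi> \<eta> - \<Phi> \<xi>0) + (ech (x \<bullet> w) - 1) * \<Phi> \<xi>0) * U \<eta>)"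
          unfolding J_def split by (simp add: algebra_simps)
        then have "norm (J \<eta> - e0 * \<Phi> \<xi>0 * U \<eta>) = norm (ech (x \<bullet> w) * (\<Phi> \<eta> - \<Phi> \<xi>0) + (ech (x \<bullet> w) - 1) * \<Phi> \<xi>0) * norm (U \<eta>)"
          by (simp add: norm_mult e0_def)
        also have "\<dots> \<le> norm (\<Phi> \<xi>0) / 2 * norm (U \<eta>)"
        proof (rule mult_right_mono)
          have "norm (ech (x \<bullet> w) * (\<Phi> \<eta> - \<Phi> \<xi>0) + (ech (x \<bullet> w) - 1) * \<Phi> \<xi>0) \<le> norm (\<Phi> \<eta> - \<Phi> \<xi>0) + norm (ech (x \<bullet> w) - 1) * norm (\<Phi> \<xi>0)"
            by (rule order_trans[OF norm_triangle_ineq]) (simp add: norm_mult)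
          also have "\<dots> \<le> norm (\<Phi> \<xi>0) / 4 + 1/4 * norm (\<Phi> \<xi>0)" using c1 c2 by (intro add_mono mult_right_mono) auto
          finally show "norm (ech (x \<bullet> w) * (\<Phi> \<eta> - \<Phi> \<xi>0) + (ech (x \<bullet> w) - 1) * \<Phi> \<xi>0) \<le> norm (\<Phi> \<xi>0) / 2" by simp
        qed simp
        finally show ?thesis .
      qed (simp add: J_def)
    qed (use intJ intU in auto)
    also have "\<dots> = \<epsilon>" by (simp add: normU \<epsilon>_def)
    finally have close: "norm ((LINT \<eta>|lborel. J \<eta>) - e0 * \<Phi> \<xi>0 * complex_of_real (I * I)) \<le> \<epsilon>" .
    have "norm (e0 * \<Phi> \<xi>0 * complex_of_real (I * I)) = 2 * \<epsilon>" using I by (simp add: norm_mult e0_def \<epsilon>_def)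
    then have "\<epsilon> \<le> norm (LINT \<eta>|lborel. J \<eta>)"
      using close norm_triangle_ineq2[of "e0 * \<Phi> \<xi>0 * complex_of_real (I * I)" "LINT \<eta>|lborel. J \<eta>"] by (simp add: norm_minus_commute)
    then show ?thesis unfolding J_def .
  qed
  moreover have "0 < \<epsilon>" using I nz by (simp add: \<epsilon>_def)
  ultimately show ?thesis using bump \<rho>(2) unfolding U_def by blast
qed

text \<open>The output on the cube at the origin already dominates \<open>\<epsilon>\<close> times
  the periodic operator, and a single local norm is at most the full amalgam norm. \<open>K\<close>
  combines \<open>1 / \<epsilon>\<close> with the norms of the two test functions relative to
  \<open>F1\<close> and \<open>F2\<close>.\<close>

theorem amalgam_lower_bound:
  fixes \<Phi> :: "(real ^ 'n) \<times> (real ^ 'n) \<Rightarrow> complex"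
  assumes test: "test_function \<Phi>" and B: "condition_B \<Phi>"
    and pos: "0 < p1" "0 < p2" "0 < p" "0 < q1" "0 < q2" "0 < q"
  shows "\<exists>K<\<infinity>. \<forall>a C. bounded (range a) \<longrightarrow> C < \<infinity> \<longrightarrow>
     (\<forall>f1 f2. schwartz f1 \<and> amalgam_norm p1 q1 f1 < \<infinity> \<and> schwartz f2 \<and> amalgam_norm p2 q2 f2 < \<infinity> \<longrightarrow>
        amalgam_norm p q (bilin_mult (lattice_symbol a \<Phi>) f1 f2) \<le> C * amalgam_norm p1 q1 f1 * amalgam_norm p2 q2 f2) \<longrightarrow>
     bilin_period_norm a p1 p2 p \<le> K * C"
proof -
  have \<Phi>: "schwartz \<Phi>" by (rule test_function_schwartz[OF test])
  obtain \<xi>0 where nz: "\<Phi> \<xi>0 \<noteq> 0" and \<xi>0: "\<xi>0 \<notin> (\<Union>\<mu>\<in>UNIV - {0}. Defs.supp (\<lambda>\<xi>. \<Phi> (\<xi> - lat2 \<mu>)))"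
    using B unfolding condition_B_def by blast
  obtain r where r: "\<And>\<xi>. \<Phi> \<xi> \<noteq> 0 \<Longrightarrow> norm \<xi> \<le> r" using test_function_support[OF test] by blast
  obtain \<delta> where \<delta>: "0 < \<delta>" "\<And>\<zeta> \<mu>. norm \<zeta> < \<delta> \<Longrightarrow> \<mu> \<noteq> 0 \<Longrightarrow> \<Phi> (\<xi>0 + \<zeta> - lat2 \<mu>) = 0"
    using condition_B_neighborhood[OF r \<xi>0] by blast
  obtain u \<rho> \<epsilon> where bump: "bump \<rho> u" and \<rho>: "2 * \<rho> < \<delta>" and \<epsilon>: "0 < \<epsilon>"
    and lower: "\<And>x. x \<in> cube \<Longrightarrow> \<epsilon> \<le> norm (LINT \<eta>|lborel. ech (x \<bullet> (fst \<eta> + snd \<eta>)) * \<Phi> \<eta> * (u (fst \<eta> - fst \<xi>0) * u (snd \<eta> - snd \<xi>0)))"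
    using multiplier_lower_bound[OF test nz \<delta>(1)] by blast
  have u: "schwartz u" and supp_u: "\<And>y. u y \<noteq> 0 \<Longrightarrow> norm y \<le> \<rho>" using bump by (auto simp: bump_def)
  obtain K1 where K1: "K1 < \<infinity>" "\<And>F v. smooth_torus F \<Longrightarrow> amalgam_norm p1 q1 (modulated F u v) \<le> K1 * torus_norm p1 F"
    using amalgam_norm_modulated[OF u pos(1) pos(4)] by blast
  obtain K2 where K2: "K2 < \<infinity>" "\<And>F v. smooth_torus F \<Longrightarrow> amalgam_norm p2 q2 (modulated F u v) \<le> K2 * torus_norm p2 F"
    using amalgam_norm_modulated[OF u pos(2) pos(5)] by blast
  define K where "K = ennreal (1 / \<epsilon>) * (K1 * K2)"
  have "K < \<infinity>" using K1 K2 by (simp add: K_def ennreal_mult_less_top)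
  moreover have "bilin_period_norm a p1 p2 p \<le> K * C"
    if bdd: "bounded (range a)" and C: "C < \<infinity>"
      and adm: "\<forall>f1 f2. schwartz f1 \<and> amalgam_norm p1 q1 f1 < \<infinity> \<and> schwartz f2 \<and> amalgam_norm p2 q2 f2 < \<infinity> \<longrightarrow>
        amalgam_norm p q (bilin_mult (lattice_symbol a \<Phi>) f1 f2) \<le> C * amalgam_norm p1 q1 f1 * amalgam_norm p2 q2 f2"
    for a C
    unfolding bilin_period_norm_def
  proof (rule Sup_least, safe)
    fix F1 F2 :: "real ^ 'n \<Rightarrow> complex" assume F: "smooth_torus F1" "smooth_torus F2"
    obtain A where a: "\<And>\<mu>. norm (a \<mu>) \<le> A" using bdd by (auto simp: bounded_iff)
    define f1 where "f1 = modulated F1 u (fst \<xi>0)"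
    define f2 where "f2 = modulated F2 u (snd \<xi>0)"
    have f: "schwartz f1" "schwartz f2" unfolding f1_def f2_def by (intro schwartz_modulated F u)+
    have n1: "amalgam_norm p1 q1 f1 \<le> K1 * torus_norm p1 F1" unfolding f1_def by (rule K1(2)[OF F(1)])
    have n2: "amalgam_norm p2 q2 f2 \<le> K2 * torus_norm p2 F2" unfolding f2_def by (rule K2(2)[OF F(2)])
    have fin: "amalgam_norm p1 q1 f1 < \<infinity>" "amalgam_norm p2 q2 f2 < \<infinity>"
      using n1 n2 K1(1) K2(1) torus_norm_finite[OF F(1) pos(1)] torus_norm_finite[OF F(2) pos(2)]
      by (auto simp: ennreal_mult_less_top intro: le_less_trans)
    define T where "T = bilin_mult (lattice_symbol a \<Phi>) f1 f2"
    have T_borel [measurable]: "T \<in> borel_measurable borel"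
      unfolding T_def by (rule bilin_mult_borel[OF lattice_symbol_borel[OF \<Phi> a] f])
    have P_borel [measurable]: "bilin_period a F1 F2 \<in> borel_measurable borel" by (rule bilin_period_borel[OF F a])
    have pw: "ennreal (norm (bilin_period a F1 F2 x)) \<le> ennreal (1 / \<epsilon>) * ennreal (norm (T (x + lat 0)))" if x: "x \<in> cube" for x
    proof -
      have "T x = bilin_period a F1 F2 x * (LINT \<eta>|lborel. ech (x \<bullet> (fst \<eta> + snd \<eta>)) * \<Phi> \<eta> * (u (fst \<eta> - fst \<xi>0) * u (snd \<eta> - snd \<xi>0)))"
        unfolding T_def f1_def f2_def by (rule bilin_mult_modulated[OF \<Phi> a F u supp_u \<rho> \<delta>(2)])
      moreover have "norm (bilin_period a F1 F2 x) * \<epsilon> \<le> norm (bilin_period a F1 F2 x) * norm (LINT \<eta>|lborel. ech (x \<bullet> (fst \<eta> + snd \<eta>)) * \<Phi> \<eta> * (u (fst \<eta> - fst \<xi>0) * u (snd \<eta> - snd \<xi>0)))"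
        by (rule mult_left_mono[OF lower[OF x]]) simp
      ultimately have "norm (bilin_period a F1 F2 x) * \<epsilon> \<le> norm (T x)" by (simp only: norm_mult)
      then have "norm (bilin_period a F1 F2 x) \<le> 1 / \<epsilon> * norm (T x)" using \<epsilon> by (simp add: field_simps)
      then have "ennreal (norm (bilin_period a F1 F2 x)) \<le> ennreal (1 / \<epsilon> * norm (T x))" by (rule ennreal_leI)
      also have "\<dots> = ennreal (1 / \<epsilon>) * ennreal (norm (T x))" using \<epsilon> by (intro ennreal_mult) auto
      finally show ?thesis by simp
    qed
    have T_meas: "(\<lambda>x. ennreal (norm (T (x + lat 0)))) \<in> borel_measurable cubeM"
      by (intro borel_measurable_cubeM) measurable
    have "torus_norm p (bilin_period a F1 F2) \<le> Lp_norm p cubeM (\<lambda>x. ennreal (1 / \<epsilon>) * ennreal (norm (T (x + lat 0))))"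
      unfolding torus_norm_eq[OF P_borel]
    proof (rule Lp_norm_mono[OF pos(3)])
      show "(\<lambda>x. ennreal (norm (bilin_period a F1 F2 x))) \<in> borel_measurable cubeM"
        by (intro borel_measurable_cubeM) measurable
    qed (use pw in auto)
    also have "\<dots> \<le> ennreal (1 / \<epsilon>) * local_norm p T 0"
      unfolding local_norm_def by (rule Lp_norm_cmult[OF pos(3) T_meas])
    also have "\<dots> \<le> ennreal (1 / \<epsilon>) * amalgam_norm p q T"
      unfolding amalgam_norm_local[OF T_borel] by (intro mult_left_mono le_Lp_norm_count_space pos) simp
    also have "\<dots> \<le> ennreal (1 / \<epsilon>) * (C * amalgam_norm p1 q1 f1 * amalgam_norm p2 q2 f2)"
      unfolding T_def using adm f fin by (intro mult_left_mono) auto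
    also have "\<dots> \<le> ennreal (1 / \<epsilon>) * (C * (K1 * torus_norm p1 F1) * (K2 * torus_norm p2 F2))"
      by (intro mult_left_mono mult_mono n1 n2) auto
    also have "\<dots> = (K * C) * (torus_norm p1 F1 * torus_norm p2 F2)" unfolding K_def by (simp only: mult_ac)
    finally show "torus_norm p (bilin_period a F1 F2) / (torus_norm p1 F1 * torus_norm p2 F2) \<le> K * C"
      by (rule divide_le_ennreal) (use \<open>K < \<infinity>\<close> C in \<open>simp add: ennreal_mult_less_top\<close>)
  qed
  ultimately show ?thesis by blast
qed

theorem theorem1:
  fixes \<Phi> :: "(real ^ 'n) \<times> (real ^ 'n) \<Rightarrow> complex"
    and p1 p2 p q1 q2 q :: ennreal
  assumes "test_function \<Phi>" and "condition_B \<Phi>"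
    and "0 < p1" and "0 < p2" and "0 < p" and "0 < q1" and "0 < q2" and "0 < q"
    and "1 / q1 + 1 / q2 \<ge> 1 / q"
  shows "\<exists>c::real. 0 < c \<and>
    (\<forall>a :: (int ^ 'n) \<times> (int ^ 'n) \<Rightarrow> complex. bounded (range a) \<longrightarrow>
       ennreal (1 / c) * bilin_period_norm a p1 p2 p
         \<le> bilin_mult_norm (lattice_symbol a \<Phi>)
             (amalgam_norm p1 q1) (amalgam_norm p2 q2) (amalgam_norm p q) \<and>
       bilin_mult_norm (lattice_symbol a \<Phi>)
           (amalgam_norm p1 q1) (amalgam_norm p2 q2) (amalgam_norm p q)
         \<le> ennreal c * bilin_period_norm a p1 p2 p)"
proof -
  obtain \<xi>0 where nz: "\<Phi> \<xi>0 \<noteq> 0" using assms(2) unfolding condition_B_def by blast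
  \<comment> \<open>\<open>C\<close> and \<open>K\<close> are obtained before \<open>a\<close> is
    fixed, which is the required independence of the constant.\<close>
  obtain C where C: "C < \<infinity>" "\<And>a f1 f2. bounded (range a) \<Longrightarrow> bilin_period_norm a p1 p2 p < \<infinity> \<Longrightarrow> schwartz f1 \<Longrightarrow> schwartz f2 \<Longrightarrow>
     amalgam_norm p1 q1 f1 < \<infinity> \<Longrightarrow> amalgam_norm p2 q2 f2 < \<infinity> \<Longrightarrow>
     amalgam_norm p q (bilin_mult (lattice_symbol a \<Phi>) f1 f2)
       \<le> C * bilin_period_norm a p1 p2 p * amalgam_norm p1 q1 f1 * amalgam_norm p2 q2 f2"
    using amalgam_upper_bound[OF assms(1) nz assms(3-9)] by blast
  obtain K where K: "K < \<infinity>" "\<And>a C. bounded (range a) \<Longrightarrow> C < \<infinity> \<Longrightarrow>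
     (\<forall>f1 f2. schwartz f1 \<and> amalgam_norm p1 q1 f1 < \<infinity> \<and> schwartz f2 \<and> amalgam_norm p2 q2 f2 < \<infinity> \<longrightarrow>
        amalgam_norm p q (bilin_mult (lattice_symbol a \<Phi>) f1 f2) \<le> C * amalgam_norm p1 q1 f1 * amalgam_norm p2 q2 f2) \<Longrightarrow>
     bilin_period_norm a p1 p2 p \<le> K * C"
    using amalgam_lower_bound[OF assms(1,2) assms(3-8)] by blast
  \<comment> \<open>The entry 1 guarantees positivity, as the other two may be 0.\<close>
  define c where "c = max 1 (max (enn2real C) (enn2real K))"
  have c: "0 < c" by (simp add: c_def)
  have Cc: "C \<le> ennreal c" and Kc: "K \<le> ennreal c"
    using C(1) K(1) by (cases C; cases K; simp add: c_def ennreal_leI)+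
  show ?thesis
  proof (intro exI conjI allI impI)
    show "0 < c" by (rule c)
    fix a :: "(int ^ 'n) \<times> (int ^ 'n) \<Rightarrow> complex" assume bdd: "bounded (range a)"
    let ?A = "bilin_period_norm a p1 p2 p"
    show "ennreal (1 / c) * ?A \<le> bilin_mult_norm (lattice_symbol a \<Phi>) (amalgam_norm p1 q1) (amalgam_norm p2 q2) (amalgam_norm p q)"
      unfolding bilin_mult_norm_def
    proof (rule Inf_greatest, safe)
      fix D :: ennreal assume D: "D < \<infinity>" and adm: "\<forall>f1 f2. schwartz f1 \<and> amalgam_norm p1 q1 f1 < \<infinity> \<and> schwartz f2 \<and> amalgam_norm p2 q2 f2 < \<infinity> \<longrightarrow>
        amalgam_norm p q (bilin_mult (lattice_symbol a \<Phi>) f1 f2) \<le> D * amalgam_norm p1 q1 f1 * amalgam_norm p2 q2 f2"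
      have "?A \<le> K * D" by (rule K(2)[OF bdd D adm])
      also have "\<dots> \<le> ennreal c * D" by (rule mult_right_mono[OF Kc]) simp
      finally have "ennreal (1 / c) * ?A \<le> ennreal (1 / c) * (ennreal c * D)" by (rule mult_left_mono) simp
      also have "\<dots> = D" using c by (simp add: mult.assoc[symmetric] ennreal_mult[symmetric])
      finally show "ennreal (1 / c) * ?A \<le> D" .
    qed
    show "bilin_mult_norm (lattice_symbol a \<Phi>) (amalgam_norm p1 q1) (amalgam_norm p2 q2) (amalgam_norm p q) \<le> ennreal c * ?A"
    proof (cases "?A = \<infinity>")
      case True
      then show ?thesis using c by (simp add: ennreal_mult_top)
    next
      case False
      then have A: "?A < \<infinity>" by (simp add: less_top)
      have "bilin_mult_norm (lattice_symbol a \<Phi>) (amalgam_norm p1 q1) (amalgam_norm p2 q2) (amalgam_norm p q) \<le> C * ?A"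
        unfolding bilin_mult_norm_def
      proof (rule Inf_lower, safe)
        show "C * ?A < \<infinity>" using C(1) A by (simp add: ennreal_mult_less_top)
      qed (rule C(2)[OF bdd A])
      also have "\<dots> \<le> ennreal c * ?A" by (rule mult_right_mono[OF Cc]) simp
      finally show ?thesis .
    qed
  qed
qed

end
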